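(* Let $\varrho_0\in[1,\infty)$, and let $h,\lambda\in(0,\frac12]$, $\varrho\in[1,\varrho_0]$ and $m\in[1,\infty)$. Then $$\min_{A^{NL}_{\lambda,\varrho,m}}E^{NL}_h-\mathcal{E}^{NL}_b(\varrho,h)\ \sim_{\varrho_0,m}\ \min\left\{\lambda^2,\ \max\left\{[(\varrho^2-1)\vee h^2]^{4/7}h^{6/7}\lambda^{5/7},\ [(\varrho^2-1)\vee h^2]^{2/3}h^{2/3}\lambda\right\}\right\}$$ whenever $(\varrho^2-1)\vee h^2\ge c_0(\lambda,h,1)$, where $c_0(\lambda,h,1)=\min\{\lambda^{1/2}h^{1/4},\,h^{1/2}\}$.
   Context: Let $I_\theta=[0,2\pi]$, $I_z=[-\frac12,\frac12]$, $\Omega=I_\theta\times I_z$ with coordinates $(\theta,z)$; $|\Omega|=2\pi$. $H^k_{\mathrm{per}}(\Omega)$ is the space of ($\Omega$-)periodic $L^2$-based Sobolev functions of order $k$. A deformation $\Phi:\Omega\to\mathbb{R}^3$ is given in cylindrical coordinates by $(\Phi_\rho,\Phi_\theta,\Phi_z)$, i.e. as a map into Cartesian $\mathbb{R}^3$ it is $(\Phi_\rho\cos\Phi_\theta,\Phi_\rho\sin\Phi_\theta,\Phi_z)$; $D\Phi$ and $D^2\Phi$ denote the first and second derivatives in $(\theta,z)$ of this $\mathbb{R}^3$-valued map. The energy is $E^{NL}_h(\Phi)=\int_\Omega|D\Phi^TD\Phi-\mathrm{id}|^2+h^2|D^2\Phi|^2\,d\theta\,dz$ (Euclidean norms, so $|D^2\Phi|^2=|\partial_\theta^2\Phi|^2+2|\partial_{\theta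 z}\Phi|^2+|\partial_z^2\Phi|^2$). The admissible set $A^{NL}_{\lambda,\varrho,m}$ consists of all $\Phi$ with $\Phi_\rho\in H^2_{\mathrm{per}}(\Omega)$, $\Phi_\theta-\theta\in H^2_{\mathrm{per}}(\Omega)$, $\Phi_z-(1-\lambda)z\in H^2_{\mathrm{per}}(\Omega)$, $\Phi_\rho\ge\varrho$, $\max_{i\in\{\theta,z\},\,j\in\{\rho,\theta,z\}}\|\partial_i\Phi_j\|_{L^\infty(\Omega)}\le m$ (derivatives of the scalar cylindrical components), and $\partial_z\Phi_z\ge0$ a.e. The bulk energy is $\mathcal{E}^{NL}_b(\varrho,h)=|\Omega|(\varrho^2-1)^2+|\Omega|\varrho^2h^2$. $a\vee b=\max\{a,b\}$. $\min_A E$ denotes the minimum energy value, i.e. the infimum of $E$ over $A$. $X\lesssim_a Y$ means $X\le CY$ with $C>0$ depending only on $a$; $X\sim_aY$ means $X\lesssim_aY$ and $Y\lesssim_aX$. *)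

theory Defs
  imports "HOL-Analysis.Analysis" "HOL-Probability.Essential_Supremum"
begin

section \<open>Domain, smooth functions and Sobolev spaces\<close>

text \<open>Points of the plane are pairs \<open>(\<theta>, z)\<close>. All functions on \<open>\<Omega>\<close> are modelled as functions on
  the whole plane; values off \<open>\<Omega>\<close> never matter, since everything below integrates over \<open>\<Omega>\<close>
  only.\<close>

definition Omega :: "(real \<times> real) set" where
  "Omega = {0..2 * pi} \<times> {- 1/2..1/2}"

definition partial_theta :: "(real \<times> real \<Rightarrow> real) \<Rightarrow> real \<times> real \<Rightarrow> real" where
  "partial_theta \<phi> = (\<lambda>(\<theta>, z). deriv (\<lambda>s. \<phi> (s, z)) \<theta>)"

definition partial_z :: "(real \<times> real \<Rightarrow> real) \<Rightarrow> real \<times> real \<Rightarrow> real" where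
  "partial_z \<phi> = (\<lambda>(\<theta>, z). deriv (\<lambda>t. \<phi> (\<theta>, t)) z)"

definition partials :: "nat \<Rightarrow> nat \<Rightarrow> (real \<times> real \<Rightarrow> real) \<Rightarrow> real \<times> real \<Rightarrow> real" where
  "partials i j \<phi> = (partial_theta ^^ i) ((partial_z ^^ j) \<phi>)"

text \<open>\<open>C\<^sup>\<infinity>\<close> on the plane: Frechet differentiability of every \<open>\<partial>\<^sub>\<theta>\<^sup>i \<partial>\<^sub>z\<^sup>j \<phi>\<close> makes all of them continuous,
  so by Schwarz's theorem no other order of differentiation has to be considered.\<close>

definition smooth :: "(real \<times> real \<Rightarrow> real) \<Rightarrow> bool" where
  "smooth \<phi> \<longleftrightarrow> (\<forall>i j p. partials i j \<phi> differentiable (at p))"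

definition interior_tests :: "(real \<times> real \<Rightarrow> real) set" where
  "interior_tests = {\<phi>. smooth \<phi> \<and> compact (closure {p. \<phi> p \<noteq> 0}) \<and>
     closure {p. \<phi> p \<noteq> 0} \<subseteq> interior Omega}"

definition periodic_tests :: "(real \<times> real \<Rightarrow> real) set" where
  "periodic_tests = {\<phi>. smooth \<phi> \<and>
     (\<forall>\<theta> z. \<phi> (\<theta> + 2 * pi, z) = \<phi> (\<theta>, z) \<and> \<phi> (\<theta>, z + 1) = \<phi> (\<theta>, z))}"

text \<open>\<open>g\<close> is the distributional derivative \<open>\<partial>\<^sub>\<theta>\<^sup>i \<partial>\<^sub>z\<^sup>j f\<close>. With \<open>T = interior_tests\<close> this is the usual
  weak derivative on the open rectangle; with \<open>T = periodic_tests\<close> it is the weak derivative on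
  the torus, i.e. that of the \<open>\<Omega>\<close>-periodic extension of \<open>f\<close> to the plane.\<close>

definition is_weak_deriv ::
  "(real \<times> real \<Rightarrow> real) set \<Rightarrow> nat \<Rightarrow> nat \<Rightarrow>
   (real \<times> real \<Rightarrow> 'a::euclidean_space) \<Rightarrow> (real \<times> real \<Rightarrow> 'a) \<Rightarrow> bool" where
  "is_weak_deriv T i j f g \<longleftrightarrow>
     integrable (lebesgue_on Omega) f \<and> integrable (lebesgue_on Omega) g \<and>
     (\<forall>\<phi>\<in>T. (\<integral>p. partials i j \<phi> p *\<^sub>R f p \<partial>lebesgue_on Omega)
            = (- 1) ^ (i + j) *\<^sub>R (\<integral>p. \<phi> p *\<^sub>R g p \<partial>lebesgue_on Omega))"

text \<open>Weak derivatives are unique almost everywhere on \<open>\<Omega>\<close>; a representative is chosen. It is used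
  only under integrals, essential suprema and almost-everywhere quantifiers.\<close>

definition weak_deriv ::
  "nat \<Rightarrow> nat \<Rightarrow> (real \<times> real \<Rightarrow> 'a::euclidean_space) \<Rightarrow> real \<times> real \<Rightarrow> 'a" where
  "weak_deriv i j f = (SOME g. is_weak_deriv interior_tests i j f g)"

definition L2 :: "(real \<times> real \<Rightarrow> real) set" where
  "L2 = {f \<in> borel_measurable (lebesgue_on Omega). integrable (lebesgue_on Omega) (\<lambda>p. (f p)\<^sup>2)}"

definition H_per :: "nat \<Rightarrow> (real \<times> real \<Rightarrow> real) set" where
  "H_per k = {f \<in> L2. \<forall>i j. i + j \<le> k \<longrightarrow> (\<exists>g\<in>L2. is_weak_deriv periodic_tests i j f g)}"

definition Linf_norm :: "(real \<times> real \<Rightarrow> real) \<Rightarrow> ereal" where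
  "Linf_norm f = esssup (lebesgue_on Omega) (\<lambda>p. ereal \<bar>f p\<bar>)"

section \<open>Deformations and energies\<close>

text \<open>A deformation is given by its cylindrical components \<open>(\<Phi>\<^sub>\<rho>, \<Phi>\<^sub>\<theta>, \<Phi>\<^sub>z)\<close>.\<close>

type_synonym deformation = "real \<times> real \<Rightarrow> real \<times> real \<times> real"

definition comp_rho :: "deformation \<Rightarrow> real \<times> real \<Rightarrow> real" where
  "comp_rho \<Phi> p = fst (\<Phi> p)"

definition comp_theta :: "deformation \<Rightarrow> real \<times> real \<Rightarrow> real" where
  "comp_theta \<Phi> p = fst (snd (\<Phi> p))"

definition comp_z :: "deformation \<Rightarrow> real \<times> real \<Rightarrow> real" where
  "comp_z \<Phi> p = snd (snd (\<Phi> p))"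

definition cartesian :: "deformation \<Rightarrow> real \<times> real \<Rightarrow> real^3" where
  "cartesian \<Phi> p = vector [comp_rho \<Phi> p * cos (comp_theta \<Phi> p),
                           comp_rho \<Phi> p * sin (comp_theta \<Phi> p), comp_z \<Phi> p]"

text \<open>The 3-by-2 matrix with columns \<open>\<partial>\<^sub>\<theta>\<Phi>\<close> and \<open>\<partial>\<^sub>z\<Phi>\<close>.\<close>

definition grad :: "deformation \<Rightarrow> real \<times> real \<Rightarrow> real^2^3" where
  "grad \<Phi> p = transpose (vector [weak_deriv 1 0 (cartesian \<Phi>) p, weak_deriv 0 1 (cartesian \<Phi>) p])"

definition hess_norm_sq :: "deformation \<Rightarrow> real \<times> real \<Rightarrow> real" where
  "hess_norm_sq \<Phi> p = (norm (weak_deriv 2 0 (cartesian \<Phi>) p))\<^sup>2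
     + 2 * (norm (weak_deriv 1 1 (cartesian \<Phi>) p))\<^sup>2
     + (norm (weak_deriv 0 2 (cartesian \<Phi>) p))\<^sup>2"

text \<open>The norm on \<^typ>\<open>real^2^2\<close> is the Frobenius norm.\<close>

definition energy_NL :: "real \<Rightarrow> deformation \<Rightarrow> ennreal" where
  "energy_NL h \<Phi> = (\<integral>\<^sup>+p. ennreal ((norm (transpose (grad \<Phi> p) ** grad \<Phi> p - mat 1))\<^sup>2
       + h\<^sup>2 * hess_norm_sq \<Phi> p) \<partial>lebesgue_on Omega)"

definition admissible_NL :: "real \<Rightarrow> real \<Rightarrow> real \<Rightarrow> deformation set" where
  "admissible_NL lam \<rho> m = {\<Phi>.
     comp_rho \<Phi> \<in> H_per 2 \<and>
     (\<lambda>(\<theta>, z). comp_theta \<Phi> (\<theta>, z) - \<theta>) \<in> H_per 2 \<and>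
     (\<lambda>(\<theta>, z). comp_z \<Phi> (\<theta>, z) - (1 - lam) * z) \<in> H_per 2 \<and>
     (AE p in lebesgue_on Omega. comp_rho \<Phi> p \<ge> \<rho>) \<and>
     (\<forall>f\<in>{comp_rho \<Phi>, comp_theta \<Phi>, comp_z \<Phi>}.
        Linf_norm (weak_deriv 1 0 f) \<le> ereal m \<and> Linf_norm (weak_deriv 0 1 f) \<le> ereal m) \<and>
     (AE p in lebesgue_on Omega. weak_deriv 0 1 (comp_z \<Phi>) p \<ge> 0)}"

text \<open>The infimum is taken in the extended reals, so it carries no junk value.\<close>

definition min_energy_NL :: "real \<Rightarrow> real \<Rightarrow> real \<Rightarrow> real \<Rightarrow> ereal" where
  "min_energy_NL h lam \<rho> m = enn2ereal (INF \<Phi>\<in>admissible_NL lam \<rho> m. energy_NL h \<Phi>)"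

definition bulk_energy_NL :: "real \<Rightarrow> real \<Rightarrow> real" where
  "bulk_energy_NL \<rho> h =
     measure lebesgue Omega * (\<rho>\<^sup>2 - 1)\<^sup>2 + measure lebesgue Omega * \<rho>\<^sup>2 * h\<^sup>2"

text \<open>\<open>c\<^sub>0(\<lambda>, h, 1)\<close>; only the value 1 of the third argument is used.\<close>

definition c0_one :: "real \<Rightarrow> real \<Rightarrow> real" where
  "c0_one lam h = min (lam powr (1/2) * h powr (1/4)) (h powr (1/2))"

end

theory Submission
  imports Defs "HOL-Computational_Algebra.Polynomial"
begin

text \<open>
Write an admissible deformation as \<open>(R, \<theta> + S, (1 - \<lambda>) z + W)\<close> with periodic \<open>R, S, W\<close>, put
\<open>T = \<theta> + S\<close> and \<open>Z = (1 - \<lambda>) z + W\<close>, and let \<open>a = max (\<rho>\<^sup>2 - 1) (h\<^sup>2)\<close>. The metric of the deformation is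
\<open>g\<^sub>1\<^sub>1 = R\<^sub>\<theta>\<^sup>2 + R\<^sup>2 T\<^sub>\<theta>\<^sup>2 + Z\<^sub>\<theta>\<^sup>2\<close>, \<open>g\<^sub>1\<^sub>2 = R\<^sub>\<theta> R\<^sub>z + R\<^sup>2 T\<^sub>\<theta> T\<^sub>z + Z\<^sub>\<theta> Z\<^sub>z\<close>, \<open>g\<^sub>2\<^sub>2 = R\<^sub>z\<^sup>2 + R\<^sup>2 T\<^sub>z\<^sup>2 + Z\<^sub>z\<^sup>2\<close>.

\<^bold>\<open>Lower bound.\<close> The bulk energy is what \<open>(g\<^sub>1\<^sub>1 - 1)\<^sup>2\<close> and the azimuthal bending cost on the mandrel
\<open>R = \<rho>\<close>. Expanding both around \<open>\<rho>\<close> produces terms linear in \<open>T\<^sub>\<theta> - 1\<close> and \<open>R\<^sub>\<theta>\<^sub>\<theta>\<close>, which have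
mean zero by periodicity, and a nonnegative excess (\<open>dens_ge_excess\<close>). Since \<open>R \<ge> \<rho>\<close>, the excess
charges \<open>a\<close> per unit of \<open>R - \<rho>\<close>, and it contains \<open>g\<^sub>1\<^sub>2\<^sup>2\<close>, \<open>(g\<^sub>2\<^sub>2 - 1)\<^sup>2\<close> and the axial bending
\<open>h\<^sup>2 (R\<^sub>z\<^sub>z - R T\<^sub>z\<^sup>2)\<^sup>2\<close>. On every line \<open>\<theta> = const\<close> the height \<open>Z\<close> is short by \<open>\<lambda>\<close>, and by
\<open>compression_pointwise\<close> (this is where \<open>Z\<^sub>z \<ge> 0\<close> enters) the missing length is compressed, used up by
\<open>R\<^sub>z\<^sup>2\<close>, or used up by the twist \<open>R\<^sup>2 T\<^sub>z\<^sup>2\<close>; the twist is in turn controlled by the shear \<open>g\<^sub>1\<^sub>2\<close>, by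
\<open>R\<^sub>z\<^sup>2\<close> and by \<open>Z\<^sub>\<theta>\<^sup>2\<close>. So unless the excess is already of order \<open>\<lambda>\<^sup>2\<close> or \<open>a \<lambda>\<close>, most lines carry
\<open>\<integral> R\<^sub>z\<^sup>2 \<ge> c \<lambda>\<close>. There \<open>r = R - \<rho>\<close> is nonnegative and periodic and satisfies the one-sided bound
\<open>r'' \<ge> - \<beta>\<close> with \<open>\<beta> = \<bar>R\<^sub>z\<^sub>z - R T\<^sub>z\<^sup>2\<bar>\<close>, because \<open>R T\<^sub>z\<^sup>2 \<ge> 0\<close>. Testing this inequality with functions of \<open>r\<close> gives two
interpolation inequalities between \<open>\<integral> r\<close>, \<open>\<integral> r'\<^sup>2\<close> and \<open>\<integral> \<beta>\<^sup>2\<close> (\<open>gagliardo_nirenberg\<close> and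
\<open>truncated_interpolation\<close>), and minimizing \<open>a \<integral> r + h\<^sup>2 \<integral> \<beta>\<^sup>2\<close> under each of them yields the two terms of
the maximum (\<open>wrinkle_cost\<close>). The hypothesis \<open>c\<^sub>0 \<le> a\<close> makes the right-hand side at most \<open>a \<lambda>\<close>
(\<open>target_le\<close>), so that the exceptional case of an excess of order \<open>a \<lambda>\<close> is harmless.

\<^bold>\<open>From smooth to Sobolev.\<close> The argument above is run for classically differentiable \<open>R, S, W\<close> (locale \<open>smooth_shell\<close>).
Convolution with a nonnegative trigonometric kernel on the torus preserves every constraint and commutes with weak
derivatives, and a version of Fatou's lemma passes the lower bound to the limit (\<open>weak_lower_bound\<close>).
A chain rule for \<open>R cos T\<close> and \<open>R sin T\<close>, also obtained by mollification, identifies the weak derivatives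
of the Cartesian deformation, and the uniqueness of weak derivatives (\<open>weak_deriv_AE\<close>) connects them
with the energy.

\<^bold>\<open>Upper bound.\<close> The uniformly compressed cylinder has excess of order \<open>\<lambda>\<^sup>2\<close>. The other
competitors are axisymmetric with generating curve \<open>R' = sin \<phi>\<close>, \<open>Z' = cos \<phi>\<close>, which has no axial
strain: \<open>N\<close> wrinkles of width \<open>l\<close> in which \<open>\<phi>\<close> runs through \<open>A sin\<close>. The amplitude \<open>A\<close> is fixed by
the prescribed compression. A single wrinkle realizes the first term of the maximum, and wrinkles filling a
length \<open>2 \<lambda>\<close> realize the second (\<open>wrinkle_scales\<close>).
\<close>

section \<open>Smooth functions of one variable\<close>

definition smooth1 :: "(real \<Rightarrow> real) \<Rightarrow> bool" where
  "smooth1 f \<longleftrightarrow> (\<forall>n x. (deriv ^^ n) f differentiable (at x))"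

definition diff_upto :: "nat \<Rightarrow> (real \<Rightarrow> real) \<Rightarrow> bool" where
  "diff_upto n f \<longleftrightarrow> (\<forall>k\<le>n. \<forall>x. (deriv ^^ k) f differentiable (at x))"

lemma smooth1_diff_upto: "smooth1 f \<longleftrightarrow> (\<forall>n. diff_upto n f)"
  unfolding smooth1_def diff_upto_def by auto

lemma diff_upto_0: "diff_upto 0 f \<longleftrightarrow> (\<forall>x. f differentiable (at x))"
  by (simp add: diff_upto_def)

lemma diff_upto_Suc: "diff_upto (Suc n) f \<longleftrightarrow> (\<forall>x. f differentiable (at x)) \<and> diff_upto n (deriv f)"
proof -
  have "(\<forall>k\<le>Suc n. \<forall>x. (deriv ^^ k) f differentiable (at x)) \<longleftrightarrow>
     (\<forall>x. f differentiable (at x)) \<and> (\<forall>k\<le>n. \<forall>x. (deriv ^^ k) (deriv f) differentiable (at x))"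
    (is "?L \<longleftrightarrow> ?R")
  proof
    assume L: ?L
    show ?R
    proof (intro conjI allI impI)
      fix x show "f differentiable (at x)" using L[rule_format, of 0] by simp
    next
      fix k x assume "k \<le> n"
      then show "(deriv ^^ k) (deriv f) differentiable (at x)"
        using L[rule_format, of "Suc k" x] by (simp add: funpow_swap1)
    qed
  next
    assume R: ?R
    show ?L
    proof (intro allI impI)
      fix k x assume "k \<le> Suc n"
      then show "(deriv ^^ k) f differentiable (at x)"
        using R by (cases k) (auto simp: funpow_swap1)
    qed
  qed
  then show ?thesis by (simp add: diff_upto_def)
qed

lemma diff_upto_mono: "diff_upto n f \<Longrightarrow> k \<le> n \<Longrightarrow> diff_upto k f"
  by (simp add: diff_upto_def)

lemma diff_upto_add: "diff_upto n f \<Longrightarrow> diff_upto n g \<Longrightarrow> diff_upto n (\<lambda>x. f x + g x)"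
proof (induction n arbitrary: f g)
  case 0 then show ?case by (simp add: diff_upto_0)
next
  case (Suc n)
  have "deriv (\<lambda>x. f x + g x) = (\<lambda>x. deriv f x + deriv g x)"
    using Suc.prems by (auto simp: diff_upto_Suc DERIV_deriv_iff_real_differentiable
        intro!: ext DERIV_imp_deriv derivative_intros)
  then show ?case using Suc by (auto simp: diff_upto_Suc)
qed

lemma diff_upto_mult: "diff_upto n f \<Longrightarrow> diff_upto n g \<Longrightarrow> diff_upto n (\<lambda>x. f x * g x)"
proof (induction n arbitrary: f g)
  case 0 then show ?case by (simp add: diff_upto_0)
next
  case (Suc n)
  have "deriv (\<lambda>x. f x * g x) = (\<lambda>x. deriv f x * g x + f x * deriv g x)"
  proof
    fix x
    have "(f has_real_derivative deriv f x) (at x)" "(g has_real_derivative deriv g x) (at x)"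
      using Suc.prems by (auto simp: diff_upto_Suc DERIV_deriv_iff_real_differentiable)
    then show "deriv (\<lambda>x. f x * g x) x = deriv f x * g x + f x * deriv g x"
      by (auto intro!: DERIV_imp_deriv derivative_eq_intros)
  qed
  moreover have "diff_upto n f" "diff_upto n g"
    using Suc.prems diff_upto_mono le_SucI by blast+
  ultimately show ?case using Suc by (auto simp: diff_upto_Suc intro!: diff_upto_add)
qed

lemma smooth1_mult: "smooth1 f \<Longrightarrow> smooth1 g \<Longrightarrow> smooth1 (\<lambda>x. f x * g x)"
  by (simp add: smooth1_diff_upto diff_upto_mult)

lemma smooth1_deriv: "smooth1 f \<Longrightarrow> smooth1 (deriv f)"
  by (auto simp: smooth1_diff_upto diff_upto_Suc dest: spec[of _ "Suc _"])

lemma smooth1_DERIV: "smooth1 f \<Longrightarrow> (f has_real_derivative deriv f x) (at x)"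
  by (metis DERIV_deriv_iff_real_differentiable diff_upto_0 smooth1_diff_upto)

lemma smooth1_continuous: "smooth1 f \<Longrightarrow> continuous_on S f"
  by (meson DERIV_continuous_on has_field_derivative_at_within smooth1_DERIV)

text \<open>A family that is closed under differentiation consists of smooth functions; the concrete
  functions below are all handled by exhibiting such a family.\<close>

lemma smooth1I:
  assumes "f \<in> F" and "\<And>g. g \<in> F \<Longrightarrow> \<exists>g'\<in>F. \<forall>x. (g has_real_derivative g' x) (at x)"
  shows "smooth1 f"
proof -
  have "diff_upto n g" if "g \<in> F" for n g
    using that
  proof (induction n arbitrary: g)
    case 0 then show ?case using assms(2) real_differentiable_def diff_upto_0 by blast
  next
    case (Suc n)
    then obtain g' where g': "g' \<in> F" "\<forall>x. (g has_real_derivative g' x) (at x)"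
      using assms(2) by blast
    then have "deriv g = g'" by (auto intro!: ext DERIV_imp_deriv)
    then show ?case using Suc.IH g' by (auto simp: diff_upto_Suc real_differentiable_def)
  qed
  then show ?thesis using assms(1) by (simp add: smooth1_diff_upto)
qed

lemma smooth1_const: "smooth1 (\<lambda>x. c)"
  by (rule smooth1I[where F = "range (\<lambda>c x. c)"]) (auto intro!: derivative_eq_intros)

lemma smooth1_affine:
  assumes "smooth1 f"
  shows "smooth1 (\<lambda>x. f (a * x + b))"
proof (rule smooth1I[where F = "{\<lambda>x. c * g (a * x + b) | c g. smooth1 g}"])
  show "(\<lambda>x. f (a * x + b)) \<in> {\<lambda>x. c * g (a * x + b) | c g. smooth1 g}"
    using assms by (auto intro!: exI[of _ 1] exI[of _ f])
next
  fix g assume "g \<in> {\<lambda>x. c * g (a * x + b) | c g. smooth1 g}"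
  then obtain c k where g: "g = (\<lambda>x. c * k (a * x + b))" "smooth1 k" by auto
  have "(g has_real_derivative (c * a) * deriv k (a * x + b)) (at x)" for x
    unfolding g(1) by (rule derivative_eq_intros DERIV_chain2[OF smooth1_DERIV[OF g(2)]] refl | simp)+
  then show "\<exists>g'\<in>{\<lambda>x. c * g (a * x + b) | c g. smooth1 g}. \<forall>x. (g has_real_derivative g' x) (at x)"
    using smooth1_deriv[OF g(2)] by (intro bexI[of _ "\<lambda>x. (c * a) * deriv k (a * x + b)"]) auto
qed

lemma smooth1_cos: "smooth1 cos"
proof (rule smooth1I[where F = "range (\<lambda>(a, b) x. a * cos x + b * sin x)"])
  show "cos \<in> range (\<lambda>(a, b) x. a * cos x + b * sin x)"
    by (auto intro!: image_eqI[of _ _ "(1, 0)"])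
next
  fix g :: "real \<Rightarrow> real" assume "g \<in> range (\<lambda>(a, b) x. a * cos x + b * sin x)"
  then obtain a b where g: "g = (\<lambda>x. a * cos x + b * sin x)" by auto
  have "(g has_real_derivative b * cos x + (- a) * sin x) (at x)" for x
    unfolding g by (auto intro!: derivative_eq_intros)
  then show "\<exists>g'\<in>range (\<lambda>(a, b) x. a * cos x + b * sin x). \<forall>x. (g has_real_derivative g' x) (at x)"
    by (intro bexI[of _ "\<lambda>x. b * cos x + (- a) * sin x"]) (auto intro!: image_eqI[of _ _ "(b, - a)"])
qed

lemma smooth1_power: "smooth1 f \<Longrightarrow> smooth1 (\<lambda>x. f x ^ n)"
  by (induction n) (auto intro: smooth1_const smooth1_mult)

text \<open>For \<open>p = 1\<close> this is the classical smooth function that is positive exactly on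
  the right half-line. The polynomial factor makes the family closed under differentiation.\<close>

definition flat :: "real poly \<Rightarrow> real \<Rightarrow> real" where
  "flat p x = (if 0 < x then poly p (1 / x) * exp (- (1 / x)) else 0)"

lemma poly_exp_decay: "((\<lambda>y. poly p y * exp (- y)) \<longlongrightarrow> (0::real)) at_top"
proof -
  have "((\<lambda>y. \<Sum>i\<le>degree p. coeff p i * (y ^ i / exp y)) \<longlongrightarrow> (\<Sum>i\<le>degree p. coeff p i * 0)) at_top"
    by (intro tendsto_intros tendsto_power_div_exp_0)
  then show ?thesis
    by (simp add: poly_altdef exp_minus divide_inverse sum_distrib_right mult.assoc)
qed

text \<open>To the right of 0 this is the product rule in the variable \<open>1 / x\<close>; at 0
  exponential decay beats the polynomial, so the difference quotient tends to 0 from both sides.\<close>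

lemma flat_DERIV: "(flat p has_real_derivative flat ([:0,0,1:] * (p - pderiv p)) x) (at x)"
proof -
  consider "x < 0" | "x = 0" | "x > 0" by linarith
  then show ?thesis
  proof cases
    case 1
    have "((\<lambda>_. 0) has_real_derivative 0) (at x)" by simp
    then have "(flat p has_real_derivative 0) (at x)"
      by (rule DERIV_cong_ev[THEN iffD1, rotated 3])
         (use 1 eventually_nhds_in_open[of "{..<0}" x] in \<open>auto elim!: eventually_mono simp: flat_def\<close>)
    then show ?thesis using 1 by (simp add: flat_def)
  next
    case 2
    have right: "((\<lambda>h. flat p h / h) \<longlongrightarrow> 0) (at_right 0)"
    proof -
      have "((\<lambda>h. poly (pCons 0 p) (inverse h) * exp (- inverse h)) \<longlongrightarrow> 0) (at_right 0)"
        by (rule filterlim_compose[OF poly_exp_decay filterlim_inverse_at_top_right])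
      then show ?thesis
        by (rule tendsto_cong[THEN iffD1, rotated])
           (auto simp: flat_def field_simps eventually_at_filter)
    qed
    have left: "((\<lambda>h. flat p h / h) \<longlongrightarrow> 0) (at_left 0)"
      by (rule tendsto_eventually) (auto simp: flat_def eventually_at_filter)
    have "((\<lambda>h. flat p h / h) \<longlongrightarrow> 0) (at 0)"
      using left right by (simp add: filterlim_at_split)
    then show ?thesis using 2 by (simp add: DERIV_def flat_def)
  next
    case 3
    have "((\<lambda>x. poly p (1 / x) * exp (- (1 / x))) has_real_derivative
       flat ([:0,0,1:] * (p - pderiv p)) x) (at x)"
      using 3 by (auto intro!: derivative_eq_intros poly_DERIV[THEN DERIV_chain2]
          simp: flat_def field_simps power2_eq_square)
    then show ?thesis
      by (rule DERIV_cong_ev[THEN iffD1, rotated 3])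
         (use 3 eventually_nhds_in_open[of "{0<..}" x] in \<open>auto elim!: eventually_mono simp: flat_def\<close>)
  qed
qed

lemma smooth1_flat: "smooth1 (flat p)"
  by (rule smooth1I[where F = "range flat"]) (use flat_DERIV in blast)+

lemma flat1_pos: "x > 0 \<Longrightarrow> flat 1 x > 0" and flat1_zero: "x \<le> 0 \<Longrightarrow> flat 1 x = 0"
  by (auto simp: flat_def)

lemma partials_prod:
  assumes "smooth1 b" "smooth1 c"
  shows "partials i j (\<lambda>(s, t). b s * c t) = (\<lambda>(s, t). (deriv ^^ i) b s * (deriv ^^ j) c t)"
proof -
  have z: "(partial_z ^^ j) (\<lambda>(s, t). b s * c t) = (\<lambda>(s, t). b s * (deriv ^^ j) c t)"
  proof (induction j)
    case (Suc j)
    have "(deriv ^^ j) c differentiable (at t)" for t using assms(2) by (simp add: smooth1_def)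
    then have "((\<lambda>t. b s * (deriv ^^ j) c t) has_real_derivative b s * deriv ((deriv ^^ j) c) t) (at t)" for s t
      by (intro DERIV_cmult) (simp add: DERIV_deriv_iff_real_differentiable)
    then show ?case using Suc
      by (auto simp: partial_z_def fun_eq_iff intro!: DERIV_imp_deriv)
  qed auto
  have "(partial_theta ^^ i) (\<lambda>(s, t). b s * (deriv ^^ j) c t) = (\<lambda>(s, t). (deriv ^^ i) b s * (deriv ^^ j) c t)"
  proof (induction i)
    case (Suc i)
    have "(deriv ^^ i) b differentiable (at t)" for t using assms(1) by (simp add: smooth1_def)
    then have "((\<lambda>s. (deriv ^^ i) b s * y) has_real_derivative deriv ((deriv ^^ i) b) s * y) (at s)" for s y
      by (intro DERIV_cmult_right) (simp add: DERIV_deriv_iff_real_differentiable)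
    then show ?case using Suc
      by (auto simp: partial_theta_def fun_eq_iff intro!: DERIV_imp_deriv)
  qed auto
  then show ?thesis by (simp add: partials_def z)
qed

lemma smooth_prod:
  assumes "smooth1 b" "smooth1 c"
  shows "smooth (\<lambda>(s, t). b s * c t)"
  unfolding smooth_def partials_prod[OF assms]
proof (intro allI)
  fix i j and p :: "real \<times> real"
  have "(deriv ^^ i) b differentiable (at (fst p))" "(deriv ^^ j) c differentiable (at (snd p))"
    using assms by (auto simp: smooth1_def)
  then have "(\<lambda>q. (deriv ^^ i) b (fst q)) differentiable (at p)"
    "(\<lambda>q. (deriv ^^ j) c (snd q)) differentiable (at p)"
    by (metis differentiable_compose bounded_linear_imp_differentiable bounded_linear_fst,
        metis differentiable_compose bounded_linear_imp_differentiable bounded_linear_snd)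
  then show "(\<lambda>(s, t). (deriv ^^ i) b s * (deriv ^^ j) c t) differentiable (at p)"
    unfolding case_prod_unfold by (rule differentiable_mult)
qed

lemma periodic_tests_prod:
  assumes "smooth1 b" "smooth1 c" "\<And>s. b (s + 2 * pi) = b s" "\<And>t. c (t + 1) = c t"
  shows "(\<lambda>(s, t). b s * c t) \<in> periodic_tests"
  using assms smooth_prod[of b c] by (auto simp: periodic_tests_def)

lemma deriv_periodic:
  assumes "\<And>s. b (s + L) = b s" shows "deriv b (s + L) = deriv (b :: real \<Rightarrow> real) s"
proof -
  have "(b has_real_derivative D) (at (s + L)) \<longleftrightarrow> (b has_real_derivative D) (at s)" for D
  proof -
    have "(b has_real_derivative D) (at (s + L)) \<longleftrightarrow> ((\<lambda>x. b (x + L)) has_real_derivative D) (at s)"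
      by (rule DERIV_shift)
    then show ?thesis by (simp add: assms)
  qed
  then show ?thesis by (simp add: deriv_def)
qed

lemma interior_Omega: "interior Omega = {0<..<2 * pi} \<times> {- 1/2<..<1/2}"
  by (simp add: Omega_def interior_Times)

text \<open>Supports in smaller closed intervals give a compact support inside the open rectangle.\<close>

lemma interior_tests_prod:
  assumes "smooth1 b" "smooth1 c" "0 < \<alpha>" "\<beta> < 2 * pi" "- 1/2 < \<gamma>" "\<delta> < 1/2"
    "\<And>s. b s \<noteq> 0 \<Longrightarrow> s \<in> {\<alpha>..\<beta>}" "\<And>t. c t \<noteq> 0 \<Longrightarrow> t \<in> {\<gamma>..\<delta>}"
  shows "(\<lambda>(s, t). b s * c t) \<in> interior_tests"
proof -
  have sub: "{p. (\<lambda>(s, t). b s * c t) p \<noteq> 0} \<subseteq> {\<alpha>..\<beta>} \<times> {\<gamma>..\<delta>}"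
    using assms(7,8) by auto
  have cl: "closed ({\<alpha>..\<beta>} \<times> {\<gamma>..\<delta>})" and co: "compact ({\<alpha>..\<beta>} \<times> {\<gamma>..\<delta>})"
    by (auto intro: closed_Times compact_Times)
  have "closure {p. (\<lambda>(s, t). b s * c t) p \<noteq> 0} \<subseteq> {\<alpha>..\<beta>} \<times> {\<gamma>..\<delta>}"
    using sub cl by (rule closure_minimal)
  moreover have "compact (closure {p. (\<lambda>(s, t). b s * c t) p \<noteq> 0})"
    using bounded_subset[OF compact_imp_bounded[OF co] sub] by (simp add: compact_closure)
  moreover have "{\<alpha>..\<beta>} \<times> {\<gamma>..\<delta>} \<subseteq> interior Omega"
    using assms(3-6) by (auto simp: interior_Omega)
  ultimately show ?thesis using smooth_prod[OF assms(1,2)] by (auto simp: interior_tests_def)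
qed

section \<open>Integration over the rectangle\<close>

abbreviation LO :: "(real \<times> real) measure" where "LO \<equiv> lebesgue_on Omega"

lemma Omega_cbox: "Omega = cbox (0, - 1/2) (2 * pi, 1/2)"
  by (simp add: Omega_def cbox_Pair_eq)

lemma Omega_lmeasurable: "Omega \<in> lmeasurable"
  by (simp add: Omega_cbox)

lemma Omega_sets [simp]: "Omega \<in> sets lebesgue"
  by (simp add: Omega_cbox)

lemma space_LO [simp]: "space LO = Omega"
  by simp

lemma measure_Omega: "measure lebesgue Omega = 2 * pi"
  by (simp add: Omega_cbox content_Pair)

lemma measure_LO: "measure LO Omega = 2 * pi"
  by (simp add: measure_restrict_space measure_Omega)

interpretation LO: finite_measure LO
  by (rule finite_measureI) (use Omega_lmeasurable in \<open>simp add: emeasure_restrict_space fmeasurable_def\<close>)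

lemma AE_LO_interior: "AE p in LO. p \<in> interior Omega"
proof -
  have "negligible (Omega - interior Omega)"
    using negligible_frontier_interval[of "(0, - 1/2) :: real \<times> real" "(2 * pi, 1/2)"]
    by (simp add: Omega_cbox interior_cbox)
  then have "Omega - interior Omega \<in> null_sets lebesgue"
    by (simp add: negligible_iff_null_sets)
  then have "AE p in lebesgue. p \<notin> Omega - interior Omega"
    by (rule AE_not_in)
  then show ?thesis
    by (auto simp: AE_restrict_space_iff)
qed

lemma AE_LO_Omega: "AE p in LO. p \<in> Omega"
  by (rule AE_I2) simp

lemma LO_measurable_borel: "f \<in> borel_measurable borel \<Longrightarrow> f \<in> borel_measurable LO"
  by (simp add: measurable_completion measurable_restrict_space1)

lemma continuous_LO_measurable:
  "continuous_on UNIV f \<Longrightarrow> (f :: real \<times> real \<Rightarrow> 'a::euclidean_space) \<in> borel_measurable LO"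
  by (intro LO_measurable_borel borel_measurable_continuous_onI)

lemma bounded_LO_integrable:
  fixes f :: "real \<times> real \<Rightarrow> 'a::euclidean_space"
  assumes "f \<in> borel_measurable LO" "\<And>p. p \<in> Omega \<Longrightarrow> norm (f p) \<le> B"
  shows "integrable LO f"
  using assms by (intro LO.integrable_const_bound[where B = B]) auto

lemma continuous_LO_bounded:
  fixes f :: "real \<times> real \<Rightarrow> 'a::euclidean_space"
  assumes "continuous_on UNIV f"
  obtains B where "B > 0" "\<And>p. p \<in> Omega \<Longrightarrow> norm (f p) \<le> B"
proof -
  have "compact (f ` Omega)"
    using assms by (intro compact_continuous_image) (auto simp: Omega_cbox intro: continuous_on_subset)
  then have "bounded (f ` Omega)" by (rule compact_imp_bounded)
  then obtain B where "B > 0" "\<forall>x\<in>f ` Omega. norm x \<le> B" using bounded_pos by blast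
  then show ?thesis using that by blast
qed

lemma continuous_LO_integrable:
  fixes f :: "real \<times> real \<Rightarrow> 'a::euclidean_space"
  assumes "continuous_on UNIV f"
  shows "integrable LO f"
  using continuous_LO_bounded[OF assms] bounded_LO_integrable[OF continuous_LO_measurable[OF assms]]
  by metis

lemma LO_integral_fst:
  fixes f :: "real \<times> real \<Rightarrow> real"
  assumes "continuous_on UNIV f"
  shows "integral\<^sup>L LO f = integral {0..2 * pi} (\<lambda>s. integral {- 1/2..1/2} (\<lambda>t. f (s, t)))"
proof -
  have "integral\<^sup>L LO f = integral Omega f"
    by (intro lebesgue_integral_eq_integral continuous_LO_integrable assms) simp
  also have "\<dots> = integral {0..2 * pi} (\<lambda>s. integral {- 1/2..1/2} (\<lambda>t. f (s, t)))"
    unfolding Omega_cbox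
    by (subst integral_prod_continuous) (auto intro: continuous_on_subset[OF assms])
  finally show ?thesis .
qed

lemma LO_integral_snd:
  fixes f :: "real \<times> real \<Rightarrow> real"
  assumes "continuous_on UNIV f"
  shows "integral\<^sup>L LO f = integral {- 1/2..1/2} (\<lambda>t. integral {0..2 * pi} (\<lambda>s. f (s, t)))"
proof -
  have "integral (cbox 0 (2 * pi)) (\<lambda>s. integral (cbox (- 1/2) (1/2)) (\<lambda>t. f (s, t))) =
     integral (cbox (- 1/2) (1/2)) (\<lambda>t. integral (cbox 0 (2 * pi)) (\<lambda>s. f (s, t)))"
    by (rule integral_swap_continuous) (auto intro: continuous_on_subset[OF assms])
  then show ?thesis using LO_integral_fst[OF assms] by simp
qed

lemma lborel_slices:
  fixes f :: "real \<times> real \<Rightarrow> real"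
  assumes f: "f \<in> borel_measurable borel" "integrable LO f"
  shows "integrable (lborel \<Otimes>\<^sub>M lborel) (\<lambda>p. indicator Omega p * f p)"
    and "integral\<^sup>L LO f = integral\<^sup>L (lborel \<Otimes>\<^sub>M lborel) (\<lambda>p. indicator Omega p * f p)"
proof -
  have Ob: "Omega \<in> sets borel" by (simp add: Omega_cbox)
  have meas: "(\<lambda>p. indicator Omega p * f p) \<in> borel_measurable lborel"
    using f(1) Ob by (simp add: borel_measurable_indicator borel_measurable_times)
  have 1: "integrable lebesgue (\<lambda>p. indicator Omega p * f p)"
    using f(2) by (subst (asm) integrable_restrict_space) auto
  then have 2: "integrable lborel (\<lambda>p. indicator Omega p * f p)"
    using meas by (simp add: integrable_completion)
  then show "integrable (lborel \<Otimes>\<^sub>M lborel) (\<lambda>p. indicator Omega p * f p)"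
    by (simp add: lborel_prod)
  have "integral\<^sup>L LO f = integral\<^sup>L lebesgue (\<lambda>p. indicator Omega p * f p)"
    by (subst integral_restrict_space) auto
  also have "\<dots> = integral\<^sup>L lborel (\<lambda>p. indicator Omega p * f p)"
    using meas by (simp add: integral_completion)
  finally show "integral\<^sup>L LO f = integral\<^sup>L (lborel \<Otimes>\<^sub>M lborel) (\<lambda>p. indicator Omega p * f p)"
    by (simp add: lborel_prod)
qed

text \<open>The hypothesis is a Henstock-Kurzweil statement, the conclusion a Lebesgue one. A function
  that is not Lebesgue integrable has Lebesgue integral 0 by convention, which is the value claimed.\<close>

lemma slice_zero:
  fixes k :: "real \<Rightarrow> real"
  assumes "(k has_integral 0) {a..b}"
  shows "integral\<^sup>L lborel (\<lambda>x. indicator {a..b} x * k x) = 0"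
proof (cases "integrable lborel (\<lambda>x. indicator {a..b} x * k x)")
  case True
  then have "set_integrable lborel {a..b} k" by (simp add: set_integrable_def)
  then have "(LINT x:{a..b}|lborel. k x) = integral {a..b} k"
    by (rule set_borel_integral_eq_integral)
  then show ?thesis using assms by (simp add: set_lebesgue_integral_def integral_unique)
qed (simp add: not_integrable_integral_eq)

text \<open>Fubini's theorem in the form in which integration by parts along lines is lifted to the
  rectangle: the integrals over slices may be Henstock-Kurzweil integrals, as the fundamental theorem of
  calculus provides them.\<close>

lemma LO_integral_zero_z:
  fixes f :: "real \<times> real \<Rightarrow> real"
  assumes f: "f \<in> borel_measurable borel" "integrable LO f"
    and z: "\<And>s. s \<in> {0..2 * pi} \<Longrightarrow> ((\<lambda>t. f (s, t)) has_integral 0) {- 1/2..1/2}"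
  shows "integral\<^sup>L LO f = 0"
proof -
  have "(\<integral>t. indicator Omega (s, t) * f (s, t) \<partial>lborel) = 0" for s
  proof (cases "s \<in> {0..2 * pi}")
    case True
    then have "(\<lambda>t. indicator Omega (s, t) * f (s, t)) = (\<lambda>t. indicator {- 1/2..1/2} t * f (s, t))"
      by (auto simp: Omega_def indicator_def)
    then show ?thesis using slice_zero[OF z[OF True]] by simp
  next
    case False
    then have "(\<lambda>t. indicator Omega (s, t) * f (s, t)) = (\<lambda>t. 0)"
      by (auto simp: Omega_def indicator_def)
    then show ?thesis by simp
  qed
  then show ?thesis
    using lborel_pair.integral_fst'[OF lborel_slices(1)[OF f]] lborel_slices(2)[OF f] by simp
qed

lemma LO_integral_zero_theta:
  fixes f :: "real \<times> real \<Rightarrow> real"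
  assumes f: "f \<in> borel_measurable borel" "integrable LO f"
    and z: "\<And>t. t \<in> {- 1/2..1/2} \<Longrightarrow> ((\<lambda>s. f (s, t)) has_integral 0) {0..2 * pi}"
  shows "integral\<^sup>L LO f = 0"
proof -
  have "(\<integral>s. indicator Omega (s, t) * f (s, t) \<partial>lborel) = 0" for t
  proof (cases "t \<in> {- 1/2..1/2}")
    case True
    then have "(\<lambda>s. indicator Omega (s, t) * f (s, t)) = (\<lambda>s. indicator {0..2 * pi} s * f (s, t))"
      by (auto simp: Omega_def indicator_def)
    then show ?thesis using slice_zero[OF z[OF True]] by simp
  next
    case False
    then have "(\<lambda>s. indicator Omega (s, t) * f (s, t)) = (\<lambda>s. 0)"
      by (auto simp: Omega_def indicator_def)
    then show ?thesis by simp
  qed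
  then show ?thesis
    using lborel_pair.integral_snd[of "\<lambda>s t. indicator Omega (s, t) * f (s, t)"] lborel_slices[OF f]
    by (simp add: case_prod_unfold)
qed

section \<open>Weak derivatives in one direction\<close>

text \<open>Only the derivative in one direction is demanded. This is the regularity of a function whose
  derivative in that direction alone has been mollified, and it allows second derivatives to be reached
  one order at a time.\<close>

definition C1_theta :: "(real \<times> real \<Rightarrow> real) \<Rightarrow> (real \<times> real \<Rightarrow> real) \<Rightarrow> bool" where
  "C1_theta \<psi> \<psi>' \<longleftrightarrow> continuous_on UNIV \<psi> \<and> continuous_on UNIV \<psi>' \<and>
     (\<forall>s t. ((\<lambda>x. \<psi> (x, t)) has_real_derivative \<psi>' (s, t)) (at s))"

definition C1_z :: "(real \<times> real \<Rightarrow> real) \<Rightarrow> (real \<times> real \<Rightarrow> real) \<Rightarrow> bool" where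
  "C1_z \<psi> \<psi>' \<longleftrightarrow> continuous_on UNIV \<psi> \<and> continuous_on UNIV \<psi>' \<and>
     (\<forall>s t. ((\<lambda>x. \<psi> (s, x)) has_real_derivative \<psi>' (s, t)) (at t))"

definition vanishing :: "(real \<times> real \<Rightarrow> real) \<Rightarrow> bool" where
  "vanishing \<psi> \<longleftrightarrow> (\<forall>p. p \<notin> interior Omega \<longrightarrow> \<psi> p = 0)"

definition periodic :: "(real \<times> real \<Rightarrow> real) \<Rightarrow> bool" where
  "periodic \<psi> \<longleftrightarrow> (\<forall>s t. \<psi> (s + 2 * pi, t) = \<psi> (s, t) \<and> \<psi> (s, t + 1) = \<psi> (s, t))"

text \<open>The finite set of exceptional points admits functions with kinks, such as the slope of a
  wrinkled profile where it meets the cylinder.\<close>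

lemma parts_has_integral_zero:
  fixes \<psi> \<psi>' u v :: "real \<Rightarrow> real"
  assumes "finite F" "a \<le> b"
    and \<psi>: "\<And>x. (\<psi> has_real_derivative \<psi>' x) (at x)"
    and u: "\<And>x. x \<in> {a..b} - F \<Longrightarrow> (u has_real_derivative v x) (at x)"
    and uc: "continuous_on {a..b} u" and bd: "\<psi> b * u b = \<psi> a * u a"
  shows "((\<lambda>x. \<psi>' x * u x + \<psi> x * v x) has_integral 0) {a..b}"
proof -
  have "((\<lambda>x. \<psi>' x * u x + \<psi> x * v x) has_integral (\<psi> b * u b - \<psi> a * u a)) {a..b}"
  proof (rule fundamental_theorem_of_calculus_strong[OF assms(1,2)])
    show "((\<lambda>x. \<psi> x * u x) has_vector_derivative \<psi>' x * u x + \<psi> x * v x) (at x)" if "x \<in> {a..b} - F" for x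
      using DERIV_mult[OF \<psi>[of x] u[OF that]]
      by (simp add: has_real_derivative_iff_has_vector_derivative algebra_simps)
    have "continuous_on {a..b} \<psi>"
      by (meson DERIV_continuous_on \<psi> has_field_derivative_at_within)
    then show "continuous_on {a..b} (\<lambda>x. \<psi> x * u x)" using uc by (intro continuous_intros)
  qed
  then show ?thesis using bd by simp
qed

text \<open>The weak derivative in one direction, \<open>D\<close> being \<open>C1_theta\<close> or
  \<open>C1_z\<close>, with \<open>V\<close> the boundary behaviour of the test functions. The tests are
  merely continuously differentiable in this direction, so that a derivative of a smooth test is again a
  test and higher weak derivatives are obtained by iteration.\<close>

definition wd :: "((real \<times> real \<Rightarrow> real) \<Rightarrow> (real \<times> real \<Rightarrow> real) \<Rightarrow> bool) \<Rightarrow>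
   ((real \<times> real \<Rightarrow> real) \<Rightarrow> bool) \<Rightarrow> (real \<times> real \<Rightarrow> real) \<Rightarrow> (real \<times> real \<Rightarrow> real) \<Rightarrow> bool" where
  "wd D V f g \<longleftrightarrow> integrable LO f \<and> integrable LO g \<and>
     (\<forall>\<psi> \<psi>'. D \<psi> \<psi>' \<longrightarrow> V \<psi> \<longrightarrow> (\<integral>p. \<psi>' p * f p \<partial>LO) = - (\<integral>p. \<psi> p * g p \<partial>LO))"

lemma integrable_mult_cont:
  assumes "continuous_on UNIV \<psi>" "integrable LO f"
  shows "integrable LO (\<lambda>p. \<psi> p * f p :: real)"
proof -
  obtain B where B: "\<And>p. p \<in> Omega \<Longrightarrow> norm (\<psi> p) \<le> B"
    using continuous_LO_bounded[OF assms(1)] by metis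
  have m: "\<psi> \<in> borel_measurable LO" by (rule continuous_LO_measurable[OF assms(1)])
  show ?thesis
  proof (rule Bochner_Integration.integrable_bound)
    show "integrable LO (\<lambda>p. B * f p)" using assms(2) by simp
    show "(\<lambda>p. \<psi> p * f p) \<in> borel_measurable LO" using m assms(2) by measurable
    show "AE p in LO. norm (\<psi> p * f p) \<le> norm (B * f p)"
      using B by (intro AE_I2) (force simp: abs_mult intro!: mult_right_mono)
  qed
qed

text \<open>The hypothesis on the boundary values serves both kinds of tests: they agree on opposite
  sides when test and function are periodic, and both sides vanish when the test does.\<close>

lemma wd_z_I:
  assumes m: "u \<in> borel_measurable borel" "v \<in> borel_measurable borel"
    and B: "\<And>p. p \<in> Omega \<Longrightarrow> \<bar>u p\<bar> \<le> B" "\<And>p. p \<in> Omega \<Longrightarrow> \<bar>v p\<bar> \<le> B"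
    and F: "finite F"
    and d: "\<And>s t. s \<in> {0..2 * pi} \<Longrightarrow> t \<in> {- 1/2..1/2} - F \<Longrightarrow> ((\<lambda>x. u (s, x)) has_real_derivative v (s, t)) (at t)"
    and c: "\<And>s. s \<in> {0..2 * pi} \<Longrightarrow> continuous_on {- 1/2..1/2} (\<lambda>x. u (s, x))"
    and bd: "\<And>\<psi> s. V \<psi> \<Longrightarrow> s \<in> {0..2 * pi} \<Longrightarrow> \<psi> (s, 1/2) * u (s, 1/2) = \<psi> (s, - 1/2) * u (s, - 1/2)"
  shows "wd C1_z V u v"
proof -
  have i: "integrable LO u" "integrable LO v"
    using B m by (auto intro!: bounded_LO_integrable[where B = B] LO_measurable_borel)
  have "(\<integral>p. \<psi>' p * u p \<partial>LO) = - (\<integral>p. \<psi> p * v p \<partial>LO)" if D: "C1_z \<psi> \<psi>'" and V: "V \<psi>" for \<psi> \<psi>'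
  proof -
    have c': "continuous_on UNIV \<psi>" "continuous_on UNIV \<psi>'" using D by (auto simp: C1_z_def)
    have i': "integrable LO (\<lambda>p. \<psi>' p * u p)" "integrable LO (\<lambda>p. \<psi> p * v p)"
      using c' i by (auto intro: integrable_mult_cont)
    have b': "\<psi> \<in> borel_measurable borel" "\<psi>' \<in> borel_measurable borel"
      using c' by (auto intro: borel_measurable_continuous_onI)
    have "(\<integral>p. \<psi>' p * u p + \<psi> p * v p \<partial>LO) = 0"
    proof (rule LO_integral_zero_z)
      show "(\<lambda>p. \<psi>' p * u p + \<psi> p * v p) \<in> borel_measurable borel" using b' m by measurable
      show "integrable LO (\<lambda>p. \<psi>' p * u p + \<psi> p * v p)" using i' by simp
      show "((\<lambda>t. \<psi>' (s, t) * u (s, t) + \<psi> (s, t) * v (s, t)) has_integral 0) {- 1/2..1/2}"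
        if "s \<in> {0..2 * pi}" for s
        by (rule parts_has_integral_zero[OF F _ _ d[OF that] c[OF that] bd[OF V that]])
           (use D in \<open>auto simp: C1_z_def\<close>)
    qed
    then show ?thesis using i' by simp
  qed
  then show ?thesis using i by (auto simp: wd_def)
qed

lemma wd_theta_I:
  assumes m: "u \<in> borel_measurable borel" "v \<in> borel_measurable borel"
    and B: "\<And>p. p \<in> Omega \<Longrightarrow> \<bar>u p\<bar> \<le> B" "\<And>p. p \<in> Omega \<Longrightarrow> \<bar>v p\<bar> \<le> B"
    and d: "\<And>s t. t \<in> {- 1/2..1/2} \<Longrightarrow> ((\<lambda>x. u (x, t)) has_real_derivative v (s, t)) (at s)"
    and bd: "\<And>\<psi> t. V \<psi> \<Longrightarrow> \<psi> (2 * pi, t) * u (2 * pi, t) = \<psi> (0, t) * u (0, t)"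
  shows "wd C1_theta V u v"
proof -
  have i: "integrable LO u" "integrable LO v"
    using B m by (auto intro!: bounded_LO_integrable[where B = B] LO_measurable_borel)
  have "(\<integral>p. \<psi>' p * u p \<partial>LO) = - (\<integral>p. \<psi> p * v p \<partial>LO)" if D: "C1_theta \<psi> \<psi>'" and V: "V \<psi>" for \<psi> \<psi>'
  proof -
    have c': "continuous_on UNIV \<psi>" "continuous_on UNIV \<psi>'" using D by (auto simp: C1_theta_def)
    have i': "integrable LO (\<lambda>p. \<psi>' p * u p)" "integrable LO (\<lambda>p. \<psi> p * v p)"
      using c' i by (auto intro: integrable_mult_cont)
    have b': "\<psi> \<in> borel_measurable borel" "\<psi>' \<in> borel_measurable borel"
      using c' by (auto intro: borel_measurable_continuous_onI)
    have "(\<integral>p. \<psi>' p * u p + \<psi> p * v p \<partial>LO) = 0"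
    proof (rule LO_integral_zero_theta)
      show "(\<lambda>p. \<psi>' p * u p + \<psi> p * v p) \<in> borel_measurable borel" using b' m by measurable
      show "integrable LO (\<lambda>p. \<psi>' p * u p + \<psi> p * v p)" using i' by simp
      show "((\<lambda>s. \<psi>' (s, t) * u (s, t) + \<psi> (s, t) * v (s, t)) has_integral 0) {0..2 * pi}"
        if "t \<in> {- 1/2..1/2}" for t
        by (rule parts_has_integral_zero[OF finite.emptyI])
           (use D d[OF that] bd[OF V] in \<open>auto simp: C1_theta_def
             intro!: continuous_at_imp_continuous_on DERIV_isCont\<close>)
    qed
    then show ?thesis using i' by simp
  qed
  then show ?thesis using i by (auto simp: wd_def)
qed

section \<open>Smooth tests and iterated weak derivatives\<close>

lemma partials_Suc_theta: "partials (Suc i) j \<phi> = partial_theta (partials i j \<phi>)"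
  by (simp add: partials_def)

lemma partials_Suc_z: "partials 0 (Suc j) \<phi> = partial_z (partials 0 j \<phi>)"
  by (simp add: partials_def)

lemma partials_0 [simp]: "partials 0 0 \<phi> = \<phi>"
  by (simp add: partials_def)

lemma smooth_C1:
  assumes "smooth \<phi>"
  shows "continuous_on UNIV (partials i j \<phi>)"
    and "C1_theta (partials i j \<phi>) (partials (Suc i) j \<phi>)"
    and "C1_z (partials 0 j \<phi>) (partials 0 (Suc j) \<phi>)"
proof -
  have d: "partials i j \<phi> differentiable (at p)" for i j p
    using assms unfolding smooth_def by blast
  have c: "continuous_on UNIV (partials i j \<phi>)" for i j
    using d by (simp add: continuous_on_eq_continuous_at differentiable_imp_continuous_within)
  show "continuous_on UNIV (partials i j \<phi>)" by (rule c)
  have "(\<lambda>x. partials i j \<phi> (x, t)) differentiable (at s)" for s t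
    by (rule differentiable_compose[OF d, of "\<lambda>x. (x, t)"]) (auto intro!: derivative_intros simp: differentiable_def)
  then have "((\<lambda>x. partials i j \<phi> (x, t)) has_real_derivative partials (Suc i) j \<phi> (s, t)) (at s)" for s t
    by (simp add: partials_Suc_theta partial_theta_def DERIV_deriv_iff_real_differentiable)
  then show "C1_theta (partials i j \<phi>) (partials (Suc i) j \<phi>)" using c by (simp add: C1_theta_def)
  have "(\<lambda>x. partials 0 j \<phi> (s, x)) differentiable (at t)" for s t
    by (rule differentiable_compose[OF d, of "\<lambda>x. (s, x)"]) (auto intro!: derivative_intros simp: differentiable_def)
  then have "((\<lambda>x. partials 0 j \<phi> (s, x)) has_real_derivative partials 0 (Suc j) \<phi> (s, t)) (at t)" for s t
    by (simp add: partials_Suc_z partial_z_def DERIV_deriv_iff_real_differentiable)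
  then show "C1_z (partials 0 j \<phi>) (partials 0 (Suc j) \<phi>)" using c by (simp add: C1_z_def)
qed

text \<open>Derivatives depend only on germs, so differentiation does not enlarge the support.\<close>

lemma partials_zero_open:
  assumes U: "open U" and z: "\<And>p. p \<in> U \<Longrightarrow> \<phi> p = 0" and p: "p \<in> U"
  shows "partials i j \<phi> p = 0"
proof -
  have th: "partial_theta \<psi> q = 0" "partial_z \<psi> q = 0" if \<psi>: "\<And>p. p \<in> U \<Longrightarrow> \<psi> p = 0" and q: "q \<in> U" for \<psi> q
  proof -
    obtain s t where st: "q = (s, t)" by fastforce
    have "open ((\<lambda>x. (x, t)) -` U)" "open ((\<lambda>x. (s, x)) -` U)"
      by (auto intro!: open_vimage[OF U] continuous_intros)
    then have ev: "\<forall>\<^sub>F x in nhds s. (x, t) \<in> U" "\<forall>\<^sub>F x in nhds t. (s, x) \<in> U"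
      using eventually_nhds_in_open[of "(\<lambda>x. (x, t)) -` U" s]
            eventually_nhds_in_open[of "(\<lambda>x. (s, x)) -` U" t] q st by auto
    have "deriv (\<lambda>x. \<psi> (x, t)) s = deriv (\<lambda>_. 0) s"
      by (rule deriv_cong_ev[OF eventually_mono[OF ev(1)]]) (auto simp: \<psi>)
    moreover have "deriv (\<lambda>x. \<psi> (s, x)) t = deriv (\<lambda>_. 0) t"
      by (rule deriv_cong_ev[OF eventually_mono[OF ev(2)]]) (auto simp: \<psi>)
    ultimately show "partial_theta \<psi> q = 0" "partial_z \<psi> q = 0"
      by (auto simp: partial_theta_def partial_z_def st)
  qed
  have 1: "\<forall>p\<in>U. (partial_z ^^ j) \<phi> p = 0"
    by (induction j) (auto simp: z intro!: th)
  have "\<forall>p\<in>U. (partial_theta ^^ i) ((partial_z ^^ j) \<phi>) p = 0"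
    by (induction i) (use 1 in \<open>auto intro!: th\<close>)
  then show ?thesis using p by (simp add: partials_def)
qed

lemma interior_tests_partials:
  assumes "\<phi> \<in> interior_tests"
  shows "vanishing (partials i j \<phi>)"
  unfolding vanishing_def
proof (intro allI impI)
  fix p assume "p \<notin> interior Omega"
  then have p: "p \<in> - closure {p. \<phi> p \<noteq> 0}" using assms by (auto simp: interior_tests_def)
  show "partials i j \<phi> p = 0"
  proof (rule partials_zero_open[OF _ _ p])
    show "open (- closure {p. \<phi> p \<noteq> 0})" by (intro open_Compl closed_closure)
    show "\<phi> q = 0" if "q \<in> - closure {p. \<phi> p \<noteq> 0}" for q
      using that closure_subset[of "{p. \<phi> p \<noteq> 0}"] by auto
  qed
qed

lemma periodic_tests_partials:
  assumes "\<phi> \<in> periodic_tests"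
  shows "periodic (partials i j \<phi>)"
proof -
  have th: "periodic (partial_theta \<psi>)" "periodic (partial_z \<psi>)" if p: "periodic \<psi>" for \<psi>
  proof -
    have sh: "\<psi> (s + 2 * pi, t) = \<psi> (s, t)" "\<psi> (s, t + 1) = \<psi> (s, t)" for s t
      using p by (simp_all add: periodic_def)
    have "deriv (\<lambda>x. \<psi> (x, t)) (s + 2 * pi) = deriv (\<lambda>x. \<psi> (x, t)) s"
      "deriv (\<lambda>x. \<psi> (s, x)) (t + 1) = deriv (\<lambda>x. \<psi> (s, x)) t" for s t
      by (rule deriv_periodic, rule sh)+
    then show "periodic (partial_theta \<psi>)" "periodic (partial_z \<psi>)"
      by (simp_all add: periodic_def partial_theta_def partial_z_def sh)
  qed
  have "periodic \<phi>" using assms by (simp add: periodic_def periodic_tests_def)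
  then have "periodic ((partial_z ^^ j) \<phi>)"
    by (induction j) (simp_all add: th)
  then have "periodic ((partial_theta ^^ i) ((partial_z ^^ j) \<phi>))"
    by (induction i) (simp_all add: th)
  then show ?thesis by (simp add: partials_def)
qed

text \<open>The properties of a set of smooth tests that allow weak derivatives in the sense of
  \<open>wd\<close> to be used against it; both interior and periodic tests have them.\<close>

definition test_class :: "(real \<times> real \<Rightarrow> real) set \<Rightarrow> ((real \<times> real \<Rightarrow> real) \<Rightarrow> bool) \<Rightarrow> bool" where
  "test_class T V \<longleftrightarrow> (\<forall>\<phi>\<in>T. smooth \<phi> \<and> (\<forall>i j. V (partials i j \<phi>)))"

lemma test_class_interior: "test_class interior_tests vanishing"
  using interior_tests_partials by (auto simp: test_class_def interior_tests_def)

lemma test_class_periodic: "test_class periodic_tests periodic"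
  using periodic_tests_partials by (auto simp: test_class_def periodic_tests_def)

text \<open>A second weak derivative is reached by two integrations by parts, each in one direction, the
  first of them tested with a first partial derivative of the smooth test.\<close>

lemma wd_is_weak_deriv:
  assumes T: "test_class T V"
  shows "integrable LO f \<Longrightarrow> is_weak_deriv T 0 0 f f"
    and "wd C1_theta V f g \<Longrightarrow> is_weak_deriv T 1 0 f g"
    and "wd C1_z V f g \<Longrightarrow> is_weak_deriv T 0 1 f g"
    and "wd C1_theta V f g \<Longrightarrow> wd C1_theta V g k \<Longrightarrow> is_weak_deriv T 2 0 f k"
    and "wd C1_theta V f g \<Longrightarrow> wd C1_z V g k \<Longrightarrow> is_weak_deriv T 1 1 f k"
    and "wd C1_z V f g \<Longrightarrow> wd C1_z V g k \<Longrightarrow> is_weak_deriv T 0 2 f k"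
proof -
  have s: "smooth \<phi>" "V (partials i j \<phi>)" if "\<phi> \<in> T" for \<phi> i j
    using T that unfolding test_class_def by simp_all
  have V: "V \<phi>" if "\<phi> \<in> T" for \<phi> using s(2)[OF that, of 0 0] by simp
  have D: "C1_theta (partials i j \<phi>) (partials (Suc i) j \<phi>)" "C1_z (partials 0 j \<phi>) (partials 0 (Suc j) \<phi>)"
    if "\<phi> \<in> T" for \<phi> i j
    using smooth_C1[OF s(1)[OF that]] by simp_all
  have D0: "C1_theta \<phi> (partials (Suc 0) 0 \<phi>)" "C1_z \<phi> (partials 0 (Suc 0) \<phi>)" if "\<phi> \<in> T" for \<phi>
    using D(1)[OF that, of 0 0] D(2)[OF that, of 0] by simp_all
  have W: "integrable LO f" "integrable LO g"
    "\<And>\<psi> \<psi>'. D \<psi> \<psi>' \<Longrightarrow> V \<psi> \<Longrightarrow> (\<integral>p. \<psi>' p * f p \<partial>LO) = - (\<integral>p. \<psi> p * g p \<partial>LO)"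
    if "wd D V f g" for D f g
    using that unfolding wd_def by blast+
  show "integrable LO f \<Longrightarrow> is_weak_deriv T 0 0 f f" by (simp add: is_weak_deriv_def)
  show "is_weak_deriv T 1 0 f g" if "wd C1_theta V f g"
    using W(1,2)[OF that] W(3)[OF that D0(1) V] by (simp add: is_weak_deriv_def)
  show "is_weak_deriv T 0 1 f g" if "wd C1_z V f g"
    using W(1,2)[OF that] W(3)[OF that D0(2) V] by (simp add: is_weak_deriv_def)
  show "is_weak_deriv T 2 0 f k" if "wd C1_theta V f g" "wd C1_theta V g k"
    using W(1)[OF that(1)] W(2)[OF that(2)] W(3)[OF that(1) D(1)[of _ "Suc 0" 0] s(2)] W(3)[OF that(2) D0(1) V]
    by (simp add: is_weak_deriv_def numeral_2_eq_2)
  show "is_weak_deriv T 1 1 f k" if "wd C1_theta V f g" "wd C1_z V g k"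
    using W(1)[OF that(1)] W(2)[OF that(2)] W(3)[OF that(1) D(1)[of _ 0 "Suc 0"] s(2)] W(3)[OF that(2) D0(2) V]
    by (simp add: is_weak_deriv_def)
  show "is_weak_deriv T 0 2 f k" if "wd C1_z V f g" "wd C1_z V g k"
    using W(1)[OF that(1)] W(2)[OF that(2)] W(3)[OF that(1) D(2)[of _ "Suc 0"] s(2)] W(3)[OF that(2) D0(2) V]
    by (simp add: is_weak_deriv_def numeral_2_eq_2)
qed

text \<open>Difference quotients of the kernel are bounded by the bound on its derivative, so dominated
  convergence applies.\<close>

lemma LO_Leibniz:
  fixes f :: "real \<times> real \<Rightarrow> real" and k k' :: "real \<Rightarrow> real \<times> real \<Rightarrow> real"
  assumes f: "integrable LO f"
    and d: "\<And>x q. ((\<lambda>x. k x q) has_real_derivative k' x q) (at x)"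
    and B: "\<And>x q. \<bar>k' x q\<bar> \<le> B"
    and c: "\<And>x. continuous_on UNIV (k x)" "\<And>x. continuous_on UNIV (k' x)"
  shows "((\<lambda>x. \<integral>q. k x q * f q \<partial>LO) has_real_derivative (\<integral>q. k' x q * f q \<partial>LO)) (at x)"
proof -
  have i: "integrable LO (\<lambda>q. k x q * f q)" for x
    by (rule integrable_mult_cont[OF c(1) f])
  have m: "k x \<in> borel_measurable LO" "k' x \<in> borel_measurable LO" "f \<in> borel_measurable LO" for x
    using continuous_LO_measurable[OF c(1)] continuous_LO_measurable[OF c(2)] f by auto
  have lip: "\<bar>k y q - k x q\<bar> \<le> B * \<bar>y - x\<bar>" for x y q
    using field_differentiable_bound[of UNIV "\<lambda>x. k x q" "\<lambda>x. k' x q" B y x] d B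
    by (auto simp: has_field_derivative_at_within)
  have "((\<lambda>h. ((\<integral>q. k (x + h) q * f q \<partial>LO) - (\<integral>q. k x q * f q \<partial>LO)) / h) \<longlongrightarrow> (\<integral>q. k' x q * f q \<partial>LO)) (at 0)"
    unfolding tendsto_at_iff_sequentially
  proof (intro allI impI)
    fix h :: "nat \<Rightarrow> real" assume h: "\<forall>i. h i \<in> UNIV - {0}" "h \<longlonglongrightarrow> 0"
    have eq: "((\<integral>q. k (x + h n) q * f q \<partial>LO) - (\<integral>q. k x q * f q \<partial>LO)) / h n =
        (\<integral>q. (k (x + h n) q - k x q) / h n * f q \<partial>LO)" for n
    proof -
      have "((\<integral>q. k (x + h n) q * f q \<partial>LO) - (\<integral>q. k x q * f q \<partial>LO)) / h n
         = (\<integral>q. k (x + h n) q * f q - k x q * f q \<partial>LO) / h n"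
        using i by simp
      also have "\<dots> = (\<integral>q. (k (x + h n) q * f q - k x q * f q) / h n \<partial>LO)" by simp
      finally show ?thesis by (simp add: field_simps)
    qed
    have "(\<lambda>n. \<integral>q. (k (x + h n) q - k x q) / h n * f q \<partial>LO) \<longlonglongrightarrow> (\<integral>q. k' x q * f q \<partial>LO)"
    proof (rule integral_dominated_convergence[where w = "\<lambda>q. B * \<bar>f q\<bar>"])
      show "(\<lambda>q. k' x q * f q) \<in> borel_measurable LO" using m by measurable
      show "(\<lambda>q. (k (x + h n) q - k x q) / h n * f q) \<in> borel_measurable LO" for n
        using m by measurable
      show "integrable LO (\<lambda>q. B * \<bar>f q\<bar>)" using f by simp
      show "AE q in LO. (\<lambda>n. (k (x + h n) q - k x q) / h n * f q) \<longlonglongrightarrow> k' x q * f q"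
      proof (rule AE_I2)
        fix q
        have "((\<lambda>h. (k (x + h) q - k x q) / h) \<longlongrightarrow> k' x q) (at 0)"
          using d by (simp add: DERIV_def)
        then have "(\<lambda>n. (k (x + h n) q - k x q) / h n) \<longlonglongrightarrow> k' x q"
          using h by (auto simp: tendsto_at_iff_sequentially o_def)
        then show "(\<lambda>n. (k (x + h n) q - k x q) / h n * f q) \<longlonglongrightarrow> k' x q * f q"
          by (intro tendsto_intros)
      qed
      show "AE q in LO. norm ((k (x + h n) q - k x q) / h n * f q) \<le> B * \<bar>f q\<bar>" for n
      proof (rule AE_I2)
        fix q
        have "\<bar>(k (x + h n) q - k x q) / h n\<bar> \<le> B"
          using lip[of "x + h n" q x] h by (simp add: divide_le_eq)
        then show "norm ((k (x + h n) q - k x q) / h n * f q) \<le> B * \<bar>f q\<bar>"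
          by (simp only: real_norm_def abs_mult mult_right_mono abs_ge_zero)
      qed
    qed
    then show "((\<lambda>h. ((\<integral>q. k (x + h) q * f q \<partial>LO) - (\<integral>q. k x q * f q \<partial>LO)) / h) \<circ> h) \<longlonglongrightarrow> (\<integral>q. k' x q * f q \<partial>LO)"
      by (simp add: o_def eq)
  qed
  then show ?thesis by (simp add: DERIV_def)
qed

section \<open>Mollification on the torus\<close>

definition cpow :: "real \<Rightarrow> nat \<Rightarrow> real \<Rightarrow> real" where
  "cpow \<alpha> n x = cos (\<alpha> * x) ^ (2 * n)"

definition cpow' :: "real \<Rightarrow> nat \<Rightarrow> real \<Rightarrow> real" where
  "cpow' \<alpha> n x = real (2 * n) * cos (\<alpha> * x) ^ (2 * n - 1) * (- (\<alpha> * sin (\<alpha> * x)))"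

lemma cpow_smooth1: "smooth1 (\<lambda>y. cpow \<alpha> n (x - y))"
proof -
  have "smooth1 (\<lambda>y. cos ((- \<alpha>) * y + \<alpha> * x) ^ (2 * n))"
    by (intro smooth1_power smooth1_affine smooth1_cos)
  then show ?thesis by (simp add: cpow_def algebra_simps)
qed

lemma cpow_DERIV: "(cpow \<alpha> n has_real_derivative cpow' \<alpha> n x) (at x)"
  unfolding cpow_def [abs_def] cpow'_def
  by (auto intro!: derivative_eq_intros simp: algebra_simps)

lemma cpow_deriv: "deriv (\<lambda>y. cpow \<alpha> n (x - y)) = (\<lambda>y. - cpow' \<alpha> n (x - y))"
proof
  fix y
  have "((\<lambda>y. cpow \<alpha> n (x - y)) has_real_derivative cpow' \<alpha> n (x - y) * (0 - 1)) (at y)"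
    by (rule DERIV_chain2[OF cpow_DERIV]) (auto intro!: derivative_eq_intros)
  then show "deriv (\<lambda>y. cpow \<alpha> n (x - y)) y = - cpow' \<alpha> n (x - y)"
    by (simp add: DERIV_imp_deriv)
qed

lemma cpow_bounds: "0 \<le> cpow \<alpha> n x" "cpow \<alpha> n x \<le> 1"
  by (simp_all add: cpow_def power_mult power_le_one abs_square_le_1)

lemma cpow'_bound: "\<bar>cpow' \<alpha> n x\<bar> \<le> 2 * real n * \<bar>\<alpha>\<bar>"
proof -
  have "\<bar>cos (\<alpha> * x) ^ (2 * n - 1)\<bar> * \<bar>sin (\<alpha> * x)\<bar> \<le> 1 * 1"
    by (intro mult_mono) (auto simp: power_abs intro!: power_le_one)
  then have "(2 * real n * \<bar>\<alpha>\<bar>) * (\<bar>cos (\<alpha> * x) ^ (2 * n - 1)\<bar> * \<bar>sin (\<alpha> * x)\<bar>) \<le> (2 * real n * \<bar>\<alpha>\<bar>) * 1"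
    by (intro mult_left_mono) auto
  then show ?thesis by (simp add: cpow'_def abs_mult algebra_simps)
qed

lemma cpow_cont [continuous_intros]:
  fixes f :: "real \<times> real \<Rightarrow> real"
  shows "continuous_on S f \<Longrightarrow> continuous_on S (\<lambda>x. cpow \<alpha> n (f x))"
  "continuous_on S f \<Longrightarrow> continuous_on S (\<lambda>x. cpow' \<alpha> n (f x))"
  unfolding cpow_def cpow'_def by (auto intro!: continuous_intros)

lemma cpow_per: "cpow (1/2) n (x + 2 * pi) = cpow (1/2) n x" "cpow pi n (y + 1) = cpow pi n y"
  by (simp_all add: cpow_def algebra_simps add_divide_distrib)

lemma cpow_per': "cpow (1/2) n (x - (y + 2 * pi)) = cpow (1/2) n (x - y)" "cpow pi n (x - (y + 1)) = cpow pi n (x - y)"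
  using cpow_per(1)[of n "x - (y + 2 * pi)"] cpow_per(2)[of n "x - (y + 1)"] by (simp_all add: algebra_simps)

text \<open>A nonnegative kernel on the torus that depends only on \<open>p - q\<close>, peaks at
  \<open>p = q\<close> and concentrates there as \<open>n\<close> grows. It is a product of trigonometric
  polynomials in the two coordinates, hence for fixed \<open>p\<close> it is itself a smooth periodic
  test function of \<open>q\<close>.\<close>

definition kraw :: "nat \<Rightarrow> real \<times> real \<Rightarrow> real \<times> real \<Rightarrow> real" where
  "kraw n p q = cpow (1/2) n (fst p - fst q) * cpow pi n (snd p - snd q)"

lemma kraw_cont [continuous_intros]:
  fixes f g :: "real \<times> real \<Rightarrow> real \<times> real"
  shows "continuous_on S f \<Longrightarrow> continuous_on S g \<Longrightarrow> continuous_on S (\<lambda>x. kraw n (f x) (g x))"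
  unfolding kraw_def by (intro continuous_intros)

lemma kraw_bounds: "0 \<le> kraw n p q" "kraw n p q \<le> 1"
  using cpow_bounds by (auto simp: kraw_def intro: mult_le_one)

lemma kraw_sym: "kraw n p q = kraw n q p"
proof -
  have "cpow \<alpha> n (x - y) = cpow \<alpha> n (y - x)" for \<alpha> x y
    unfolding cpow_def by (metis cos_minus minus_diff_eq mult_minus_right)
  then show ?thesis unfolding kraw_def by metis
qed

text \<open>Products of one-variable functions are the only periodic tests needed, since the kernel has
  this form.\<close>

definition ptests :: "((real \<Rightarrow> real) \<times> (real \<Rightarrow> real)) set" where
  "ptests = {(b, c). smooth1 b \<and> smooth1 c \<and> (\<forall>s. b (s + 2 * pi) = b s) \<and> (\<forall>t. c (t + 1) = c t)}"

definition pw_theta :: "(real \<times> real \<Rightarrow> real) \<Rightarrow> (real \<times> real \<Rightarrow> real) \<Rightarrow> bool" where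
  "pw_theta f g \<longleftrightarrow> integrable LO f \<and> integrable LO g \<and> (\<forall>(b, c)\<in>ptests.
     (\<integral>p. deriv b (fst p) * c (snd p) * f p \<partial>LO) = - (\<integral>p. b (fst p) * c (snd p) * g p \<partial>LO))"

definition pw_z :: "(real \<times> real \<Rightarrow> real) \<Rightarrow> (real \<times> real \<Rightarrow> real) \<Rightarrow> bool" where
  "pw_z f g \<longleftrightarrow> integrable LO f \<and> integrable LO g \<and> (\<forall>(b, c)\<in>ptests.
     (\<integral>p. b (fst p) * deriv c (snd p) * f p \<partial>LO) = - (\<integral>p. b (fst p) * c (snd p) * g p \<partial>LO))"

lemma kraw_ptests: "(\<lambda>y. cpow (1/2) n (s - y), \<lambda>y. cpow pi n (t - y)) \<in> ptests"
  by (simp add: ptests_def cpow_smooth1 cpow_per')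

text \<open>Differentiating in \<open>p\<close> differentiates the kernel; as it depends on \<open>p -
  q\<close>, this is minus its derivative in \<open>q\<close>, and the definition of the weak derivative
  moves that onto \<open>f\<close>.\<close>

lemma kraw_DERIV_theta:
  assumes "pw_theta f g"
  shows "((\<lambda>x. \<integral>q. kraw n (x, t) q * f q \<partial>LO) has_real_derivative (\<integral>q. kraw n (s, t) q * g q \<partial>LO)) (at s)"
proof -
  have f: "integrable LO f" using assms by (simp add: pw_theta_def)
  let ?k' = "\<lambda>x q. cpow' (1/2) n (x - fst q) * cpow pi n (t - snd q)"
  have "((\<lambda>x. \<integral>q. kraw n (x, t) q * f q \<partial>LO) has_real_derivative (\<integral>q. ?k' s q * f q \<partial>LO)) (at s)"
  proof (rule LO_Leibniz[OF f])
    show "((\<lambda>x. kraw n (x, t) q) has_real_derivative ?k' x q) (at x)" for x q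
    proof -
      have "((\<lambda>x. cpow (1/2) n (x - fst q)) has_real_derivative cpow' (1/2) n (x - fst q) * (1 - 0)) (at x)"
        by (rule DERIV_chain2[OF cpow_DERIV]) (auto intro!: derivative_eq_intros)
      from DERIV_cmult_right[OF this, of "cpow pi n (t - snd q)"] show ?thesis by (simp add: kraw_def)
    qed
    show "\<bar>?k' x q\<bar> \<le> real n" for x q
    proof -
      have "\<bar>cpow' (1/2) n (x - fst q)\<bar> * \<bar>cpow pi n (t - snd q)\<bar> \<le> real n * 1"
        by (intro mult_mono) (use cpow'_bound[of "1/2" n] cpow_bounds in auto)
      then show ?thesis by (simp add: abs_mult)
    qed
    show "continuous_on UNIV (kraw n (x, t))" for x
      using kraw_cont[of UNIV "\<lambda>_. (x,t)" "\<lambda>q. q" n] by (simp add: continuous_on_id)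
    show "continuous_on UNIV (?k' x)" for x by (intro continuous_intros)
  qed
  moreover have "(\<integral>q. ?k' s q * f q \<partial>LO) = (\<integral>q. kraw n (s, t) q * g q \<partial>LO)"
    using assms bspec[OF conjunct2[OF conjunct2[OF assms[unfolded pw_theta_def]]] kraw_ptests[of n s t]]
    by (simp add: cpow_deriv kraw_def)
  ultimately show ?thesis by simp
qed

lemma kraw_DERIV_z:
  assumes "pw_z f g"
  shows "((\<lambda>x. \<integral>q. kraw n (s, x) q * f q \<partial>LO) has_real_derivative (\<integral>q. kraw n (s, t) q * g q \<partial>LO)) (at t)"
proof -
  have f: "integrable LO f" using assms by (simp add: pw_z_def)
  let ?k' = "\<lambda>x q. cpow (1/2) n (s - fst q) * cpow' pi n (x - snd q)"
  have "((\<lambda>x. \<integral>q. kraw n (s, x) q * f q \<partial>LO) has_real_derivative (\<integral>q. ?k' t q * f q \<partial>LO)) (at t)"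
  proof (rule LO_Leibniz[OF f])
    show "((\<lambda>x. kraw n (s, x) q) has_real_derivative ?k' x q) (at x)" for x q
    proof -
      have "((\<lambda>x. cpow pi n (x - snd q)) has_real_derivative cpow' pi n (x - snd q) * (1 - 0)) (at x)"
        by (rule DERIV_chain2[OF cpow_DERIV]) (auto intro!: derivative_eq_intros)
      from DERIV_cmult[OF this, of "cpow (1/2) n (s - fst q)"] show ?thesis by (simp add: kraw_def)
    qed
    show "\<bar>?k' x q\<bar> \<le> 2 * real n * pi" for x q
    proof -
      have "\<bar>cpow (1/2) n (s - fst q)\<bar> * \<bar>cpow' pi n (x - snd q)\<bar> \<le> 1 * (2 * real n * pi)"
        by (intro mult_mono) (use cpow'_bound[of pi n] cpow_bounds in auto)
      then show ?thesis by (simp add: abs_mult)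
    qed
    show "continuous_on UNIV (kraw n (s, x))" for x
      using kraw_cont[of UNIV "\<lambda>_. (s,x)" "\<lambda>q. q" n] by (simp add: continuous_on_id)
    show "continuous_on UNIV (?k' x)" for x by (intro continuous_intros)
  qed
  moreover have "(\<integral>q. ?k' t q * f q \<partial>LO) = (\<integral>q. kraw n (s, t) q * g q \<partial>LO)"
    using assms bspec[OF conjunct2[OF conjunct2[OF assms[unfolded pw_z_def]]] kraw_ptests[of n s t]]
    by (simp add: cpow_deriv kraw_def)
  ultimately show ?thesis by simp
qed

lemma pw_const: "pw_theta (\<lambda>_. c) (\<lambda>_. 0)" "pw_z (\<lambda>_. c) (\<lambda>_. 0)"
proof -
  have w: "wd C1_theta periodic (\<lambda>_. c) (\<lambda>_. 0)"
    by (rule wd_theta_I[where B = "\<bar>c\<bar>"]) (auto simp: periodic_def dest: spec[of _ 0])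
  have w': "wd C1_z periodic (\<lambda>_. c) (\<lambda>_. 0)"
  proof (rule wd_z_I[where B = "\<bar>c\<bar>" and F = "{}"])
    fix \<psi> s assume "periodic \<psi>"
    then have "\<psi> (s, - 1/2 + 1) = \<psi> (s, - 1/2)" unfolding periodic_def by blast
    then show "\<psi> (s, 1 / 2) * c = \<psi> (s, - 1 / 2) * c" by simp
  qed auto
  have D: "C1_theta (\<lambda>(s, t). b s * c t) (\<lambda>(s, t). deriv b s * c t)"
     "C1_z (\<lambda>(s, t). b s * c t) (\<lambda>(s, t). b s * deriv c t)" "periodic (\<lambda>(s, t). b s * c t)"
    if "(b, c) \<in> ptests" for b c
  proof -
    have s: "smooth1 b" "smooth1 c" "periodic (\<lambda>(s, t). b s * c t)"
      using that by (auto simp: ptests_def periodic_def)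
    have cf: "continuous_on UNIV (\<lambda>p :: real \<times> real. k (fst p))" "continuous_on UNIV (\<lambda>p :: real \<times> real. k (snd p))"
      if "smooth1 k" for k
      by (rule continuous_on_compose2[OF smooth1_continuous[OF that, of UNIV]], simp_all add: continuous_on_fst continuous_on_snd continuous_on_id)+
    note cs = cf[OF s(1)] cf[OF s(2)] cf[OF smooth1_deriv[OF s(1)]] cf[OF smooth1_deriv[OF s(2)]]
    have "continuous_on UNIV (\<lambda>(s, t). b s * c t)" "continuous_on UNIV (\<lambda>(s, t). deriv b s * c t)"
      "continuous_on UNIV (\<lambda>(s, t). b s * deriv c t)"
      unfolding case_prod_unfold by (rule continuous_on_mult cs)+
    then show "C1_theta (\<lambda>(s, t). b s * c t) (\<lambda>(s, t). deriv b s * c t)"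
     "C1_z (\<lambda>(s, t). b s * c t) (\<lambda>(s, t). b s * deriv c t)" "periodic (\<lambda>(s, t). b s * c t)"
      using s(3) DERIV_cmult_right[OF smooth1_DERIV[OF s(1)]] DERIV_cmult[OF smooth1_DERIV[OF s(2)]]
      by (simp_all add: C1_theta_def C1_z_def)
  qed
  have "(\<integral>p. deriv b (fst p) * d (snd p) * c \<partial>LO) = - (\<integral>p. b (fst p) * d (snd p) * 0 \<partial>LO)"
    if "(b, d) \<in> ptests" for b d
    using w D(1)[OF that] D(3)[OF that] unfolding wd_def case_prod_unfold by blast
  then show "pw_theta (\<lambda>_. c) (\<lambda>_. 0)" unfolding pw_theta_def by auto
  have "(\<integral>p. b (fst p) * deriv d (snd p) * c \<partial>LO) = - (\<integral>p. b (fst p) * d (snd p) * 0 \<partial>LO)"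
    if "(b, d) \<in> ptests" for b d
    using w' D(2)[OF that] D(3)[OF that] unfolding wd_def case_prod_unfold by blast
  then show "pw_z (\<lambda>_. c) (\<lambda>_. 0)" unfolding pw_z_def by auto
qed

definition kmass :: "nat \<Rightarrow> real" where
  "kmass n = (\<integral>q. kraw n (0, 0) q \<partial>LO)"

text \<open>Translation invariance without a change of variables: the derivative of the mass with respect
  to \<open>p\<close> is the kernel integrated against the weak derivative of the constant 1.\<close>

lemma kraw_integral: "(\<integral>q. kraw n p q \<partial>LO) = kmass n"
proof -
  have z: "(\<integral>q. kraw n (s, t) q \<partial>LO) = (\<integral>q. kraw n (0, t) q \<partial>LO)" for s t
    using kraw_DERIV_theta[OF pw_const(1)[of 1], of n t] by (intro DERIV_isconst_all) auto
  have "(\<integral>q. kraw n (s, t) q \<partial>LO) = (\<integral>q. kraw n (s, 0) q \<partial>LO)" for s t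
    using kraw_DERIV_z[OF pw_const(2)[of 1], of n s] by (intro DERIV_isconst_all) auto
  then show ?thesis using z unfolding kmass_def by (metis prod.collapse)
qed

text \<open>Points of the plane are to stay single variables in quantified statements.\<close>

declare split_paired_All [simp del] split_paired_Ex [simp del]

text \<open>The \<open>n\<close>-th kernel is the \<open>n\<close>-th power of the first one, which
  exceeds \<open>1 - \<epsilon>\<close> on a ball around \<open>p\<close>. So the mass decays more slowly
  than any fixed geometric rate.\<close>

lemma kmass_lower_bound:
  assumes p: "p \<in> interior Omega" and \<epsilon>: "0 < \<epsilon>" "\<epsilon> < 1"
  obtains \<mu> where "\<mu> > 0" "\<And>n. kmass n \<ge> \<mu> * (1 - \<epsilon>) ^ n"
proof -
  have c1: "continuous_on UNIV (\<lambda>q. kraw 1 p q)" by (intro continuous_intros)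
  have pp: "kraw 1 p p = 1" by (simp add: kraw_def cpow_def)
  have "open {q. kraw 1 p q > 1 - \<epsilon>}"
    using open_Collect_less[OF continuous_on_const c1] .
  then have "open ({q. kraw 1 p q > 1 - \<epsilon>} \<inter> interior Omega)" by (intro open_Int open_interior)
  moreover have "p \<in> {q. kraw 1 p q > 1 - \<epsilon>} \<inter> interior Omega" using p pp \<epsilon> by simp
  ultimately obtain r where r: "r > 0" "ball p r \<subseteq> {q. kraw 1 p q > 1 - \<epsilon>} \<inter> interior Omega"
    by (metis open_contains_ball)
  let ?B = "ball p r"
  have BO: "?B \<subseteq> Omega" using r(2) interior_subset by blast
  have Bs: "?B \<in> sets LO" using BO by (simp add: sets_restrict_space_iff)
  have \<mu>: "measure LO ?B = measure lebesgue ?B" using BO by (simp add: measure_restrict_space)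
  have kn: "kraw n p q = kraw 1 p q ^ n" for n q
    by (simp add: kraw_def cpow_def power_mult power_mult_distrib)
  have "kmass n \<ge> measure lebesgue ?B * (1 - \<epsilon>) ^ n" for n
  proof -
    have "(\<integral>q. indicator ?B q * (1 - \<epsilon>) ^ n \<partial>LO) \<le> (\<integral>q. kraw n p q \<partial>LO)"
    proof (rule integral_mono)
      show "integrable LO (\<lambda>q. indicator ?B q * (1 - \<epsilon>) ^ n)"
        by (intro integrable_mult_left integrable_real_indicator Bs)
           (simp add: LO.emeasure_eq_measure)
      show "integrable LO (kraw n p)"
        by (rule continuous_LO_integrable) (intro continuous_intros)
      show "indicator ?B q * (1 - \<epsilon>) ^ n \<le> kraw n p q" for q
      proof (cases "q \<in> ?B")
        case True
        then have "1 - \<epsilon> \<le> kraw 1 p q" using r(2) by auto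
        then have "(1 - \<epsilon>) ^ n \<le> kraw n p q" using \<epsilon> by (simp add: kn[of n] power_mono)
        then show ?thesis using True by simp
      qed (simp add: kraw_bounds)
    qed
    moreover have "?B \<inter> Omega = ?B" using BO by blast
    ultimately show ?thesis using Bs by (simp add: kraw_integral \<mu>)
  qed
  moreover have "measure lebesgue ?B > 0" using content_ball_pos[OF r(1), of p] by (simp add: measure_completion)
  ultimately show ?thesis using that by blast
qed

lemma kmass_pos: "kmass n > 0"
proof -
  have p: "(pi, 0) \<in> interior Omega" by (simp add: interior_Omega)
  obtain \<mu> where "\<mu> > 0" "kmass n \<ge> \<mu> * (1 - 1/2) ^ n"
    using kmass_lower_bound[OF p, of "1/2"] by auto
  moreover from this have "0 < \<mu> * (1 - 1/2) ^ n" by simp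
  ultimately show ?thesis by linarith
qed

definition K :: "nat \<Rightarrow> real \<times> real \<Rightarrow> real \<times> real \<Rightarrow> real" where
  "K n p q = kraw n p q / kmass n"

definition moll :: "nat \<Rightarrow> (real \<times> real \<Rightarrow> real) \<Rightarrow> real \<times> real \<Rightarrow> real" where
  "moll n f p = (\<integral>q. K n p q * f q \<partial>LO)"

lemma K_nonneg: "0 \<le> K n p q"
  using kraw_bounds kmass_pos[of n] by (simp add: K_def)

lemma K_le: "K n p q \<le> 1 / kmass n"
  using kraw_bounds kmass_pos[of n] by (simp add: K_def divide_right_mono)

lemma K_sym: "K n p q = K n q p"
  by (simp add: K_def kraw_sym[of n p q])

lemma K_integral: "(\<integral>q. K n p q \<partial>LO) = 1"
  using kmass_pos[of n] by (simp add: K_def kraw_integral)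

lemma K_cont [continuous_intros]:
  fixes f g :: "real \<times> real \<Rightarrow> real \<times> real"
  shows "continuous_on S f \<Longrightarrow> continuous_on S g \<Longrightarrow> continuous_on S (\<lambda>x. K n (f x) (g x))"
  unfolding K_def using kmass_pos[of n] by (intro continuous_intros) auto

lemma K_mult_integrable: "integrable LO f \<Longrightarrow> integrable LO (\<lambda>q. K n p q * f q)"
  by (intro integrable_mult_cont continuous_intros)

lemma moll_const [simp]: "moll n (\<lambda>_. c) p = c"
  by (simp add: moll_def K_integral)

lemma moll_add: "integrable LO f \<Longrightarrow> integrable LO g \<Longrightarrow> moll n (\<lambda>q. f q + g q) p = moll n f p + moll n g p"
  using K_mult_integrable[of f n p] K_mult_integrable[of g n p] by (simp add: moll_def distrib_left)

lemma moll_diff: "integrable LO f \<Longrightarrow> integrable LO g \<Longrightarrow> moll n (\<lambda>q. f q - g q) p = moll n f p - moll n g p"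
  using K_mult_integrable[of f n p] K_mult_integrable[of g n p] by (simp add: moll_def right_diff_distrib)

lemma moll_cmult: "moll n (\<lambda>q. c * f q) p = c * moll n f p"
proof -
  have "(\<lambda>q. K n p q * (c * f q)) = (\<lambda>q. c * (K n p q * f q))" by (auto simp: algebra_simps)
  then show ?thesis by (simp add: moll_def)
qed

lemma moll_mono:
  assumes "integrable LO f" "integrable LO g" "AE q in LO. f q \<le> g q"
  shows "moll n f p \<le> moll n g p"
  unfolding moll_def
  by (rule integral_mono_AE[OF K_mult_integrable[OF assms(1)] K_mult_integrable[OF assms(2)]])
     (use assms(3) in \<open>auto elim!: eventually_mono intro: mult_left_mono K_nonneg\<close>)

lemma moll_abs: "integrable LO f \<Longrightarrow> \<bar>moll n f p\<bar> \<le> moll n (\<lambda>q. \<bar>f q\<bar>) p"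
  unfolding moll_def using integral_abs_bound[of LO "\<lambda>q. K n p q * f q"]
  by (simp add: abs_mult K_nonneg)

lemma moll_abs_le:
  assumes "integrable LO f" "AE q in LO. \<bar>f q\<bar> \<le> B"
  shows "\<bar>moll n f p\<bar> \<le> B"
proof -
  have "moll n (\<lambda>q. \<bar>f q\<bar>) p \<le> moll n (\<lambda>_. B) p" using assms by (intro moll_mono) auto
  then show ?thesis using moll_abs[OF assms(1), of n p] by simp
qed

text \<open>Jensen's inequality, from the tangent to the square at the mean value.\<close>

lemma moll_square_le:
  assumes f: "integrable LO f" "integrable LO (\<lambda>q. (f q)\<^sup>2)"
  shows "(moll n f p)\<^sup>2 \<le> moll n (\<lambda>q. (f q)\<^sup>2) p"
proof -
  let ?c = "moll n f p"
  have "moll n (\<lambda>q. 2 * ?c * f q - ?c\<^sup>2) p \<le> moll n (\<lambda>q. (f q)\<^sup>2) p"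
  proof (rule moll_mono)
    have "2 * ?c * x - ?c\<^sup>2 \<le> x\<^sup>2" for x
      using zero_le_power2[of "x - ?c"] by (simp add: power2_diff algebra_simps)
    then show "AE q in LO. 2 * ?c * f q - ?c\<^sup>2 \<le> (f q)\<^sup>2" by simp
  qed (use f in auto)
  moreover have "moll n (\<lambda>q. 2 * ?c * f q - ?c\<^sup>2) p = 2 * ?c * ?c - ?c\<^sup>2"
    using f by (subst moll_diff) (simp_all add: moll_cmult)
  ultimately show ?thesis by (simp add: power2_eq_square)
qed

lemma moll_cont:
  assumes f: "integrable LO f"
  shows "continuous_on UNIV (moll n f)"
  unfolding continuous_on_sequentially
proof (intro allI impI ballI, elim conjE)
  fix x :: "nat \<Rightarrow> real \<times> real" and a assume x: "x \<longlonglongrightarrow> a"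
  have "(\<lambda>k. \<integral>q. K n (x k) q * f q \<partial>LO) \<longlonglongrightarrow> (\<integral>q. K n a q * f q \<partial>LO)"
  proof (rule integral_dominated_convergence[where w = "\<lambda>q. 1 / kmass n * \<bar>f q\<bar>"])
    show "(\<lambda>q. K n a q * f q) \<in> borel_measurable LO" "(\<lambda>q. K n (x i) q * f q) \<in> borel_measurable LO" for i
      using K_mult_integrable[OF f] by auto
    show "integrable LO (\<lambda>q. 1 / kmass n * \<bar>f q\<bar>)" using f by simp
    show "AE q in LO. (\<lambda>k. K n (x k) q * f q) \<longlonglongrightarrow> K n a q * f q"
    proof (rule AE_I2)
      fix q
      have "continuous_on UNIV (\<lambda>p. K n p q)" by (intro continuous_intros)
      then have "isCont (\<lambda>p. K n p q) a" by (simp add: continuous_on_eq_continuous_at)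
      then have "(\<lambda>k. K n (x k) q) \<longlonglongrightarrow> K n a q" using x by (rule isCont_tendsto_compose)
      then show "(\<lambda>k. K n (x k) q * f q) \<longlonglongrightarrow> K n a q * f q" by (intro tendsto_intros)
    qed
    show "AE q in LO. norm (K n (x i) q * f q) \<le> 1 / kmass n * \<bar>f q\<bar>" for i
    proof (rule AE_I2)
      fix q
      have "\<bar>K n (x i) q\<bar> \<le> 1 / kmass n" using K_nonneg K_le by simp
      then show "norm (K n (x i) q * f q) \<le> 1 / kmass n * \<bar>f q\<bar>"
        by (simp only: real_norm_def abs_mult mult_right_mono abs_ge_zero)
    qed
  qed
  then show "(moll n f \<circ> x) \<longlonglongrightarrow> moll n f a" by (simp add: moll_def o_def)
qed

lemma moll_integrable: "integrable LO f \<Longrightarrow> integrable LO (moll n f)"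
  by (rule continuous_LO_integrable[OF moll_cont])

interpretation LO2: pair_sigma_finite LO LO ..

text \<open>Fubini's theorem and the symmetry of the kernel.\<close>

lemma moll_integral:
  assumes f: "integrable LO f"
  shows "(\<integral>p. moll n f p \<partial>LO) = (\<integral>p. f p \<partial>LO)"
proof -
  have fst_m: "(\<lambda>x. fst x) \<in> borel_measurable LO" "(\<lambda>x. snd x) \<in> borel_measurable LO"
    by (auto intro!: continuous_LO_measurable continuous_intros)
  have m: "(\<lambda>x. fst (fst x)) \<in> borel_measurable (LO \<Otimes>\<^sub>M LO)" "(\<lambda>x. snd (fst x)) \<in> borel_measurable (LO \<Otimes>\<^sub>M LO)"
    "(\<lambda>x. fst (snd x)) \<in> borel_measurable (LO \<Otimes>\<^sub>M LO)" "(\<lambda>x. snd (snd x)) \<in> borel_measurable (LO \<Otimes>\<^sub>M LO)"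
    "(\<lambda>x. f (snd x)) \<in> borel_measurable (LO \<Otimes>\<^sub>M LO)"
    by (rule measurable_compose[OF measurable_fst fst_m(1)] measurable_compose[OF measurable_fst fst_m(2)]
      measurable_compose[OF measurable_snd fst_m(1)] measurable_compose[OF measurable_snd fst_m(2)]
      measurable_compose[OF measurable_snd borel_measurable_integrable[OF f]])+
  have meas: "(\<lambda>(p, q). K n p q * f q) \<in> borel_measurable (LO \<Otimes>\<^sub>M LO)"
    unfolding K_def kraw_def cpow_def case_prod_unfold using m by measurable
  have int: "integrable (LO \<Otimes>\<^sub>M LO) (\<lambda>(p, q). K n p q * f q)"
  proof (rule LO2.Fubini_integrable[OF meas])
    have "(\<lambda>p. \<integral>q. norm (case (p, q) of (p, q) \<Rightarrow> K n p q * f q) \<partial>LO) = moll n (\<lambda>q. \<bar>f q\<bar>)"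
      by (auto simp: moll_def abs_mult K_nonneg)
    then show "integrable LO (\<lambda>p. \<integral>q. norm (case (p, q) of (p, q) \<Rightarrow> K n p q * f q) \<partial>LO)"
      using f by (simp add: moll_integrable)
    show "AE p in LO. integrable LO (\<lambda>q. case (p, q) of (p, q) \<Rightarrow> K n p q * f q)"
      using K_mult_integrable[OF f] by simp
  qed
  have "(\<integral>p. moll n f p \<partial>LO) = (\<integral>p. (\<integral>q. K n p q * f q \<partial>LO) \<partial>LO)" by (simp add: moll_def)
  also have "\<dots> = (\<integral>q. (\<integral>p. K n p q * f q \<partial>LO) \<partial>LO)"
    using LO2.Fubini_integral[OF int] by simp
  also have "\<dots> = (\<integral>q. f q \<partial>LO)"
  proof -
    have "(\<integral>p. K n p q * f q \<partial>LO) = f q" for q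
    proof -
      have "(\<lambda>p. K n p q * f q) = (\<lambda>p. K n q p * f q)" using K_sym by metis
      then show ?thesis by (simp add: K_integral)
    qed
    then show ?thesis by (simp only:)
  qed
  finally show ?thesis .
qed

lemma moll_L1_le:
  assumes "integrable LO f"
  shows "(\<integral>p. \<bar>moll n f p\<bar> \<partial>LO) \<le> (\<integral>p. \<bar>f p\<bar> \<partial>LO)"
proof -
  have "(\<integral>p. \<bar>moll n f p\<bar> \<partial>LO) \<le> (\<integral>p. moll n (\<lambda>q. \<bar>f q\<bar>) p \<partial>LO)"
    using assms by (intro integral_mono moll_abs integrable_abs moll_integrable) auto
  then show ?thesis using assms by (simp add: moll_integral)
qed

text \<open>No other point of \<open>Omega\<close> is congruent to an interior point \<open>p\<close>, so
  away from \<open>p\<close> the \<open>n\<close>-th kernel is at most \<open>(1 - \<eta>)^n\<close>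
  while its mass is at least a multiple of \<open>(1 - \<eta> / 2)^n\<close>: the normalized kernel tends
  to 0 there, uniformly.\<close>

lemma moll_tendsto_continuous:
  assumes g: "continuous_on UNIV g" and p: "p \<in> interior Omega"
  shows "(\<lambda>n. moll n g p) \<longlonglongrightarrow> g p"
proof (rule LIMSEQ_I)
  fix r :: real assume r: "r > 0"
  obtain B where B: "B > 0" "\<And>q. q \<in> Omega \<Longrightarrow> norm (g q) \<le> B"
    using continuous_LO_bounded[OF g] by metis
  have "isCont g p" using g by (simp add: continuous_on_eq_continuous_at)
  then obtain \<delta> where \<delta>: "\<delta> > 0" "\<And>q. dist q p < \<delta> \<Longrightarrow> \<bar>g q - g p\<bar> < r / 2"
    using r unfolding continuous_at_eps_delta dist_real_def by (metis half_gt_zero_iff)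
  let ?S = "Omega - ball p \<delta>"
  have comp: "compact ?S" by (auto simp: Omega_cbox intro: compact_diff)
  have lt1: "kraw 1 p q < 1" if "q \<in> ?S" for q
  proof (rule ccontr)
    assume "\<not> kraw 1 p q < 1"
    then have 1: "kraw 1 p q \<ge> 1" by simp
    have a: "cpow (1/2) 1 (fst p - fst q) \<ge> 1" "cpow pi 1 (snd p - snd q) \<ge> 1"
      using 1 cpow_bounds[of "1/2" 1 "fst p - fst q"] cpow_bounds[of pi 1 "snd p - snd q"]
        mult_left_le[of "cpow pi 1 (snd p - snd q)" "cpow (1/2) 1 (fst p - fst q)"]
        mult_left_le[of "cpow (1/2) 1 (fst p - fst q)" "cpow pi 1 (snd p - snd q)"]
      by (simp_all add: kraw_def mult.commute)
    have qp: "q \<in> Omega" using that by simp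
    have sin0: "sin ((fst p - fst q) / 2) = 0" "sin (pi * (snd p - snd q)) = 0"
      using a sin_squared_eq[of "(fst p - fst q) / 2"] sin_squared_eq[of "pi * (snd p - snd q)"]
        zero_le_power2[of "sin ((fst p - fst q) / 2)"] zero_le_power2[of "sin (pi * (snd p - snd q))"]
      by (simp_all add: cpow_def)
    have bnd: "\<bar>fst p - fst q\<bar> < 2 * pi" "\<bar>snd p - snd q\<bar> < 1"
      using p qp unfolding interior_Omega by (auto simp: Omega_def)
    have z: "x = 0" if "sin x = 0" "\<bar>x\<bar> < pi" for x :: real
      using that sin_gt_zero[of x] sin_gt_zero[of "- x"] by (cases "x = 0"; cases "x > 0") auto
    have "fst p = fst q" using z[OF sin0(1)] bnd(1) by auto
    moreover have "\<bar>pi * (snd p - snd q)\<bar> < pi" using bnd(2) by (simp add: abs_mult)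
    then have "snd p = snd q" using z[OF sin0(2)] by auto
    ultimately have "p = q" by (simp add: prod_eq_iff)
    then show False using that \<delta>(1) by simp
  qed
  obtain \<eta> where \<eta>: "0 < \<eta>" "\<eta> < 1" "\<And>q. q \<in> ?S \<Longrightarrow> kraw 1 p q \<le> 1 - \<eta>"
  proof (cases "?S = {}")
    case True show ?thesis by (rule that[of "1/2"]) (simp, simp, use True in blast)
  next
    case False
    have "continuous_on ?S (\<lambda>q. kraw 1 p q)" by (intro continuous_intros)
    then obtain q0 where q0: "q0 \<in> ?S" "\<And>q. q \<in> ?S \<Longrightarrow> kraw 1 p q \<le> kraw 1 p q0"
      using continuous_attains_sup[OF comp False] by metis
    show ?thesis
    proof (rule that[of "min (1/2) (1 - kraw 1 p q0)"])
      show "kraw 1 p q \<le> 1 - min (1/2) (1 - kraw 1 p q0)" if "q \<in> ?S" for q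
        using q0(2)[OF that] by linarith
    qed (use lt1[OF q0(1)] in auto)
  qed
  obtain \<mu> where \<mu>: "\<mu> > 0" "\<And>n. kmass n \<ge> \<mu> * (1 - \<eta> / 2) ^ n"
    using kmass_lower_bound[OF p, of "\<eta> / 2"] \<eta> by auto
  \<comment> \<open>The ratio of the decay of the kernel away from \<open>p\<close> to that of its mass.\<close>
  define \<theta> where "\<theta> = (1 - \<eta>) / (1 - \<eta> / 2)"
  have \<theta>: "0 \<le> \<theta>" "\<theta> < 1" using \<eta> by (auto simp: \<theta>_def)
  have far: "K n p q \<le> \<theta> ^ n / \<mu>" if "q \<in> ?S" for n q
  proof -
    have "kraw n p q = kraw 1 p q ^ n" by (simp add: kraw_def cpow_def power_mult power_mult_distrib)
    also have "\<dots> \<le> (1 - \<eta>) ^ n" using \<eta>(3)[OF that] kraw_bounds by (intro power_mono) auto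
    finally have "K n p q \<le> (1 - \<eta>) ^ n / (\<mu> * (1 - \<eta> / 2) ^ n)"
      unfolding K_def using \<mu> \<eta> kraw_bounds by (intro frac_le) auto
    then show ?thesis by (simp add: \<theta>_def power_divide mult.commute)
  qed
  have bound: "\<bar>moll n g p - g p\<bar> \<le> r / 2 + 2 * pi * (2 * B * (\<theta> ^ n / \<mu>))" for n
  proof -
    have gi: "integrable LO g" by (rule continuous_LO_integrable[OF g])
    have pO: "p \<in> Omega" using p interior_subset by blast
    have "moll n g p - g p = moll n (\<lambda>q. g q - g p) p"
      using gi by (subst moll_diff) auto
    then have "\<bar>moll n g p - g p\<bar> \<le> (\<integral>q. K n p q * \<bar>g q - g p\<bar> \<partial>LO)"
      using moll_abs[of "\<lambda>q. g q - g p" n p] gi by (simp add: moll_def)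
    also have "\<dots> \<le> (\<integral>q. K n p q * (r / 2) + 2 * B * (\<theta> ^ n / \<mu>) \<partial>LO)"
    proof (rule integral_mono_AE)
      show "integrable LO (\<lambda>q. K n p q * \<bar>g q - g p\<bar>)" using gi by (intro K_mult_integrable) auto
      show "integrable LO (\<lambda>q. K n p q * (r / 2) + 2 * B * (\<theta> ^ n / \<mu>))"
        using K_mult_integrable[of "\<lambda>_. r / 2" n p] by auto
      show "AE q in LO. K n p q * \<bar>g q - g p\<bar> \<le> K n p q * (r / 2) + 2 * B * (\<theta> ^ n / \<mu>)"
        using AE_LO_Omega
      proof eventually_elim
        fix q assume q: "q \<in> Omega"
        show "K n p q * \<bar>g q - g p\<bar> \<le> K n p q * (r / 2) + 2 * B * (\<theta> ^ n / \<mu>)"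
        proof (cases "dist q p < \<delta>")
          case True
          then have "K n p q * \<bar>g q - g p\<bar> \<le> K n p q * (r / 2)"
            using \<delta>(2)[OF True] K_nonneg by (intro mult_left_mono) auto
          moreover have "0 \<le> 2 * B * (\<theta> ^ n / \<mu>)" using B(1) \<theta> \<mu>(1) by simp
          ultimately show ?thesis by linarith
        next
          case False
          then have "K n p q \<le> \<theta> ^ n / \<mu>" using q by (intro far) (auto simp: dist_commute)
          moreover have "\<bar>g q - g p\<bar> \<le> 2 * B" using B(2)[OF q] B(2)[OF pO] by auto
          ultimately have "K n p q * \<bar>g q - g p\<bar> \<le> (\<theta> ^ n / \<mu>) * (2 * B)"
            using K_nonneg \<theta>(1) \<mu>(1) by (intro mult_mono) auto
          moreover have "0 \<le> K n p q * (r / 2)" using K_nonneg r by simp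
          ultimately show ?thesis by (simp add: mult.commute)
        qed
      qed
    qed
    also have "\<dots> = r / 2 + 2 * pi * (2 * B * (\<theta> ^ n / \<mu>))"
      using K_mult_integrable[of "\<lambda>_. r / 2" n p] measure_LO
      by (subst Bochner_Integration.integral_add) (auto simp: K_integral)
    finally show ?thesis .
  qed
  have "(\<lambda>n. 2 * pi * (2 * B * (\<theta> ^ n / \<mu>))) \<longlonglongrightarrow> 2 * pi * (2 * B * (0 / \<mu>))"
    using \<theta> \<mu>(1) by (intro tendsto_intros LIMSEQ_realpow_zero) auto
  then have "\<forall>\<^sub>F n in sequentially. 2 * pi * (2 * B * (\<theta> ^ n / \<mu>)) < r / 2"
    using r by (intro order_tendstoD(2)) auto
  then obtain N where N: "\<And>n. n \<ge> N \<Longrightarrow> 2 * pi * (2 * B * (\<theta> ^ n / \<mu>)) < r / 2"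
    unfolding eventually_sequentially by blast
  have "norm (moll n g p - g p) < r" if "n \<ge> N" for n
    using bound[of n] N[OF that] by simp
  then show "\<exists>N. \<forall>n\<ge>N. norm (moll n g p - g p) < r" by blast
qed

text \<open>First truncate, then use the almost everywhere approximation of a measurable function by
  continuous ones; after truncation dominated convergence applies.\<close>

lemma continuous_dense_L1:
  fixes f :: "real \<times> real \<Rightarrow> real"
  assumes f: "integrable LO f" and \<epsilon>: "\<epsilon> > 0"
  obtains g where "continuous_on UNIV g" "(\<integral>p. \<bar>f p - g p\<bar> \<partial>LO) < \<epsilon>"
proof -
  \<comment> \<open>\<open>T k\<close> truncates at height \<open>k\<close>.\<close>
  define T :: "real \<Rightarrow> real \<Rightarrow> real" where "T k x = max (- k) (min k x)" for k x
  have fm: "f \<in> borel_measurable LO" using f by simp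
  have Tm: "(\<lambda>p. T k (u p)) \<in> borel_measurable LO" if "u \<in> borel_measurable LO" for u k
    unfolding T_def using that by measurable
  have Tb: "\<bar>T k x\<bar> \<le> k" "\<bar>x - T k x\<bar> \<le> \<bar>x\<bar>" if "k \<ge> 0" for k x
    using that by (auto simp: T_def)
  have "(\<lambda>k. \<integral>p. \<bar>f p - T (real k) (f p)\<bar> \<partial>LO) \<longlonglongrightarrow> (\<integral>p. 0 \<partial>LO)"
  proof (rule integral_dominated_convergence[where w = "\<lambda>p. \<bar>f p\<bar>"])
    show "AE p in LO. (\<lambda>k. \<bar>f p - T (real k) (f p)\<bar>) \<longlonglongrightarrow> 0"
    proof (rule AE_I2)
      fix p
      obtain N where N: "\<bar>f p\<bar> \<le> real N" using real_arch_simple by blast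
      have "\<forall>\<^sub>F k in sequentially. \<bar>f p - T (real k) (f p)\<bar> = 0"
        using eventually_ge_at_top[of N]
      proof eventually_elim
        case (elim k)
        then have "\<bar>f p\<bar> \<le> real k" using N by linarith
        then show ?case by (auto simp: T_def)
      qed
      then show "(\<lambda>k. \<bar>f p - T (real k) (f p)\<bar>) \<longlonglongrightarrow> 0" by (rule tendsto_eventually)
    qed
  qed (use f fm Tm Tb in auto)
  then have "\<forall>\<^sub>F k in sequentially. (\<integral>p. \<bar>f p - T (real k) (f p)\<bar> \<partial>LO) < \<epsilon> / 2"
    using \<epsilon> by (intro order_tendstoD(2)) auto
  then obtain k where k: "(\<integral>p. \<bar>f p - T (real k) (f p)\<bar> \<partial>LO) < \<epsilon> / 2"
    unfolding eventually_sequentially by blast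
  have "f measurable_on Omega" using fm by (simp add: measurable_on_iff_borel_measurable)
  then obtain N g where N: "negligible N" "\<And>n. continuous_on UNIV (g n)"
    "\<And>x. x \<notin> N \<Longrightarrow> (\<lambda>n. g n x) \<longlonglongrightarrow> (if x \<in> Omega then f x else 0)"
    unfolding measurable_on_def by blast
  have "AE p in lebesgue. p \<notin> N" using N(1) by (intro AE_not_in) (simp add: negligible_iff_null_sets)
  then have "AE p in LO. p \<notin> N" by (simp add: AE_restrict_space_iff eventually_mono)
  then have AN: "AE p in LO. (\<lambda>n. g n p) \<longlonglongrightarrow> f p"
    using AE_LO_Omega
  proof eventually_elim
    case (elim p) then show ?case using N(3)[of p] by simp
  qed
  have gm: "g n \<in> borel_measurable LO" for n by (rule continuous_LO_measurable[OF N(2)])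
  have "(\<lambda>n. \<integral>p. \<bar>T (real k) (f p) - T (real k) (g n p)\<bar> \<partial>LO) \<longlonglongrightarrow> (\<integral>p. 0 \<partial>LO)"
  proof (rule integral_dominated_convergence[where w = "\<lambda>p. 2 * real k"])
    show "AE p in LO. (\<lambda>n. \<bar>T (real k) (f p) - T (real k) (g n p)\<bar>) \<longlonglongrightarrow> 0"
      using AN
    proof eventually_elim
      case (elim p)
      have "(\<lambda>n. \<bar>T (real k) (f p) - T (real k) (g n p)\<bar>) \<longlonglongrightarrow> \<bar>T (real k) (f p) - T (real k) (f p)\<bar>"
        unfolding T_def by (intro tendsto_intros elim)
      then show ?case by simp
    qed
    show "AE p in LO. norm \<bar>T (real k) (f p) - T (real k) (g n p)\<bar> \<le> 2 * real k" for n
      using Tb(1)[of "real k" "f _"] Tb(1)[of "real k" "g n _"] by (intro AE_I2) (smt (verit) real_norm_def of_nat_0_le_iff)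
  qed (use fm gm Tm in auto)
  then have "\<forall>\<^sub>F n in sequentially. (\<integral>p. \<bar>T (real k) (f p) - T (real k) (g n p)\<bar> \<partial>LO) < \<epsilon> / 2"
    using \<epsilon> by (intro order_tendstoD(2)) auto
  then obtain n where n: "(\<integral>p. \<bar>T (real k) (f p) - T (real k) (g n p)\<bar> \<partial>LO) < \<epsilon> / 2"
    unfolding eventually_sequentially by blast
  let ?h = "\<lambda>p. T (real k) (g n p)"
  have hc: "continuous_on UNIV ?h" unfolding T_def by (intro continuous_intros N(2))
  have Tfi: "integrable LO (\<lambda>p. T (real k) (f p))"
    using Tb(1) by (intro bounded_LO_integrable[where B = "real k"] Tm fm) auto
  have hi: "integrable LO ?h" by (rule continuous_LO_integrable[OF hc])
  have "(\<integral>p. \<bar>f p - ?h p\<bar> \<partial>LO) \<le> (\<integral>p. \<bar>f p - T (real k) (f p)\<bar> + \<bar>T (real k) (f p) - ?h p\<bar> \<partial>LO)"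
    using f Tfi hi by (intro integral_mono) auto
  also have "\<dots> = (\<integral>p. \<bar>f p - T (real k) (f p)\<bar> \<partial>LO) + (\<integral>p. \<bar>T (real k) (f p) - ?h p\<bar> \<partial>LO)"
    using f Tfi hi by (intro Bochner_Integration.integral_add) auto
  finally show ?thesis using that[OF hc] k n by simp
qed

text \<open>Mollification contracts the \<open>L\<^sup>1\<close> norm, so it suffices to know the claim
  for a continuous function close to \<open>f\<close>.\<close>

lemma moll_L1_tendsto:
  assumes f: "integrable LO f"
  shows "(\<lambda>n. \<integral>p. \<bar>moll n f p - f p\<bar> \<partial>LO) \<longlonglongrightarrow> 0"
proof (rule LIMSEQ_I)
  fix r :: real assume r: "r > 0"
  obtain g where g: "continuous_on UNIV g" "(\<integral>p. \<bar>f p - g p\<bar> \<partial>LO) < r / 3"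
    using continuous_dense_L1[OF f, of "r / 3"] r by auto
  have gi: "integrable LO g" by (rule continuous_LO_integrable[OF g(1)])
  obtain B where B: "B > 0" "\<And>q. q \<in> Omega \<Longrightarrow> norm (g q) \<le> B"
    using continuous_LO_bounded[OF g(1)] by metis
  have Bm: "\<bar>moll n g p\<bar> \<le> B" for n p
    using B by (intro moll_abs_le[OF gi] AE_I2) auto
  have "(\<lambda>n. \<integral>p. \<bar>moll n g p - g p\<bar> \<partial>LO) \<longlonglongrightarrow> (\<integral>p. 0 \<partial>LO)"
  proof (rule integral_dominated_convergence[where w = "\<lambda>p. 2 * B"])
    show "AE p in LO. (\<lambda>n. \<bar>moll n g p - g p\<bar>) \<longlonglongrightarrow> 0"
      using AE_LO_interior
    proof eventually_elim
      case (elim p)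
      have "(\<lambda>n. \<bar>moll n g p - g p\<bar>) \<longlonglongrightarrow> \<bar>g p - g p\<bar>"
        by (intro tendsto_intros moll_tendsto_continuous g(1) elim)
      then show ?case by simp
    qed
    show "AE p in LO. norm \<bar>moll n g p - g p\<bar> \<le> 2 * B" for n
      using AE_LO_Omega
    proof eventually_elim
      case (elim p) then show ?case using Bm[of n p] B(2)[OF elim] by auto
    qed
  qed (use gi moll_integrable[OF gi] in auto)
  then have "\<forall>\<^sub>F n in sequentially. (\<integral>p. \<bar>moll n g p - g p\<bar> \<partial>LO) < r / 3"
    using r by (intro order_tendstoD(2)) auto
  then obtain N where N: "\<And>n. n \<ge> N \<Longrightarrow> (\<integral>p. \<bar>moll n g p - g p\<bar> \<partial>LO) < r / 3"
    unfolding eventually_sequentially by blast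
  have "(\<integral>p. \<bar>moll n f p - f p\<bar> \<partial>LO) < r" if n: "n \<ge> N" for n
  proof -
    have d: "integrable LO (\<lambda>p. f p - g p)" using f gi by simp
    have i: "integrable LO (\<lambda>p. \<bar>moll n (\<lambda>q. f q - g q) p\<bar>)" "integrable LO (\<lambda>p. \<bar>moll n g p - g p\<bar>)" "integrable LO (\<lambda>p. \<bar>f p - g p\<bar>)"
      using d gi moll_integrable[OF d, of n] moll_integrable[OF gi, of n] by auto
    have "(\<integral>p. \<bar>moll n f p - f p\<bar> \<partial>LO) \<le> (\<integral>p. \<bar>moll n (\<lambda>q. f q - g q) p\<bar> + \<bar>moll n g p - g p\<bar> + \<bar>f p - g p\<bar> \<partial>LO)"
    proof (rule integral_mono)
      show "\<bar>moll n f p - f p\<bar> \<le> \<bar>moll n (\<lambda>q. f q - g q) p\<bar> + \<bar>moll n g p - g p\<bar> + \<bar>f p - g p\<bar>" for p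
        using f gi by (subst moll_diff) auto
    qed (use i f moll_integrable[OF f, of n] in auto)
    also have "\<dots> = (\<integral>p. \<bar>moll n (\<lambda>q. f q - g q) p\<bar> \<partial>LO) + (\<integral>p. \<bar>moll n g p - g p\<bar> \<partial>LO) + (\<integral>p. \<bar>f p - g p\<bar> \<partial>LO)"
      using i by simp
    also have "\<dots> < r / 3 + r / 3 + r / 3"
      using moll_L1_le[OF d, of n] g(2) N[OF n] by linarith
    finally show ?thesis by simp
  qed
  then show "\<exists>N. \<forall>n\<ge>N. norm ((\<integral>p. \<bar>moll n f p - f p\<bar> \<partial>LO) - 0) < r"
    by (auto intro!: exI[of _ N])
qed

lemma moll_DERIV:
  "pw_theta f g \<Longrightarrow> ((\<lambda>x. moll n f (x, t)) has_real_derivative moll n g (s, t)) (at s)"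
  "pw_z f g \<Longrightarrow> ((\<lambda>x. moll n f (s, x)) has_real_derivative moll n g (s, t)) (at t)"
  using DERIV_cdivide[OF kraw_DERIV_theta[of f g n t s], where c = "kmass n"]
        DERIV_cdivide[OF kraw_DERIV_z[of f g n s t], where c = "kmass n"]
  by (simp_all add: moll_def K_def)

lemma kraw_per:
  "kraw n (s + 2 * pi, t) q = kraw n (s, t) q" "kraw n (s, t + 1) q = kraw n (s, t) q"
proof -
  have "s + 2 * pi - fst q = (s - fst q) + 2 * pi" "t + 1 - snd q = (t - snd q) + 1" by simp_all
  then show "kraw n (s + 2 * pi, t) q = kraw n (s, t) q" "kraw n (s, t + 1) q = kraw n (s, t) q"
    by (simp_all only: kraw_def fst_conv snd_conv cpow_per)
qed

lemma moll_periodic: "periodic (moll n f)"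
  by (simp add: periodic_def moll_def K_def kraw_per)

text \<open>The kernel multiplied by a smooth cut-off is an interior test. Hence all mollifications of
  \<open>g\<close> times the cut-off vanish, and so does their \<open>L\<^sup>1\<close> limit.\<close>

lemma interior_tests_separate:
  assumes g: "integrable LO g" and z: "\<And>\<phi>. \<phi> \<in> interior_tests \<Longrightarrow> (\<integral>p. \<phi> p * g p \<partial>LO) = 0"
  shows "AE p in LO. g p = 0"
proof -
  \<comment> \<open>The cut-offs \<open>b k\<close> and \<open>c k\<close> are positive exactly at distance more than \<open>\<alpha> k\<close> from the sides.\<close>
  define \<alpha> :: "nat \<Rightarrow> real" where "\<alpha> k = 1 / real (k + 3)" for k
  define b where "b k s = flat 1 (1 * s + (- \<alpha> k)) * flat 1 ((- 1) * s + (2 * pi - \<alpha> k))" for k s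
  define c where "c k t = flat 1 (1 * t + (1/2 - \<alpha> k)) * flat 1 ((- 1) * t + (1/2 - \<alpha> k))" for k t
  have \<alpha>: "0 < \<alpha> k" for k by (simp add: \<alpha>_def)
  have sm: "smooth1 (b k)" "smooth1 (c k)" for k
    unfolding b_def[abs_def] c_def[abs_def] by (intro smooth1_mult smooth1_affine smooth1_flat)+
  have b0: "b k s \<noteq> 0 \<Longrightarrow> s \<in> {\<alpha> k..2 * pi - \<alpha> k}" for k s
    using flat1_zero[of "s - \<alpha> k"] flat1_zero[of "2 * pi - \<alpha> k - s"] by (force simp: b_def)
  have c0: "c k t \<noteq> 0 \<Longrightarrow> t \<in> {- 1/2 + \<alpha> k..1/2 - \<alpha> k}" for k t
    using flat1_zero[of "t + (1/2 - \<alpha> k)"] flat1_zero[of "1/2 - \<alpha> k - t"] by (force simp: c_def)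
  have bc: "continuous_on UNIV (\<lambda>q :: real \<times> real. b k (fst q) * c k (snd q))" for k
    by (intro continuous_on_mult continuous_on_compose2[OF smooth1_continuous[OF sm(1), of UNIV] continuous_on_fst[OF continuous_on_id]]
        continuous_on_compose2[OF smooth1_continuous[OF sm(2), of UNIV] continuous_on_snd[OF continuous_on_id]]) auto
  have cut: "AE q in LO. b k (fst q) * c k (snd q) * g q = 0" for k
  proof -
    let ?f = "\<lambda>q. b k (fst q) * c k (snd q) * g q"
    have fi: "integrable LO ?f" by (rule integrable_mult_cont[OF bc g])
    have "moll n ?f p = 0" for n p
    proof -
      let ?\<phi> = "\<lambda>(s, t). (cpow (1/2) n (fst p - s) * b k s) * (cpow pi n (snd p - t) * c k t)"
      have "?\<phi> \<in> interior_tests"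
      proof (rule interior_tests_prod)
        show "smooth1 (\<lambda>s. cpow (1/2) n (fst p - s) * b k s)" "smooth1 (\<lambda>t. cpow pi n (snd p - t) * c k t)"
          by (intro smooth1_mult cpow_smooth1 sm)+
        show "0 < \<alpha> k" "2 * pi - \<alpha> k < 2 * pi" "- 1/2 < - 1/2 + \<alpha> k" "1/2 - \<alpha> k < 1/2"
          using \<alpha>[of k] by auto
      qed (use b0 c0 in auto)
      then have "(\<integral>q. ?\<phi> q * g q \<partial>LO) = 0" by (rule z)
      moreover have "K n p q * ?f q = ?\<phi> q * g q / kmass n" for q
        by (simp add: K_def kraw_def case_prod_unfold)
      ultimately show ?thesis by (simp add: moll_def)
    qed
    then have "(\<lambda>n::nat. \<integral>q. \<bar>?f q\<bar> \<partial>LO) \<longlonglongrightarrow> 0"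
      using moll_L1_tendsto[OF fi] by simp
    then have "(\<integral>q. \<bar>?f q\<bar> \<partial>LO) = 0" by (simp add: LIMSEQ_const_iff)
    then have "AE q in LO. \<bar>?f q\<bar> = 0"
      using fi by (subst (asm) integral_nonneg_eq_0_iff_AE) auto
    then show ?thesis by simp
  qed
  have "AE q in LO. \<forall>k. b k (fst q) * c k (snd q) * g q = 0"
    using cut by (simp add: AE_all_countable)
  then show ?thesis using AE_LO_interior
  proof eventually_elim
    case (elim q)
    let ?m = "min (min (fst q) (2 * pi - fst q)) (min (snd q + 1/2) (1/2 - snd q))"
    have m: "?m > 0" using elim(2) by (auto simp: interior_Omega mem_Times_iff)
    obtain k where k: "1 / real (Suc k) < ?m" using nat_approx_posE[OF m] by metis
    have "\<alpha> k \<le> 1 / real (Suc k)" by (auto simp: \<alpha>_def intro!: divide_left_mono)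
    then have "\<alpha> k < ?m" using k by linarith
    then have "b k (fst q) > 0" "c k (snd q) > 0"
      by (auto simp: b_def c_def intro!: mult_pos_pos flat1_pos)
    then show ?case using elim(1)[rule_format, of k] by auto
  qed
qed

text \<open>Each component of the difference of two weak derivatives is annihilated by all interior
  tests.\<close>

lemma weak_deriv_AE:
  fixes f g :: "real \<times> real \<Rightarrow> 'a::euclidean_space"
  assumes g: "is_weak_deriv interior_tests i j f g"
  shows "AE p in LO. weak_deriv i j f p = g p"
proof -
  define w where "w = weak_deriv i j f"
  have w: "is_weak_deriv interior_tests i j f w"
    unfolding w_def weak_deriv_def by (rule someI[where P = "is_weak_deriv interior_tests i j f", OF g])
  have i: "integrable LO w" "integrable LO g" using w g by (auto simp: is_weak_deriv_def)
  have "AE p in LO. (w p - g p) \<bullet> e = 0" if "e \<in> Basis" for e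
  proof (rule interior_tests_separate)
    show "integrable LO (\<lambda>p. (w p - g p) \<bullet> e)" using i by simp
    fix \<phi> assume \<phi>: "\<phi> \<in> interior_tests"
    have c: "continuous_on UNIV \<phi>"
      using smooth_C1(1)[of \<phi> 0 0] \<phi> by (simp add: interior_tests_def)
    have "(- 1) ^ (i + j) *\<^sub>R (\<integral>p. \<phi> p *\<^sub>R w p \<partial>LO) = (- 1 :: real) ^ (i + j) *\<^sub>R (\<integral>p. \<phi> p *\<^sub>R g p \<partial>LO)"
      using w g \<phi> by (simp add: is_weak_deriv_def)
    then have eq: "(\<integral>p. \<phi> p *\<^sub>R w p \<partial>LO) = (\<integral>p. \<phi> p *\<^sub>R g p \<partial>LO)" by simp
    obtain B where B: "\<And>p. p \<in> Omega \<Longrightarrow> norm (\<phi> p) \<le> B" using continuous_LO_bounded[OF c] by metis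
    have si: "integrable LO (\<lambda>p. \<phi> p *\<^sub>R k p)" if k: "integrable LO k" for k :: "real \<times> real \<Rightarrow> 'a"
    proof (rule Bochner_Integration.integrable_bound)
      show "integrable LO (\<lambda>p. B *\<^sub>R k p)" using k by simp
      show "(\<lambda>p. \<phi> p *\<^sub>R k p) \<in> borel_measurable LO"
        using continuous_LO_measurable[OF c] k by measurable
      show "AE p in LO. norm (\<phi> p *\<^sub>R k p) \<le> norm (B *\<^sub>R k p)"
        using AE_LO_Omega
      proof eventually_elim
        case (elim p)
        then have "\<bar>\<phi> p\<bar> \<le> \<bar>B\<bar>" using B[OF elim] by simp
        then show ?case by (simp add: mult_right_mono)
      qed
    qed
    have "(\<integral>p. \<phi> p * ((w p - g p) \<bullet> e) \<partial>LO) = (\<integral>p. (\<phi> p *\<^sub>R w p - \<phi> p *\<^sub>R g p) \<bullet> e \<partial>LO)"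
      by (simp add: inner_diff_left algebra_simps)
    also have "\<dots> = (\<integral>p. \<phi> p *\<^sub>R w p - \<phi> p *\<^sub>R g p \<partial>LO) \<bullet> e"
      using si[OF i(1)] si[OF i(2)] by (intro integral_inner_left) auto
    also have "\<dots> = 0" using si[OF i(1)] si[OF i(2)] eq by simp
    finally show "(\<integral>p. \<phi> p * ((w p - g p) \<bullet> e) \<partial>LO) = 0" .
  qed
  then have "AE p in LO. \<forall>e\<in>Basis. (w p - g p) \<bullet> e = 0" by (simp add: AE_ball_countable countable_finite)
  then show ?thesis
    unfolding w_def[symmetric]
  proof eventually_elim
    case (elim p) then show ?case by (simp add: euclidean_eq_iff[of "w p"] inner_diff_left)
  qed
qed

section \<open>Limits of mollified functions\<close>

text \<open>All functions of the family are to converge along one subsequence, so it is extracted from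
  the sum of their \<open>L\<^sup>1\<close> errors.\<close>

lemma moll_AE_subseq:
  assumes F: "finite F" "\<And>f. f \<in> F \<Longrightarrow> integrable LO f"
  obtains r :: "nat \<Rightarrow> nat" where "strict_mono r"
    "\<And>f. f \<in> F \<Longrightarrow> AE p in LO. (\<lambda>n. moll (r n) f p) \<longlonglongrightarrow> f p"
proof -
  let ?u = "\<lambda>n p. \<Sum>f\<in>F. \<bar>moll n f p - f p\<bar>"
  have ui: "integrable LO (\<lambda>p. \<bar>moll n f p - f p\<bar>)" if "f \<in> F" for n f
    using F(2)[OF that] moll_integrable[OF F(2)[OF that], of n] by auto
  have "(\<lambda>n. \<Sum>f\<in>F. \<integral>p. \<bar>moll n f p - f p\<bar> \<partial>LO) \<longlonglongrightarrow> (\<Sum>f\<in>F. 0)"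
    by (intro tendsto_sum moll_L1_tendsto F(2))
  moreover have "(\<integral>p. norm (?u n p) \<partial>LO) = (\<Sum>f\<in>F. \<integral>p. \<bar>moll n f p - f p\<bar> \<partial>LO)" for n
  proof -
    have "norm (?u n p) = ?u n p" for p by (simp add: sum_nonneg)
    then have "(\<integral>p. norm (?u n p) \<partial>LO) = (\<integral>p. ?u n p \<partial>LO)" by (simp only:)
    also have "\<dots> = (\<Sum>f\<in>F. \<integral>p. \<bar>moll n f p - f p\<bar> \<partial>LO)" by (rule Bochner_Integration.integral_sum[OF ui])
    finally show ?thesis .
  qed
  ultimately have "(\<lambda>n. \<integral>p. norm (?u n p) \<partial>LO) \<longlonglongrightarrow> 0" by simp
  then obtain r :: "nat \<Rightarrow> nat" where r: "strict_mono r" "AE p in LO. (\<lambda>n. ?u (r n) p) \<longlonglongrightarrow> 0"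
    using tendsto_L1_AE_subseq[of LO ?u] ui by (auto intro!: Bochner_Integration.integrable_sum)
  have "AE p in LO. (\<lambda>n. moll (r n) f p) \<longlonglongrightarrow> f p" if f: "f \<in> F" for f
    using r(2)
  proof eventually_elim
    case (elim p)
    have le: "\<bar>moll (r n) f p - f p\<bar> \<le> ?u (r n) p" for n
      using F(1) f by (intro member_le_sum) auto
    have "(\<lambda>n. moll (r n) f p - f p) \<longlonglongrightarrow> 0"
      by (rule tendsto_0_le[OF elim, of _ 1]) (use le in auto)
    then show ?case by (simp add: LIM_zero_iff)
  qed
  then show ?thesis using r(1) that by blast
qed

lemma integrable_mult_bounded:
  fixes f q :: "real \<times> real \<Rightarrow> real"
  assumes "integrable LO f" "q \<in> borel_measurable LO" "AE p in LO. \<bar>q p\<bar> \<le> B"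
  shows "integrable LO (\<lambda>p. f p * q p)"
proof (rule Bochner_Integration.integrable_bound)
  show "integrable LO (\<lambda>p. B * f p)" using assms(1) by simp
  show "(\<lambda>p. f p * q p) \<in> borel_measurable LO" using assms(1,2) by measurable
  show "AE p in LO. norm (f p * q p) \<le> norm (B * f p)"
    using assms(3)
  proof eventually_elim
    case (elim p)
    then have "\<bar>q p\<bar> \<le> \<bar>B\<bar>" by simp
    then show ?case using mult_right_mono[of "\<bar>q p\<bar>" "\<bar>B\<bar>" "\<bar>f p\<bar>"]
      by (simp add: abs_mult mult.commute)
  qed
qed

text \<open>The typical limit in a nonlinear expression: one factor converges in
  \<open>L\<^sup>1\<close>, the others boundedly and almost everywhere.\<close>

lemma moll_mult_tendsto:
  fixes f q :: "real \<times> real \<Rightarrow> real" and qn :: "nat \<Rightarrow> real \<times> real \<Rightarrow> real"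
  assumes f: "integrable LO f" and r: "strict_mono r"
    and qn: "\<And>n. qn n \<in> borel_measurable LO" "\<And>n. AE p in LO. \<bar>qn n p\<bar> \<le> B"
    and q: "q \<in> borel_measurable LO" "AE p in LO. (\<lambda>n. qn n p) \<longlonglongrightarrow> q p"
  shows "(\<lambda>n. \<integral>p. moll (r n) f p * qn n p \<partial>LO) \<longlonglongrightarrow> (\<integral>p. f p * q p \<partial>LO)"
proof -
  have mi: "integrable LO (moll (r n) f)" for n by (rule moll_integrable[OF f])
  have i1: "integrable LO (\<lambda>p. (moll (r n) f p - f p) * qn n p)" for n
    by (rule integrable_mult_bounded[OF _ qn]) (use f mi in auto)
  have i2: "integrable LO (\<lambda>p. f p * qn n p)" for n
    by (rule integrable_mult_bounded[OF f qn])
  have L1: "(\<lambda>n. \<integral>p. (moll (r n) f p - f p) * qn n p \<partial>LO) \<longlonglongrightarrow> 0"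
  proof (rule tendsto_0_le)
    show "(\<lambda>n. \<integral>p. \<bar>moll (r n) f p - f p\<bar> \<partial>LO) \<longlonglongrightarrow> 0"
      using LIMSEQ_subseq_LIMSEQ[OF moll_L1_tendsto[OF f] r] by (simp add: o_def)
    show "\<forall>\<^sub>F n in sequentially. norm (\<integral>p. (moll (r n) f p - f p) * qn n p \<partial>LO) \<le> norm (\<integral>p. \<bar>moll (r n) f p - f p\<bar> \<partial>LO) * B"
    proof (rule always_eventually, rule allI)
      fix n
      have "norm (\<integral>p. (moll (r n) f p - f p) * qn n p \<partial>LO) \<le> (\<integral>p. norm ((moll (r n) f p - f p) * qn n p) \<partial>LO)"
        by (rule integral_norm_bound)
      also have "\<dots> \<le> (\<integral>p. \<bar>moll (r n) f p - f p\<bar> * B \<partial>LO)"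
      proof (rule integral_mono_AE)
        show "AE p in LO. norm ((moll (r n) f p - f p) * qn n p) \<le> \<bar>moll (r n) f p - f p\<bar> * B"
          using qn(2)[of n]
        proof eventually_elim
          case (elim p) then show ?case by (simp add: abs_mult mult_left_mono)
        qed
      qed (use i1 f mi in auto)
      also have "\<dots> = norm (\<integral>p. \<bar>moll (r n) f p - f p\<bar> \<partial>LO) * B" by simp
      finally show "norm (\<integral>p. (moll (r n) f p - f p) * qn n p \<partial>LO) \<le> norm (\<integral>p. \<bar>moll (r n) f p - f p\<bar> \<partial>LO) * B" .
    qed
  qed
  have L2: "(\<lambda>n. \<integral>p. f p * qn n p \<partial>LO) \<longlonglongrightarrow> (\<integral>p. f p * q p \<partial>LO)"
  proof (rule integral_dominated_convergence[where w = "\<lambda>p. \<bar>f p\<bar> * B"])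
    show "AE p in LO. (\<lambda>n. f p * qn n p) \<longlonglongrightarrow> f p * q p"
      using q(2) by eventually_elim (intro tendsto_intros)
    show "AE p in LO. norm (f p * qn n p) \<le> \<bar>f p\<bar> * B" for n
      using qn(2)[of n] by eventually_elim (simp add: abs_mult mult_left_mono)
  qed (use f q i2 in auto)
  have "(\<integral>p. moll (r n) f p * qn n p \<partial>LO) = (\<integral>p. (moll (r n) f p - f p) * qn n p \<partial>LO) + (\<integral>p. f p * qn n p \<partial>LO)" for n
    using i1[of n] i2[of n] by (subst Bochner_Integration.integral_add[symmetric]) (auto simp: algebra_simps)
  then show ?thesis using tendsto_add[OF L1 L2] by simp
qed

section \<open>The chain rule\<close>

text \<open>The arguments in the two coordinate directions are the same; indexing them by a datatype
  allows the chain rule to be proved once.\<close>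

datatype direction = Theta | Zed

definition C1 :: "direction \<Rightarrow> (real \<times> real \<Rightarrow> real) \<Rightarrow> (real \<times> real \<Rightarrow> real) \<Rightarrow> bool" where
  "C1 d = (case d of Theta \<Rightarrow> C1_theta | Zed \<Rightarrow> C1_z)"

definition pw :: "direction \<Rightarrow> (real \<times> real \<Rightarrow> real) \<Rightarrow> (real \<times> real \<Rightarrow> real) \<Rightarrow> bool" where
  "pw d = (case d of Theta \<Rightarrow> pw_theta | Zed \<Rightarrow> pw_z)"

lemma C1_cont: "C1 d u v \<Longrightarrow> continuous_on UNIV u \<and> continuous_on UNIV v"
  by (cases d) (simp_all add: C1_def C1_theta_def C1_z_def)

definition line :: "direction \<Rightarrow> real \<times> real \<Rightarrow> real \<Rightarrow> real \<times> real" where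
  "line d p x = (case d of Theta \<Rightarrow> (x, snd p) | Zed \<Rightarrow> (fst p, x))"

definition coord :: "direction \<Rightarrow> real \<times> real \<Rightarrow> real" where
  "coord d p = (case d of Theta \<Rightarrow> fst p | Zed \<Rightarrow> snd p)"

lemma line_coord [simp]: "line d p (coord d p) = p"
  by (cases d) (simp_all add: line_def coord_def)

lemma C1_iff: "C1 d u v \<longleftrightarrow> continuous_on UNIV u \<and> continuous_on UNIV v \<and>
    (\<forall>p. ((\<lambda>x. u (line d p x)) has_real_derivative v p) (at (coord d p)))"
  by (cases d) (simp_all add: C1_def C1_theta_def C1_z_def line_def coord_def split_paired_All)

lemma C1_DERIV: "C1 d u v \<Longrightarrow> ((\<lambda>x. u (line d p x)) has_real_derivative v p) (at (coord d p))"
  by (simp add: C1_iff)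

lemma C1_mult:
  assumes u: "C1 d u u'" and v: "C1 d v v'"
  shows "C1 d (\<lambda>p. u p * v p) (\<lambda>p. u' p * v p + u p * v' p)"
  unfolding C1_iff
proof (intro conjI allI)
  show "((\<lambda>x. u (line d p x) * v (line d p x)) has_real_derivative u' p * v p + u p * v' p) (at (coord d p))" for p
    using DERIV_mult[OF C1_DERIV[OF u, of p] C1_DERIV[OF v, of p]] by (simp add: mult.commute)
qed (use C1_cont[OF u] C1_cont[OF v] in \<open>auto intro!: continuous_on_mult continuous_on_add\<close>)

lemma C1_add:
  assumes u: "C1 d u u'" and v: "C1 d v v'"
  shows "C1 d (\<lambda>p. u p + v p) (\<lambda>p. u' p + v' p)"
  unfolding C1_iff
proof (intro conjI allI)
  show "((\<lambda>x. u (line d p x) + v (line d p x)) has_real_derivative u' p + v' p) (at (coord d p))" for p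
    using DERIV_add[OF C1_DERIV[OF u, of p] C1_DERIV[OF v, of p]] .
qed (use C1_cont[OF u] C1_cont[OF v] in \<open>auto intro!: continuous_on_add\<close>)

lemma C1_const: "C1 d (\<lambda>_. c) (\<lambda>_. 0)"
  by (simp add: C1_iff)

lemma C1_cos_sin:
  assumes u: "C1 d u u'"
  shows "C1 d (\<lambda>p. cos (u p)) (\<lambda>p. - sin (u p) * u' p)" "C1 d (\<lambda>p. sin (u p)) (\<lambda>p. cos (u p) * u' p)"
proof -
  have c: "continuous_on UNIV (\<lambda>p. cos (u p))" "continuous_on UNIV (\<lambda>p. sin (u p))" "continuous_on UNIV u'"
    using C1_cont[OF u] by (auto intro: continuous_on_cos continuous_on_sin)
  have 1: "((\<lambda>x. cos (u (line d p x))) has_real_derivative - sin (u p) * u' p) (at (coord d p))" for p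
    using DERIV_chain2[OF DERIV_cos C1_DERIV[OF u, of p]] by simp
  have 2: "((\<lambda>x. sin (u (line d p x))) has_real_derivative cos (u p) * u' p) (at (coord d p))" for p
    using DERIV_chain2[OF DERIV_sin C1_DERIV[OF u, of p]] by simp
  show "C1 d (\<lambda>p. cos (u p)) (\<lambda>p. - sin (u p) * u' p)" "C1 d (\<lambda>p. sin (u p)) (\<lambda>p. cos (u p) * u' p)"
    unfolding C1_iff using c 1 2 by (auto intro!: continuous_on_mult continuous_on_minus)
qed

lemma C1_moll:
  assumes "pw d f g"
  shows "C1 d (moll n f) (moll n g)" "integrable LO f" "integrable LO g"
  using assms
  by (cases d; simp add: C1_def pw_def C1_theta_def C1_z_def moll_DERIV moll_cont pw_theta_def pw_z_def)+

lemma C1_wd: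
  assumes "C1 d u v"
  shows "wd (C1 d) vanishing u v"
proof -
  have c: "continuous_on UNIV u" "continuous_on UNIV v" using C1_cont[OF assms] by auto
  obtain B1 B2 where B: "\<And>p. p \<in> Omega \<Longrightarrow> norm (u p) \<le> B1" "\<And>p. p \<in> Omega \<Longrightarrow> norm (v p) \<le> B2"
    using continuous_LO_bounded[OF c(1)] continuous_LO_bounded[OF c(2)] by metis
  have b: "u \<in> borel_measurable borel" "v \<in> borel_measurable borel"
    using c by (auto intro: borel_measurable_continuous_onI)
  have bd: "\<bar>u p\<bar> \<le> max B1 B2" "\<bar>v p\<bar> \<le> max B1 B2" if "p \<in> Omega" for p
    using B[OF that] by auto
  show ?thesis
  proof (cases d)
    case Theta
    then have 1: "C1 d = C1_theta" by (simp add: C1_def)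
    show ?thesis unfolding 1
      by (rule wd_theta_I[OF b bd]) (use assms 1 in \<open>auto simp: C1_theta_def vanishing_def interior_Omega\<close>)
  next
    case Zed
    then have 2: "C1 d = C1_z" by (simp add: C1_def)
    show ?thesis unfolding 2
    proof (rule wd_z_I[OF b bd finite.emptyI])
      show "continuous_on {- 1 / 2..1 / 2} (\<lambda>x. u (s, x))" for s
        by (rule continuous_on_compose2[OF c(1)]) (auto intro!: continuous_intros)
    qed (use assms 2 in \<open>auto simp: C1_z_def vanishing_def interior_Omega\<close>)
  qed
qed

text \<open>A periodic weak derivative is in particular a weak derivative inside the rectangle. The tests
  are wider than on the hypothesis side, namely merely \<open>C\<^sup>1\<close>, which is reached by
  mollifying \<open>f\<close> instead of the test.\<close>

lemma pw_imp_wd: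
  assumes P: "pw d f g"
  shows "wd (C1 d) vanishing f g"
proof -
  note m = C1_moll[OF P]
  have "(\<integral>p. \<psi>' p * f p \<partial>LO) = - (\<integral>p. \<psi> p * g p \<partial>LO)" if \<psi>: "C1 d \<psi> \<psi>'" "vanishing \<psi>" for \<psi> \<psi>'
  proof -
    have c: "continuous_on UNIV \<psi>" "continuous_on UNIV \<psi>'" using C1_cont[OF \<psi>(1)] by auto
    obtain B1 B2 where B: "\<And>p. p \<in> Omega \<Longrightarrow> norm (\<psi> p) \<le> B1" "\<And>p. p \<in> Omega \<Longrightarrow> norm (\<psi>' p) \<le> B2"
      using continuous_LO_bounded[OF c(1)] continuous_LO_bounded[OF c(2)] by metis
    have b: "AE p in LO. \<bar>\<psi> p\<bar> \<le> B1" "AE p in LO. \<bar>\<psi>' p\<bar> \<le> B2"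
      using B AE_LO_Omega by (auto elim!: eventually_mono)
    have l: "AE p in LO. (\<lambda>n. q p) \<longlonglongrightarrow> q p" for q :: "real \<times> real \<Rightarrow> real" by simp
    note cm = continuous_LO_measurable[OF c(1)] continuous_LO_measurable[OF c(2)]
    have "(\<lambda>n. \<integral>p. moll (id n) f p * \<psi>' p \<partial>LO) \<longlonglongrightarrow> (\<integral>p. f p * \<psi>' p \<partial>LO)"
      by (rule moll_mult_tendsto[OF m(2) strict_mono_id cm(2) b(2) cm(2) l])
    moreover have "(\<lambda>n. \<integral>p. moll (id n) g p * \<psi> p \<partial>LO) \<longlonglongrightarrow> (\<integral>p. g p * \<psi> p \<partial>LO)"
      by (rule moll_mult_tendsto[OF m(3) strict_mono_id cm(1) b(1) cm(1) l])
    moreover have "(\<integral>p. moll n f p * \<psi>' p \<partial>LO) = - (\<integral>p. moll n g p * \<psi> p \<partial>LO)" for n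
      using C1_wd[OF m(1)] \<psi> by (auto simp: wd_def mult.commute)
    ultimately have "(\<lambda>n. - (\<integral>p. moll n g p * \<psi> p \<partial>LO)) \<longlonglongrightarrow> (\<integral>p. f p * \<psi>' p \<partial>LO)"
      "(\<lambda>n. - (\<integral>p. moll n g p * \<psi> p \<partial>LO)) \<longlonglongrightarrow> - (\<integral>p. g p * \<psi> p \<partial>LO)"
      using tendsto_minus[of "\<lambda>n. \<integral>p. moll n g p * \<psi> p \<partial>LO"] by simp_all
    then have "(\<integral>p. f p * \<psi>' p \<partial>LO) = - (\<integral>p. g p * \<psi> p \<partial>LO)"
      by (rule LIMSEQ_unique)
    then show ?thesis by (simp add: mult.commute)
  qed
  then show ?thesis using m by (auto simp: wd_def)
qed

text \<open>For mollified \<open>R\<close> and \<open>S\<close> this is the classical chain rule. Every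
  term of the second derivative contains at most one factor that converges only in
  \<open>L\<^sup>1\<close>, the others converging boundedly almost everywhere, so each term passes to the
  limit. The function \<open>l\<close> is the non-periodic affine part of the angle; adding a constant to
  it turns the cosine into a sine.\<close>

lemma chain_rule:
  assumes R: "pw d R R1" "pw d R1 R11" and S: "pw d S S1" "pw d S1 S11"
    and l: "C1 d l (\<lambda>_. \<kappa>)"
    and B: "AE p in LO. \<bar>R p\<bar> \<le> B" "AE p in LO. \<bar>R1 p\<bar> \<le> B" "AE p in LO. \<bar>S1 p\<bar> \<le> B"
  shows "wd (C1 d) vanishing (\<lambda>p. R p * cos (S p + l p))
      (\<lambda>p. R1 p * cos (S p + l p) - R p * (S1 p + \<kappa>) * sin (S p + l p))" (is "wd (C1 d) vanishing ?u ?v")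
    and "wd (C1 d) vanishing (\<lambda>p. R1 p * cos (S p + l p) - R p * (S1 p + \<kappa>) * sin (S p + l p))
      (\<lambda>p. (R11 p - R p * (S1 p + \<kappa>)\<^sup>2) * cos (S p + l p)
         - (2 * R1 p * (S1 p + \<kappa>) + R p * S11 p) * sin (S p + l p))" (is "wd (C1 d) vanishing _ ?w")
proof -
  note i = C1_moll(2,3)[OF R(1)] C1_moll(2,3)[OF R(2)] C1_moll(2,3)[OF S(1)] C1_moll(2,3)[OF S(2)]
  have lc: "continuous_on UNIV l" using C1_cont[OF l] by auto
  have lm: "l \<in> borel_measurable LO" by (rule continuous_LO_measurable[OF lc])
  obtain r :: "nat \<Rightarrow> nat" where r: "strict_mono r"
    "\<And>f. f \<in> {R, R1, S, S1} \<Longrightarrow> AE p in LO. (\<lambda>n. moll (r n) f p) \<longlonglongrightarrow> f p"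
    using moll_AE_subseq[of "{R, R1, S, S1}"] i by auto
  \<comment> \<open>\<open>?un\<close>, \<open>?vn\<close> and \<open>?wn\<close> are the product and its classical derivatives for the mollified data.\<close>
  let ?T = "\<lambda>p. S p + l p" and ?T1 = "\<lambda>p. S1 p + \<kappa>"
  let ?Tn = "\<lambda>n p. moll (r n) S p + l p" and ?T1n = "\<lambda>n p. moll (r n) S1 p + \<kappa>"
  let ?un = "\<lambda>n p. moll (r n) R p * cos (?Tn n p)"
  let ?vn = "\<lambda>n p. moll (r n) R1 p * cos (?Tn n p) - moll (r n) R p * ?T1n n p * sin (?Tn n p)"
  let ?wn = "\<lambda>n p. (moll (r n) R11 p - moll (r n) R p * (?T1n n p)\<^sup>2) * cos (?Tn n p)
         - (2 * moll (r n) R1 p * ?T1n n p + moll (r n) R p * moll (r n) S11 p) * sin (?Tn n p)"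
  have meas: "R \<in> borel_measurable LO" "R1 \<in> borel_measurable LO" "R11 \<in> borel_measurable LO"
    "S \<in> borel_measurable LO" "S1 \<in> borel_measurable LO" "S11 \<in> borel_measurable LO"
    using i by auto
  have mollm: "moll n f \<in> borel_measurable LO" if "integrable LO f" for n f
    using moll_integrable[OF that] by auto
  note mm = mollm[OF i(1)] mollm[OF i(2)] mollm[OF i(4)] mollm[OF i(5)] mollm[OF i(6)] mollm[OF i(8)]
  have Bn: "\<bar>moll n R p\<bar> \<le> B" "\<bar>moll n R1 p\<bar> \<le> B" "\<bar>moll n S1 p + \<kappa>\<bar> \<le> B + \<bar>\<kappa>\<bar>" for n p
    using moll_abs_le[OF i(1) B(1), of n p] moll_abs_le[OF i(2) B(2), of n p] moll_abs_le[OF i(6) B(3), of n p] by auto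
  have B0: "0 \<le> B" using Bn(1)[of 0 "(0,0)"] by linarith
  have DT: "C1 d (?Tn n) (?T1n n)" for n by (rule C1_add[OF C1_moll(1)[OF S(1)] l])
  have Dc0: "C1 d (\<lambda>_. c) (\<lambda>_. 0)" for c by (rule C1_const)
  have DT1: "C1 d (?T1n n) (\<lambda>p. moll (r n) S11 p + 0)" for n by (rule C1_add[OF C1_moll(1)[OF S(2)] Dc0])
  have D1: "C1 d (?un n) (?vn n)" for n
    using C1_mult[OF C1_moll(1)[OF R(1)] C1_cos_sin(1)[OF DT]] by (simp add: algebra_simps)
  have D2: "C1 d (?vn n) (?wn n)" for n
  proof -
    have a: "C1 d (\<lambda>p. moll (r n) R1 p * cos (?Tn n p)) (\<lambda>p. moll (r n) R11 p * cos (?Tn n p) + moll (r n) R1 p * (- sin (?Tn n p) * ?T1n n p))"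
      by (rule C1_mult[OF C1_moll(1)[OF R(2)] C1_cos_sin(1)[OF DT]])
    have b: "C1 d (\<lambda>p. (- 1 * moll (r n) R p) * ?T1n n p * sin (?Tn n p))
       (\<lambda>p. ((0 * moll (r n) R p + - 1 * moll (r n) R1 p) * ?T1n n p + (- 1 * moll (r n) R p) * (moll (r n) S11 p + 0)) * sin (?Tn n p)
          + (- 1 * moll (r n) R p) * ?T1n n p * (cos (?Tn n p) * ?T1n n p))"
      by (rule C1_mult[OF C1_mult[OF C1_mult[OF Dc0 C1_moll(1)[OF R(1)]] DT1] C1_cos_sin(2)[OF DT]])
    have "(\<lambda>p. moll (r n) R1 p * cos (?Tn n p) + (- 1 * moll (r n) R p) * ?T1n n p * sin (?Tn n p)) = ?vn n"
      by (simp add: algebra_simps)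
    moreover have "(\<lambda>p. (moll (r n) R11 p * cos (?Tn n p) + moll (r n) R1 p * (- sin (?Tn n p) * ?T1n n p)) +
       (((0 * moll (r n) R p + - 1 * moll (r n) R1 p) * ?T1n n p + (- 1 * moll (r n) R p) * (moll (r n) S11 p + 0)) * sin (?Tn n p)
          + (- 1 * moll (r n) R p) * ?T1n n p * (cos (?Tn n p) * ?T1n n p))) = ?wn n"
      by (simp add: algebra_simps power2_eq_square)
    ultimately show ?thesis using C1_add[OF a b] by simp
  qed
  have conv: "AE p in LO. (\<lambda>n. moll (r n) R p) \<longlonglongrightarrow> R p" "AE p in LO. (\<lambda>n. moll (r n) S p) \<longlonglongrightarrow> S p"
    "AE p in LO. (\<lambda>n. moll (r n) R1 p) \<longlonglongrightarrow> R1 p" "AE p in LO. (\<lambda>n. moll (r n) S1 p) \<longlonglongrightarrow> S1 p"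
    using r(2) by auto
  have trig: "\<bar>x * cos y\<bar> \<le> \<bar>x\<bar>" "\<bar>x * sin y\<bar> \<le> \<bar>x\<bar>" for x y :: real
    by (simp_all add: abs_mult mult_left_le)
  define C where "C = B + (B + \<bar>\<kappa>\<bar>) + (B + \<bar>\<kappa>\<bar>)\<^sup>2 + 1"
  have C: "B \<le> C" "B + \<bar>\<kappa>\<bar> \<le> C" "(B + \<bar>\<kappa>\<bar>)\<^sup>2 \<le> C" "1 \<le> C" using B0 by (auto simp: C_def)
  have T1C: "\<bar>?T1n n p\<bar> \<le> C" "(?T1n n p)\<^sup>2 \<le> C" for n p
  proof -
    show "\<bar>?T1n n p\<bar> \<le> C" using Bn(3)[of "r n" p] C by linarith
    have "(?T1n n p)\<^sup>2 \<le> (B + \<bar>\<kappa>\<bar>)\<^sup>2" using Bn(3)[of "r n" p] by (rule power2_le_iff_abs_le[THEN iffD2, rotated]) (use B0 in auto)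
    then show "(?T1n n p)\<^sup>2 \<le> C" using C by linarith
  qed
  have lim: "(\<lambda>n. \<integral>p. moll (r n) f p * (\<psi> p * qn n p) \<partial>LO) \<longlonglongrightarrow> (\<integral>p. f p * (\<psi> p * q p) \<partial>LO)"
    and int: "integrable LO (\<lambda>p. f p * (\<psi> p * q p))" and intn: "integrable LO (\<lambda>p. moll (r n) f p * (\<psi> p * qn n p))"
    if A: "integrable LO f" "continuous_on UNIV \<psi>" "\<And>n. qn n \<in> borel_measurable LO"
      "\<And>n p. \<bar>qn n p\<bar> \<le> C" "q \<in> borel_measurable LO" "AE p in LO. (\<lambda>n. qn n p) \<longlonglongrightarrow> q p" for f \<psi> qn q n
  proof -
    obtain B1 where B1: "\<And>p. p \<in> Omega \<Longrightarrow> norm (\<psi> p) \<le> B1" "B1 > 0" using continuous_LO_bounded[OF A(2)] by metis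
    have m: "\<psi> \<in> borel_measurable LO" by (rule continuous_LO_measurable[OF A(2)])
    have bn: "AE p in LO. \<bar>\<psi> p * qn n p\<bar> \<le> B1 * C" for n
      using AE_LO_Omega
    proof eventually_elim
      case (elim p) then show ?case unfolding abs_mult using B1(1)[OF elim] A(4)[of n p] by (intro mult_mono) auto
    qed
    have cv: "AE p in LO. (\<lambda>n. \<psi> p * qn n p) \<longlonglongrightarrow> \<psi> p * q p"
      using A(6) by eventually_elim (intro tendsto_intros)
    have b: "AE p in LO. \<bar>\<psi> p * q p\<bar> \<le> B1 * C"
    proof -
      have "AE p in LO. \<forall>n. \<bar>\<psi> p * qn n p\<bar> \<le> B1 * C" using bn by (simp add: AE_all_countable)
      then show ?thesis using cv
      proof eventually_elim
        case (elim p)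
        then have "(\<lambda>n. \<bar>\<psi> p * qn n p\<bar>) \<longlonglongrightarrow> \<bar>\<psi> p * q p\<bar>" by (intro tendsto_rabs)
        then show ?case by (rule LIMSEQ_le_const2) (use elim in auto)
      qed
    qed
    show "(\<lambda>n. \<integral>p. moll (r n) f p * (\<psi> p * qn n p) \<partial>LO) \<longlonglongrightarrow> (\<integral>p. f p * (\<psi> p * q p) \<partial>LO)"
      by (rule moll_mult_tendsto[OF A(1) r(1) _ bn _ cv]) (use m A(3,5) in measurable)
    show "integrable LO (\<lambda>p. f p * (\<psi> p * q p))"
      by (rule integrable_mult_bounded[OF A(1) _ b]) (use m A(5) in measurable)
    show "integrable LO (\<lambda>p. moll (r n) f p * (\<psi> p * qn n p))"
      by (rule integrable_mult_bounded[OF moll_integrable[OF A(1)] _ bn]) (use m A(3) in measurable)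
  qed
  have q1: "\<And>n. (\<lambda>p. cos (?Tn n p)) \<in> borel_measurable LO" "(\<lambda>p. cos (?T p)) \<in> borel_measurable LO"
     "\<And>n p. \<bar>cos (?Tn n p)\<bar> \<le> C" "AE p in LO. (\<lambda>n. cos (?Tn n p)) \<longlonglongrightarrow> cos (?T p)"
  proof -
    show "(\<lambda>p. cos (?Tn n p)) \<in> borel_measurable LO" for n using mm lm by measurable
    show "(\<lambda>p. cos (?T p)) \<in> borel_measurable LO" using meas lm by measurable
    show "\<bar>cos (?Tn n p)\<bar> \<le> C" for n p using C abs_cos_le_one[of "?Tn n p"] by linarith
    show "AE p in LO. (\<lambda>n. cos (?Tn n p)) \<longlonglongrightarrow> cos (?T p)"
      using conv by eventually_elim (intro tendsto_intros)
  qed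
  have q2: "\<And>n. (\<lambda>p. ?T1n n p * sin (?Tn n p)) \<in> borel_measurable LO" "(\<lambda>p. ?T1 p * sin (?T p)) \<in> borel_measurable LO"
     "\<And>n p. \<bar>?T1n n p * sin (?Tn n p)\<bar> \<le> C" "AE p in LO. (\<lambda>n. ?T1n n p * sin (?Tn n p)) \<longlonglongrightarrow> ?T1 p * sin (?T p)"
  proof -
    show "(\<lambda>p. ?T1n n p * sin (?Tn n p)) \<in> borel_measurable LO" for n using mm lm by measurable
    show "(\<lambda>p. ?T1 p * sin (?T p)) \<in> borel_measurable LO" using meas lm by measurable
    show "\<bar>?T1n n p * sin (?Tn n p)\<bar> \<le> C" for n p using trig(2) T1C(1) order_trans by blast
    show "AE p in LO. (\<lambda>n. ?T1n n p * sin (?Tn n p)) \<longlonglongrightarrow> ?T1 p * sin (?T p)"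
      using conv by eventually_elim (intro tendsto_intros)
  qed
  have q3: "\<And>n. (\<lambda>p. moll (r n) R p * sin (?Tn n p)) \<in> borel_measurable LO" "(\<lambda>p. R p * sin (?T p)) \<in> borel_measurable LO"
     "\<And>n p. \<bar>moll (r n) R p * sin (?Tn n p)\<bar> \<le> C" "AE p in LO. (\<lambda>n. moll (r n) R p * sin (?Tn n p)) \<longlonglongrightarrow> R p * sin (?T p)"
  proof -
    show "(\<lambda>p. moll (r n) R p * sin (?Tn n p)) \<in> borel_measurable LO" for n using mm lm by measurable
    show "(\<lambda>p. R p * sin (?T p)) \<in> borel_measurable LO" using meas lm by measurable
    show "\<bar>moll (r n) R p * sin (?Tn n p)\<bar> \<le> C" for n p using trig(2) Bn(1) C(1) order_trans by metis
    show "AE p in LO. (\<lambda>n. moll (r n) R p * sin (?Tn n p)) \<longlonglongrightarrow> R p * sin (?T p)"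
      using conv by eventually_elim (intro tendsto_intros)
  qed
  have q4: "\<And>n. (\<lambda>p. (?T1n n p)\<^sup>2 * cos (?Tn n p)) \<in> borel_measurable LO" "(\<lambda>p. (?T1 p)\<^sup>2 * cos (?T p)) \<in> borel_measurable LO"
     "\<And>n p. \<bar>(?T1n n p)\<^sup>2 * cos (?Tn n p)\<bar> \<le> C" "AE p in LO. (\<lambda>n. (?T1n n p)\<^sup>2 * cos (?Tn n p)) \<longlonglongrightarrow> (?T1 p)\<^sup>2 * cos (?T p)"
  proof -
    show "(\<lambda>p. (?T1n n p)\<^sup>2 * cos (?Tn n p)) \<in> borel_measurable LO" for n using mm lm by measurable
    show "(\<lambda>p. (?T1 p)\<^sup>2 * cos (?T p)) \<in> borel_measurable LO" using meas lm by measurable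
    show "\<bar>(?T1n n p)\<^sup>2 * cos (?Tn n p)\<bar> \<le> C" for n p
      using trig(1)[of "(?T1n n p)\<^sup>2" "?Tn n p"] T1C(2)[of n p] by simp
    show "AE p in LO. (\<lambda>n. (?T1n n p)\<^sup>2 * cos (?Tn n p)) \<longlonglongrightarrow> (?T1 p)\<^sup>2 * cos (?T p)"
      using conv by eventually_elim (intro tendsto_intros)
  qed
  have one: "continuous_on UNIV (\<lambda>_ :: real \<times> real. 1 :: real)" by simp
  have iu: "integrable LO ?u" using int[OF i(1) one q1(1,3,2,4)] by simp
  have iv: "integrable LO ?v"
    using Bochner_Integration.integrable_diff[OF int[OF i(2) one q1(1,3,2,4)] int[OF i(1) one q2(1,3,2,4)]]
    by (simp add: mult.assoc)
  have weq: "?w = (\<lambda>p. R11 p * (1 * cos (?T p)) - R p * (1 * ((?T1 p)\<^sup>2 * cos (?T p))) - 2 * (R1 p * (1 * (?T1 p * sin (?T p)))) - S11 p * (1 * (R p * sin (?T p))))"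
    by (auto simp: algebra_simps)
  have iw: "integrable LO ?w"
    unfolding weq
    by (intro Bochner_Integration.integrable_diff integrable_mult_right
        int[OF i(4) one q1(1,3,2,4)] int[OF i(1) one q4(1,3,2,4)] int[OF i(2) one q2(1,3,2,4)] int[OF i(8) one q3(1,3,2,4)])
  have Lu: "(\<lambda>n. \<integral>p. \<psi> p * ?un n p \<partial>LO) \<longlonglongrightarrow> (\<integral>p. \<psi> p * ?u p \<partial>LO)" if "continuous_on UNIV \<psi>" for \<psi>
    using lim[OF i(1) that q1(1,3,2,4)] by (simp add: algebra_simps)
  have Lv: "(\<lambda>n. \<integral>p. \<psi> p * ?vn n p \<partial>LO) \<longlonglongrightarrow> (\<integral>p. \<psi> p * ?v p \<partial>LO)" if c: "continuous_on UNIV \<psi>" for \<psi>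
  proof -
    have e1: "(\<lambda>p. \<psi> p * ?v p) = (\<lambda>p. R1 p * (\<psi> p * cos (?T p)) - R p * (\<psi> p * (?T1 p * sin (?T p))))"
      by (auto simp: algebra_simps)
    have e2: "(\<lambda>p. \<psi> p * ?vn n p) = (\<lambda>p. moll (r n) R1 p * (\<psi> p * cos (?Tn n p)) - moll (r n) R p * (\<psi> p * (?T1n n p * sin (?Tn n p))))" for n
      by (auto simp: algebra_simps)
    show ?thesis unfolding e1 e2
      using tendsto_diff[OF lim[OF i(2) c q1(1,3,2,4)] lim[OF i(1) c q2(1,3,2,4)]]
      by (simp only: Bochner_Integration.integral_diff int[OF i(2) c q1(1,3,2,4)] int[OF i(1) c q2(1,3,2,4)]
          intn[OF i(2) c q1(1,3,2,4)] intn[OF i(1) c q2(1,3,2,4)])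
  qed
  have Lw: "(\<lambda>n. \<integral>p. \<psi> p * ?wn n p \<partial>LO) \<longlonglongrightarrow> (\<integral>p. \<psi> p * ?w p \<partial>LO)" if c: "continuous_on UNIV \<psi>" for \<psi>
  proof -
    have e1: "(\<lambda>p. \<psi> p * ?w p) = (\<lambda>p. R11 p * (\<psi> p * cos (?T p)) - R p * (\<psi> p * ((?T1 p)\<^sup>2 * cos (?T p))) - 2 * (R1 p * (\<psi> p * (?T1 p * sin (?T p)))) - S11 p * (\<psi> p * (R p * sin (?T p))))"
      by (auto simp: algebra_simps)
    have e2: "(\<lambda>p. \<psi> p * ?wn n p) = (\<lambda>p. moll (r n) R11 p * (\<psi> p * cos (?Tn n p)) - moll (r n) R p * (\<psi> p * ((?T1n n p)\<^sup>2 * cos (?Tn n p))) - 2 * (moll (r n) R1 p * (\<psi> p * (?T1n n p * sin (?Tn n p)))) - moll (r n) S11 p * (\<psi> p * (moll (r n) R p * sin (?Tn n p))))" for n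
      by (auto simp: algebra_simps)
    have i1: "(\<integral>p. a p - b p - 2 * g p - k p \<partial>LO) = (\<integral>p. a p \<partial>LO) - (\<integral>p. b p \<partial>LO) - 2 * (\<integral>p. g p \<partial>LO) - (\<integral>p. k p \<partial>LO)"
      if "integrable LO a" "integrable LO b" "integrable LO g" "integrable LO k" for a b g k :: "real \<times> real \<Rightarrow> real"
      using that by simp
    show ?thesis unfolding e1 e2
      unfolding i1[OF int[OF i(4) c q1(1,3,2,4)] int[OF i(1) c q4(1,3,2,4)] int[OF i(2) c q2(1,3,2,4)] int[OF i(8) c q3(1,3,2,4)]]
        i1[OF intn[OF i(4) c q1(1,3,2,4)] intn[OF i(1) c q4(1,3,2,4)] intn[OF i(2) c q2(1,3,2,4)] intn[OF i(8) c q3(1,3,2,4)]]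
      by (intro tendsto_diff tendsto_mult_left lim[OF i(4) c q1(1,3,2,4)] lim[OF i(1) c q4(1,3,2,4)] lim[OF i(2) c q2(1,3,2,4)] lim[OF i(8) c q3(1,3,2,4)])
  qed
  have fin: "(\<integral>p. \<psi>' p * a p \<partial>LO) = - (\<integral>p. \<psi> p * b p \<partial>LO)"
    if \<psi>: "C1 d \<psi> \<psi>'" "vanishing \<psi>" and ab: "\<And>n. C1 d (an n) (bn n)"
      "(\<lambda>n. \<integral>p. \<psi>' p * an n p \<partial>LO) \<longlonglongrightarrow> (\<integral>p. \<psi>' p * a p \<partial>LO)"
      "(\<lambda>n. \<integral>p. \<psi> p * bn n p \<partial>LO) \<longlonglongrightarrow> (\<integral>p. \<psi> p * b p \<partial>LO)" for \<psi> \<psi>' an bn a b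
  proof -
    have "(\<integral>p. \<psi>' p * an n p \<partial>LO) = - (\<integral>p. \<psi> p * bn n p \<partial>LO)" for n
      using C1_wd[OF ab(1)] \<psi> by (auto simp: wd_def)
    then have "(\<lambda>n. - (\<integral>p. \<psi> p * bn n p \<partial>LO)) \<longlonglongrightarrow> (\<integral>p. \<psi>' p * a p \<partial>LO)" using ab(2) by simp
    then show ?thesis using LIMSEQ_unique tendsto_minus[OF ab(3)] by blast
  qed
  show "wd (C1 d) vanishing ?u ?v"
    unfolding wd_def using iu iv fin[OF _ _ D1 Lu Lv] C1_cont by blast
  show "wd (C1 d) vanishing ?v ?w"
    unfolding wd_def using iv iw fin[OF _ _ D2 Lv Lw] C1_cont by blast
qed

section \<open>Interpolation inequalities on an interval\<close>

lemma integral_Cauchy_Schwarz: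
  fixes f g :: "real \<Rightarrow> real"
  assumes "continuous_on {a..b} f" "continuous_on {a..b} g"
  shows "(integral {a..b} (\<lambda>x. f x * g x))\<^sup>2 \<le> integral {a..b} (\<lambda>x. (f x)\<^sup>2) * integral {a..b} (\<lambda>x. (g x)\<^sup>2)"
proof -
  define F G H where "F = integral {a..b} (\<lambda>x. (f x)\<^sup>2)" and "G = integral {a..b} (\<lambda>x. (g x)\<^sup>2)"
    and "H = integral {a..b} (\<lambda>x. f x * g x)"
  have i: "(\<lambda>x. (f x)\<^sup>2) integrable_on {a..b}" "(\<lambda>x. (g x)\<^sup>2) integrable_on {a..b}" "(\<lambda>x. f x * g x) integrable_on {a..b}"
    using assms by (auto intro!: integrable_continuous_interval continuous_on_power continuous_on_mult)
  have q: "0 \<le> F - 2 * t * H + t\<^sup>2 * G" for t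
  proof -
    have "((\<lambda>x. (f x)\<^sup>2 - (2 * t) * (f x * g x) + t\<^sup>2 * (g x)\<^sup>2) has_integral (F - (2 * t) * H + t\<^sup>2 * G)) {a..b}"
      unfolding F_def G_def H_def
      by (intro has_integral_add has_integral_diff has_integral_mult_right integrable_integral i)
    moreover have "0 \<le> (f x)\<^sup>2 - (2 * t) * (f x * g x) + t\<^sup>2 * (g x)\<^sup>2" for x
      using zero_le_power2[of "f x - t * g x"] by (simp add: power2_diff power_mult_distrib algebra_simps)
    ultimately show ?thesis by (auto intro: has_integral_nonneg)
  qed
  have G0: "G \<ge> 0" unfolding G_def by (rule integral_nonneg[OF i(2)]) simp
  have "H\<^sup>2 \<le> F * G"
  proof (cases "G = 0")
    case True
    have "H = 0"
    proof (rule ccontr)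
      assume "H \<noteq> 0"
      then show False using q[of "(F + 1) / (2 * H)"] True by simp
    qed
    then show ?thesis using True by simp
  next
    case False
    then have "G > 0" using G0 by simp
    then show ?thesis using q[of "H / G"] by (simp add: field_simps power2_eq_square)
  qed
  then show ?thesis by (simp add: F_def G_def H_def)
qed

lemma diff_le_integral_deriv:
  fixes F F' :: "real \<Rightarrow> real"
  assumes d: "\<And>x. (F has_real_derivative F' x) (at x)" and c: "continuous_on {a..b} F'"
    and x: "x \<in> {a..b}" and y: "y \<in> {a..b}"
  shows "\<bar>F x - F y\<bar> \<le> integral {a..b} (\<lambda>x. \<bar>F' x\<bar>)"
proof -
  have *: "\<bar>F u - F v\<bar> \<le> integral {a..b} (\<lambda>x. \<bar>F' x\<bar>)" if "v \<le> u" "u \<in> {a..b}" "v \<in> {a..b}" for u v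
  proof -
    have sub: "{v..u} \<subseteq> {a..b}" using that by auto
    have c': "continuous_on {v..u} F'" by (rule continuous_on_subset[OF c sub])
    have "(F' has_integral (F u - F v)) {v..u}"
      using that(1) d by (intro fundamental_theorem_of_calculus)
        (auto simp: has_real_derivative_iff_has_vector_derivative[symmetric] intro: has_field_derivative_at_within)
    then have "F u - F v = integral {v..u} F'" by (simp add: integral_unique)
    then have "\<bar>F u - F v\<bar> \<le> integral {v..u} (\<lambda>x. \<bar>F' x\<bar>)"
      using integral_norm_bound_integral[of F' "{v..u}" "\<lambda>x. \<bar>F' x\<bar>"] c'
      by (auto intro!: integrable_continuous_interval continuous_intros)
    also have "\<dots> \<le> integral {a..b} (\<lambda>x. \<bar>F' x\<bar>)"
      by (rule integral_subset_le[OF sub]) (auto intro!: integrable_continuous_interval continuous_on_rabs c c')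
    finally show ?thesis .
  qed
  show ?thesis using *[of x y] *[of y x] x y by (cases "x \<le> y") (auto simp: abs_minus_commute)
qed

lemma periodic_of_int:
  fixes f :: "real \<Rightarrow> real"
  assumes per: "\<And>x. f (x + 1) = f x"
  shows "f (x - of_int k) = f x"
proof -
  have ip: "f (x + real n) = f x" for x n
    by (induction n arbitrary: x) (use per in \<open>auto simp: add.assoc[symmetric]\<close>)
  show ?thesis
  proof (cases "k \<ge> 0")
    case True
    then have e: "x - of_int k + real (nat k) = x" by simp
    show ?thesis using ip[of "x - of_int k" "nat k"] unfolding e by (rule sym)
  next
    case False
    then have e: "x + real (nat (- k)) = x - of_int k" by simp
    show ?thesis using ip[of x "nat (- k)"] unfolding e .
  qed
qed

text \<open>Here \<open>r\<close> is the distance to the obstacle along a line. The curvature of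
  \<open>r\<close> is bounded on one side only, by a function \<open>\<beta>\<close> whose square is paid
  for by the bending energy.\<close>

locale interp =
  fixes r r' r'' \<beta> :: "real \<Rightarrow> real"
  assumes d: "\<And>x. (r has_real_derivative r' x) (at x)" "\<And>x. (r' has_real_derivative r'' x) (at x)"
    and c: "continuous_on UNIV r''" "continuous_on UNIV \<beta>"
    and per: "\<And>x. r (x + 1) = r x"
    and convex: "\<And>x. r'' x \<ge> - \<beta> x" and \<beta>: "\<And>x. \<beta> x \<ge> 0"
    and r0: "\<And>x. r x \<ge> 0"
begin

abbreviation "J \<equiv> {- 1/2..1/2 :: real}"

lemma cont: "continuous_on S r" "continuous_on S r'" "continuous_on S r''" "continuous_on S \<beta>"
  using d by (meson DERIV_continuous_on has_field_derivative_at_within)+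
             (use c in \<open>auto intro: continuous_on_subset\<close>)

lemma per': "r' (x + 1) = r' x"
proof -
  have "deriv r (x + 1) = deriv r x" by (rule deriv_periodic) (rule per)
  then show ?thesis using d(1) DERIV_imp_deriv by metis
qed

text \<open>Integrating \<open>(\<eta>(r) r')'\<close> over a period gives 0, and \<open>\<eta>(r) r''
  \<ge> - \<eta>(r) \<beta>\<close> because \<open>\<eta> \<ge> 0\<close>: the one-sided curvature bound
  suffices as long as the test has a sign.\<close>

lemma test_identity:
  assumes \<eta>: "\<And>x. x \<ge> 0 \<Longrightarrow> (\<eta> has_real_derivative \<eta>' x) (at x)" "continuous_on {0..} \<eta>'"
    and \<eta>0: "\<And>x. x \<ge> 0 \<Longrightarrow> \<eta> x \<ge> 0"
  shows "integral J (\<lambda>x. \<eta>' (r x) * (r' x)\<^sup>2) \<le> integral J (\<lambda>x. \<eta> (r x) * \<beta> x)"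
proof -
  have \<eta>c: "continuous_on {0..} \<eta>"
    using \<eta>(1) by (intro continuous_at_imp_continuous_on) (auto intro: DERIV_isCont)
  have cc: "continuous_on J (\<lambda>x. \<eta> (r x))" "continuous_on J (\<lambda>x. \<eta>' (r x))"
    using r0 by (auto intro!: continuous_on_compose2[OF \<eta>c] continuous_on_compose2[OF \<eta>(2)] cont)
  have ch: "((\<lambda>x. \<eta> (r x)) has_real_derivative \<eta>' (r x) * r' x) (at x)" for x
    by (rule DERIV_chain2[OF \<eta>(1)[OF r0] d(1)])
  have H1: "((\<lambda>x. \<eta>' (r x) * r' x * r' x + \<eta> (r x) * r'' x) has_integral 0) J"
  proof (rule parts_has_integral_zero[of "{}" "- 1/2" "1/2" "\<lambda>x. \<eta> (r x)" "\<lambda>x. \<eta>' (r x) * r' x" r' r''])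
    have "r (1/2) = r (- 1/2)" "r' (1/2) = r' (- 1/2)"
      using per[of "- 1/2"] per'[of "- 1/2"] by simp_all
    then show "\<eta> (r (1/2)) * r' (1/2) = \<eta> (r (- 1/2)) * r' (- 1/2)" by simp
    show "((\<lambda>x. \<eta> (r x)) has_real_derivative \<eta>' (r x) * r' x) (at x)" for x by (rule ch)
    show "(r' has_real_derivative r'' x) (at x)" for x by (rule d(2))
    show "continuous_on {- 1/2..1/2} r'" by (rule cont)
  qed simp_all
  have i1: "(\<lambda>x. \<eta>' (r x) * (r' x)\<^sup>2) integrable_on J" "(\<lambda>x. \<eta> (r x) * \<beta> x) integrable_on J"
    by (rule integrable_continuous_interval[OF continuous_on_mult[OF cc(2) continuous_on_power[OF cont(2)]]],
        rule integrable_continuous_interval[OF continuous_on_mult[OF cc(1) cont(4)]])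
  have H2: "((\<lambda>x. \<eta>' (r x) * (r' x)\<^sup>2 - \<eta> (r x) * \<beta> x) has_integral
     (integral J (\<lambda>x. \<eta>' (r x) * (r' x)\<^sup>2) - integral J (\<lambda>x. \<eta> (r x) * \<beta> x))) J"
    by (rule has_integral_diff[OF integrable_integral[OF i1(1)] integrable_integral[OF i1(2)]])
  have "\<eta>' (r x) * (r' x)\<^sup>2 - \<eta> (r x) * \<beta> x \<le> \<eta>' (r x) * r' x * r' x + \<eta> (r x) * r'' x" for x
  proof -
    have "\<eta> (r x) * - \<beta> x \<le> \<eta> (r x) * r'' x" by (rule mult_left_mono[OF convex \<eta>0[OF r0]])
    then show ?thesis by (simp add: power2_eq_square mult.assoc)
  qed
  from has_integral_le[OF H2 H1 this] show ?thesis by simp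
qed

text \<open>The test \<open>\<eta>(x) = l x / (l + x)\<close> behaves like \<open>x\<close> below the
  height \<open>l\<close> and is bounded by \<open>l\<close> above it. Where \<open>r > l\<close> the
  slope bound \<open>m\<close> is used instead.\<close>

lemma truncated_interpolation:
  assumes m: "\<And>x. \<bar>r' x\<bar> \<le> m" and l: "l > 0"
  shows "integral J (\<lambda>x. (r' x)\<^sup>2) \<le> (2 + m\<^sup>2) / l * integral J r + 2 * l\<^sup>2 * integral J (\<lambda>x. (\<beta> x)\<^sup>2)"
proof -
  define \<eta> \<eta>' where "\<eta> x = l * x / (l + x)" and "\<eta>' x = l\<^sup>2 / (l + x)\<^sup>2" for x
  have \<eta>d: "(\<eta> has_real_derivative \<eta>' x) (at x)" if "x \<ge> 0" for x
    unfolding \<eta>_def[abs_def] \<eta>'_def using that l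
    by (auto intro!: derivative_eq_intros simp: field_simps power2_eq_square)
  have \<eta>c: "continuous_on {0..} \<eta>'"
    unfolding \<eta>'_def[abs_def] using l by (intro continuous_intros) auto
  have \<eta>0: "\<eta> x \<ge> 0" if "x \<ge> 0" for x using that l by (simp add: \<eta>_def)
  have T: "integral J (\<lambda>x. \<eta>' (r x) * (r' x)\<^sup>2) \<le> integral J (\<lambda>x. \<eta> (r x) * \<beta> x)"
    by (rule test_identity[OF \<eta>d \<eta>c \<eta>0])
  have \<eta>cc: "continuous_on {0..} \<eta>"
    using \<eta>d by (intro continuous_at_imp_continuous_on) (auto intro: DERIV_isCont)
  have cc: "continuous_on S (\<lambda>x. \<eta> (r x))" "continuous_on S (\<lambda>x. \<eta>' (r x))" for S
    using r0 by (auto intro!: continuous_on_compose2[OF \<eta>cc] continuous_on_compose2[OF \<eta>c] cont)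
  have p1: "(r' x)\<^sup>2 \<le> 4 * (\<eta>' (r x) * (r' x)\<^sup>2) + m\<^sup>2 / l * r x" for x
  proof (cases "r x \<le> l")
    case True
    have "(l + r x)\<^sup>2 \<le> (2 * l)\<^sup>2" using True r0[of x] l by (intro power_mono) auto
    then have "1 \<le> 4 * \<eta>' (r x)" using l r0[of x] by (simp add: \<eta>'_def field_simps power_mult_distrib)
    then have "1 * (r' x)\<^sup>2 \<le> 4 * \<eta>' (r x) * (r' x)\<^sup>2" by (rule mult_right_mono) simp
    moreover have "0 \<le> m\<^sup>2 / l * r x" using l r0[of x] by simp
    ultimately show ?thesis by (simp add: mult.assoc)
  next
    case False
    have "(r' x)\<^sup>2 \<le> m\<^sup>2" using m[of x] by (metis abs_ge_zero order_trans power2_abs power_mono)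
    moreover have "m\<^sup>2 * 1 \<le> m\<^sup>2 * (r x / l)" using False l by (intro mult_left_mono) auto
    moreover have "0 \<le> 4 * (\<eta>' (r x) * (r' x)\<^sup>2)" by (simp add: \<eta>'_def)
    ultimately show ?thesis by simp
  qed
  have p2: "\<eta> (r x) * \<beta> x \<le> 1 / (2 * l) * r x + l\<^sup>2 / 2 * (\<beta> x)\<^sup>2" for x
  proof -
    have e1: "\<eta> (r x) \<le> l" "\<eta> (r x) \<le> r x"
      using l r0[of x] by (simp_all add: \<eta>_def field_simps)
    then have "(\<eta> (r x))\<^sup>2 \<le> l * r x"
      unfolding power2_eq_square using \<eta>0[OF r0[of x]] l by (intro mult_mono) auto
    then have "(\<eta> (r x) / l)\<^sup>2 \<le> r x / l" using l by (simp add: power_divide field_simps power2_eq_square)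
    moreover have "2 * (\<eta> (r x) / l) * (l * \<beta> x) \<le> (\<eta> (r x) / l)\<^sup>2 + (l * \<beta> x)\<^sup>2"
      by (rule sum_squares_bound)
    then have "2 * (\<eta> (r x) * \<beta> x) \<le> (\<eta> (r x) / l)\<^sup>2 + (l * \<beta> x)\<^sup>2" using l by simp
    ultimately have "2 * (\<eta> (r x) * \<beta> x) \<le> r x / l + l\<^sup>2 * (\<beta> x)\<^sup>2"
      using l by (simp add: power_mult_distrib)
    then show ?thesis by simp
  qed
  define c1 c2 c3 where "c1 = m\<^sup>2 / l" and "c2 = 1 / (2 * l)" and "c3 = l\<^sup>2 / 2"
  have ii: "(\<lambda>x. (r' x)\<^sup>2) integrable_on J" "(\<lambda>x. 4 * (\<eta>' (r x) * (r' x)\<^sup>2)) integrable_on J"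
    "(\<lambda>x. c1 * r x) integrable_on J" "(\<lambda>x. \<eta> (r x) * \<beta> x) integrable_on J"
    "(\<lambda>x. c2 * r x) integrable_on J" "(\<lambda>x. c3 * (\<beta> x)\<^sup>2) integrable_on J"
    by (rule integrable_continuous_interval, intro continuous_intros cc cont)+
  have "integral J (\<lambda>x. (r' x)\<^sup>2) \<le> integral J (\<lambda>x. 4 * (\<eta>' (r x) * (r' x)\<^sup>2) + c1 * r x)"
    by (rule integral_le[OF ii(1) integrable_add[OF ii(2,3)]]) (use p1 in \<open>simp add: c1_def\<close>)
  also have "\<dots> = 4 * integral J (\<lambda>x. \<eta>' (r x) * (r' x)\<^sup>2) + c1 * integral J r"
    using integral_add[OF ii(2,3)] by simp
  also have "\<dots> \<le> 4 * (c2 * integral J r + c3 * integral J (\<lambda>x. (\<beta> x)\<^sup>2)) + c1 * integral J r"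
  proof -
    have "integral J (\<lambda>x. \<eta> (r x) * \<beta> x) \<le> integral J (\<lambda>x. c2 * r x + c3 * (\<beta> x)\<^sup>2)"
      by (rule integral_le[OF ii(4) integrable_add[OF ii(5,6)]]) (use p2 in \<open>simp add: c2_def c3_def\<close>)
    also have "\<dots> = c2 * integral J r + c3 * integral J (\<lambda>x. (\<beta> x)\<^sup>2)"
      using integral_add[OF ii(5,6)] by simp
    finally show ?thesis using T by simp
  qed
  finally show ?thesis using l unfolding c1_def c2_def c3_def by (simp add: field_simps)
qed

text \<open>With \<open>M\<close> the maximum of \<open>r\<close>, testing with \<open>r\<close> itself
  gives \<open>B\<^sup>2 \<le> M A E\<close>, and integrating \<open>(r\<^sup>2)'\<close> from a zero of
  \<open>r\<close> gives \<open>M\<^sup>3 \<le> 4 A B\<close>; eliminating \<open>M\<close> proves the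
  claim.\<close>

lemma gagliardo_nirenberg_aux:
  assumes y: "y \<in> J" "r y = 0"
  shows "(integral J (\<lambda>x. (r' x)\<^sup>2)) ^ 5 \<le> 4 * (integral J r) ^ 4 * (integral J (\<lambda>x. (\<beta> x)\<^sup>2)) ^ 3"
proof -
  define A B E where "A = integral J r" and "B = integral J (\<lambda>x. (r' x)\<^sup>2)" and "E = integral J (\<lambda>x. (\<beta> x)\<^sup>2)"
  obtain x0 where x0: "x0 \<in> J" "\<And>x. x \<in> J \<Longrightarrow> r x \<le> r x0"
    using continuous_attains_sup[of J r] cont by auto
  define M where "M = r x0"
  have M: "M \<ge> 0" "\<And>x. x \<in> J \<Longrightarrow> r x \<le> M" using r0 x0 by (auto simp: M_def)
  have nn: "A \<ge> 0" "B \<ge> 0" "E \<ge> 0"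
    unfolding A_def B_def E_def
    by (intro integral_nonneg integrable_continuous_interval continuous_on_power cont; simp add: r0)+
  have r2: "integral J (\<lambda>x. (r x)\<^sup>2) \<le> M * A"
  proof -
    have "integral J (\<lambda>x. (r x)\<^sup>2) \<le> integral J (\<lambda>x. M * r x)"
      by (rule integral_le) (use M r0 in \<open>auto intro!: integrable_continuous_interval continuous_intros cont mult_right_mono simp: power2_eq_square\<close>)
    then show ?thesis by (simp add: A_def)
  qed
  have BE: "B\<^sup>2 \<le> M * A * E"
  proof -
    have "integral J (\<lambda>x. 1 * (r' x)\<^sup>2) \<le> integral J (\<lambda>x. r x * \<beta> x)"
      by (rule test_identity[of "\<lambda>x. x" "\<lambda>_. 1"]) auto
    then have "B\<^sup>2 \<le> (integral J (\<lambda>x. r x * \<beta> x))\<^sup>2"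
      using nn by (intro power_mono) (auto simp: B_def)
    also have "\<dots> \<le> integral J (\<lambda>x. (r x)\<^sup>2) * E"
      unfolding E_def by (rule integral_Cauchy_Schwarz) (rule cont)+
    also have "\<dots> \<le> M * A * E" using r2 nn by (intro mult_right_mono)
    finally show ?thesis .
  qed
  have M3: "M ^ 3 \<le> 4 * A * B"
  proof (cases "M = 0")
    case True then show ?thesis using nn by simp
  next
    case False
    have "((\<lambda>x. (r x)\<^sup>2) has_real_derivative 2 * r x * r' x) (at x)" for x
      using d(1)[of x] by (auto intro!: derivative_eq_intros)
    then have "\<bar>(r x0)\<^sup>2 - (r y)\<^sup>2\<bar> \<le> integral J (\<lambda>x. \<bar>2 * r x * r' x\<bar>)"
      using x0(1) y(1) by (intro diff_le_integral_deriv) (auto intro!: continuous_intros cont)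
    also have "(\<lambda>x. \<bar>2 * r x * r' x\<bar>) = (\<lambda>x. 2 * (r x * \<bar>r' x\<bar>))"
      using r0 by (simp add: abs_mult mult.assoc)
    also have "integral J \<dots> = 2 * integral J (\<lambda>x. r x * \<bar>r' x\<bar>)" by (rule integral_mult_right)
    finally have 1: "M\<^sup>2 \<le> 2 * integral J (\<lambda>x. r x * \<bar>r' x\<bar>)" using y by (simp add: M_def)
    have "(M\<^sup>2)\<^sup>2 \<le> (2 * integral J (\<lambda>x. r x * \<bar>r' x\<bar>))\<^sup>2" using 1 by (intro power_mono) auto
    also have "\<dots> = 4 * (integral J (\<lambda>x. r x * \<bar>r' x\<bar>))\<^sup>2" by (simp add: power_mult_distrib)
    also have "(integral J (\<lambda>x. r x * \<bar>r' x\<bar>))\<^sup>2 \<le> integral J (\<lambda>x. (r x)\<^sup>2) * integral J (\<lambda>x. (\<bar>r' x\<bar>)\<^sup>2)"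
      by (rule integral_Cauchy_Schwarz) (auto intro!: continuous_intros cont)
    also have "\<dots> \<le> (M * A) * B" using r2 nn by (simp add: B_def mult_right_mono)
    finally have "M * M ^ 3 \<le> M * (4 * A * B)" by (simp add: power2_eq_square power3_eq_cube algebra_simps)
    then show ?thesis using False M(1) by simp
  qed
  have "B * B ^ 5 = (B\<^sup>2) ^ 3" by (simp add: power2_eq_square power3_eq_cube eval_nat_numeral)
  also have "\<dots> \<le> (M * A * E) ^ 3" using BE by (intro power_mono) auto
  also have "\<dots> = M ^ 3 * (A ^ 3 * E ^ 3)" by (simp add: power_mult_distrib)
  also have "\<dots> \<le> (4 * A * B) * (A ^ 3 * E ^ 3)" using M3 nn by (intro mult_right_mono) auto
  also have "\<dots> = B * (4 * A ^ 4 * E ^ 3)" by (simp add: eval_nat_numeral)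
  finally have *: "B * B ^ 5 \<le> B * (4 * A ^ 4 * E ^ 3)" .
  have "B ^ 5 \<le> 4 * A ^ 4 * E ^ 3"
  proof (cases "B = 0")
    case True then show ?thesis using nn by simp
  next
    case False
    then have "B > 0" using nn by simp
    then show ?thesis using * by (simp add: mult_le_cancel_left_pos)
  qed
  then show ?thesis by (simp add: A_def B_def E_def)
qed

text \<open>Subtracting the minimum creates a zero, leaves the derivatives unchanged and only decreases
  \<open>\<integral> r\<close>.\<close>

lemma gagliardo_nirenberg:
  "(integral J (\<lambda>x. (r' x)\<^sup>2)) ^ 5 \<le> 4 * (integral J r) ^ 4 * (integral J (\<lambda>x. (\<beta> x)\<^sup>2)) ^ 3"
proof -
  obtain y where y: "y \<in> J" "\<And>x. x \<in> J \<Longrightarrow> r y \<le> r x"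
    using continuous_attains_inf[of J r] cont by auto
  have all: "r y \<le> r x" for x
  proof -
    define k where "k = \<lfloor>x + 1/2\<rfloor>"
    have k: "x - of_int k \<in> J" unfolding k_def atLeastAtMost_iff by linarith
    have "r (x - of_int k) = r x" by (rule periodic_of_int) (rule per)
    then show ?thesis using y(2)[OF k] by simp
  qed
  have i: "interp (\<lambda>x. r x - r y) r' r'' \<beta>"
  proof (unfold_locales)
    show "((\<lambda>x. r x - r y) has_real_derivative r' x) (at x)" for x
      using DERIV_diff[OF d(1)[of x] DERIV_const[of "r y"]] by simp
    show "0 \<le> r x - r y" for x using all[of x] by simp
  qed (fact d(2) c(1) c(2) convex \<beta> | simp only: per)+
  have "integral J (\<lambda>x. r x - r y) \<le> integral J r"
    by (rule integral_le) (use r0 in \<open>auto intro!: integrable_continuous_interval continuous_intros cont\<close>)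
  moreover have "0 \<le> integral J (\<lambda>x. r x - r y)"
    by (rule integral_nonneg) (use all in \<open>auto intro!: integrable_continuous_interval continuous_intros cont\<close>)
  ultimately have "(integral J (\<lambda>x. r x - r y)) ^ 4 \<le> (integral J r) ^ 4" by (intro power_mono) auto
  moreover have "0 \<le> integral J (\<lambda>x. (\<beta> x)\<^sup>2)"
    by (rule integral_nonneg) (auto intro!: integrable_continuous_interval continuous_intros cont)
  ultimately have "4 * (integral J (\<lambda>x. r x - r y)) ^ 4 * (integral J (\<lambda>x. (\<beta> x)\<^sup>2)) ^ 3
      \<le> 4 * (integral J r) ^ 4 * (integral J (\<lambda>x. (\<beta> x)\<^sup>2)) ^ 3"
    by (intro mult_right_mono) auto
  then show ?thesis using interp.gagliardo_nirenberg_aux[OF i y(1)] by simp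
qed

end

text \<open>The derivative vanishes somewhere by Rolle's theorem, hence it is bounded by
  \<open>\<integral> \<bar>w''\<bar>\<close>.\<close>

lemma poincare:
  fixes w w' w'' :: "real \<Rightarrow> real"
  assumes d: "\<And>x. (w has_real_derivative w' x) (at x)" "\<And>x. (w' has_real_derivative w'' x) (at x)"
    and c: "continuous_on UNIV w''" and ab: "a < b" "w a = w b"
  shows "integral {a..b} (\<lambda>x. (w' x)\<^sup>2) \<le> (b - a)\<^sup>2 * integral {a..b} (\<lambda>x. (w'' x)\<^sup>2)"
proof -
  have cw: "continuous_on S w'" "continuous_on S w''" for S
    using d by (meson DERIV_continuous_on has_field_derivative_at_within)
               (use c in \<open>auto intro: continuous_on_subset\<close>)
  obtain z where z: "a < z" "z < b" "w' z = 0"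
    using MVT2[of a b w w'] ab d(1) by (metis diff_self mult_eq_0_iff diff_gt_0_iff_gt order_less_irrefl)
  define V where "V = integral {a..b} (\<lambda>x. \<bar>w'' x\<bar>)"
  have V0: "V \<ge> 0" unfolding V_def
    by (rule integral_nonneg) (auto intro!: integrable_continuous_interval continuous_intros cw)
  have le: "(w' x)\<^sup>2 \<le> V\<^sup>2" if "x \<in> {a..b}" for x
  proof -
    have "\<bar>w' x - w' z\<bar> \<le> V" unfolding V_def
      by (rule diff_le_integral_deriv[OF d(2) cw(2) that]) (use z in auto)
    then show ?thesis using z(3) V0 by (simp add: power2_le_iff_abs_le)
  qed
  have "integral {a..b} (\<lambda>x. (w' x)\<^sup>2) \<le> integral {a..b} (\<lambda>x. V\<^sup>2)"
    by (rule integral_le) (use le in \<open>auto intro!: integrable_continuous_interval continuous_intros cw\<close>)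
  then have 1: "integral {a..b} (\<lambda>x. (w' x)\<^sup>2) \<le> (b - a) * V\<^sup>2" using ab by simp
  have "V\<^sup>2 = (integral {a..b} (\<lambda>x. 1 * \<bar>w'' x\<bar>))\<^sup>2" by (simp add: V_def)
  also have "\<dots> \<le> integral {a..b} (\<lambda>x. (1::real)\<^sup>2) * integral {a..b} (\<lambda>x. (\<bar>w'' x\<bar>)\<^sup>2)"
    by (rule integral_Cauchy_Schwarz) (auto intro!: continuous_intros cw)
  also have "\<dots> = (b - a) * integral {a..b} (\<lambda>x. (w'' x)\<^sup>2)" using ab by simp
  finally have "(b - a) * V\<^sup>2 \<le> (b - a) * ((b - a) * integral {a..b} (\<lambda>x. (w'' x)\<^sup>2))"
    using ab by (intro mult_left_mono) auto
  then show ?thesis using 1 by (simp add: power2_eq_square algebra_simps)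
qed

section \<open>The lower bound for smooth periodic deformations\<close>

abbreviation J :: "real set" where "J \<equiv> {- 1/2..1/2}"

abbreviation I :: "(real \<times> real \<Rightarrow> real) \<Rightarrow> real" where "I f \<equiv> integral\<^sup>L LO f"

lemma LO_mono:
  assumes "continuous_on UNIV f" "continuous_on UNIV g" "\<And>p. p \<in> Omega \<Longrightarrow> f p \<le> g p"
  shows "I f \<le> I g"
  by (rule integral_mono_AE[OF continuous_LO_integrable[OF assms(1)] continuous_LO_integrable[OF assms(2)]])
     (rule AE_I2, use assms(3) in simp)

lemma LO_const: "I (\<lambda>p. c) = 2 * pi * c"
  using measure_LO by simp

lemma slice_cont:
  fixes f :: "real \<times> real \<Rightarrow> real"
  assumes "continuous_on UNIV f"
  shows "continuous_on S (\<lambda>t. f (s, t))" "continuous_on S' (\<lambda>s. f (s, t))"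
  by (rule continuous_on_compose2[OF assms]; intro continuous_intros subset_UNIV)+

lemma slice_integrals_cont:
  fixes f :: "real \<times> real \<Rightarrow> real"
  assumes "continuous_on UNIV f"
  shows "continuous_on {0..2 * pi} (\<lambda>s. integral J (\<lambda>t. f (s, t)))"
    and "continuous_on J (\<lambda>t. integral {0..2 * pi} (\<lambda>s. f (s, t)))"
proof -
  have 1: "continuous_on ({0..2 * pi} \<times> cbox (- 1/2) (1/2)) (\<lambda>(s, t). f (s, t))"
    using continuous_on_subset[OF assms] by simp
  show "continuous_on {0..2 * pi} (\<lambda>s. integral J (\<lambda>t. f (s, t)))"
    using integral_continuous_on_param[OF 1] by simp
  have "continuous_on UNIV (\<lambda>q. f (snd q, fst q))"
    by (rule continuous_on_compose2[OF assms]) (intro continuous_intros subset_UNIV)+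
  then have 2: "continuous_on (J \<times> cbox 0 (2 * pi)) (\<lambda>(t, s). f (s, t))"
    using continuous_on_subset[of UNIV "\<lambda>q. f (snd q, fst q)"] by (simp add: case_prod_unfold)
  show "continuous_on J (\<lambda>t. integral {0..2 * pi} (\<lambda>s. f (s, t)))"
    using integral_continuous_on_param[OF 2] by simp
qed

lemma LO_le_slices_z:
  assumes "continuous_on UNIV f" "continuous_on UNIV g"
    "\<And>s. s \<in> {0..2 * pi} \<Longrightarrow> integral J (\<lambda>t. f (s, t)) \<le> integral J (\<lambda>t. g (s, t))"
  shows "I f \<le> I g"
  unfolding LO_integral_fst[OF assms(1)] LO_integral_fst[OF assms(2)]
  by (rule integral_le[OF _ _ assms(3)]) (rule integrable_continuous_interval slice_integrals_cont assms(1,2))+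

lemma LO_le_slices_theta:
  assumes "continuous_on UNIV f" "continuous_on UNIV g"
    "\<And>t. t \<in> J \<Longrightarrow> integral {0..2 * pi} (\<lambda>s. f (s, t)) \<le> integral {0..2 * pi} (\<lambda>s. g (s, t))"
  shows "I f \<le> I g"
  unfolding LO_integral_snd[OF assms(1)] LO_integral_snd[OF assms(2)]
  by (rule integral_le[OF _ _ assms(3)]) (rule integrable_continuous_interval slice_integrals_cont assms(1,2))+

text \<open>The rectangle is crossed along two segments of total length at most \<open>2 \<pi> + 1/2 <
  8\<close>.\<close>

lemma C1_oscillation:
  assumes f: "C1_theta f f1" "C1_z f f2" and B: "\<And>p. \<bar>f1 p\<bar> \<le> m" "\<And>p. \<bar>f2 p\<bar> \<le> m" and m: "1 \<le> m"
    and p: "p \<in> Omega"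
  shows "\<bar>f p - f (0, 0)\<bar> \<le> 8 * m"
proof -
  obtain s t where st: "p = (s, t)" "0 \<le> s" "s \<le> 2 * pi" "\<bar>t\<bar> \<le> 1/2" using p by (cases p) (auto simp: Omega_def)
  have "\<bar>f (s, t) - f (0, t)\<bar> \<le> m * \<bar>s - 0\<bar>"
    using field_differentiable_bound[of UNIV "\<lambda>s. f (s, t)" "\<lambda>s. f1 (s, t)" m s 0] f(1) B(1)
    by (simp add: C1_theta_def)
  moreover have "\<bar>f (0, t) - f (0, 0)\<bar> \<le> m * \<bar>t - 0\<bar>"
    using field_differentiable_bound[of UNIV "\<lambda>t. f (0, t)" "\<lambda>t. f2 (0, t)" m t 0] f(2) B(2)
    by (simp add: C1_z_def)
  moreover have "m * \<bar>s - 0\<bar> \<le> m * 7" using st m pi_less_4 pi_approx by (intro mult_left_mono) auto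
  moreover have "m * \<bar>t - 0\<bar> \<le> m * 1" using st m by (intro mult_left_mono) auto
  ultimately show ?thesis by (simp add: st)
qed

text \<open>The energy density in cylindrical components, with arguments named after derivatives
  (\<open>T1\<close> and \<open>T2\<close> are the derivatives of the angle). From the bending part only
  the terms needed below are kept: the radial components of the two pure second derivatives, and the
  vertical component of the azimuthal one.\<close>

definition dens where
  "dens h R Rt Rz Rtt Rzz T1 T2 Zt Zz Ztt =
     (Rt\<^sup>2 + R\<^sup>2 * T1\<^sup>2 + Zt\<^sup>2 - 1)\<^sup>2 + 2 * (Rt * Rz + R\<^sup>2 * T1 * T2 + Zt * Zz)\<^sup>2
     + (Rz\<^sup>2 + R\<^sup>2 * T2\<^sup>2 + Zz\<^sup>2 - 1)\<^sup>2
     + h\<^sup>2 * ((Rtt - R * T1\<^sup>2)\<^sup>2 + Ztt\<^sup>2 + (Rzz - R * T2\<^sup>2)\<^sup>2 :: real)"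

text \<open>What remains of the density after the bulk energy and the terms of mean zero have been split
  off; \<open>a\<close> will be \<open>max (\<rho>\<^sup>2 - 1) (h\<^sup>2)\<close>.\<close>

definition excess where
  "excess a h \<rho> R Rt Rz Rzz T1 T2 Zt Zz Ztt =
     2 * a * ((R - \<rho>) * T1\<^sup>2 + (T1 - 1)\<^sup>2) + 2 * (\<rho>\<^sup>2 - 1) * Zt\<^sup>2 + h\<^sup>2 * Ztt\<^sup>2
     + (Rt\<^sup>2 + R\<^sup>2 * T1\<^sup>2 + Zt\<^sup>2 - \<rho>\<^sup>2)\<^sup>2 + 2 * (Rt * Rz + R\<^sup>2 * T1 * T2 + Zt * Zz)\<^sup>2
     + (Rz\<^sup>2 + R\<^sup>2 * T2\<^sup>2 + Zz\<^sup>2 - 1)\<^sup>2 + h\<^sup>2 * (Rzz - R * T2\<^sup>2)\<^sup>2"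

text \<open>The square \<open>(G - 1)\<^sup>2\<close> is expanded around \<open>G =
  \<rho>\<^sup>2\<close>, and the bending square is bounded below by its tangent at \<open>-
  \<rho>\<close>, the value on the mandrel. Both expansions produce \<open>(R - \<rho>) T1\<^sup>2 + (T1
  - 1)\<^sup>2\<close>, with the factors \<open>2 (\<rho>\<^sup>2 - 1)\<close> and \<open>2
  h\<^sup>2\<close>. The linear terms in \<open>T1 - 1\<close> and \<open>Rtt\<close> integrate to 0 by
  periodicity.\<close>

lemma dens_ge_excess:
  fixes \<rho> h R T1 :: real
  assumes \<rho>: "1 \<le> \<rho>" and R: "\<rho> \<le> R" and a: "a \<le> (\<rho>\<^sup>2 - 1) + h\<^sup>2"
  shows "dens h R Rt Rz Rtt Rzz T1 T2 Zt Zz Ztt \<ge>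
     ((\<rho>\<^sup>2 - 1)\<^sup>2 + \<rho>\<^sup>2 * h\<^sup>2) + (4 * \<rho>\<^sup>2 * (\<rho>\<^sup>2 - 1) + 4 * \<rho>\<^sup>2 * h\<^sup>2) * (T1 - 1) - 2 * \<rho> * h\<^sup>2 * Rtt
     + excess a h \<rho> R Rt Rz Rzz T1 T2 Zt Zz Ztt"
proof -
  define x y where "x = R - \<rho>" and "y = T1 - 1"
  have x: "x \<ge> 0" using R by (simp add: x_def)
  define G where "G = Rt\<^sup>2 + R\<^sup>2 * T1\<^sup>2 + Zt\<^sup>2"
  define q where "q = x * T1\<^sup>2 + y\<^sup>2"
  have q0: "q \<ge> 0" using x by (simp add: q_def)
  have e1: "(G - 1)\<^sup>2 = (\<rho>\<^sup>2 - 1)\<^sup>2 + 2 * (\<rho>\<^sup>2 - 1) * (G - \<rho>\<^sup>2) + (G - \<rho>\<^sup>2)\<^sup>2"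
    by (simp add: power2_eq_square algebra_simps)
  have r1: "\<rho>\<^sup>2 - 1 \<ge> 0" using \<rho> by (simp add: one_le_power)
  have GG: "G - \<rho>\<^sup>2 = Rt\<^sup>2 + Zt\<^sup>2 + (2 * \<rho> + x) * (x * T1\<^sup>2) + \<rho>\<^sup>2 * y\<^sup>2 + 2 * \<rho>\<^sup>2 * y"
    by (simp add: G_def x_def y_def power2_eq_square algebra_simps)
  have "1 * (x * T1\<^sup>2) \<le> (2 * \<rho> + x) * (x * T1\<^sup>2)"
    using x \<rho> by (intro mult_right_mono) auto
  moreover have "1 * y\<^sup>2 \<le> \<rho>\<^sup>2 * y\<^sup>2" using r1 by (intro mult_right_mono) auto
  ultimately have "G - \<rho>\<^sup>2 \<ge> Zt\<^sup>2 + q + 2 * \<rho>\<^sup>2 * y"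
    using GG zero_le_power2[of Rt] unfolding q_def by linarith
  then have e2: "2 * (\<rho>\<^sup>2 - 1) * (Zt\<^sup>2 + q + 2 * \<rho>\<^sup>2 * y) \<le> 2 * (\<rho>\<^sup>2 - 1) * (G - \<rho>\<^sup>2)"
    using r1 by (intro mult_left_mono) auto
  define P U V Ry RU RV Q :: real where "P = \<rho> * Rtt" and "U = x * T1\<^sup>2" and "V = y\<^sup>2" and "Ry = \<rho>\<^sup>2 * y"
    and "RU = \<rho> * U" and "RV = \<rho>\<^sup>2 * V" and "Q = (Rtt - R * T1\<^sup>2)\<^sup>2"
  have "0 \<le> (Rtt - R * T1\<^sup>2 + \<rho>)\<^sup>2" by simp
  also have "\<dots> = Q + 2 * P - 2 * RU - 2 * RV - 4 * Ry - \<rho>\<^sup>2"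
    by (simp add: RU_def RV_def Q_def P_def U_def V_def Ry_def x_def y_def power2_eq_square algebra_simps)
  \<comment> \<open>The tangent to the square at \<open>- \<rho>\<close>.\<close>
  finally have f1: "0 \<le> Q + 2 * P - 2 * RU - 2 * RV - 4 * Ry - \<rho>\<^sup>2" .
  have f2: "1 * U \<le> RU" unfolding RU_def using x \<rho> by (intro mult_right_mono) (auto simp: U_def)
  have f3: "1 * V \<le> RV" unfolding RV_def using r1 by (intro mult_right_mono) (auto simp: V_def)
  have "Q \<ge> \<rho>\<^sup>2 - 2 * P + 4 * Ry + 2 * U + 2 * V"
    using f1 f2 f3 by linarith
  then have "(Rtt - R * T1\<^sup>2)\<^sup>2 \<ge> \<rho>\<^sup>2 - 2 * \<rho> * Rtt + 4 * \<rho>\<^sup>2 * y + 2 * q"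
    by (simp add: P_def U_def V_def Ry_def Q_def q_def mult.assoc distrib_left)
  then have e3: "h\<^sup>2 * (\<rho>\<^sup>2 - 2 * \<rho> * Rtt + 4 * \<rho>\<^sup>2 * y + 2 * q) \<le> h\<^sup>2 * (Rtt - R * T1\<^sup>2)\<^sup>2"
    by (intro mult_left_mono) auto
  have e4: "2 * a * q \<le> 2 * ((\<rho>\<^sup>2 - 1) + h\<^sup>2) * q" using a q0 by (intro mult_right_mono) auto
  have "dens h R Rt Rz Rtt Rzz T1 T2 Zt Zz Ztt = (G - 1)\<^sup>2 + 2 * (Rt * Rz + R\<^sup>2 * T1 * T2 + Zt * Zz)\<^sup>2
     + (Rz\<^sup>2 + R\<^sup>2 * T2\<^sup>2 + Zz\<^sup>2 - 1)\<^sup>2 + (h\<^sup>2 * (Rtt - R * T1\<^sup>2)\<^sup>2 + h\<^sup>2 * Ztt\<^sup>2 + h\<^sup>2 * (Rzz - R * T2\<^sup>2)\<^sup>2)"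
    by (simp add: dens_def G_def algebra_simps)
  moreover have "excess a h \<rho> R Rt Rz Rzz T1 T2 Zt Zz Ztt = 2 * a * q + 2 * (\<rho>\<^sup>2 - 1) * Zt\<^sup>2 + h\<^sup>2 * Ztt\<^sup>2
     + (G - \<rho>\<^sup>2)\<^sup>2 + 2 * (Rt * Rz + R\<^sup>2 * T1 * T2 + Zt * Zz)\<^sup>2
     + (Rz\<^sup>2 + R\<^sup>2 * T2\<^sup>2 + Zz\<^sup>2 - 1)\<^sup>2 + h\<^sup>2 * (Rzz - R * T2\<^sup>2)\<^sup>2"
    by (simp add: excess_def G_def q_def x_def y_def)
  moreover have "2 * (\<rho>\<^sup>2 - 1) * (Zt\<^sup>2 + q + 2 * \<rho>\<^sup>2 * y) = 2 * (\<rho>\<^sup>2 - 1) * Zt\<^sup>2 + 2 * (\<rho>\<^sup>2 - 1) * q + 4 * \<rho>\<^sup>2 * (\<rho>\<^sup>2 - 1) * y"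
    "h\<^sup>2 * (\<rho>\<^sup>2 - 2 * \<rho> * Rtt + 4 * \<rho>\<^sup>2 * y + 2 * q) = \<rho>\<^sup>2 * h\<^sup>2 - 2 * \<rho> * h\<^sup>2 * Rtt + 4 * \<rho>\<^sup>2 * h\<^sup>2 * y + 2 * h\<^sup>2 * q"
    "2 * ((\<rho>\<^sup>2 - 1) + h\<^sup>2) * q = 2 * (\<rho>\<^sup>2 - 1) * q + 2 * h\<^sup>2 * q"
    "(4 * \<rho>\<^sup>2 * (\<rho>\<^sup>2 - 1) + 4 * \<rho>\<^sup>2 * h\<^sup>2) * (T1 - 1) = 4 * \<rho>\<^sup>2 * (\<rho>\<^sup>2 - 1) * y + 4 * \<rho>\<^sup>2 * h\<^sup>2 * y"
    by (simp_all add: algebra_simps y_def)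
  ultimately show ?thesis using e1 e2 e3 e4 by linarith
qed

lemma powr_frac_power: "x > 0 \<Longrightarrow> n > 0 \<Longrightarrow> (x powr (real k / real n)) ^ n = x ^ k"
  by (simp add: powr_power powr_realpow)

lemma seventh_powers:
  assumes "(x::real) > 0"
  shows "(x powr (4/7)) ^ 7 = x ^ 4" "(x powr (6/7)) ^ 7 = x ^ 6" "(x powr (5/7)) ^ 7 = x ^ 5"
  using powr_frac_power[OF assms, of 7 4] powr_frac_power[OF assms, of 7 6] powr_frac_power[OF assms, of 7 5]
  by simp_all

lemma powr_two_thirds:
  assumes "(x::real) > 0"
  shows "x powr (2/3) = (x\<^sup>2) powr (1/3)"
proof -
  have "x powr (2/3) = (x powr 2) powr (1/3)" unfolding powr_powr by simp
  then show ?thesis using assms by simp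
qed

text \<open>The width at which the obstacle cost \<open>a l\<close> balances the bending cost
  \<open>h\<^sup>2 / l\<^sup>2\<close>.\<close>

lemma balanced_width_exists:
  fixes a h :: real
  assumes "0 < a" "0 < h"
  obtains l where "0 < l" "l ^ 3 = h\<^sup>2 / a" "a * l = a powr (2/3) * h powr (2/3)"
proof -
  define l where "l = (h\<^sup>2 / a) powr (1/3)"
  have l: "l > 0" using assms by (simp add: l_def)
  have l3: "l ^ 3 = h\<^sup>2 / a" using powr_frac_power[of "h\<^sup>2 / a" 3 1] assms by (simp add: l_def)
  have "l = h powr (2/3) / a powr (1/3)"
    using assms by (simp add: l_def powr_divide powr_two_thirds)
  moreover have "a = a powr (2/3) * a powr (1/3)" using assms by (simp add: powr_add[symmetric])
  then have "a / a powr (1/3) = a powr (2/3)" using assms by (simp add: divide_eq_eq)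
  ultimately have "a * l = a powr (2/3) * h powr (2/3)" by (metis times_divide_eq_left times_divide_eq_right mult.commute)
  then show ?thesis using that l l3 by blast
qed

text \<open>Here \<open>A\<close>, \<open>B\<close> and \<open>D\<close> are \<open>\<integral>
  r\<close>, \<open>\<integral> r'\<^sup>2\<close> and \<open>\<integral> \<beta>\<^sup>2\<close> on a
  line. Writing \<open>A\<^sup>4 D\<^sup>3\<close> in terms of \<open>a A\<close> and \<open>h\<^sup>2
  D\<close> bounds the seventh power of the cost from below and gives the first term of the maximum. The
  second one comes from the truncated inequality at the balanced width, where both of its terms are
  multiples of the cost.\<close>

lemma wrinkle_cost:
  fixes a h lam m A B D c0 :: real
  assumes pos: "0 < a" "0 < h" "0 < lam" "0 \<le> A" "0 \<le> D" "0 < c0" "c0 \<le> 1"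
    and B: "c0 * lam \<le> B"
    and GN: "B ^ 5 \<le> 4 * A ^ 4 * D ^ 3"
    and tr: "\<And>l. l > 0 \<Longrightarrow> B \<le> (2 + m\<^sup>2) / l * A + 2 * l\<^sup>2 * D"
  shows "min (c0 ^ 5 / 4) (c0 / (4 + m\<^sup>2)) * max (a powr (4/7) * h powr (6/7) * lam powr (5/7)) (a powr (2/3) * h powr (2/3) * lam)
     \<le> a * A + h\<^sup>2 * D"
proof -
  define e where "e = a * A + h\<^sup>2 * D"
  have e0: "e \<ge> 0" using pos by (simp add: e_def)
  define Y1 Y2 where "Y1 = a powr (4/7) * h powr (6/7) * lam powr (5/7)" and "Y2 = a powr (2/3) * h powr (2/3) * lam"
  have Y: "Y1 > 0" "Y2 > 0" using pos by (auto simp: Y1_def Y2_def)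
  have Y17: "Y1 ^ 7 = a ^ 4 * h ^ 6 * lam ^ 5"
    using pos by (simp add: Y1_def power_mult_distrib seventh_powers)
  have 1: "c0 ^ 5 / 4 * Y1 \<le> e"
  proof -
    have A: "a * A \<le> e" "h\<^sup>2 * D \<le> e" using pos by (auto simp: e_def)
    have "(c0 * lam) ^ 5 \<le> B ^ 5" using B pos by (intro power_mono) auto
    then have "(c0 * lam) ^ 5 \<le> 4 * A ^ 4 * D ^ 3" using GN by linarith
    then have "a ^ 4 * h ^ 6 * (c0 * lam) ^ 5 \<le> a ^ 4 * h ^ 6 * (4 * A ^ 4 * D ^ 3)"
      using pos by (intro mult_left_mono) auto
    also have "\<dots> = 4 * ((a * A) ^ 4 * (h\<^sup>2 * D) ^ 3)" by (simp add: power_mult_distrib algebra_simps flip: power_mult)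
    also have "\<dots> \<le> 4 * (e ^ 4 * e ^ 3)"
      using A pos e0 by (intro mult_left_mono mult_mono power_mono) auto
    also have "\<dots> = 4 * e ^ 7" by (simp add: power_add[symmetric])
    finally have "c0 ^ 5 / 4 * Y1 ^ 7 \<le> e ^ 7" by (simp add: Y17 power_mult_distrib algebra_simps)
    moreover have "(c0 ^ 5 / 4) ^ 7 \<le> (c0 ^ 5 / 4) ^ 1"
      using pos power_le_one[of c0 5] by (intro power_decreasing) auto
    then have "(c0 ^ 5 / 4) ^ 7 * Y1 ^ 7 \<le> c0 ^ 5 / 4 * Y1 ^ 7" using Y by (intro mult_right_mono) auto
    ultimately have "(c0 ^ 5 / 4 * Y1) ^ 7 \<le> e ^ 7" unfolding power_mult_distrib[of _ Y1] by linarith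
    then show ?thesis using e0 by (rule power_le_imp_le_base[of _ 6, simplified]) 
  qed
  have 2: "c0 / (4 + m\<^sup>2) * Y2 \<le> e"
  proof -
    obtain l where l: "0 < l" and l3': "l ^ 3 = h\<^sup>2 / a" and al': "a * l = a powr (2/3) * h powr (2/3)"
      using balanced_width_exists[OF pos(1,2)] .
    have l3: "l\<^sup>2 * (a * l) = h\<^sup>2" using l3' pos by (simp add: power2_eq_square power3_eq_cube field_simps)
    have al: "a * l * lam = Y2" by (simp only: al' Y2_def)
    have "c0 * lam * (a * l) \<le> B * (a * l)" using B pos l by (intro mult_right_mono) auto
    also have "\<dots> \<le> ((2 + m\<^sup>2) / l * A + 2 * l\<^sup>2 * D) * (a * l)" using tr[OF l] pos l by (intro mult_right_mono) auto
    also have "\<dots> = (2 + m\<^sup>2) * (a * A) + 2 * ((l\<^sup>2 * (a * l)) * D)" using l by (simp add: field_simps)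
    also have "\<dots> = (2 + m\<^sup>2) * (a * A) + 2 * (h\<^sup>2 * D)" by (simp only: l3)
    also have "\<dots> \<le> (4 + m\<^sup>2) * (a * A) + (4 + m\<^sup>2) * (h\<^sup>2 * D)"
      using pos by (intro add_mono mult_right_mono) auto
    also have "\<dots> = (4 + m\<^sup>2) * e" by (simp add: e_def distrib_left)
    finally have "c0 * lam * (a * l) \<le> (4 + m\<^sup>2) * e" .
    moreover have "c0 * Y2 = c0 * lam * (a * l)" unfolding al[symmetric] by simp
    ultimately have "c0 * Y2 \<le> (4 + m\<^sup>2) * e" by linarith
    moreover have "4 + m\<^sup>2 > 0" using zero_le_power2[of m] by linarith
    ultimately show ?thesis by (simp add: divide_le_eq mult.commute)
  qed
  have "min (c0 ^ 5 / 4) (c0 / (4 + m\<^sup>2)) * max Y1 Y2 \<le> e"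
  proof (cases "Y1 \<le> Y2")
    case True
    have "min (c0 ^ 5 / 4) (c0 / (4 + m\<^sup>2)) * Y2 \<le> c0 / (4 + m\<^sup>2) * Y2"
      using Y by (intro mult_right_mono min.cobounded2) simp
    then show ?thesis using True 2 by simp
  next
    case False
    have "min (c0 ^ 5 / 4) (c0 / (4 + m\<^sup>2)) * Y1 \<le> c0 ^ 5 / 4 * Y1"
      using Y by (intro mult_right_mono min.cobounded1) simp
    then show ?thesis using False 1 by simp
  qed
  then show ?thesis by (simp add: Y1_def Y2_def e_def)
qed

text \<open>If \<open>\<lambda> \<le> h\<^sup>1\<^sup>/\<^sup>2\<close>, then \<open>c\<^sub>0 \<ge>
  \<lambda>\<close>, whence \<open>\<lambda>\<^sup>2 \<le> a \<lambda>\<close>. Otherwise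
  \<open>c\<^sub>0 = h\<^sup>1\<^sup>/\<^sup>2\<close>, and both terms of the maximum are at most
  \<open>a \<lambda>\<close>.\<close>

lemma target_le:
  fixes a h lam :: real
  assumes pos: "0 < h" "h \<le> 1/2" "0 < lam" "lam \<le> 1/2" "0 < a" and ha: "h\<^sup>2 \<le> a" and c0: "c0_one lam h \<le> a"
  shows "min (lam\<^sup>2) (max (a powr (4/7) * h powr (6/7) * lam powr (5/7)) (a powr (2/3) * h powr (2/3) * lam)) \<le> a * lam"
proof -
  have 2: "a powr (2/3) * h powr (2/3) * lam \<le> a * lam"
  proof -
    have "h powr (2/3) = (h\<^sup>2) powr (1/3)" using pos by (simp add: powr_two_thirds)
    also have "\<dots> \<le> a powr (1/3)" using ha pos by (intro powr_mono2) auto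
    finally have "a powr (2/3) * h powr (2/3) \<le> a powr (2/3) * a powr (1/3)" by (intro mult_left_mono) auto
    also have "\<dots> = a" using pos by (simp add: powr_add[symmetric])
    finally show ?thesis using pos by (intro mult_right_mono) auto
  qed
  show ?thesis
  proof (cases "lam \<le> h powr (1/2)")
    case True
    have "lam = lam powr (1/2) * lam powr (1/2)" using pos by (simp add: powr_add[symmetric])
    also have "\<dots> \<le> lam powr (1/2) * (h powr (1/2)) powr (1/2)"
      using True pos by (intro mult_left_mono powr_mono2) auto
    also have "\<dots> = lam powr (1/2) * h powr (1/4)" by (simp add: powr_powr)
    finally have l1: "lam \<le> lam powr (1/2) * h powr (1/4)" .
    have "lam \<le> c0_one lam h" using l1 True by (simp add: c0_one_def)
    then have "lam\<^sup>2 \<le> a * lam" using c0 pos by (simp add: power2_eq_square)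
    then show ?thesis by linarith
  next
    case False
    then have lh: "h powr (1/2) \<le> lam" by simp
    have "h powr (1/4) = (h powr (1/2)) powr (1/2)" by (simp add: powr_powr)
    also have "\<dots> \<le> lam powr (1/2)" using lh by (intro powr_mono2) auto
    finally have "h powr (1/4) * h powr (1/4) \<le> lam powr (1/2) * h powr (1/4)" by (intro mult_right_mono) auto
    then have "h powr (1/2) \<le> lam powr (1/2) * h powr (1/4)" using pos by (simp add: powr_add[symmetric])
    then have a: "h powr (1/2) \<le> a" using c0 by (simp add: c0_one_def)
    have 1: "a powr (4/7) * h powr (6/7) * lam powr (5/7) \<le> a * lam"
    proof (rule power_le_imp_le_base[of _ 6, simplified])
      have "h = (h powr (1/2))\<^sup>2" using pos powr_frac_power[of h 2 1] by simp
      then have h1: "h \<le> a\<^sup>2" "h \<le> lam\<^sup>2" using a lh by (metis power_mono powr_ge_zero)+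
      have "h ^ 6 \<le> h\<^sup>2 * h" using pos power_decreasing[of 3 6 h] by (simp add: power3_eq_cube power2_eq_square)
      also have "\<dots> \<le> a ^ 3 * lam\<^sup>2"
      proof -
        have "h\<^sup>2 \<le> a ^ 3"
        proof -
          have e: "(h powr (1/2)) ^ 4 = ((h powr (1/2))\<^sup>2)\<^sup>2" by (simp flip: power_mult)
          have e2: "(h powr (1/2))\<^sup>2 = h" using pos powr_frac_power[of h 2 1] by simp
          have "(h powr (1/2)) ^ 4 = h\<^sup>2" unfolding e e2 ..
          then have "h\<^sup>2 = (h powr (1/2)) ^ 4" by simp
          also have "\<dots> \<le> (h powr (1/2)) ^ 3" using pos by (intro power_decreasing) (auto simp: powr_le1)
          also have "\<dots> \<le> a ^ 3" using a by (intro power_mono) auto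
          finally show ?thesis .
        qed
        then show ?thesis using h1 pos by (intro mult_mono) auto
      qed
      finally have "a ^ 4 * lam ^ 5 * h ^ 6 \<le> a ^ 4 * lam ^ 5 * (a ^ 3 * lam\<^sup>2)"
        using pos by (intro mult_left_mono) auto
      then show "(a powr (4/7) * h powr (6/7) * lam powr (5/7)) ^ 7 \<le> (a * lam) ^ 7"
        using pos by (simp add: power_mult_distrib seventh_powers algebra_simps flip: power_add)
    qed (use pos in simp)
    show ?thesis using 1 2 by (auto simp: min_le_iff_disj)
  qed
qed

text \<open>\<open>K\<close> bounds the radius, \<open>c0 * lam\<close> is the amount of
  \<open>\<integral> R\<^sub>z\<^sup>2\<close> that a wrinkled line carries, and the two arguments of the
  outer minimum correspond to a large and to a small excess.\<close>

definition lower_const :: "real \<Rightarrow> real \<Rightarrow> real" where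
  "lower_const \<rho>0 m = (let K = \<rho>0 + 1 + 16 * m; c0 = 1 / (2 * (1 + 6 * m\<^sup>2)) in
     min (1 / (7 + 240 * m\<^sup>2 + K\<^sup>2 * m\<^sup>2)) (min (c0 ^ 5 / 4) (c0 / (4 + m\<^sup>2)) / (2 + K)))"

lemma lower_const_pos:
  assumes "1 \<le> \<rho>0" "1 \<le> m"
  shows "lower_const \<rho>0 m > 0"
proof -
  define K c0 where "K = \<rho>0 + 1 + 16 * m" and "c0 = 1 / (2 * (1 + 6 * m\<^sup>2))"
  have p: "0 \<le> m\<^sup>2" "0 \<le> K\<^sup>2 * m\<^sup>2" by simp_all
  have "0 < 7 + 240 * m\<^sup>2 + K\<^sup>2 * m\<^sup>2" "0 < 1 + 6 * m\<^sup>2" "0 < 4 + m\<^sup>2" using p by linarith+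
  moreover have "0 < 2 + K" using assms by (simp add: K_def)
  ultimately show ?thesis
    unfolding lower_const_def Let_def K_def[symmetric] c0_def[symmetric]
    by (simp add: c0_def)
qed

text \<open>The classically differentiable data for which the lower bound is proved. The angle enters
  only through its derivatives \<open>T1\<close> and \<open>T2\<close>, and besides the periodicity of
  \<open>R\<close> and \<open>W\<close> only three mean values record the boundary conditions.\<close>

locale smooth_shell =
  fixes R Rt Rz Rtt Rzz T1 T2 W Zt Ztt Zz :: "real \<times> real \<Rightarrow> real" and \<rho> \<rho>0 h lam m :: real
  assumes params: "1 \<le> \<rho>" "\<rho> \<le> \<rho>0" "0 < h" "h \<le> 1/2" "0 < lam" "lam \<le> 1/2" "1 \<le> m"
    and R: "C1_theta R Rt" "C1_z R Rz" "C1_z Rz Rzz" "periodic R"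
    and W: "C1_theta W Zt" "C1_theta Zt Ztt" "periodic W"
    and cont0: "continuous_on UNIV Rtt" "continuous_on UNIV T1" "continuous_on UNIV T2" "continuous_on UNIV Zz"
    and means: "I Rtt = 0" "I T1 = 2 * pi" "\<And>s. integral J (\<lambda>t. Zz (s, t)) = 1 - lam"
    and bounds: "\<And>p. \<rho> \<le> R p" "\<And>p. \<bar>Rt p\<bar> \<le> m" "\<And>p. \<bar>Rz p\<bar> \<le> m" "\<And>p. \<bar>T2 p\<bar> \<le> m"
      "\<And>p. \<bar>Zz p\<bar> \<le> m" "\<And>p. 0 \<le> Zz p"
begin

definition a where "a = max (\<rho>\<^sup>2 - 1) (h\<^sup>2)"
definition x where "x p = R p - \<rho>"
definition y where "y p = T1 p - 1"
definition gg where "gg p = (Rt p)\<^sup>2 + (R p)\<^sup>2 * (T1 p)\<^sup>2 + (Zt p)\<^sup>2 - \<rho>\<^sup>2"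
definition g12 where "g12 p = Rt p * Rz p + (R p)\<^sup>2 * T1 p * T2 p + Zt p * Zz p"
definition g22 where "g22 p = (Rz p)\<^sup>2 + (R p)\<^sup>2 * (T2 p)\<^sup>2 + (Zz p)\<^sup>2"
definition b where "b p = Rzz p - R p * (T2 p)\<^sup>2"
definition n where "n p = excess a h \<rho> (R p) (Rt p) (Rz p) (Rzz p) (T1 p) (T2 p) (Zt p) (Zz p) (Ztt p)"
definition N where "N = I n"

lemma cont1: "continuous_on S R" "continuous_on S Rt" "continuous_on S Rz" "continuous_on S Rzz"
  "continuous_on S Rtt" "continuous_on S T1" "continuous_on S T2" "continuous_on S Zz" "continuous_on S Zt" "continuous_on S Ztt"
  using R W cont0 unfolding C1_theta_def C1_z_def by (meson continuous_on_subset subset_UNIV)+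

lemma cont2: "continuous_on S x" "continuous_on S y" "continuous_on S gg" "continuous_on S g12" "continuous_on S g22" "continuous_on S b"
  unfolding x_def[abs_def] y_def[abs_def] gg_def[abs_def] g12_def[abs_def] g22_def[abs_def] b_def[abs_def]
  by (intro continuous_on_add continuous_on_diff continuous_on_mult continuous_on_power continuous_on_const cont1)+

lemma n_eq: "n p = 2 * a * (x p * (T1 p)\<^sup>2 + (y p)\<^sup>2) + 2 * (\<rho>\<^sup>2 - 1) * (Zt p)\<^sup>2 + h\<^sup>2 * (Ztt p)\<^sup>2
     + (gg p)\<^sup>2 + 2 * (g12 p)\<^sup>2 + (g22 p - 1)\<^sup>2 + h\<^sup>2 * (b p)\<^sup>2"
  by (simp add: n_def excess_def x_def y_def gg_def g12_def g22_def b_def)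

lemma cont3: "continuous_on S n"
  unfolding n_eq[abs_def]
  by (intro continuous_on_add continuous_on_diff continuous_on_mult continuous_on_power continuous_on_const cont1 cont2)

lemma a_pos: "a > 0" "\<rho>\<^sup>2 - 1 \<ge> 0" "a \<le> (\<rho>\<^sup>2 - 1) + h\<^sup>2"
  using params by (auto simp: a_def one_le_power less_max_iff_disj)

lemma x_nonneg: "x p \<ge> 0"
  using bounds(1) by (simp add: x_def)

lemma n_parts:
  "2 * a * (x p * (T1 p)\<^sup>2 + (y p)\<^sup>2) \<le> n p" "(gg p)\<^sup>2 \<le> n p" "2 * (g12 p)\<^sup>2 \<le> n p" "(g22 p - 1)\<^sup>2 \<le> n p"
  "h\<^sup>2 * (b p)\<^sup>2 \<le> n p" "2 * (\<rho>\<^sup>2 - 1) * (Zt p)\<^sup>2 + h\<^sup>2 * (Ztt p)\<^sup>2 \<le> n p" "0 \<le> n p"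
proof -
  have "0 \<le> 2 * a * (x p * (T1 p)\<^sup>2 + (y p)\<^sup>2)" "0 \<le> 2 * (\<rho>\<^sup>2 - 1) * (Zt p)\<^sup>2" "0 \<le> h\<^sup>2 * (Ztt p)\<^sup>2"
    "0 \<le> (gg p)\<^sup>2" "0 \<le> 2 * (g12 p)\<^sup>2" "0 \<le> (g22 p - 1)\<^sup>2" "0 \<le> h\<^sup>2 * (b p)\<^sup>2"
    using a_pos x_nonneg[of p] by simp_all
  then show "2 * a * (x p * (T1 p)\<^sup>2 + (y p)\<^sup>2) \<le> n p" "(gg p)\<^sup>2 \<le> n p" "2 * (g12 p)\<^sup>2 \<le> n p" "(g22 p - 1)\<^sup>2 \<le> n p"
  "h\<^sup>2 * (b p)\<^sup>2 \<le> n p" "2 * (\<rho>\<^sup>2 - 1) * (Zt p)\<^sup>2 + h\<^sup>2 * (Ztt p)\<^sup>2 \<le> n p" "0 \<le> n p"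
    unfolding n_eq by linarith+
qed

lemma LOI: "continuous_on UNIV f \<Longrightarrow> integrable LO (f :: real \<times> real \<Rightarrow> real)"
  by (rule continuous_LO_integrable)

text \<open>The terms of \<open>dens_ge_excess\<close> that are linear in \<open>T1 - 1\<close> and
  \<open>Rtt\<close> integrate to 0.\<close>

lemma energy_ge:
  "I (\<lambda>p. dens h (R p) (Rt p) (Rz p) (Rtt p) (Rzz p) (T1 p) (T2 p) (Zt p) (Zz p) (Ztt p)) \<ge> 2 * pi * ((\<rho>\<^sup>2 - 1)\<^sup>2 + \<rho>\<^sup>2 * h\<^sup>2) + N"
proof -
  define k1 k2 k3 where "k1 = (\<rho>\<^sup>2 - 1)\<^sup>2 + \<rho>\<^sup>2 * h\<^sup>2" and "k2 = 4 * \<rho>\<^sup>2 * (\<rho>\<^sup>2 - 1) + 4 * \<rho>\<^sup>2 * h\<^sup>2" and "k3 = 2 * \<rho> * h\<^sup>2"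
  have i: "integrable LO T1" "integrable LO Rtt" "integrable LO n" by (rule LOI cont1 cont3)+
  have "I (\<lambda>p. (k1 - k2) + k2 * T1 p - k3 * Rtt p + n p) \<le> I (\<lambda>p. dens h (R p) (Rt p) (Rz p) (Rtt p) (Rzz p) (T1 p) (T2 p) (Zt p) (Zz p) (Ztt p))"
  proof (rule LO_mono)
    show "continuous_on UNIV (\<lambda>p. (k1 - k2) + k2 * T1 p - k3 * Rtt p + n p)"
      by (intro continuous_on_add continuous_on_diff continuous_on_mult continuous_on_const cont1 cont3)
    show "continuous_on UNIV (\<lambda>p. dens h (R p) (Rt p) (Rz p) (Rtt p) (Rzz p) (T1 p) (T2 p) (Zt p) (Zz p) (Ztt p))"
      unfolding dens_def by (intro continuous_on_add continuous_on_diff continuous_on_mult continuous_on_power continuous_on_const cont1)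
    show "(k1 - k2) + k2 * T1 p - k3 * Rtt p + n p \<le> dens h (R p) (Rt p) (Rz p) (Rtt p) (Rzz p) (T1 p) (T2 p) (Zt p) (Zz p) (Ztt p)" for p
      using dens_ge_excess[OF params(1) bounds(1)[of p] a_pos(3), where Rt = "Rt p" and Rz = "Rz p" and Rtt = "Rtt p"
          and Rzz = "Rzz p" and ?T1.0 = "T1 p" and ?T2.0 = "T2 p" and Zt = "Zt p" and Zz = "Zz p" and Ztt = "Ztt p"]
      unfolding n_def k1_def[symmetric] k2_def[symmetric] k3_def[symmetric] by (simp add: right_diff_distrib)
  qed
  moreover have "I (\<lambda>p. (k1 - k2) + k2 * T1 p - k3 * Rtt p + n p) = 2 * pi * (k1 - k2) + k2 * I T1 - k3 * I Rtt + I n"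
    using i LO_const[of "k1 - k2"] by simp
  ultimately show ?thesis using means by (simp add: N_def k1_def algebra_simps)
qed

lemma N_nonneg: "N \<ge> 0"
  unfolding N_def by (rule integral_nonneg_AE) (simp add: n_parts(7))

text \<open>The part \<open>\<rho>\<^sup>2 - 1\<close> of \<open>a\<close> is controlled directly, the
  part \<open>h\<^sup>2\<close> by the bending term and Poincare's inequality on the circles \<open>z =
  const\<close>.\<close>

lemma Zt_bound: "a * I (\<lambda>p. (Zt p)\<^sup>2) \<le> 4 * pi\<^sup>2 * N"
proof -
  have c: "continuous_on UNIV (\<lambda>p. (Zt p)\<^sup>2)" "continuous_on UNIV (\<lambda>p. (Ztt p)\<^sup>2)" "continuous_on UNIV (\<lambda>p. (2 * pi)\<^sup>2 * (Ztt p)\<^sup>2)"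
    by (intro continuous_on_power continuous_on_mult continuous_on_const cont1)+
  have "I (\<lambda>p. (Zt p)\<^sup>2) \<le> I (\<lambda>p. (2 * pi)\<^sup>2 * (Ztt p)\<^sup>2)"
  proof (rule LO_le_slices_theta[OF c(1,3)])
    fix t :: real
    have "integral {0..2 * pi} (\<lambda>s. (Zt (s, t))\<^sup>2) \<le> (2 * pi - 0)\<^sup>2 * integral {0..2 * pi} (\<lambda>s. (Ztt (s, t))\<^sup>2)"
    proof (rule poincare)
      show "((\<lambda>s. W (s, t)) has_real_derivative Zt (s, t)) (at s)" "((\<lambda>s. Zt (s, t)) has_real_derivative Ztt (s, t)) (at s)" for s
        using W by (simp_all add: C1_theta_def)
      show "continuous_on UNIV (\<lambda>s. Ztt (s, t))" by (rule slice_cont(2)) (rule cont1)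
      show "W (0, t) = W (2 * pi, t)" using W(3)[unfolded periodic_def, rule_format, of 0 t] by simp
    qed simp
    then show "integral {0..2 * pi} (\<lambda>s. (Zt (s, t))\<^sup>2) \<le> integral {0..2 * pi} (\<lambda>s. (2 * pi)\<^sup>2 * (Ztt (s, t))\<^sup>2)"
      by simp
  qed
  then have P: "I (\<lambda>p. (Zt p)\<^sup>2) \<le> 4 * pi\<^sup>2 * I (\<lambda>p. (Ztt p)\<^sup>2)" by (simp add: power_mult_distrib)
  define U V where "U = I (\<lambda>p. (Zt p)\<^sup>2)" and "V = I (\<lambda>p. (Ztt p)\<^sup>2)"
  have U0: "U \<ge> 0" unfolding U_def by simp
  have "I (\<lambda>p. 2 * (\<rho>\<^sup>2 - 1) * (Zt p)\<^sup>2 + h\<^sup>2 * (Ztt p)\<^sup>2) \<le> N"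
    unfolding N_def by (rule LO_mono[OF _ cont3 n_parts(6)]) (intro continuous_on_add continuous_on_mult continuous_on_const c)
  then have "2 * (\<rho>\<^sup>2 - 1) * U + h\<^sup>2 * V \<le> N"
    using LOI[OF c(1)] LOI[OF c(2)] by (simp add: U_def V_def)
  then have 1: "4 * pi\<^sup>2 * (2 * (\<rho>\<^sup>2 - 1) * U + h\<^sup>2 * V) \<le> 4 * pi\<^sup>2 * N" by (intro mult_left_mono) auto
  have "a * U \<le> ((\<rho>\<^sup>2 - 1) + h\<^sup>2) * U" using a_pos(3) U0 by (rule mult_right_mono)
  also have "\<dots> = 1 * ((\<rho>\<^sup>2 - 1) * U) + h\<^sup>2 * U" by (simp add: algebra_simps)
  also have "\<dots> \<le> (4 * pi\<^sup>2 * 2) * ((\<rho>\<^sup>2 - 1) * U) + h\<^sup>2 * (4 * pi\<^sup>2 * V)"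
  proof -
    have "1 \<le> 4 * pi\<^sup>2 * 2" using pi_gt3 power_mono[of 3 pi 2] by simp
    then show ?thesis using P a_pos(2) U0 by (intro add_mono mult_right_mono mult_left_mono) (auto simp: U_def V_def)
  qed
  also have "\<dots> = 4 * pi\<^sup>2 * (2 * (\<rho>\<^sup>2 - 1) * U + h\<^sup>2 * V)" by (simp add: algebra_simps)
  finally show ?thesis unfolding U_def[symmetric] using 1 by linarith
qed

definition K where "K = \<rho>0 + 1 + 16 * m"

text \<open>If the radius were large at the origin, it would exceed \<open>\<rho>0 + 1\<close>
  everywhere. As \<open>T1\<close> has mean 1, the azimuthal metric would then be too large on average.\<close>

lemma R_le_K:
  assumes N: "N \<le> 1" and p: "p \<in> Omega"
  shows "R p \<le> K"
proof -
  have "R (0, 0) \<le> 8 * m + \<rho>0 + 1"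
  proof (rule ccontr)
    assume "\<not> R (0, 0) \<le> 8 * m + \<rho>0 + 1"
    then have big: "\<rho>0 + 1 \<le> R q" if "q \<in> Omega" for q using C1_oscillation[OF R(1,2) bounds(2,3) params(7) that] by linarith
    have pt: "(\<rho>0 + 1)\<^sup>2 * (2 * T1 q - 1) \<le> (\<rho>\<^sup>2 + 1/2) + n q / 2" if q: "q \<in> Omega" for q
    proof -
      have "2 * T1 q - 1 \<le> (T1 q)\<^sup>2" using zero_le_power2[of "T1 q - 1"] by (simp add: power2_diff)
      then have "(\<rho>0 + 1)\<^sup>2 * (2 * T1 q - 1) \<le> (\<rho>0 + 1)\<^sup>2 * (T1 q)\<^sup>2" by (intro mult_left_mono) auto
      also have "\<dots> \<le> (R q)\<^sup>2 * (T1 q)\<^sup>2" using big[OF q] params by (intro mult_right_mono power_mono) auto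
      also have "\<dots> \<le> \<rho>\<^sup>2 + gg q" by (simp add: gg_def)
      also have "\<dots> \<le> \<rho>\<^sup>2 + (1 + (gg q)\<^sup>2) / 2"
        using zero_le_power2[of "gg q - 1"] by (simp add: power2_diff)
      finally show ?thesis using n_parts(2)[of q] unfolding add_divide_distrib by linarith
    qed
    have "I (\<lambda>q. (\<rho>0 + 1)\<^sup>2 * (2 * T1 q - 1)) \<le> I (\<lambda>q. (\<rho>\<^sup>2 + 1/2) + n q / 2)"
    proof (rule LO_mono[OF _ _ pt])
      show "continuous_on UNIV (\<lambda>q. (\<rho>0 + 1)\<^sup>2 * (2 * T1 q - 1))"
        by (intro continuous_on_diff continuous_on_mult continuous_on_const cont1)
      show "continuous_on UNIV (\<lambda>q. (\<rho>\<^sup>2 + 1/2) + n q / 2)"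
        using continuous_on_add[OF continuous_on_const[of _ "\<rho>\<^sup>2 + 1/2"] continuous_on_mult[OF continuous_on_const[of _ "1/2"] cont3]] by simp
    qed
    moreover have "I (\<lambda>q. (\<rho>0 + 1)\<^sup>2 * (2 * T1 q - 1)) = (\<rho>0 + 1)\<^sup>2 * (2 * pi)"
      using LOI[OF cont1(6)] means(2) LO_const[of 1] by simp
    moreover have "I (\<lambda>q. (\<rho>\<^sup>2 + 1/2) + n q / 2) = 2 * pi * (\<rho>\<^sup>2 + 1/2) + N / 2"
      using LOI[OF cont3] LO_const[of "\<rho>\<^sup>2 + 1/2"] by (simp add: N_def)
    ultimately have "(\<rho>0 + 1)\<^sup>2 * (2 * pi) \<le> 2 * pi * (\<rho>\<^sup>2 + 1/2) + 1/2" using N by linarith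
    also have "\<dots> \<le> 2 * pi * (\<rho>\<^sup>2 + 1)" using pi_gt3 by (simp add: algebra_simps)
    finally have "(\<rho>0 + 1)\<^sup>2 \<le> \<rho>\<^sup>2 + 1" by (simp add: mult.commute)
    moreover have "\<rho>\<^sup>2 \<le> \<rho>0\<^sup>2" using params by (intro power_mono) auto
    ultimately show False using params by (simp add: power2_sum)
  qed
  then show ?thesis using C1_oscillation[OF R(1,2) bounds(2,3) params(7) p] unfolding K_def by linarith
qed

text \<open>The part of the axial shortening that is not due to the slope \<open>R\<^sub>z\<close>.\<close>

definition Gm where "Gm p = \<bar>g22 p - 1\<bar> + 6 * (g12 p)\<^sup>2 + 6 * m\<^sup>2 * (Zt p)\<^sup>2 + 2 * K\<^sup>2 * m\<^sup>2 * (y p)\<^sup>2"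

lemma cont_Gm: "continuous_on S Gm"
  unfolding Gm_def[abs_def]
  by (intro continuous_on_add continuous_on_diff continuous_on_mult continuous_on_power continuous_on_const continuous_on_rabs cont1 cont2)

text \<open>Where \<open>0 \<le> Zz \<le> 1\<close> one has \<open>1 - Zz \<le> 1 - Zz\<^sup>2\<close>.
  The twist \<open>R\<^sup>2 T2\<^sup>2\<close> is estimated through the shear: multiplied by
  \<open>T1\<^sup>2\<close> it is controlled by \<open>(R\<^sup>2 T1 T2)\<^sup>2\<close>, in which the
  other terms of \<open>g12\<close> are moved to the right-hand side, and \<open>T1\<close> can be far
  from 1 only at the expense of \<open>(T1 - 1)\<^sup>2\<close>.\<close>

lemma compression_pointwise:
  assumes RK: "R p \<le> K"
  shows "1 - Zz p \<le> Gm p + (1 + 6 * m\<^sup>2) * (Rz p)\<^sup>2"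
proof -
  define Q where "Q = (R p)\<^sup>2 * (T2 p)\<^sup>2"
  have Q0: "Q \<ge> 0" by (simp add: Q_def)
  have R1: "1 \<le> R p" using bounds(1)[of p] params by linarith
  have 1: "1 - Zz p \<le> \<bar>g22 p - 1\<bar> + (Rz p)\<^sup>2 + Q"
  proof (cases "Zz p \<le> 1")
    case True
    have "(Zz p)\<^sup>2 \<le> Zz p" using True bounds(6)[of p] by (simp add: power2_eq_square mult_left_le)
    then show ?thesis unfolding g22_def Q_def by linarith
  next
    case False then show ?thesis using Q0 zero_le_power2[of "Rz p"] by linarith
  qed
  have 2: "Q \<le> 6 * (g12 p)\<^sup>2 + 6 * m\<^sup>2 * (Rz p)\<^sup>2 + 6 * m\<^sup>2 * (Zt p)\<^sup>2 + 2 * K\<^sup>2 * m\<^sup>2 * (y p)\<^sup>2"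
  proof -
    have "1 \<le> 2 * (T1 p)\<^sup>2 + 2 * (y p)\<^sup>2"
      using zero_le_power2[of "2 * T1 p - 1"] by (simp add: y_def power2_eq_square algebra_simps)
    then have "Q * 1 \<le> Q * (2 * (T1 p)\<^sup>2 + 2 * (y p)\<^sup>2)" using Q0 by (rule mult_left_mono)
    then have A: "Q \<le> 2 * (Q * (T1 p)\<^sup>2) + 2 * (Q * (y p)\<^sup>2)" by (simp add: distrib_left mult.left_commute)
    have "Q \<le> K\<^sup>2 * m\<^sup>2" unfolding Q_def
      using RK R1 bounds(4)[of p] by (intro mult_mono power_mono power2_le_iff_abs_le[THEN iffD2]) (use params in auto)
    then have B: "Q * (y p)\<^sup>2 \<le> (K\<^sup>2 * m\<^sup>2) * (y p)\<^sup>2" by (intro mult_right_mono) auto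
    define u v w where "u = g12 p" and "v = Rt p * Rz p" and "w = Zt p * Zz p"
    have "(R p)\<^sup>2 * T1 p * T2 p = u - v - w" by (simp add: u_def v_def w_def g12_def)
    then have "(R p)\<^sup>2 * (Q * (T1 p)\<^sup>2) = (u - v - w)\<^sup>2"
      unfolding Q_def by (metis (no_types, opaque_lifting) power2_eq_square power_mult_distrib mult.assoc mult.commute)
    moreover have "(u - v - w)\<^sup>2 \<le> 3 * (u\<^sup>2 + v\<^sup>2 + w\<^sup>2)"
      using zero_le_power2[of "u + v"] zero_le_power2[of "u + w"] zero_le_power2[of "v - w"]
      by (simp add: power2_eq_square algebra_simps)
    moreover have "1 * (Q * (T1 p)\<^sup>2) \<le> (R p)\<^sup>2 * (Q * (T1 p)\<^sup>2)"
      using R1 Q0 by (intro mult_right_mono) (auto simp: one_le_power)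
    moreover have "v\<^sup>2 \<le> m\<^sup>2 * (Rz p)\<^sup>2" unfolding v_def power_mult_distrib
      using bounds(2)[of p] params by (intro mult_right_mono power2_le_iff_abs_le[THEN iffD2]) auto
    moreover have "w\<^sup>2 \<le> m\<^sup>2 * (Zt p)\<^sup>2" unfolding w_def power_mult_distrib mult.commute[of "(Zt p)\<^sup>2"]
      using bounds(5)[of p] params by (intro mult_right_mono power2_le_iff_abs_le[THEN iffD2]) auto
    ultimately have C: "Q * (T1 p)\<^sup>2 \<le> 3 * (g12 p)\<^sup>2 + 3 * (m\<^sup>2 * (Rz p)\<^sup>2) + 3 * (m\<^sup>2 * (Zt p)\<^sup>2)"
      unfolding u_def by (simp add: distrib_left)
    show ?thesis using A B C by (simp add: mult.assoc)
  qed
  show ?thesis using 1 2 unfolding Gm_def by (simp add: algebra_simps)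
qed

text \<open>With this threshold the constants collected in the estimate of \<open>Gm\<close> below add up
  to 1.\<close>

definition c1 where "c1 = 1 / (7 + 240 * m\<^sup>2 + K\<^sup>2 * m\<^sup>2)"

text \<open>Lines with \<open>\<integral> Rz\<^sup>2 < c0 * lam\<close> leave half of the compression
  \<open>lam\<close> to \<open>Gm\<close>.\<close>

definition c0 where "c0 = 1 / (2 * (1 + 6 * m\<^sup>2))"

definition c2 where "c2 = min (c0 ^ 5 / 4) (c0 / (4 + m\<^sup>2))"

lemma csts: "0 < c1" "c1 \<le> 1" "0 < c0" "c0 \<le> 1" "0 < c2" "K > 0"
proof -
  have p: "0 \<le> m\<^sup>2" "0 \<le> K\<^sup>2 * m\<^sup>2" by simp_all
  have "0 < 7 + 240 * m\<^sup>2 + K\<^sup>2 * m\<^sup>2" "1 \<le> 7 + 240 * m\<^sup>2 + K\<^sup>2 * m\<^sup>2" using p by linarith+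
  then show "0 < c1" "c1 \<le> 1" unfolding c1_def by (simp_all only: divide_le_eq_1_pos zero_less_divide_1_iff)
  show c0: "0 < c0" "c0 \<le> 1" unfolding c0_def using p(1) by (simp_all add: divide_le_eq add_pos_nonneg)
  have "4 + m\<^sup>2 > 0" using p by linarith
  then show "0 < c2" unfolding c2_def using c0 by simp
  show "K > 0" unfolding K_def using params by simp
qed

text \<open>The first-power term is absorbed by \<open>2 t \<bar>u\<bar> \<le> t\<^sup>2 +
  u\<^sup>2\<close> with \<open>t = lam / 8\<close>; the other terms are bounded by the excess, possibly
  divided by \<open>a\<close>. The bound \<open>pi / 2 * lam\<close> is a quarter of what would arise if
  \<open>Gm\<close> accounted for the whole compression.\<close>

lemma Gm_small:
  assumes N: "N \<le> c1 * lam\<^sup>2" "N \<le> c1 * (a * lam)"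
  shows "I Gm \<le> pi / 2 * lam"
proof -
  \<comment> \<open>The weight in front of the quadratic term when \<open>2 t \<bar>u\<bar> \<le> t\<^sup>2 + u\<^sup>2\<close> is used with \<open>t = lam / 8\<close>.\<close>
  define \<kappa> where "\<kappa> = 4 / lam"
  have pt: "Gm p \<le> lam / 16 + (\<kappa> + 3 + K\<^sup>2 * m\<^sup>2 / a) * n p + 6 * m\<^sup>2 * (Zt p)\<^sup>2" for p
  proof -
    have "\<bar>g22 p - 1\<bar> \<le> lam / 16 + \<kappa> * (g22 p - 1)\<^sup>2"
    proof -
      have "0 \<le> (\<bar>g22 p - 1\<bar> - lam / 8)\<^sup>2" by simp
      then have "(lam / 4) * \<bar>g22 p - 1\<bar> \<le> (g22 p - 1)\<^sup>2 + lam\<^sup>2 / 64"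
        by (simp add: power2_diff power_divide algebra_simps)
      then have "\<kappa> * ((lam / 4) * \<bar>g22 p - 1\<bar>) \<le> \<kappa> * ((g22 p - 1)\<^sup>2 + lam\<^sup>2 / 64)"
        using params by (intro mult_left_mono) (auto simp: \<kappa>_def)
      then show ?thesis using params by (simp add: \<kappa>_def power2_eq_square field_simps)
    qed
    also have "\<dots> \<le> lam / 16 + \<kappa> * n p"
      using n_parts(4)[of p] params by (intro add_left_mono mult_left_mono) (auto simp: \<kappa>_def)
    finally have A: "\<bar>g22 p - 1\<bar> \<le> lam / 16 + \<kappa> * n p" .
    have B: "6 * (g12 p)\<^sup>2 \<le> 3 * n p" using n_parts(3)[of p] by linarith
    have "0 \<le> a * (x p * (T1 p)\<^sup>2)" using a_pos x_nonneg[of p] by simp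
    then have "2 * a * (y p)\<^sup>2 \<le> n p" using n_parts(1)[of p] by (simp add: distrib_left)
    then have "K\<^sup>2 * m\<^sup>2 / a * (2 * a * (y p)\<^sup>2) \<le> K\<^sup>2 * m\<^sup>2 / a * n p"
      using a_pos by (intro mult_left_mono) auto
    then have C: "2 * K\<^sup>2 * m\<^sup>2 * (y p)\<^sup>2 \<le> K\<^sup>2 * m\<^sup>2 / a * n p" using a_pos by (simp add: field_simps)
    show ?thesis using A B C unfolding Gm_def by (simp add: distrib_right)
  qed
  define kk where "kk = \<kappa> + 3 + K\<^sup>2 * m\<^sup>2 / a"
  have c: "continuous_on UNIV (\<lambda>p. (Zt p)\<^sup>2)" by (intro continuous_on_power cont1)
  have "I Gm \<le> I (\<lambda>p. lam / 16 + kk * n p + (6 * m\<^sup>2) * (Zt p)\<^sup>2)"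
    by (rule LO_mono[OF cont_Gm], intro continuous_on_add continuous_on_mult continuous_on_const cont3 c, use pt in \<open>simp add: kk_def\<close>)
  also have "\<dots> = 2 * pi * (lam / 16) + kk * N + 6 * m\<^sup>2 * I (\<lambda>p. (Zt p)\<^sup>2)"
    using LOI[OF cont3] LOI[OF c] LO_const[of "lam / 16"] by (simp add: N_def)
  also have "\<dots> \<le> pi / 8 * lam + (4 * c1 * lam + 3 * c1 * lam + K\<^sup>2 * m\<^sup>2 * (c1 * lam)) + 240 * m\<^sup>2 * (c1 * lam)"
  proof -
    have "\<kappa> * N \<le> \<kappa> * (c1 * lam\<^sup>2)" using N(1) params by (intro mult_left_mono) (auto simp: \<kappa>_def)
    then have k1: "\<kappa> * N \<le> 4 * c1 * lam" using params by (simp add: \<kappa>_def power2_eq_square)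
    have "lam * lam \<le> lam * 1" using params by (intro mult_left_mono) auto
    then have "c1 * lam\<^sup>2 \<le> c1 * lam" using csts(1) by (intro mult_left_mono) (auto simp: power2_eq_square)
    then have k2: "3 * N \<le> 3 * c1 * lam" using N(1) by linarith
    have Na: "N / a \<le> c1 * lam" using N(2) a_pos by (simp add: divide_le_eq mult.commute mult.left_commute)
    then have "K\<^sup>2 * m\<^sup>2 * (N / a) \<le> K\<^sup>2 * m\<^sup>2 * (c1 * lam)" by (intro mult_left_mono) auto
    then have k3: "K\<^sup>2 * m\<^sup>2 / a * N \<le> K\<^sup>2 * m\<^sup>2 * (c1 * lam)" by simp
    have "I (\<lambda>p. (Zt p)\<^sup>2) \<le> 4 * pi\<^sup>2 * (N / a)" using Zt_bound a_pos by (simp add: le_divide_eq mult.commute)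
    also have "\<dots> \<le> 40 * (c1 * lam)"
    proof -
      have "pi \<le> 3.15" using pi_approx by simp
      then have "pi\<^sup>2 \<le> 3.15\<^sup>2" by (intro power_mono) auto
      then have "4 * pi\<^sup>2 \<le> 40" by (simp add: power2_eq_square)
      then show ?thesis using Na N_nonneg a_pos by (intro mult_mono) auto
    qed
    finally have "6 * m\<^sup>2 * I (\<lambda>p. (Zt p)\<^sup>2) \<le> 6 * m\<^sup>2 * (40 * (c1 * lam))" by (intro mult_left_mono) auto
    then have k4: "6 * m\<^sup>2 * I (\<lambda>p. (Zt p)\<^sup>2) \<le> 240 * m\<^sup>2 * (c1 * lam)" by simp
    have "kk * N = \<kappa> * N + 3 * N + K\<^sup>2 * m\<^sup>2 / a * N" by (simp add: kk_def distrib_right)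
    then show ?thesis using k1 k2 k3 k4 by linarith
  qed
  also have "\<dots> = pi / 8 * lam + c1 * (7 + 240 * m\<^sup>2 + K\<^sup>2 * m\<^sup>2) * lam" by (simp add: algebra_simps)
  also have "c1 * (7 + 240 * m\<^sup>2 + K\<^sup>2 * m\<^sup>2) = 1"
  proof -
    have "0 < 7 + 240 * m\<^sup>2 + K\<^sup>2 * m\<^sup>2" by (intro add_pos_nonneg) auto
    then show ?thesis by (simp add: c1_def)
  qed
  also have "pi / 8 * lam + 1 * lam \<le> pi / 2 * lam"
  proof -
    have "(pi / 8 + 1) * lam \<le> (pi / 2) * lam" using pi_gt3 params by (intro mult_right_mono) auto
    then show ?thesis by (simp add: distrib_right)
  qed
  finally show ?thesis .
qed

definition Y' where "Y' = max (a powr (4/7) * h powr (6/7) * lam powr (5/7)) (a powr (2/3) * h powr (2/3) * lam)"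

lemma Y'_pos: "Y' > 0"
  unfolding Y'_def using a_pos params by (simp add: less_max_iff_disj)

text \<open>Either the line is wrinkled and the first summand is at least 1, or \<open>Gm\<close> carries
  half of the compression and the second one is. Adding the two alternatives avoids selecting a set of
  good lines.\<close>

lemma slice_dichotomy:
  assumes RK: "\<And>p. p \<in> Omega \<Longrightarrow> R p \<le> K" and s: "s \<in> {0..2 * pi}"
  shows "1 \<le> integral J (\<lambda>t. (a * x (s, t) + h\<^sup>2 * (b (s, t))\<^sup>2) / (c2 * Y') + 2 / lam * Gm (s, t))"
proof -
  define A B D G where "A = integral J (\<lambda>t. x (s, t))" and "B = integral J (\<lambda>t. (Rz (s, t))\<^sup>2)"
    and "D = integral J (\<lambda>t. (b (s, t))\<^sup>2)" and "G = integral J (\<lambda>t. Gm (s, t))"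
  have ic: "(\<lambda>t. f (s, t)) integrable_on J" if "continuous_on UNIV f" for f :: "real \<times> real \<Rightarrow> real"
    by (intro integrable_continuous_interval slice_cont that)
  have cc: "continuous_on UNIV (\<lambda>p. (Rz p)\<^sup>2)" "continuous_on UNIV (\<lambda>p. (b p)\<^sup>2)"
    by (intro continuous_on_power cont1 cont2)+
  note i = ic[OF cont2(1)] ic[OF cc(1)] ic[OF cc(2)] ic[OF cont_Gm] ic[OF cont1(8)]
  have nn: "A \<ge> 0" "B \<ge> 0" "D \<ge> 0" "G \<ge> 0"
    unfolding A_def B_def D_def G_def
    by (rule integral_nonneg[OF i(1)], simp add: x_nonneg, rule integral_nonneg[OF i(2)], simp,
        rule integral_nonneg[OF i(3)], simp, rule integral_nonneg[OF i(4)], simp add: Gm_def)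
  have eq: "integral J (\<lambda>t. (a * x (s, t) + h\<^sup>2 * (b (s, t))\<^sup>2) / (c2 * Y') + 2 / lam * Gm (s, t))
      = (a * A + h\<^sup>2 * D) / (c2 * Y') + 2 / lam * G"
  proof -
    have "((\<lambda>t. (a * x (s, t) + h\<^sup>2 * (b (s, t))\<^sup>2) / (c2 * Y') + 2 / lam * Gm (s, t)) has_integral
      ((a * A + h\<^sup>2 * D) / (c2 * Y') + 2 / lam * G)) J"
      unfolding A_def D_def G_def
      by (intro has_integral_add has_integral_divide has_integral_mult_right integrable_integral i)
    then show ?thesis by (rule integral_unique)
  qed
  \<comment> \<open>The line is short by \<open>lam\<close>.\<close>
  have cmp: "lam \<le> G + (1 + 6 * m\<^sup>2) * B"
  proof -
    have "integral J (\<lambda>t. 1 - Zz (s, t)) \<le> integral J (\<lambda>t. Gm (s, t) + (1 + 6 * m\<^sup>2) * (Rz (s, t))\<^sup>2)"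
    proof (rule integral_le)
      show "(\<lambda>t. 1 - Zz (s, t)) integrable_on J" using integrable_diff[OF integrable_const_ivl i(5)] by simp
      show "(\<lambda>t. Gm (s, t) + (1 + 6 * m\<^sup>2) * (Rz (s, t))\<^sup>2) integrable_on J"
        by (intro integrable_add i integrable_on_mult_right)
      show "1 - Zz (s, t) \<le> Gm (s, t) + (1 + 6 * m\<^sup>2) * (Rz (s, t))\<^sup>2" if "t \<in> J" for t
        by (rule compression_pointwise[OF RK]) (use that s in \<open>simp add: Omega_def\<close>)
    qed
    moreover have "integral J (\<lambda>t. 1 - Zz (s, t)) = lam"
    proof -
      have "integral J (\<lambda>t. 1 - Zz (s, t)) = integral J (\<lambda>t. 1) - integral J (\<lambda>t. Zz (s, t))"
        by (rule integral_diff[OF integrable_const_ivl i(5)])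
      then show ?thesis using means(3)[of s] by simp
    qed
    moreover have "integral J (\<lambda>t. Gm (s, t) + (1 + 6 * m\<^sup>2) * (Rz (s, t))\<^sup>2) = G + (1 + 6 * m\<^sup>2) * B"
      unfolding G_def B_def
      by (rule integral_unique, intro has_integral_add has_integral_mult_right integrable_integral i)
    ultimately show ?thesis by simp
  qed
  have ip: "interp (\<lambda>t. x (s, t)) (\<lambda>t. Rz (s, t)) (\<lambda>t. Rzz (s, t)) (\<lambda>t. \<bar>b (s, t)\<bar>)"
  proof
    show "((\<lambda>t. x (s, t)) has_real_derivative Rz (s, t)) (at t)" for t
      unfolding x_def using DERIV_diff[of "\<lambda>t. R (s, t)" "Rz (s, t)" t UNIV "\<lambda>_. \<rho>" 0] R(2) by (simp add: C1_z_def)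
    show "((\<lambda>t. Rz (s, t)) has_real_derivative Rzz (s, t)) (at t)" for t using R(3) by (simp add: C1_z_def)
    show "continuous_on UNIV (\<lambda>t. Rzz (s, t))" by (rule slice_cont(1)[OF cont1(4)])
    show "continuous_on UNIV (\<lambda>t. \<bar>b (s, t)\<bar>)" by (intro continuous_on_rabs slice_cont(1) cont2)
    show "x (s, t + 1) = x (s, t)" for t using R(4) by (simp add: x_def periodic_def)
    show "- \<bar>b (s, t)\<bar> \<le> Rzz (s, t)" for t
    proof -
      have "0 \<le> R (s, t) * (T2 (s, t))\<^sup>2" using bounds(1)[of "(s, t)"] params by (intro mult_nonneg_nonneg) auto
      then show ?thesis by (simp add: b_def)
    qed
  qed (simp_all add: x_nonneg)
  have GN: "B ^ 5 \<le> 4 * A ^ 4 * D ^ 3" using interp.gagliardo_nirenberg[OF ip] by (simp add: A_def B_def D_def)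
  have tr: "B \<le> (2 + m\<^sup>2) / l * A + 2 * l\<^sup>2 * D" if "l > 0" for l
    using interp.truncated_interpolation[OF ip bounds(3) that] by (simp add: A_def B_def D_def)
  show ?thesis
  proof (cases "c0 * lam \<le> B")
    case True
    have "c2 * Y' \<le> a * A + h\<^sup>2 * D"
      unfolding c2_def Y'_def
      by (rule wrinkle_cost[OF a_pos(1) params(3,5) nn(1,3) csts(3,4) True GN tr])
    then have "1 \<le> (a * A + h\<^sup>2 * D) / (c2 * Y')" using csts(5) Y'_pos by simp
    moreover have "0 \<le> 2 / lam * G" using nn(4) params by simp
    ultimately show ?thesis unfolding eq by linarith
  next
    case False
    have m6: "1 + 6 * m\<^sup>2 > 0" by (simp add: add_pos_nonneg)
    then have "(1 + 6 * m\<^sup>2) * B \<le> (1 + 6 * m\<^sup>2) * (c0 * lam)" using False by (intro mult_left_mono) auto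
    also have "\<dots> = lam / 2" using m6 by (simp add: c0_def field_simps)
    finally have "lam / 2 \<le> G" using cmp by linarith
    then have "1 \<le> 2 / lam * G" using params by (simp add: field_simps)
    moreover have "0 \<le> (a * A + h\<^sup>2 * D) / (c2 * Y')" using nn a_pos csts(5) Y'_pos by simp
    ultimately show ?thesis unfolding eq by linarith
  qed
qed

text \<open>Integrated over all lines, the two alternatives add up to at least \<open>2 * pi\<close>, and
  \<open>Gm\<close> contributes at most half of it. The factor \<open>T1\<^sup>2\<close> in front of
  \<open>R - \<rho>\<close> in the excess is removed as in \<open>compression_pointwise\<close>.\<close>

lemma wrinkling_bound:
  assumes N: "N \<le> c1 * lam\<^sup>2" "N \<le> c1 * (a * lam)"
  shows "c2 / (2 + K) * Y' \<le> N"
proof -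
  have "lam\<^sup>2 \<le> 1" using params by (simp add: power_le_one)
  then have "c1 * lam\<^sup>2 \<le> 1 * 1" using csts by (intro mult_mono) auto
  then have N1: "N \<le> 1" using N(1) by simp
  note RK = R_le_K[OF N1]
  define F where "F p = (a * x p + h\<^sup>2 * (b p)\<^sup>2) / (c2 * Y') + 2 / lam * Gm p" for p
  have cF': "continuous_on UNIV (\<lambda>p. a * x p + h\<^sup>2 * (b p)\<^sup>2)"
    by (intro continuous_on_add continuous_on_mult continuous_on_power continuous_on_const cont2)
  have cF: "continuous_on UNIV F" unfolding F_def[abs_def]
    using csts(5) Y'_pos by (intro continuous_on_add continuous_on_divide continuous_on_mult continuous_on_const cont_Gm cF') auto
  have "I (\<lambda>_. 1) \<le> I F"
    by (rule LO_le_slices_z[OF continuous_on_const cF]) (use slice_dichotomy[OF RK] in \<open>simp add: F_def\<close>)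
  then have 1: "2 * pi \<le> I F" using LO_const[of 1] by simp
  have "I F = I (\<lambda>p. a * x p + h\<^sup>2 * (b p)\<^sup>2) / (c2 * Y') + 2 / lam * I Gm"
    unfolding F_def[abs_def] using LOI[OF cF'] LOI[OF cont_Gm] by simp
  moreover have "2 / lam * I Gm \<le> 2 / lam * (pi / 2 * lam)"
    using Gm_small[OF N] params by (intro mult_left_mono) auto
  ultimately have "pi \<le> I (\<lambda>p. a * x p + h\<^sup>2 * (b p)\<^sup>2) / (c2 * Y')" using 1 params by simp
  then have 2: "pi * (c2 * Y') \<le> I (\<lambda>p. a * x p + h\<^sup>2 * (b p)\<^sup>2)" using csts(5) Y'_pos by (simp add: le_divide_eq)
  have "I (\<lambda>p. a * x p + h\<^sup>2 * (b p)\<^sup>2) \<le> I (\<lambda>p. (2 + K) * n p)"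
  proof (rule LO_mono[OF cF'])
    show "continuous_on UNIV (\<lambda>p. (2 + K) * n p)" by (intro continuous_on_mult continuous_on_const cont3)
    fix p assume p: "p \<in> Omega"
    have xK: "x p \<le> K" using RK[OF p] params by (simp add: x_def)
    have "1 \<le> 2 * (T1 p)\<^sup>2 + 2 * (y p)\<^sup>2"
      using zero_le_power2[of "2 * T1 p - 1"] by (simp add: y_def power2_eq_square algebra_simps)
    then have "x p * 1 \<le> x p * (2 * (T1 p)\<^sup>2 + 2 * (y p)\<^sup>2)" using x_nonneg by (rule mult_left_mono)
    also have "\<dots> = 2 * (x p * (T1 p)\<^sup>2) + 2 * (x p * (y p)\<^sup>2)" by (simp add: algebra_simps)
    also have "\<dots> \<le> 2 * ((1 + K) * (x p * (T1 p)\<^sup>2)) + 2 * ((1 + K) * (y p)\<^sup>2)"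
    proof -
      have "1 * (x p * (T1 p)\<^sup>2) \<le> (1 + K) * (x p * (T1 p)\<^sup>2)" using csts(6) x_nonneg by (intro mult_right_mono) auto
      moreover have "x p * (y p)\<^sup>2 \<le> (1 + K) * (y p)\<^sup>2" using xK by (intro mult_right_mono) auto
      ultimately show ?thesis by linarith
    qed
    finally have "a * x p \<le> a * (2 * ((1 + K) * (x p * (T1 p)\<^sup>2)) + 2 * ((1 + K) * (y p)\<^sup>2))"
      using a_pos by (intro mult_left_mono) auto
    also have "\<dots> = (1 + K) * (2 * a * (x p * (T1 p)\<^sup>2 + (y p)\<^sup>2))" by (simp add: algebra_simps)
    also have "\<dots> \<le> (1 + K) * n p" using n_parts(1) csts(6) by (intro mult_left_mono) auto
    finally show "a * x p + h\<^sup>2 * (b p)\<^sup>2 \<le> (2 + K) * n p" using n_parts(5)[of p] by (simp add: algebra_simps)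
  qed
  then have 3: "pi * (c2 * Y') \<le> (2 + K) * N" using 2 by (simp add: N_def)
  have "1 * (c2 * Y') \<le> pi * (c2 * Y')" using csts(5) Y'_pos pi_gt3 by (intro mult_right_mono) auto
  then have "c2 * Y' \<le> (2 + K) * N" using 3 by linarith
  then show ?thesis using csts(6) by (simp add: divide_le_eq mult.commute)
qed

text \<open>If the excess is not small, it exceeds a multiple of \<open>lam\<^sup>2\<close> or of
  \<open>a * lam\<close>, hence of the target.\<close>

lemma lower_bound:
  assumes c0: "c0_one lam h \<le> a"
  shows "2 * pi * ((\<rho>\<^sup>2 - 1)\<^sup>2 + \<rho>\<^sup>2 * h\<^sup>2) + lower_const \<rho>0 m * min (lam\<^sup>2) Y'
    \<le> I (\<lambda>p. dens h (R p) (Rt p) (Rz p) (Rtt p) (Rzz p) (T1 p) (T2 p) (Zt p) (Zz p) (Ztt p))"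
proof -
  define Y where "Y = min (lam\<^sup>2) Y'"
  have Y: "Y \<ge> 0" "Y \<le> lam\<^sup>2" "Y \<le> Y'" using Y'_pos by (auto simp: Y_def)
  have Ya: "Y \<le> a * lam"
  proof -
    have "h\<^sup>2 \<le> a" by (simp add: a_def)
    then show ?thesis using target_le[OF params(3-6) a_pos(1) _ c0] by (simp add: Y_def Y'_def)
  qed
  have ck: "0 \<le> c2 / (2 + K)" using csts by simp
  have "min c1 (c2 / (2 + K)) * Y \<le> N"
  proof (cases "N \<le> c1 * lam\<^sup>2 \<and> N \<le> c1 * (a * lam)")
    case True
    have "min c1 (c2 / (2 + K)) * Y \<le> c2 / (2 + K) * Y'"
      using Y ck by (intro mult_mono) auto
    then show ?thesis using wrinkling_bound True by linarith
  next
    case False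
    have "min c1 (c2 / (2 + K)) * Y \<le> c1 * lam\<^sup>2" "min c1 (c2 / (2 + K)) * Y \<le> c1 * (a * lam)"
      using Y Ya csts by (auto intro!: mult_mono)
    then show ?thesis using False by linarith
  qed
  moreover have "lower_const \<rho>0 m = min c1 (c2 / (2 + K))"
    by (simp add: lower_const_def c1_def c2_def c0_def K_def Let_def)
  ultimately show ?thesis using energy_ge by (simp add: Y_def)
qed

end

section \<open>From weak to smooth deformations\<close>

lemma ptests_deriv:
  assumes "(b, c) \<in> ptests"
  shows "(deriv b, c) \<in> ptests" "(b, deriv c) \<in> ptests"
  using assms by (auto simp: ptests_def smooth1_deriv deriv_periodic)

lemma ptests_test:
  assumes "(b, c) \<in> ptests"
  shows "(\<lambda>(s, t). b s * c t) \<in> periodic_tests"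
    "partials i j (\<lambda>(s, t). b s * c t) = (\<lambda>p. (deriv ^^ i) b (fst p) * (deriv ^^ j) c (snd p))"
  using assms by (auto simp: ptests_def periodic_tests_prod partials_prod)

lemma is_weak_deriv_ptests:
  fixes f g :: "real \<times> real \<Rightarrow> real"
  assumes "is_weak_deriv periodic_tests i j f g" "(b, c) \<in> ptests"
  shows "(\<integral>p. (deriv ^^ i) b (fst p) * (deriv ^^ j) c (snd p) * f p \<partial>LO)
    = (- 1) ^ (i + j) * (\<integral>p. b (fst p) * c (snd p) * g p \<partial>LO)"
  using assms(1) ptests_test[OF assms(2)] unfolding is_weak_deriv_def
  by (auto simp: case_prod_unfold dest!: bspec)

text \<open>The definition provides second derivatives of \<open>f\<close> itself. They are derivatives
  of the first derivatives because the derivative of a product test is again a product test.\<close>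

lemma H_per_pw:
  assumes f: "f \<in> H_per 2"
  obtains f1 f11 f2 f22 where "pw Theta f f1" "pw Theta f1 f11" "pw Zed f f2" "pw Zed f2 f22"
    "f1 \<in> L2" "f11 \<in> L2" "f2 \<in> L2" "f22 \<in> L2"
proof -
  have ex: "\<exists>g\<in>L2. is_weak_deriv periodic_tests i j f g" if "i + j \<le> 2" for i j
    using f that unfolding H_per_def by blast
  obtain f1 where f1: "f1 \<in> L2" "is_weak_deriv periodic_tests 1 0 f f1" using ex[of 1 0] by auto
  obtain f11 where f11: "f11 \<in> L2" "is_weak_deriv periodic_tests 2 0 f f11" using ex[of 2 0] by auto
  obtain f2 where f2: "f2 \<in> L2" "is_weak_deriv periodic_tests 0 1 f f2" using ex[of 0 1] by auto
  obtain f22 where f22: "f22 \<in> L2" "is_weak_deriv periodic_tests 0 2 f f22" using ex[of 0 2] by auto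
  have i: "integrable LO f" "integrable LO f1" "integrable LO f11" "integrable LO f2" "integrable LO f22"
    using f1 f11 f2 f22 by (auto simp: is_weak_deriv_def)
  have 1: "pw Theta f f1" unfolding pw_def pw_theta_def
    using i is_weak_deriv_ptests[OF f1(2)] by auto
  have 2: "pw Zed f f2" unfolding pw_def pw_z_def
    using i is_weak_deriv_ptests[OF f2(2)] by auto
  have "(\<integral>p. deriv b (fst p) * c (snd p) * f1 p \<partial>LO) = - (\<integral>p. b (fst p) * c (snd p) * f11 p \<partial>LO)"
    if "(b, c) \<in> ptests" for b c
    using is_weak_deriv_ptests[OF f1(2) ptests_deriv(1)[OF that]] is_weak_deriv_ptests[OF f11(2) that]
    by (simp add: numeral_2_eq_2)
  then have 3: "pw Theta f1 f11" unfolding pw_def pw_theta_def using i by auto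
  have "(\<integral>p. b (fst p) * deriv c (snd p) * f2 p \<partial>LO) = - (\<integral>p. b (fst p) * c (snd p) * f22 p \<partial>LO)"
    if "(b, c) \<in> ptests" for b c
    using is_weak_deriv_ptests[OF f2(2) ptests_deriv(2)[OF that]] is_weak_deriv_ptests[OF f22(2) that]
    by (simp add: numeral_2_eq_2)
  then have 4: "pw Zed f2 f22" unfolding pw_def pw_z_def using i by auto
  show ?thesis using that[OF 1 3 2 4] f1(1) f11(1) f2(1) f22(1) by blast
qed

lemma pw_mean_zero:
  assumes "pw Theta f g"
  shows "I g = 0"
proof -
  have c: "(\<lambda>_. 1, \<lambda>_. 1) \<in> ptests" by (simp add: ptests_def smooth1_const)
  have "(\<integral>p. deriv (\<lambda>_. 1) (fst p) * (\<lambda>_. 1) (snd p) * f p \<partial>LO) = - (\<integral>p. (\<lambda>_. 1) (fst p) * (\<lambda>_. 1) (snd p) * g p \<partial>LO)"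
    using assms c unfolding pw_def pw_theta_def by fastforce
  then show ?thesis by simp
qed

lemma Linf_norm_AE:
  assumes "Linf_norm f \<le> ereal m"
  shows "AE p in LO. \<bar>f p\<bar> \<le> m"
proof -
  have "AE p in LO. ereal \<bar>f p\<bar> \<le> esssup LO (\<lambda>p. ereal \<bar>f p\<bar>)" by (rule esssup_AE)
  then show ?thesis
  proof eventually_elim
    case (elim p)
    then have "ereal \<bar>f p\<bar> \<le> ereal m" using assms unfolding Linf_norm_def by (rule order_trans)
    then show ?case by simp
  qed
qed

lemma wd_add:
  assumes "wd D V f g" "wd D V f' g'" and D: "\<And>\<psi> \<psi>'. D \<psi> \<psi>' \<Longrightarrow> continuous_on UNIV \<psi> \<and> continuous_on UNIV \<psi>'"
  shows "wd D V (\<lambda>p. f p + f' p) (\<lambda>p. g p + g' p)"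
proof -
  have i: "integrable LO f" "integrable LO g" "integrable LO f'" "integrable LO g'"
    using assms by (auto simp: wd_def)
  have "(\<integral>p. \<psi>' p * (f p + f' p) \<partial>LO) = - (\<integral>p. \<psi> p * (g p + g' p) \<partial>LO)" if \<psi>: "D \<psi> \<psi>'" "V \<psi>" for \<psi> \<psi>'
  proof -
    have c: "continuous_on UNIV \<psi>" "continuous_on UNIV \<psi>'" using D[OF \<psi>(1)] by auto
    have e: "(\<integral>p. \<psi>' p * f p \<partial>LO) = - (\<integral>p. \<psi> p * g p \<partial>LO)" "(\<integral>p. \<psi>' p * f' p \<partial>LO) = - (\<integral>p. \<psi> p * g' p \<partial>LO)"
      using assms(1,2) \<psi> by (auto simp: wd_def)
    show ?thesis
      using e integrable_mult_cont[OF c(2) i(1)] integrable_mult_cont[OF c(2) i(3)]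
        integrable_mult_cont[OF c(1) i(2)] integrable_mult_cont[OF c(1) i(4)]
      by (simp add: distrib_left)
  qed
  then show ?thesis using i by (auto simp: wd_def)
qed

lemma C1_affine:
  "C1 Theta (\<lambda>p. \<alpha> * fst p + \<beta> * snd p + c) (\<lambda>_. \<alpha>)" "C1 Zed (\<lambda>p. \<alpha> * fst p + \<beta> * snd p + c) (\<lambda>_. \<beta>)"
  unfolding C1_iff line_def coord_def
  by (auto intro!: continuous_intros derivative_eq_intros)

lemma vec3_eq: "(vector [x, y, z] :: real^3) = x *\<^sub>R axis 1 1 + y *\<^sub>R axis 2 1 + z *\<^sub>R axis 3 1"
  by (simp add: vec_eq_iff forall_3 axis_def)

text \<open>A combination of scalar weak derivatives with constant basis vectors.\<close>

lemma is_weak_deriv_vec3: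
  fixes f1 f2 f3 g1 g2 g3 :: "real \<times> real \<Rightarrow> real"
  assumes w: "is_weak_deriv T i j f1 g1" "is_weak_deriv T i j f2 g2" "is_weak_deriv T i j f3 g3"
    and T: "\<And>\<phi>. \<phi> \<in> T \<Longrightarrow> smooth \<phi>"
  shows "is_weak_deriv T i j (\<lambda>p. vector [f1 p, f2 p, f3 p] :: real^3) (\<lambda>p. vector [g1 p, g2 p, g3 p])"
proof -
  have i: "integrable LO f1" "integrable LO f2" "integrable LO f3" "integrable LO g1" "integrable LO g2" "integrable LO g3"
    using w by (auto simp: is_weak_deriv_def)
  have vi: "integrable LO (\<lambda>p. vector [f p, g p, k p] :: real^3)"
    and ve: "(\<integral>p. \<phi> p *\<^sub>R (vector [f p, g p, k p] :: real^3) \<partial>LO) =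
      vector [\<integral>p. \<phi> p * f p \<partial>LO, \<integral>p. \<phi> p * g p \<partial>LO, \<integral>p. \<phi> p * k p \<partial>LO]"
    if fi: "integrable LO f" "integrable LO g" "integrable LO k" and \<phi>: "continuous_on UNIV \<phi>" for f g k \<phi>
  proof -
    show "integrable LO (\<lambda>p. vector [f p, g p, k p] :: real^3)"
      unfolding vec3_eq using fi by (intro Bochner_Integration.integrable_add integrable_scaleR_left)
    note m = integrable_mult_cont[OF \<phi> fi(1)] integrable_mult_cont[OF \<phi> fi(2)] integrable_mult_cont[OF \<phi> fi(3)]
    show "(\<integral>p. \<phi> p *\<^sub>R (vector [f p, g p, k p] :: real^3) \<partial>LO) =
      vector [\<integral>p. \<phi> p * f p \<partial>LO, \<integral>p. \<phi> p * g p \<partial>LO, \<integral>p. \<phi> p * k p \<partial>LO]"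
      unfolding vec3_eq scaleR_add_right scaleR_scaleR
      using m by (simp add: integrable_scaleR_left)
  qed
  show ?thesis
    unfolding is_weak_deriv_def
  proof (intro conjI ballI)
    show "integrable LO (\<lambda>p. vector [f1 p, f2 p, f3 p] :: real^3)" "integrable LO (\<lambda>p. vector [g1 p, g2 p, g3 p] :: real^3)"
      using vi[OF i(1-3) continuous_on_const[of _ 0]] vi[OF i(4-6) continuous_on_const[of _ 0]] .
    fix \<phi> assume \<phi>: "\<phi> \<in> T"
    have c: "continuous_on UNIV (partials i j \<phi>)" "continuous_on UNIV \<phi>"
      using smooth_C1(1)[OF T[OF \<phi>], of i j] smooth_C1(1)[OF T[OF \<phi>], of 0 0] by simp_all
    have e: "(\<integral>p. partials i j \<phi> p * f1 p \<partial>LO) = (- 1) ^ (i + j) * (\<integral>p. \<phi> p * g1 p \<partial>LO)"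
      "(\<integral>p. partials i j \<phi> p * f2 p \<partial>LO) = (- 1) ^ (i + j) * (\<integral>p. \<phi> p * g2 p \<partial>LO)"
      "(\<integral>p. partials i j \<phi> p * f3 p \<partial>LO) = (- 1) ^ (i + j) * (\<integral>p. \<phi> p * g3 p \<partial>LO)"
      using w \<phi> by (simp_all add: is_weak_deriv_def)
    show "(\<integral>p. partials i j \<phi> p *\<^sub>R (vector [f1 p, f2 p, f3 p] :: real^3) \<partial>LO)
      = (- 1) ^ (i + j) *\<^sub>R (\<integral>p. \<phi> p *\<^sub>R (vector [g1 p, g2 p, g3 p] :: real^3) \<partial>LO)"
      unfolding ve[OF i(1-3) c(1)] ve[OF i(4-6) c(2)] e
      by (simp add: vec_eq_iff forall_3)
  qed
qed

lemma interior_weak_deriv_vec3: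
  fixes f1 f2 f3 g1 g2 g3 :: "real \<times> real \<Rightarrow> real"
  assumes "is_weak_deriv interior_tests i j f1 g1" "is_weak_deriv interior_tests i j f2 g2" "is_weak_deriv interior_tests i j f3 g3"
  shows "is_weak_deriv interior_tests i j (\<lambda>p. vector [f1 p, f2 p, f3 p] :: real^3) (\<lambda>p. vector [g1 p, g2 p, g3 p])"
  by (rule is_weak_deriv_vec3[OF assms]) (simp add: interior_tests_def)

lemma norm_vec3: "(norm (vector [x, y, z] :: real^3))\<^sup>2 = x\<^sup>2 + y\<^sup>2 + z\<^sup>2"
  by (simp add: norm_vec_def L2_set_def sum_3)

lemma inner_vec3: "(vector [x, y, z] :: real^3) \<bullet> vector [x', y', z'] = x * x' + y * y' + z * z'"
  by (simp add: inner_vec_def sum_3)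

lemma metric_norm:
  fixes u v :: "real^3"
  defines "G \<equiv> transpose (vector [u, v]) :: real^2^3"
  shows "(norm (transpose G ** G - mat 1))\<^sup>2 = (u \<bullet> u - 1)\<^sup>2 + 2 * (u \<bullet> v)\<^sup>2 + (v \<bullet> v - 1)\<^sup>2"
proof -
  have e: "(transpose G ** G) $ i $ j = (vector [u, v] :: real^3^2) $ i \<bullet> (vector [u, v] :: real^3^2) $ j" for i j
    by (simp add: G_def transpose_transpose matrix_matrix_mult_def inner_vec_def transpose_def)
  have n: "(norm (A :: real^2^2))\<^sup>2 = (A$1$1)\<^sup>2 + (A$1$2)\<^sup>2 + (A$2$1)\<^sup>2 + (A$2$2)\<^sup>2" for A
    by (simp add: norm_vec_def L2_set_def sum_2 real_sqrt_pow2 add_nonneg_nonneg)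
  show ?thesis
    unfolding n by (simp add: e mat_def inner_commute[of v u])
qed

text \<open>A rotation about the vertical axis, from the moving cylindrical frame to Cartesian
  coordinates.\<close>

lemma rotated_inner:
  fixes c s :: real
  assumes "s\<^sup>2 + c\<^sup>2 = 1"
  shows "(vector [a * c - b * s, a * s + b * c, z] :: real^3) \<bullet> vector [a' * c - b' * s, a' * s + b' * c, z']
     = a * a' + b * b' + z * z'"
proof -
  have "(a * c - b * s) * (a' * c - b' * s) + (a * s + b * c) * (a' * s + b' * c) = (a * a' + b * b') * (s\<^sup>2 + c\<^sup>2)"
    by (simp add: power2_eq_square algebra_simps)
  then show ?thesis by (simp add: inner_vec3 assms)
qed

text \<open>In the moving frame the derivatives of the Cartesian deformation have the components
  displayed in \<open>dens\<close>; the tangential ones \<open>q1\<close> and \<open>q2\<close>, the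
  mixed derivative \<open>w\<close> and \<open>Zzz\<close> contribute nonnegative squares.\<close>

lemma density_ge_dens:
  assumes u: "u = vector [Rt * cos T - R * T1 * sin T, Rt * sin T + R * T1 * cos T, Zt]"
    and v: "v = vector [Rz * cos T - R * T2 * sin T, Rz * sin T + R * T2 * cos T, Zz]"
    and uu: "uu = vector [(Rtt - R * T1\<^sup>2) * cos T - q1 * sin T, (Rtt - R * T1\<^sup>2) * sin T + q1 * cos T, Ztt]"
    and vv: "vv = vector [(Rzz - R * T2\<^sup>2) * cos T - q2 * sin T, (Rzz - R * T2\<^sup>2) * sin T + q2 * cos T, Zzz]"
  shows "dens h R Rt Rz Rtt Rzz T1 T2 Zt Zz Ztt \<le>
     (norm (transpose (transpose (vector [u, v]) :: real^2^3) ** transpose (vector [u, v]) - mat 1))\<^sup>2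
     + h\<^sup>2 * ((norm (uu :: real^3))\<^sup>2 + 2 * (norm (w :: real^3))\<^sup>2 + (norm (vv :: real^3))\<^sup>2)"
proof -
  note r = rotated_inner[OF sin_cos_squared_add]
  have "u \<bullet> u = Rt\<^sup>2 + R\<^sup>2 * T1\<^sup>2 + Zt\<^sup>2" "u \<bullet> v = Rt * Rz + R\<^sup>2 * T1 * T2 + Zt * Zz" "v \<bullet> v = Rz\<^sup>2 + R\<^sup>2 * T2\<^sup>2 + Zz\<^sup>2"
    unfolding u v r by (simp_all add: power2_eq_square algebra_simps)
  moreover have "(norm uu)\<^sup>2 = (Rtt - R * T1\<^sup>2)\<^sup>2 + q1\<^sup>2 + Ztt\<^sup>2" "(norm vv)\<^sup>2 = (Rzz - R * T2\<^sup>2)\<^sup>2 + q2\<^sup>2 + Zzz\<^sup>2"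
    unfolding power2_norm_eq_inner uu vv r by (simp_all add: power2_eq_square)
  moreover have "h\<^sup>2 * ((Rtt - R * T1\<^sup>2)\<^sup>2 + Ztt\<^sup>2 + (Rzz - R * T2\<^sup>2)\<^sup>2) \<le>
     h\<^sup>2 * (((Rtt - R * T1\<^sup>2)\<^sup>2 + q1\<^sup>2 + Ztt\<^sup>2) + 2 * (norm w)\<^sup>2 + ((Rzz - R * T2\<^sup>2)\<^sup>2 + q2\<^sup>2 + Zzz\<^sup>2))"
    using zero_le_power2[of q1] zero_le_power2[of q2] zero_le_power2[of Zzz] zero_le_power2[of "norm w"]
    by (intro mult_left_mono) (linarith, simp)
  ultimately show ?thesis unfolding metric_norm dens_def by simp
qed

text \<open>Second derivatives enter at most quadratically, everything else is bounded. This is the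
  domination used to pass to the limit.\<close>

lemma dens_bound:
  fixes \<beta> :: real
  assumes \<beta>: "1 \<le> \<beta>" and b: "\<bar>R\<bar> \<le> \<beta>" "\<bar>Rt\<bar> \<le> \<beta>" "\<bar>Rz\<bar> \<le> \<beta>" "\<bar>T1\<bar> \<le> \<beta>" "\<bar>T2\<bar> \<le> \<beta>" "\<bar>Zt\<bar> \<le> \<beta>" "\<bar>Zz\<bar> \<le> \<beta>"
  shows "0 \<le> dens h R Rt Rz Rtt Rzz T1 T2 Zt Zz Ztt"
    "dens h R Rt Rz Rtt Rzz T1 T2 Zt Zz Ztt \<le> (50 * \<beta> ^ 8 + 4 * h\<^sup>2 * \<beta> ^ 6) + h\<^sup>2 * (2 * Rtt\<^sup>2 + Ztt\<^sup>2 + 2 * Rzz\<^sup>2)"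
proof -
  show "0 \<le> dens h R Rt Rz Rtt Rzz T1 T2 Zt Zz Ztt" unfolding dens_def by (intro add_nonneg_nonneg mult_nonneg_nonneg) auto
  have p2: "\<beta>\<^sup>2 \<le> \<beta> ^ 4" "1 \<le> \<beta> ^ 4" using \<beta> by (auto intro: power_increasing simp: one_le_power)
  have prod: "\<bar>x * y\<bar> \<le> \<beta>\<^sup>2" if "\<bar>x\<bar> \<le> \<beta>" "\<bar>y\<bar> \<le> \<beta>" for x y
    unfolding abs_mult power2_eq_square using that by (intro mult_mono) auto
  have quad: "\<bar>(x * y) * (z * w)\<bar> \<le> \<beta> ^ 4" if "\<bar>x\<bar> \<le> \<beta>" "\<bar>y\<bar> \<le> \<beta>" "\<bar>z\<bar> \<le> \<beta>" "\<bar>w\<bar> \<le> \<beta>" for x y z w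
  proof -
    have "\<bar>x * y\<bar> * \<bar>z * w\<bar> \<le> \<beta>\<^sup>2 * \<beta>\<^sup>2" using prod[OF that(1,2)] prod[OF that(3,4)] by (intro mult_mono) auto
    then show ?thesis by (simp add: abs_mult power_add[symmetric])
  qed
  have sq: "x\<^sup>2 \<le> k\<^sup>2" if "\<bar>x\<bar> \<le> k" for x k :: real
    using that by (metis abs_ge_zero power2_abs power_mono)
  have b2: "0 \<le> x\<^sup>2" "x\<^sup>2 \<le> \<beta> ^ 4" if "\<bar>x\<bar> \<le> \<beta>" for x
    using order_trans[OF sq[OF that] p2(1)] by simp_all
  have b4: "0 \<le> R\<^sup>2 * x\<^sup>2" "R\<^sup>2 * x\<^sup>2 \<le> \<beta> ^ 4" if "\<bar>x\<bar> \<le> \<beta>" for x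
    using quad[OF b(1) b(1) that that] by (simp_all add: power2_eq_square)
  have A: "(Rt\<^sup>2 + R\<^sup>2 * T1\<^sup>2 + Zt\<^sup>2 - 1)\<^sup>2 \<le> (4 * \<beta> ^ 4)\<^sup>2"
    using b2[OF b(2)] b4[OF b(4)] b2[OF b(6)] p2 by (intro sq abs_leI) linarith+
  have B: "(Rt * Rz + R\<^sup>2 * T1 * T2 + Zt * Zz)\<^sup>2 \<le> (3 * \<beta> ^ 4)\<^sup>2"
  proof (rule sq)
    have e: "R\<^sup>2 * T1 * T2 = (R * R) * (T1 * T2)" by (simp add: power2_eq_square)
    have "\<bar>R\<^sup>2 * T1 * T2\<bar> \<le> \<beta> ^ 4" unfolding e by (rule quad[OF b(1) b(1) b(4) b(5)])
    then show "\<bar>Rt * Rz + R\<^sup>2 * T1 * T2 + Zt * Zz\<bar> \<le> 3 * \<beta> ^ 4"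
      using prod[OF b(2) b(3)] prod[OF b(6) b(7)] p2(1) by linarith
  qed
  have C: "(Rz\<^sup>2 + R\<^sup>2 * T2\<^sup>2 + Zz\<^sup>2 - 1)\<^sup>2 \<le> (4 * \<beta> ^ 4)\<^sup>2"
    using b2[OF b(3)] b4[OF b(5)] b2[OF b(7)] p2 by (intro sq abs_leI) linarith+
  have D: "(X - R * Y\<^sup>2)\<^sup>2 \<le> 2 * X\<^sup>2 + 2 * \<beta> ^ 6" if Y: "\<bar>Y\<bar> \<le> \<beta>" for X Y
  proof -
    have "\<bar>R\<bar> * \<bar>Y * Y\<bar> \<le> \<beta> * \<beta>\<^sup>2" using b(1) prod[OF Y Y] \<beta> by (intro mult_mono) auto
    then have "\<bar>R * Y\<^sup>2\<bar> \<le> \<beta> ^ 3" by (simp add: abs_mult power2_eq_square power3_eq_cube)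
    then have "(R * Y\<^sup>2)\<^sup>2 \<le> (\<beta> ^ 3)\<^sup>2" by (rule sq)
    then have "(R * Y\<^sup>2)\<^sup>2 \<le> \<beta> ^ 6" by (simp flip: power_mult)
    moreover have "(X - R * Y\<^sup>2)\<^sup>2 \<le> 2 * X\<^sup>2 + 2 * (R * Y\<^sup>2)\<^sup>2"
      using zero_le_power2[of "X + R * Y\<^sup>2"] by (simp add: power2_diff power2_sum)
    ultimately show ?thesis by linarith
  qed
  have E: "h\<^sup>2 * ((Rtt - R * T1\<^sup>2)\<^sup>2 + Ztt\<^sup>2 + (Rzz - R * T2\<^sup>2)\<^sup>2) \<le> h\<^sup>2 * ((2 * Rtt\<^sup>2 + 2 * \<beta> ^ 6) + Ztt\<^sup>2 + (2 * Rzz\<^sup>2 + 2 * \<beta> ^ 6))"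
    by (intro mult_left_mono add_mono D b) auto
  have e8: "(4 * \<beta> ^ 4)\<^sup>2 = 16 * \<beta> ^ 8" "(3 * \<beta> ^ 4)\<^sup>2 = 9 * \<beta> ^ 8" by (simp_all add: power_mult_distrib flip: power_mult)
  show "dens h R Rt Rz Rtt Rzz T1 T2 Zt Zz Ztt \<le> (50 * \<beta> ^ 8 + 4 * h\<^sup>2 * \<beta> ^ 6) + h\<^sup>2 * (2 * Rtt\<^sup>2 + Ztt\<^sup>2 + 2 * Rzz\<^sup>2)"
    using A B C E unfolding dens_def e8 by (simp add: algebra_simps)
qed

lemma moll_oscillation:
  assumes R: "pw Theta R R1" "pw Zed R R2"
    and B: "AE p in LO. \<bar>R1 p\<bar> \<le> m" "AE p in LO. \<bar>R2 p\<bar> \<le> m" and m: "1 \<le> m"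
    and p: "p \<in> Omega"
  shows "\<bar>moll n R p - moll n R (0, 0)\<bar> \<le> 8 * m"
proof (rule C1_oscillation[OF _ _ _ _ m p])
  show "C1_theta (moll n R) (moll n R1)" "C1_z (moll n R) (moll n R2)"
    using C1_moll(1)[OF R(1)] C1_moll(1)[OF R(2)] by (simp_all add: C1_def)
  show "\<bar>moll n R1 q\<bar> \<le> m" "\<bar>moll n R2 q\<bar> \<le> m" for q
    by (rule moll_abs_le[OF C1_moll(3)[OF R(1)] B(1)] moll_abs_le[OF C1_moll(3)[OF R(2)] B(2)])+
qed

text \<open>The bounded gradient controls the oscillation; the mean value is that of \<open>R\<close>.\<close>

lemma moll_uniformly_bounded:
  assumes R: "pw Theta R R1" "pw Zed R R2"
    and B: "AE p in LO. \<bar>R1 p\<bar> \<le> m" "AE p in LO. \<bar>R2 p\<bar> \<le> m" and m: "1 \<le> m"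
    and p: "p \<in> Omega"
  shows "\<bar>moll n R p\<bar> \<le> 16 * m + \<bar>I R\<bar>"
proof -
  have i: "integrable LO R" using R by (auto dest: C1_moll)
  define v where "v = moll n R (0, 0)"
  have "\<bar>I (\<lambda>p. moll n R p - v)\<bar> \<le> I (\<lambda>p. \<bar>moll n R p - v\<bar>)" by (rule integral_abs_bound)
  also have "\<dots> \<le> I (\<lambda>p. 8 * m)"
  proof (rule integral_mono_AE)
    show "AE p in LO. \<bar>moll n R p - v\<bar> \<le> 8 * m"
      using AE_LO_Omega by eventually_elim (use moll_oscillation[OF R B m] in \<open>simp add: v_def\<close>)
  qed (use moll_integrable[OF i, of n] in auto)
  also have "\<dots> = 2 * pi * (8 * m)" by (rule LO_const)
  finally have "\<bar>I R - 2 * pi * v\<bar> \<le> 2 * pi * (8 * m)"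
    using moll_integrable[OF i, of n] by (simp add: moll_integral[OF i] measure_LO)
  then have "\<bar>2 * pi * v\<bar> \<le> 2 * pi * (8 * m) + \<bar>I R\<bar>" by linarith
  also have "\<dots> \<le> 2 * pi * (8 * m) + 2 * pi * \<bar>I R\<bar>"
    using pi_gt3 mult_right_mono[of 1 "2 * pi" "\<bar>I R\<bar>"] by simp
  also have "\<dots> = 2 * pi * (8 * m + \<bar>I R\<bar>)" by (simp add: algebra_simps)
  finally have "2 * pi * \<bar>v\<bar> \<le> 2 * pi * (8 * m + \<bar>I R\<bar>)" by (simp add: abs_mult)
  then have "\<bar>v\<bar> \<le> 8 * m + \<bar>I R\<bar>" by (subst (asm) mult_le_cancel_left_pos) simp_all
  then show ?thesis using moll_oscillation[OF R B m p, of n] by (simp add: v_def)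
qed

lemma essentially_bounded:
  assumes R: "pw Theta R R1" "pw Zed R R2"
    and B: "AE p in LO. \<bar>R1 p\<bar> \<le> m" "AE p in LO. \<bar>R2 p\<bar> \<le> m" and m: "1 \<le> m"
  shows "AE p in LO. \<bar>R p\<bar> \<le> 16 * m + \<bar>I R\<bar>"
proof -
  have i: "integrable LO R" using R by (auto dest: C1_moll)
  obtain r :: "nat \<Rightarrow> nat" where r: "strict_mono r" "\<And>f. f \<in> {R} \<Longrightarrow> AE p in LO. (\<lambda>n. moll (r n) f p) \<longlonglongrightarrow> f p"
    using moll_AE_subseq[of "{R}"] i by auto
  have "AE p in LO. (\<lambda>n. moll (r n) R p) \<longlonglongrightarrow> R p" using r(2) by simp
  then show ?thesis using AE_LO_Omega
  proof eventually_elim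
    case (elim p)
    have "(\<lambda>n. \<bar>moll (r n) R p\<bar>) \<longlonglongrightarrow> \<bar>R p\<bar>" using elim(1) by (rule tendsto_rabs)
    then show ?case
      by (rule LIMSEQ_le_const2) (use moll_uniformly_bounded[OF R B m elim(2)] in auto)
  qed
qed

text \<open>Fatou's lemma for \<open>dn - en \<ge> 0\<close>: as the integrals of the dominating
  functions do not change, a lower bound for those of \<open>en\<close> is an upper bound for those of
  the differences.\<close>

lemma integral_lower_limit:
  fixes e d :: "real \<times> real \<Rightarrow> real" and en dn :: "nat \<Rightarrow> real \<times> real \<Rightarrow> real"
  assumes en: "\<And>n. integrable LO (en n)" and dn: "\<And>n. integrable LO (dn n)"
    and e: "e \<in> borel_measurable LO" and d: "integrable LO d"
    and le: "\<And>n. AE p in LO. en n p \<le> dn n p" and nn: "AE p in LO. 0 \<le> e p" and ed: "AE p in LO. e p \<le> d p"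
    and conv: "AE p in LO. (\<lambda>n. en n p) \<longlonglongrightarrow> e p" "AE p in LO. (\<lambda>n. dn n p) \<longlonglongrightarrow> d p"
    and D: "\<And>n. I (dn n) = I d" and L: "\<And>n. L \<le> I (en n)"
  shows "ennreal L \<le> (\<integral>\<^sup>+p. ennreal (e p) \<partial>LO)"
proof -
  have ei: "integrable LO e"
    by (rule Bochner_Integration.integrable_bound[OF d e]) (use nn ed in \<open>eventually_elim, simp\<close>)
  have dL: "L \<le> I d"
  proof -
    have "I (en 0) \<le> I (dn 0)" by (rule integral_mono_AE[OF en dn le])
    then show ?thesis using L[of 0] D[of 0] by linarith
  qed
  have "ennreal (I (\<lambda>p. d p - e p)) = (\<integral>\<^sup>+p. ennreal (d p - e p) \<partial>LO)"
    by (rule nn_integral_eq_integral[symmetric]) (use d ei ed in \<open>auto elim: eventually_mono\<close>)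
  also have "\<dots> = (\<integral>\<^sup>+p. liminf (\<lambda>n. ennreal (dn n p - en n p)) \<partial>LO)"
  proof (rule nn_integral_cong_AE)
    show "AE p in LO. ennreal (d p - e p) = liminf (\<lambda>n. ennreal (dn n p - en n p))"
      using conv
    proof eventually_elim
      case (elim p)
      have "(\<lambda>n. ennreal (dn n p - en n p)) \<longlonglongrightarrow> ennreal (d p - e p)"
        by (intro tendsto_ennrealI tendsto_diff elim)
      then show ?case using lim_imp_Liminf[OF sequentially_bot] by metis
    qed
  qed
  also have "\<dots> \<le> liminf (\<lambda>n. \<integral>\<^sup>+p. ennreal (dn n p - en n p) \<partial>LO)"
    using en dn by (intro nn_integral_liminf) auto
  also have "\<dots> \<le> liminf (\<lambda>n::nat. ennreal (I d - L))"
  proof (rule Liminf_mono, rule always_eventually, rule allI)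
    fix n
    have "(\<integral>\<^sup>+p. ennreal (dn n p - en n p) \<partial>LO) = ennreal (I (\<lambda>p. dn n p - en n p))"
      by (rule nn_integral_eq_integral) (use dn en le[of n] in \<open>auto elim: eventually_mono\<close>)
    also have "\<dots> \<le> ennreal (I d - L)"
      using dn[of n] en[of n] D[of n] L[of n] by (intro ennreal_leI) simp
    finally show "(\<integral>\<^sup>+p. ennreal (dn n p - en n p) \<partial>LO) \<le> ennreal (I d - L)" .
  qed
  also have "\<dots> = ennreal (I d - L)" by (simp add: Liminf_const)
  finally have "ennreal (I d - I e) \<le> ennreal (I d - L)" using d ei by simp
  then have "L \<le> I e" using dL by (simp add: ennreal_le_iff)
  moreover have "(\<integral>\<^sup>+p. ennreal (e p) \<partial>LO) = ennreal (I e)" by (rule nn_integral_eq_integral[OF ei nn])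
  ultimately show ?thesis by (simp add: ennreal_leI)
qed

text \<open>The mollified components satisfy all hypotheses of \<open>smooth_shell\<close>: the kernel is
  nonnegative with mass 1, so pointwise bounds survive. Their density is dominated by a constant plus
  mollified squares of second derivatives (Jensen), and mollification preserves the integrals of these
  dominating functions.\<close>

lemma weak_lower_bound:
  fixes R R1 R11 R2 R22 S S1 S2 W W1 W11 W2 :: "real \<times> real \<Rightarrow> real"
  assumes params: "1 \<le> \<rho>" "\<rho> \<le> \<rho>0" "0 < h" "h \<le> 1/2" "0 < lam" "lam \<le> 1/2" "1 \<le> m"
    and c0: "c0_one lam h \<le> max (\<rho>\<^sup>2 - 1) (h\<^sup>2)"
    and R: "pw Theta R R1" "pw Theta R1 R11" "pw Zed R R2" "pw Zed R2 R22"
    and S: "pw Theta S S1" "pw Zed S S2"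
    and W: "pw Theta W W1" "pw Theta W1 W11" "pw Zed W W2"
    and sq: "integrable LO (\<lambda>p. (R11 p)\<^sup>2)" "integrable LO (\<lambda>p. (R22 p)\<^sup>2)" "integrable LO (\<lambda>p. (W11 p)\<^sup>2)"
    and b: "AE p in LO. \<rho> \<le> R p" "AE p in LO. \<bar>R1 p\<bar> \<le> m" "AE p in LO. \<bar>R2 p\<bar> \<le> m" "AE p in LO. \<bar>S1 p + 1\<bar> \<le> m"
      "AE p in LO. \<bar>S2 p\<bar> \<le> m" "AE p in LO. \<bar>W1 p\<bar> \<le> m" "AE p in LO. \<bar>W2 p + (1 - lam)\<bar> \<le> m" "AE p in LO. 0 \<le> W2 p + (1 - lam)"
  shows "ennreal (2 * pi * ((\<rho>\<^sup>2 - 1)\<^sup>2 + \<rho>\<^sup>2 * h\<^sup>2) + lower_const \<rho>0 m * min (lam\<^sup>2)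
      (max (max (\<rho>\<^sup>2 - 1) (h\<^sup>2) powr (4/7) * h powr (6/7) * lam powr (5/7)) (max (\<rho>\<^sup>2 - 1) (h\<^sup>2) powr (2/3) * h powr (2/3) * lam)))
    \<le> (\<integral>\<^sup>+p. ennreal (dens h (R p) (R1 p) (R2 p) (R11 p) (R22 p) (S1 p + 1) (S2 p) (W1 p) (W2 p + (1 - lam)) (W11 p)) \<partial>LO)"
    (is "ennreal ?L \<le> _")
proof -
  note i = C1_moll(2,3)[OF R(1)] C1_moll(3)[OF R(2)] C1_moll(3)[OF R(3)] C1_moll(3)[OF R(4)]
    C1_moll(3)[OF S(1)] C1_moll(3)[OF S(2)] C1_moll(2,3)[OF W(1)] C1_moll(3)[OF W(2)] C1_moll(3)[OF W(3)]
  \<comment> \<open>One constant that bounds \<open>R\<close>, its mollifications and all first derivatives.\<close>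
  define \<beta> where "\<beta> = 16 * m + \<bar>I R\<bar>"
  have \<beta>: "1 \<le> \<beta>" "m \<le> \<beta>" using params by (auto simp: \<beta>_def)
  define F where "F = {R, R1, R11, R2, R22, S1, S2, W1, W11, W2, \<lambda>p. (R11 p)\<^sup>2, \<lambda>p. (R22 p)\<^sup>2, \<lambda>p. (W11 p)\<^sup>2}"
  obtain r :: "nat \<Rightarrow> nat" where r: "strict_mono r" "\<And>f. f \<in> F \<Longrightarrow> AE p in LO. (\<lambda>n. moll (r n) f p) \<longlonglongrightarrow> f p"
    using moll_AE_subseq[of F] i sq by (auto simp: F_def)
  define en where "en n p = dens h (moll (r n) R p) (moll (r n) R1 p) (moll (r n) R2 p) (moll (r n) R11 p) (moll (r n) R22 p)
     (moll (r n) S1 p + 1) (moll (r n) S2 p) (moll (r n) W1 p) (moll (r n) W2 p + (1 - lam)) (moll (r n) W11 p)" for n p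
  define e where "e p = dens h (R p) (R1 p) (R2 p) (R11 p) (R22 p) (S1 p + 1) (S2 p) (W1 p) (W2 p + (1 - lam)) (W11 p)" for p
  define \<kappa> where "\<kappa> = 50 * \<beta> ^ 8 + 4 * h\<^sup>2 * \<beta> ^ 6"
  define dn where "dn n p = \<kappa> + h\<^sup>2 * (2 * moll (r n) (\<lambda>p. (R11 p)\<^sup>2) p + moll (r n) (\<lambda>p. (W11 p)\<^sup>2) p + 2 * moll (r n) (\<lambda>p. (R22 p)\<^sup>2) p)" for n p
  define d where "d p = \<kappa> + h\<^sup>2 * (2 * (R11 p)\<^sup>2 + (W11 p)\<^sup>2 + 2 * (R22 p)\<^sup>2)" for p
  have mS: "moll n (\<lambda>p. S1 p + 1) p = moll n S1 p + 1" "moll n (\<lambda>p. W2 p + (1 - lam)) p = moll n W2 p + (1 - lam)" for n p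
    using moll_add[OF i(6) LO.integrable_const, of n 1 p] moll_add[OF i(11) LO.integrable_const, of n "1 - lam" p] by simp_all
  have cm: "continuous_on UNIV (moll n R)" "continuous_on UNIV (moll n R1)" "continuous_on UNIV (moll n R2)" "continuous_on UNIV (moll n R11)"
    "continuous_on UNIV (moll n R22)" "continuous_on UNIV (moll n S1)" "continuous_on UNIV (moll n S2)" "continuous_on UNIV (moll n W1)"
    "continuous_on UNIV (moll n W2)" "continuous_on UNIV (moll n W11)" for n
    by (rule moll_cont i)+
  have is1: "integrable LO (\<lambda>p. S1 p + 1)" "integrable LO (\<lambda>p. W2 p + (1 - lam))" using i by auto
  have bn: "\<bar>moll n R1 p\<bar> \<le> m" "\<bar>moll n R2 p\<bar> \<le> m" "\<bar>moll n S1 p + 1\<bar> \<le> m" "\<bar>moll n S2 p\<bar> \<le> m" "\<bar>moll n W1 p\<bar> \<le> m"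
    "\<bar>moll n W2 p + (1 - lam)\<bar> \<le> m" "\<rho> \<le> moll n R p" "0 \<le> moll n W2 p + (1 - lam)" for n p
  proof -
    show "\<bar>moll n R1 p\<bar> \<le> m" "\<bar>moll n R2 p\<bar> \<le> m" "\<bar>moll n S2 p\<bar> \<le> m" "\<bar>moll n W1 p\<bar> \<le> m"
      by (rule moll_abs_le[OF i(2) b(2)] moll_abs_le[OF i(4) b(3)] moll_abs_le[OF i(7) b(5)] moll_abs_le[OF i(9) b(6)])+
    show "\<bar>moll n S1 p + 1\<bar> \<le> m" "\<bar>moll n W2 p + (1 - lam)\<bar> \<le> m"
      using moll_abs_le[OF is1(1) b(4)] moll_abs_le[OF is1(2) b(7)] unfolding mS .
    have "moll n (\<lambda>_. \<rho>) p \<le> moll n R p" by (rule moll_mono[OF _ i(1) b(1)]) simp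
    then show "\<rho> \<le> moll n R p" by simp
    have "moll n (\<lambda>_. 0) p \<le> moll n (\<lambda>p. W2 p + (1 - lam)) p" by (rule moll_mono[OF _ is1(2) b(8)]) simp
    then show "0 \<le> moll n W2 p + (1 - lam)" unfolding mS by simp
  qed
  have shell: "smooth_shell (moll n R) (moll n R1) (moll n R2) (moll n R11) (moll n R22) (\<lambda>p. moll n S1 p + 1) (moll n S2)
     (moll n W) (moll n W1) (moll n W11) (\<lambda>p. moll n W2 p + (1 - lam)) \<rho> \<rho>0 h lam m" for n
  proof
    show "C1_theta (moll n R) (moll n R1)" "C1_z (moll n R) (moll n R2)" "C1_z (moll n R2) (moll n R22)"
      "C1_theta (moll n W) (moll n W1)" "C1_theta (moll n W1) (moll n W11)"
      using C1_moll(1)[OF R(1), of n] C1_moll(1)[OF R(3), of n] C1_moll(1)[OF R(4), of n] C1_moll(1)[OF W(1), of n] C1_moll(1)[OF W(2), of n]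
      by (simp_all add: C1_def)
    show "periodic (moll n R)" "periodic (moll n W)" by (rule moll_periodic)+
    show "I (moll n R11) = 0" using moll_integral[OF i(3)] pw_mean_zero[OF R(2)] by simp
    show "I (\<lambda>p. moll n S1 p + 1) = 2 * pi"
      using moll_integrable[OF i(6), of n] moll_integral[OF i(6), of n] pw_mean_zero[OF S(1)] LO_const[of 1] by simp
    show "integral J (\<lambda>t. moll n W2 (s, t) + (1 - lam)) = 1 - lam" for s
    proof -
      have "((\<lambda>t. moll n W2 (s, t)) has_integral (moll n W (s, 1/2) - moll n W (s, - 1/2))) J"
        using moll_DERIV(2)[of W W2 n s] W(3)
        by (intro fundamental_theorem_of_calculus)
           (auto simp: pw_def has_real_derivative_iff_has_vector_derivative[symmetric] intro: has_field_derivative_at_within)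
      moreover have "moll n W (s, - 1/2 + 1) = moll n W (s, - 1/2)"
        using moll_periodic[of n W] unfolding periodic_def by blast
      ultimately have "((\<lambda>t. moll n W2 (s, t)) has_integral 0) J" by simp
      then have "((\<lambda>t. moll n W2 (s, t) + (1 - lam)) has_integral (0 + (1/2 - (- 1/2)) *\<^sub>R (1 - lam))) J"
        by (intro has_integral_add) (use has_integral_const_real[of "1 - lam" "- 1/2" "1/2"] in simp_all)
      then show ?thesis by (simp add: integral_unique)
    qed
  qed (use params bn cm in \<open>auto intro: continuous_on_add\<close>)
  have enc: "continuous_on UNIV (en n)" for n
    unfolding en_def[abs_def] dens_def
    by (intro continuous_on_add continuous_on_diff continuous_on_mult continuous_on_power continuous_on_const cm)
  have L: "?L \<le> I (en n)" for n
    using smooth_shell.lower_bound[OF shell[of "r n"]] c0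
    unfolding smooth_shell.a_def[OF shell] smooth_shell.Y'_def[OF shell] en_def[abs_def] by simp
  have Rb: "AE p in LO. \<bar>R p\<bar> \<le> \<beta>" unfolding \<beta>_def by (rule essentially_bounded[OF R(1,3) b(2,3) params(7)])
  have Rnb: "\<bar>moll n R p\<bar> \<le> \<beta>" if "p \<in> Omega" for n p
    unfolding \<beta>_def by (rule moll_uniformly_bounded[OF R(1,3) b(2,3) params(7) that])
  have up: "\<And>x. \<bar>x\<bar> \<le> m \<Longrightarrow> \<bar>x\<bar> \<le> \<beta>" using \<beta>(2) by linarith
  have le: "AE p in LO. en n p \<le> dn n p" for n
    using AE_LO_Omega
  proof eventually_elim
    case (elim p)
    have "en n p \<le> \<kappa> + h\<^sup>2 * (2 * (moll (r n) R11 p)\<^sup>2 + (moll (r n) W11 p)\<^sup>2 + 2 * (moll (r n) R22 p)\<^sup>2)"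
      unfolding en_def \<kappa>_def by (intro dens_bound(2) \<beta>(1) Rnb elim up bn)
    also have "\<dots> \<le> dn n p"
      unfolding dn_def using moll_square_le[OF i(3) sq(1)] moll_square_le[OF i(10) sq(3)] moll_square_le[OF i(5) sq(2)]
      by (intro add_left_mono mult_left_mono add_mono) auto
    finally show ?case .
  qed
  have bb: "AE p in LO. 0 \<le> e p \<and> e p \<le> d p"
    using Rb b(2) b(3) b(4) b(5) b(6) b(7)
  proof eventually_elim
    case (elim p)
    note db = dens_bound[OF \<beta>(1) elim(1) up[OF elim(2)] up[OF elim(3)] up[OF elim(4)] up[OF elim(5)] up[OF elim(6)] up[OF elim(7)],
        of h "R11 p" "R22 p" "W11 p"]
    show ?case using db unfolding e_def d_def \<kappa>_def by simp
  qed
  have conve: "AE p in LO. (\<lambda>n. en n p) \<longlonglongrightarrow> e p"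
  proof -
    have c: "AE p in LO. (\<lambda>n. moll (r n) R p) \<longlonglongrightarrow> R p" "AE p in LO. (\<lambda>n. moll (r n) R1 p) \<longlonglongrightarrow> R1 p"
      "AE p in LO. (\<lambda>n. moll (r n) R2 p) \<longlonglongrightarrow> R2 p" "AE p in LO. (\<lambda>n. moll (r n) R11 p) \<longlonglongrightarrow> R11 p"
      "AE p in LO. (\<lambda>n. moll (r n) R22 p) \<longlonglongrightarrow> R22 p" "AE p in LO. (\<lambda>n. moll (r n) S1 p) \<longlonglongrightarrow> S1 p"
      "AE p in LO. (\<lambda>n. moll (r n) S2 p) \<longlonglongrightarrow> S2 p" "AE p in LO. (\<lambda>n. moll (r n) W1 p) \<longlonglongrightarrow> W1 p"
      "AE p in LO. (\<lambda>n. moll (r n) W2 p) \<longlonglongrightarrow> W2 p" "AE p in LO. (\<lambda>n. moll (r n) W11 p) \<longlonglongrightarrow> W11 p"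
      by (rule r(2), simp add: F_def)+
    show ?thesis using c
    proof eventually_elim
      case (elim p)
      show ?case unfolding en_def e_def dens_def
        by (intro tendsto_add tendsto_diff tendsto_mult tendsto_power tendsto_const elim)
    qed
  qed
  have convd: "AE p in LO. (\<lambda>n. dn n p) \<longlonglongrightarrow> d p"
  proof -
    have c: "AE p in LO. (\<lambda>n. moll (r n) (\<lambda>p. (R11 p)\<^sup>2) p) \<longlonglongrightarrow> (R11 p)\<^sup>2"
      "AE p in LO. (\<lambda>n. moll (r n) (\<lambda>p. (W11 p)\<^sup>2) p) \<longlonglongrightarrow> (W11 p)\<^sup>2"
      "AE p in LO. (\<lambda>n. moll (r n) (\<lambda>p. (R22 p)\<^sup>2) p) \<longlonglongrightarrow> (R22 p)\<^sup>2"
      by (rule r(2), simp add: F_def)+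
    show ?thesis using c
    proof eventually_elim
      case (elim p)
      show ?case unfolding dn_def d_def by (intro tendsto_add tendsto_mult tendsto_const elim)
    qed
  qed
  have meas: "e \<in> borel_measurable LO"
  proof -
    have "R \<in> borel_measurable LO" "R1 \<in> borel_measurable LO" "R2 \<in> borel_measurable LO" "R11 \<in> borel_measurable LO"
      "R22 \<in> borel_measurable LO" "S1 \<in> borel_measurable LO" "S2 \<in> borel_measurable LO" "W1 \<in> borel_measurable LO"
      "W2 \<in> borel_measurable LO" "W11 \<in> borel_measurable LO"
      using i by auto
    then show ?thesis unfolding e_def[abs_def] dens_def by measurable
  qed
  note ms = moll_integrable[OF sq(1)] moll_integrable[OF sq(2)] moll_integrable[OF sq(3)]
  have "ennreal ?L \<le> (\<integral>\<^sup>+p. ennreal (e p) \<partial>LO)"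
  proof (rule integral_lower_limit[where en = en and dn = dn and d = d])
    show "integrable LO (en n)" for n by (rule continuous_LO_integrable[OF enc])
    show "integrable LO (dn n)" for n unfolding dn_def[abs_def] using ms by auto
    show "integrable LO d" unfolding d_def[abs_def] using sq by auto
    show "I (dn n) = I d" for n
      unfolding dn_def[abs_def] d_def[abs_def] using ms[of "r n"] sq by (simp add: moll_integral)
    show "AE p in LO. 0 \<le> e p" "AE p in LO. e p \<le> d p" using bb by auto
  qed (rule meas le conve convd L)+
  then show ?thesis by (simp add: e_def)
qed

lemma wd_weak_deriv_AE:
  "wd (C1 Theta) vanishing f g \<Longrightarrow> AE p in LO. weak_deriv 1 0 f p = g p"
  "wd (C1 Zed) vanishing f g \<Longrightarrow> AE p in LO. weak_deriv 0 1 f p = g p"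
  by (rule weak_deriv_AE, rule wd_is_weak_deriv(2)[OF test_class_interior], simp add: C1_def)
     (rule weak_deriv_AE, rule wd_is_weak_deriv(3)[OF test_class_interior], simp add: C1_def)

lemma chain_rule_pair:
  assumes R: "pw d R R1" "pw d R1 R11" and S: "pw d S S1" "pw d S1 S11"
    and l: "C1 d fst (\<lambda>_. \<kappa>)"
    and B: "AE p in LO. \<bar>R p\<bar> \<le> B" "AE p in LO. \<bar>R1 p\<bar> \<le> B" "AE p in LO. \<bar>S1 p\<bar> \<le> B"
  defines "T \<equiv> \<lambda>p. S p + fst p" and "T1 \<equiv> \<lambda>p. S1 p + \<kappa>"
  shows "wd (C1 d) vanishing (\<lambda>p. R p * cos (T p)) (\<lambda>p. R1 p * cos (T p) - R p * T1 p * sin (T p))"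
    and "wd (C1 d) vanishing (\<lambda>p. R1 p * cos (T p) - R p * T1 p * sin (T p))
      (\<lambda>p. (R11 p - R p * (T1 p)\<^sup>2) * cos (T p) - (2 * R1 p * T1 p + R p * S11 p) * sin (T p))"
    and "wd (C1 d) vanishing (\<lambda>p. R p * sin (T p)) (\<lambda>p. R1 p * sin (T p) + R p * T1 p * cos (T p))"
    and "wd (C1 d) vanishing (\<lambda>p. R1 p * sin (T p) + R p * T1 p * cos (T p))
      (\<lambda>p. (R11 p - R p * (T1 p)\<^sup>2) * sin (T p) + (2 * R1 p * T1 p + R p * S11 p) * cos (T p))"
proof -
  note c = chain_rule[OF R S l B]
  show "wd (C1 d) vanishing (\<lambda>p. R p * cos (T p)) (\<lambda>p. R1 p * cos (T p) - R p * T1 p * sin (T p))"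
    "wd (C1 d) vanishing (\<lambda>p. R1 p * cos (T p) - R p * T1 p * sin (T p))
      (\<lambda>p. (R11 p - R p * (T1 p)\<^sup>2) * cos (T p) - (2 * R1 p * T1 p + R p * S11 p) * sin (T p))"
    using c by (simp_all add: T_def T1_def)
  have l': "C1 d (\<lambda>p. fst p + (- (pi / 2))) (\<lambda>p. \<kappa>)"
    using C1_add[OF l C1_const[of d "- (pi / 2)"]] by simp
  have sh: "cos (x + (y + (- (pi / 2)))) = sin (x + y)" "sin (x + (y + (- (pi / 2)))) = - cos (x + y)" for x y :: real
  proof -
    have e: "x + (y + (- (pi / 2))) = (x + y) - pi / 2" by simp
    show "cos (x + (y + (- (pi / 2)))) = sin (x + y)" "sin (x + (y + (- (pi / 2)))) = - cos (x + y)"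
      unfolding e cos_diff sin_diff by simp_all
  qed
  note c' = chain_rule[OF R S l' B, unfolded sh]
  show "wd (C1 d) vanishing (\<lambda>p. R p * sin (T p)) (\<lambda>p. R1 p * sin (T p) + R p * T1 p * cos (T p))"
    "wd (C1 d) vanishing (\<lambda>p. R1 p * sin (T p) + R p * T1 p * cos (T p))
      (\<lambda>p. (R11 p - R p * (T1 p)\<^sup>2) * sin (T p) + (2 * R1 p * T1 p + R p * S11 p) * cos (T p))"
    using c' by (simp_all add: T_def T1_def)
qed

lemma cartesian_weak_deriv_AE:
  assumes w: "wd (C1 d) vanishing x x1" "wd (C1 d) vanishing y y1" "wd (C1 d) vanishing z z1"
    "wd (C1 d) vanishing x1 x11" "wd (C1 d) vanishing y1 y11" "wd (C1 d) vanishing z1 z11"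
  shows "d = Theta \<Longrightarrow> AE p in LO. weak_deriv 1 0 (\<lambda>p. vector [x p, y p, z p] :: real^3) p = vector [x1 p, y1 p, z1 p]"
    "d = Theta \<Longrightarrow> AE p in LO. weak_deriv 2 0 (\<lambda>p. vector [x p, y p, z p] :: real^3) p = vector [x11 p, y11 p, z11 p]"
    "d = Zed \<Longrightarrow> AE p in LO. weak_deriv 0 1 (\<lambda>p. vector [x p, y p, z p] :: real^3) p = vector [x1 p, y1 p, z1 p]"
    "d = Zed \<Longrightarrow> AE p in LO. weak_deriv 0 2 (\<lambda>p. vector [x p, y p, z p] :: real^3) p = vector [x11 p, y11 p, z11 p]"
proof -
  note W = wd_is_weak_deriv[OF test_class_interior]
  show "AE p in LO. weak_deriv 1 0 (\<lambda>p. vector [x p, y p, z p] :: real^3) p = vector [x1 p, y1 p, z1 p]" if "d = Theta"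
  proof (rule weak_deriv_AE, rule interior_weak_deriv_vec3)
    have e: "C1 d = C1_theta" using that by (simp add: C1_def)
    show "is_weak_deriv interior_tests 1 0 x x1" "is_weak_deriv interior_tests 1 0 y y1" "is_weak_deriv interior_tests 1 0 z z1"
      using w unfolding e by (blast intro: W(2))+
  qed
  show "AE p in LO. weak_deriv 2 0 (\<lambda>p. vector [x p, y p, z p] :: real^3) p = vector [x11 p, y11 p, z11 p]" if "d = Theta"
  proof (rule weak_deriv_AE, rule interior_weak_deriv_vec3)
    have e: "C1 d = C1_theta" using that by (simp add: C1_def)
    show "is_weak_deriv interior_tests 2 0 x x11" "is_weak_deriv interior_tests 2 0 y y11" "is_weak_deriv interior_tests 2 0 z z11"
      using w unfolding e by (blast intro: W(4))+
  qed
  show "AE p in LO. weak_deriv 0 1 (\<lambda>p. vector [x p, y p, z p] :: real^3) p = vector [x1 p, y1 p, z1 p]" if "d = Zed"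
  proof (rule weak_deriv_AE, rule interior_weak_deriv_vec3)
    have e: "C1 d = C1_z" using that by (simp add: C1_def)
    show "is_weak_deriv interior_tests 0 1 x x1" "is_weak_deriv interior_tests 0 1 y y1" "is_weak_deriv interior_tests 0 1 z z1"
      using w unfolding e by (blast intro: W(3))+
  qed
  show "AE p in LO. weak_deriv 0 2 (\<lambda>p. vector [x p, y p, z p] :: real^3) p = vector [x11 p, y11 p, z11 p]" if "d = Zed"
  proof (rule weak_deriv_AE, rule interior_weak_deriv_vec3)
    have e: "C1 d = C1_z" using that by (simp add: C1_def)
    show "is_weak_deriv interior_tests 0 2 x x11" "is_weak_deriv interior_tests 0 2 y y11" "is_weak_deriv interior_tests 0 2 z z11"
      using w unfolding e by (blast intro: W(6))+
  qed
qed

text \<open>What remains is to recognize the weak derivatives in the energy and in the constraints as the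
  cylindrical expressions of \<open>dens\<close>.\<close>

theorem admissible_lower_bound:
  assumes params: "1 \<le> \<rho>" "\<rho> \<le> \<rho>0" "0 < h" "h \<le> 1/2" "0 < lam" "lam \<le> 1/2" "1 \<le> m"
    and c0: "c0_one lam h \<le> max (\<rho>\<^sup>2 - 1) (h\<^sup>2)"
    and \<Phi>: "\<Phi> \<in> admissible_NL lam \<rho> m"
  shows "ennreal (2 * pi * ((\<rho>\<^sup>2 - 1)\<^sup>2 + \<rho>\<^sup>2 * h\<^sup>2) + lower_const \<rho>0 m * min (lam\<^sup>2)
      (max (max (\<rho>\<^sup>2 - 1) (h\<^sup>2) powr (4/7) * h powr (6/7) * lam powr (5/7)) (max (\<rho>\<^sup>2 - 1) (h\<^sup>2) powr (2/3) * h powr (2/3) * lam)))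
    \<le> energy_NL h \<Phi>"
proof -
  define R S W where "R = comp_rho \<Phi>" and "S = (\<lambda>p. comp_theta \<Phi> p - fst p)" and "W = (\<lambda>p. comp_z \<Phi> p - (1 - lam) * snd p)"
  have per: "R \<in> H_per 2" "S \<in> H_per 2" "W \<in> H_per 2"
    using \<Phi> unfolding admissible_NL_def by (simp_all add: R_def S_def W_def case_prod_unfold)
  have cT: "comp_theta \<Phi> = (\<lambda>p. S p + fst p)" and cZ: "comp_z \<Phi> = (\<lambda>p. W p + (1 - lam) * snd p)"
    by (simp_all add: S_def W_def)
  obtain R1 R11 R2 R22 where R: "pw Theta R R1" "pw Theta R1 R11" "pw Zed R R2" "pw Zed R2 R22"
    and RL: "R1 \<in> L2" "R11 \<in> L2" "R2 \<in> L2" "R22 \<in> L2" using H_per_pw[OF per(1)] .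
  obtain S1 S11 S2 S22 where S: "pw Theta S S1" "pw Theta S1 S11" "pw Zed S S2" "pw Zed S2 S22"
    using H_per_pw[OF per(2)] by metis
  obtain W1 W11 W2 W22 where W: "pw Theta W W1" "pw Theta W1 W11" "pw Zed W W2" "pw Zed W2 W22"
    and WL: "W1 \<in> L2" "W11 \<in> L2" "W2 \<in> L2" "W22 \<in> L2" using H_per_pw[OF per(3)] .
  have sq: "integrable LO (\<lambda>p. (R11 p)\<^sup>2)" "integrable LO (\<lambda>p. (R22 p)\<^sup>2)" "integrable LO (\<lambda>p. (W11 p)\<^sup>2)"
    using RL WL by (auto simp: L2_def)
  have fs: "C1 Theta fst (\<lambda>_. 1)" "C1 Zed fst (\<lambda>_. 0)" "C1 Theta (\<lambda>p. (1 - lam) * snd p) (\<lambda>_. 0)" "C1 Zed (\<lambda>p. (1 - lam) * snd p) (\<lambda>_. 1 - lam)"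
    using C1_affine[of 1 0 0] C1_affine[of 0 "1 - lam" 0] by simp_all
  have wT: "wd (C1 Theta) vanishing (comp_theta \<Phi>) (\<lambda>p. S1 p + 1)" "wd (C1 Zed) vanishing (comp_theta \<Phi>) (\<lambda>p. S2 p + 0)"
    unfolding cT by (rule wd_add[OF pw_imp_wd[OF S(1)] C1_wd[OF fs(1)] C1_cont], assumption)
      (rule wd_add[OF pw_imp_wd[OF S(3)] C1_wd[OF fs(2)] C1_cont], assumption)
  have wZ: "wd (C1 Theta) vanishing (comp_z \<Phi>) (\<lambda>p. W1 p + 0)" "wd (C1 Zed) vanishing (comp_z \<Phi>) (\<lambda>p. W2 p + (1 - lam))"
    unfolding cZ by (rule wd_add[OF pw_imp_wd[OF W(1)] C1_wd[OF fs(3)] C1_cont], assumption)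
      (rule wd_add[OF pw_imp_wd[OF W(3)] C1_wd[OF fs(4)] C1_cont], assumption)
  have wZ2: "wd (C1 Theta) vanishing (\<lambda>p. W1 p + 0) (\<lambda>p. W11 p + 0)" "wd (C1 Zed) vanishing (\<lambda>p. W2 p + (1 - lam)) (\<lambda>p. W22 p + 0)"
    by (rule wd_add[OF pw_imp_wd[OF W(2)] C1_wd[OF C1_const] C1_cont], assumption)
      (rule wd_add[OF pw_imp_wd[OF W(4)] C1_wd[OF C1_const] C1_cont], assumption)
  have lin: "AE p in LO. \<bar>weak_deriv 1 0 f p\<bar> \<le> m" "AE p in LO. \<bar>weak_deriv 0 1 f p\<bar> \<le> m"
    if "f \<in> {comp_rho \<Phi>, comp_theta \<Phi>, comp_z \<Phi>}" for f
  proof -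
    have ln: "Linf_norm (weak_deriv 1 0 f) \<le> ereal m" "Linf_norm (weak_deriv 0 1 f) \<le> ereal m"
      using \<Phi> that unfolding admissible_NL_def mem_Collect_eq by blast+
    show "AE p in LO. \<bar>weak_deriv 1 0 f p\<bar> \<le> m" by (rule Linf_norm_AE[OF ln(1)])
    show "AE p in LO. \<bar>weak_deriv 0 1 f p\<bar> \<le> m" by (rule Linf_norm_AE[OF ln(2)])
  qed
  have tr: "AE p in LO. \<bar>g p\<bar> \<le> m" if "AE p in LO. \<bar>f p\<bar> \<le> m" "AE p in LO. f p = g p" for f g :: "real \<times> real \<Rightarrow> real"
    using that by eventually_elim simp
  have bR: "AE p in LO. \<bar>R1 p\<bar> \<le> m" "AE p in LO. \<bar>R2 p\<bar> \<le> m"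
    by (rule tr[OF lin(1)[of R]], simp add: R_def, rule wd_weak_deriv_AE(1)[OF pw_imp_wd[OF R(1)]])
       (rule tr[OF lin(2)[of R]], simp add: R_def, rule wd_weak_deriv_AE(2)[OF pw_imp_wd[OF R(3)]])
  have bS: "AE p in LO. \<bar>S1 p + 1\<bar> \<le> m" "AE p in LO. \<bar>S2 p + 0\<bar> \<le> m"
    by (rule tr[OF lin(1)[of "comp_theta \<Phi>"]], simp, rule wd_weak_deriv_AE(1)[OF wT(1)])
       (rule tr[OF lin(2)[of "comp_theta \<Phi>"]], simp, rule wd_weak_deriv_AE(2)[OF wT(2)])
  have bW: "AE p in LO. \<bar>W1 p + 0\<bar> \<le> m" "AE p in LO. \<bar>W2 p + (1 - lam)\<bar> \<le> m"
    by (rule tr[OF lin(1)[of "comp_z \<Phi>"]], simp, rule wd_weak_deriv_AE(1)[OF wZ(1)])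
       (rule tr[OF lin(2)[of "comp_z \<Phi>"]], simp, rule wd_weak_deriv_AE(2)[OF wZ(2)])
  have bR0: "AE p in LO. \<rho> \<le> R p" using \<Phi> by (simp add: admissible_NL_def R_def)
  have "AE p in LO. weak_deriv 0 1 (comp_z \<Phi>) p \<ge> 0" using \<Phi> by (simp add: admissible_NL_def)
  then have bW0: "AE p in LO. 0 \<le> W2 p + (1 - lam)" using wd_weak_deriv_AE(2)[OF wZ(2)] by eventually_elim simp
  define B where "B = 16 * m + \<bar>I R\<bar>"
  have B: "m + 1 \<le> B" using params by (simp add: B_def)
  have BR: "AE p in LO. \<bar>R p\<bar> \<le> B" unfolding B_def by (rule essentially_bounded[OF R(1,3) bR params(7)])
  have B1: "AE p in LO. \<bar>R1 p\<bar> \<le> B" using bR(1) by eventually_elim (use B in linarith)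
  have B2: "AE p in LO. \<bar>R2 p\<bar> \<le> B" using bR(2) by eventually_elim (use B in linarith)
  have B3: "AE p in LO. \<bar>S1 p\<bar> \<le> B" using bS(1) by eventually_elim (use B in linarith)
  have B4: "AE p in LO. \<bar>S2 p\<bar> \<le> B" using bS(2) by eventually_elim (use B in linarith)
  note ct = chain_rule_pair[of Theta R R1 R11 S S1 S11 1 B, OF R(1,2) S(1,2) fs(1) BR B1 B3]
  note cz = chain_rule_pair[of Zed R R2 R22 S S2 S22 0 B, OF R(3,4) S(3,4) fs(2) BR B2 B4]
  have cart: "cartesian \<Phi> = (\<lambda>p. vector [R p * cos (S p + fst p), R p * sin (S p + fst p), comp_z \<Phi> p])"
    by (simp add: fun_eq_iff cartesian_def R_def S_def)
  note A1 = cartesian_weak_deriv_AE(1)[OF ct(1) ct(3) wZ(1) ct(2) ct(4) wZ2(1) refl, folded cart]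
  note A2 = cartesian_weak_deriv_AE(2)[OF ct(1) ct(3) wZ(1) ct(2) ct(4) wZ2(1) refl, folded cart]
  note A3 = cartesian_weak_deriv_AE(3)[OF cz(1) cz(3) wZ(2) cz(2) cz(4) wZ2(2) refl, folded cart]
  note A4 = cartesian_weak_deriv_AE(4)[OF cz(1) cz(3) wZ(2) cz(2) cz(4) wZ2(2) refl, folded cart]
  have "(\<integral>\<^sup>+p. ennreal (dens h (R p) (R1 p) (R2 p) (R11 p) (R22 p) (S1 p + 1) (S2 p + 0) (W1 p + 0) (W2 p + (1 - lam)) (W11 p + 0)) \<partial>LO)
     \<le> energy_NL h \<Phi>"
    unfolding energy_NL_def
  proof (rule nn_integral_mono_AE)
    show "AE p in LO. ennreal (dens h (R p) (R1 p) (R2 p) (R11 p) (R22 p) (S1 p + 1) (S2 p + 0) (W1 p + 0) (W2 p + (1 - lam)) (W11 p + 0))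
       \<le> ennreal ((norm (transpose (grad \<Phi> p) ** grad \<Phi> p - mat 1))\<^sup>2 + h\<^sup>2 * hess_norm_sq \<Phi> p)"
      using A1 A2 A3 A4
    proof eventually_elim
      case (elim p)
      show ?case
        unfolding grad_def hess_norm_sq_def
        by (rule ennreal_leI, rule density_ge_dens[OF elim(1) elim(3) elim(2) elim(4)])
    qed
  qed
  then have e: "(\<integral>\<^sup>+p. ennreal (dens h (R p) (R1 p) (R2 p) (R11 p) (R22 p) (S1 p + 1) (S2 p) (W1 p) (W2 p + (1 - lam)) (W11 p)) \<partial>LO)
     \<le> energy_NL h \<Phi>"
    unfolding add_0_right .
  have b0: "AE p in LO. \<bar>S2 p\<bar> \<le> m" "AE p in LO. \<bar>W1 p\<bar> \<le> m" using bS(2) bW(1) unfolding add_0_right .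
  show ?thesis
    by (rule order_trans[OF weak_lower_bound[OF params c0 R S(1,3) W(1-3) sq bR0 bR bS(1) b0 bW(2) bW0] e])
qed

section \<open>Axisymmetric deformations\<close>

text \<open>Cartesian components of an axisymmetric deformation are products of \<open>cos\<close>,
  \<open>sin\<close> or 1 in \<open>\<theta>\<close> with a profile in \<open>z\<close>.\<close>

lemma wd_separable_z:
  fixes c w w' :: "real \<Rightarrow> real"
  assumes c: "continuous_on UNIV c" "\<And>s. \<bar>c s\<bar> \<le> 1"
    and w: "continuous_on UNIV w" "w' \<in> borel_measurable borel" "\<And>t. t \<in> J \<Longrightarrow> \<bar>w' t\<bar> \<le> B"
    and F: "finite F" "\<And>t. t \<in> J - F \<Longrightarrow> (w has_real_derivative w' t) (at t)"
    and V: "\<And>\<psi> s. V \<psi> \<Longrightarrow> \<psi> (s, 1/2) * w (1/2) = \<psi> (s, - 1/2) * w (- 1/2)"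
  shows "wd C1_z V (\<lambda>p. c (fst p) * w (snd p)) (\<lambda>p. c (fst p) * w' (snd p))"
proof -
  have wc: "continuous_on UNIV (\<lambda>p. c (fst p) * w (snd p))"
    by (intro continuous_on_mult continuous_on_compose2[OF c(1)] continuous_on_compose2[OF w(1)] continuous_on_fst continuous_on_snd continuous_on_id) auto
  have m: "(\<lambda>p. c (fst p)) \<in> borel_measurable borel" "(\<lambda>p. w' (snd p)) \<in> borel_measurable borel"
    using measurable_compose[OF borel_measurable_continuous_onI[OF continuous_on_fst[OF continuous_on_id]] borel_measurable_continuous_onI[OF c(1)]]
      measurable_compose[OF borel_measurable_continuous_onI[OF continuous_on_snd[OF continuous_on_id]] w(2)] by simp_all
  obtain B' where B': "\<And>p. p \<in> Omega \<Longrightarrow> norm (c (fst p) * w (snd p)) \<le> B'" using continuous_LO_bounded[OF wc] by metis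
  show ?thesis
  proof (rule wd_z_I[where B = "max B B'" and F = F])
    show "(\<lambda>p. c (fst p) * w (snd p)) \<in> borel_measurable borel" by (rule borel_measurable_continuous_onI[OF wc])
    show "(\<lambda>p. c (fst p) * w' (snd p)) \<in> borel_measurable borel" using m by measurable
    show "\<bar>c (fst p) * w (snd p)\<bar> \<le> max B B'" if "p \<in> Omega" for p using B'[OF that] by simp
    show "\<bar>c (fst p) * w' (snd p)\<bar> \<le> max B B'" if "p \<in> Omega" for p
    proof -
      have "\<bar>c (fst p)\<bar> * \<bar>w' (snd p)\<bar> \<le> 1 * B"
        using c(2)[of "fst p"] w(3)[of "snd p"] that by (intro mult_mono) (auto simp: Omega_def)
      then show ?thesis by (simp add: abs_mult)
    qed
    show "((\<lambda>x. c (fst (s, x)) * w (snd (s, x))) has_real_derivative c (fst (s, t)) * w' (snd (s, t))) (at t)" if "t \<in> {- 1 / 2..1 / 2} - F" for s t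
      using DERIV_cmult[OF F(2)[OF that], of "c s"] by simp
    show "continuous_on {- 1 / 2..1 / 2} (\<lambda>x. c (fst (s, x)) * w (snd (s, x)))" for s
      using continuous_on_mult[OF continuous_on_const continuous_on_subset[OF w(1)], of "{- 1/2..1/2}" "c s"] by simp
    show "\<psi> (s, 1 / 2) * (c (fst (s, 1 / 2)) * w (snd (s, 1 / 2))) = \<psi> (s, - 1 / 2) * (c (fst (s, - 1 / 2)) * w (snd (s, - 1 / 2)))" if "V \<psi>" for \<psi> s
      using V[OF that, of s] by (simp add: mult.left_commute)
  qed (rule F(1))
qed

lemma wd_separable_theta:
  fixes c c' w :: "real \<Rightarrow> real"
  assumes c: "\<And>s. (c has_real_derivative c' s) (at s)" "continuous_on UNIV c'" "\<And>s. \<bar>c s\<bar> \<le> 1" "\<And>s. \<bar>c' s\<bar> \<le> 1"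
    and w: "w \<in> borel_measurable borel" "\<And>t. t \<in> J \<Longrightarrow> \<bar>w t\<bar> \<le> B"
    and V: "\<And>\<psi> t. V \<psi> \<Longrightarrow> \<psi> (2 * pi, t) * c (2 * pi) = \<psi> (0, t) * c 0"
  shows "wd C1_theta V (\<lambda>p. c (fst p) * w (snd p)) (\<lambda>p. c' (fst p) * w (snd p))"
proof -
  have cc: "continuous_on UNIV c" using c(1) by (meson DERIV_continuous_on has_field_derivative_at_within)
  have m: "(\<lambda>p. c (fst p)) \<in> borel_measurable borel" "(\<lambda>p. c' (fst p)) \<in> borel_measurable borel" "(\<lambda>p. w (snd p)) \<in> borel_measurable borel"
    using measurable_compose[OF borel_measurable_continuous_onI[OF continuous_on_fst[OF continuous_on_id]] borel_measurable_continuous_onI[OF cc]]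
      measurable_compose[OF borel_measurable_continuous_onI[OF continuous_on_fst[OF continuous_on_id]] borel_measurable_continuous_onI[OF c(2)]]
      measurable_compose[OF borel_measurable_continuous_onI[OF continuous_on_snd[OF continuous_on_id]] w(1)] by simp_all
  have bd: "\<bar>k (fst p) * w (snd p)\<bar> \<le> B" if "\<And>s. \<bar>k s\<bar> \<le> 1" "p \<in> Omega" for k :: "real \<Rightarrow> real" and p
  proof -
    have "\<bar>k (fst p)\<bar> * \<bar>w (snd p)\<bar> \<le> 1 * B"
      using that(1)[of "fst p"] w(2)[of "snd p"] that(2) by (intro mult_mono) (auto simp: Omega_def)
    then show ?thesis by (simp add: abs_mult)
  qed
  show ?thesis
  proof (rule wd_theta_I[where B = B])
    show "(\<lambda>p. c (fst p) * w (snd p)) \<in> borel_measurable borel" "(\<lambda>p. c' (fst p) * w (snd p)) \<in> borel_measurable borel"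
      using m by measurable
    show "((\<lambda>x. c (fst (x, t)) * w (snd (x, t))) has_real_derivative c' (fst (s, t)) * w (snd (s, t))) (at s)" for s t
      using DERIV_cmult_right[OF c(1)[of s], of "w t"] by simp
    show "\<psi> (2 * pi, t) * (c (fst (2 * pi, t)) * w (snd (2 * pi, t))) = \<psi> (0, t) * (c (fst (0, t)) * w (snd (0, t)))" if "V \<psi>" for \<psi> t
      using V[OF that, of t] by (simp add: mult.assoc[symmetric])
    show "\<bar>c (fst p) * w (snd p)\<bar> \<le> B" "\<bar>c' (fst p) * w (snd p)\<bar> \<le> B" if "p \<in> Omega" for p
      by (rule bd[OF c(3) that] bd[OF c(4) that])+
  qed
qed

lemma vanishing_boundary:
  assumes "vanishing \<psi>"
  shows "\<psi> (s, 1/2) * x = \<psi> (s, - 1/2) * y" "\<psi> (2 * pi, t) * x = \<psi> (0, t) * y"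
  using assms by (simp_all add: vanishing_def interior_Omega)

lemma periodic_boundary:
  assumes "periodic \<psi>"
  shows "\<psi> (s, 1/2) = \<psi> (s, - 1/2)" "\<psi> (2 * pi, t) = \<psi> (0, t)"
  using assms[unfolded periodic_def, rule_format, of s "- 1/2"] assms[unfolded periodic_def, rule_format, of 0 t] by simp_all

text \<open>A function of \<open>z\<close> with continuous derivative \<open>p\<close> and with a bounded
  second derivative \<open>q\<close> off a finite set, as produced by gluing wrinkles to a straight
  cylinder.\<close>

locale profile =
  fixes w p q :: "real \<Rightarrow> real" and F :: "real set" and B :: real
  assumes fin: "finite F"
    and wp: "continuous_on UNIV w" "\<And>t. t \<in> J - F \<Longrightarrow> (w has_real_derivative p t) (at t)"
    and pq: "continuous_on UNIV p" "\<And>t. t \<in> J - F \<Longrightarrow> (p has_real_derivative q t) (at t)"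
    and q: "q \<in> borel_measurable borel" "\<And>t. t \<in> J \<Longrightarrow> \<bar>q t\<bar> \<le> B"
begin

lemma meas: "w \<in> borel_measurable borel" "p \<in> borel_measurable borel"
  by (rule borel_measurable_continuous_onI wp(1) pq(1))+

lemma bounds_ex: obtains C where "\<And>t. t \<in> J \<Longrightarrow> \<bar>w t\<bar> \<le> C" "\<And>t. t \<in> J \<Longrightarrow> \<bar>p t\<bar> \<le> C" "\<And>t. t \<in> J \<Longrightarrow> \<bar>q t\<bar> \<le> C"
proof -
  have "bounded (w ` J)" "bounded (p ` J)"
    by (intro compact_imp_bounded compact_continuous_image continuous_on_subset[OF wp(1)] continuous_on_subset[OF pq(1)]; simp)+
  then obtain C1 C2 where "\<forall>x\<in>w ` J. norm x \<le> C1" "\<forall>x\<in>p ` J. norm x \<le> C2" by (meson bounded_iff)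
  then show ?thesis using q(2) that[of "max (max C1 C2) B"] by (fastforce simp: le_max_iff_disj)
qed

lemma wd_z:
  assumes c: "continuous_on UNIV c" "\<And>s. \<bar>c s\<bar> \<le> 1"
  shows "wd C1_z vanishing (\<lambda>x. c (fst x) * w (snd x)) (\<lambda>x. c (fst x) * p (snd x))"
    "wd C1_z vanishing (\<lambda>x. c (fst x) * p (snd x)) (\<lambda>x. c (fst x) * q (snd x))"
proof -
  obtain C where C: "\<And>t. t \<in> J \<Longrightarrow> \<bar>w t\<bar> \<le> C" "\<And>t. t \<in> J \<Longrightarrow> \<bar>p t\<bar> \<le> C" "\<And>t. t \<in> J \<Longrightarrow> \<bar>q t\<bar> \<le> C" by (rule bounds_ex) blast
  show "wd C1_z vanishing (\<lambda>x. c (fst x) * w (snd x)) (\<lambda>x. c (fst x) * p (snd x))"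
    by (rule wd_separable_z[OF c wp(1) meas(2) C(2) fin wp(2) vanishing_boundary(1)])
  show "wd C1_z vanishing (\<lambda>x. c (fst x) * p (snd x)) (\<lambda>x. c (fst x) * q (snd x))"
    by (rule wd_separable_z[OF c pq(1) q(1) C(3) fin pq(2) vanishing_boundary(1)])
qed

lemma wd_theta:
  assumes c: "\<And>s. (c has_real_derivative c' s) (at s)" "continuous_on UNIV c'" "\<And>s. \<bar>c s\<bar> \<le> 1" "\<And>s. \<bar>c' s\<bar> \<le> 1"
  shows "wd C1_theta vanishing (\<lambda>x. c (fst x) * w (snd x)) (\<lambda>x. c' (fst x) * w (snd x))"
proof -
  obtain C where C: "\<And>t. t \<in> J \<Longrightarrow> \<bar>w t\<bar> \<le> C" using bounds_ex by metis
  show ?thesis by (rule wd_separable_theta[OF c meas(1) C vanishing_boundary(2)])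
qed

text \<open>The function and its slope take equal values at both ends, so integration by parts against
  periodic tests leaves no boundary term.\<close>

lemma H_per_profile:
  assumes per: "w (1/2) = w (- 1/2)" "p (1/2) = p (- 1/2)"
  shows "(\<lambda>x. w (snd x)) \<in> H_per 2"
proof -
  obtain C where C: "\<And>t. t \<in> J \<Longrightarrow> \<bar>w t\<bar> \<le> C" "\<And>t. t \<in> J \<Longrightarrow> \<bar>p t\<bar> \<le> C" "\<And>t. t \<in> J \<Longrightarrow> \<bar>q t\<bar> \<le> C" by (rule bounds_ex) blast
  have one: "continuous_on UNIV (\<lambda>_ :: real. 1 :: real)" "\<And>s::real. \<bar>1::real\<bar> \<le> 1" by simp_all
  have z1: "wd C1_z periodic (\<lambda>x. 1 * w (snd x)) (\<lambda>x. 1 * p (snd x))"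
    by (rule wd_separable_z[OF one wp(1) meas(2) C(2) fin wp(2)]) (simp_all add: periodic_boundary per)
  have z2: "wd C1_z periodic (\<lambda>x. 1 * p (snd x)) (\<lambda>x. 1 * q (snd x))"
    by (rule wd_separable_z[OF one pq(1) q(1) C(3) fin pq(2)]) (simp_all add: periodic_boundary per)
  have t1: "wd C1_theta periodic (\<lambda>x. 1 * w (snd x)) (\<lambda>x. 0 * w (snd x))"
    by (rule wd_separable_theta[OF _ _ _ _ meas(1) C(1)]) (simp_all add: periodic_boundary)
  have t2: "wd C1_theta periodic (\<lambda>x. 0 * w (snd x)) (\<lambda>x. 0 * w (snd x))"
    by (rule wd_separable_theta[OF _ _ _ _ meas(1) C(1)]) simp_all
  have t3: "wd C1_z periodic (\<lambda>x. 0 * w (snd x)) (\<lambda>x. 0 * p (snd x))"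
    by (rule wd_separable_z[OF _ _ wp(1) meas(2) C(2) fin wp(2)]) (simp_all add: periodic_boundary per)
  have L2: "(\<lambda>x. k (snd x)) \<in> L2" if k: "k \<in> borel_measurable borel" "\<And>t. t \<in> J \<Longrightarrow> \<bar>k t\<bar> \<le> C" for k :: "real \<Rightarrow> real"
  proof -
    have m: "(\<lambda>x :: real \<times> real. k (snd x)) \<in> borel_measurable LO"
      using measurable_compose[OF borel_measurable_continuous_onI[OF continuous_on_snd[OF continuous_on_id]] k(1)]
      by (intro LO_measurable_borel) simp
    have "norm ((k (snd x))\<^sup>2) \<le> C\<^sup>2" if "x \<in> Omega" for x
    proof -
      have "\<bar>k (snd x)\<bar> \<le> C" using k(2)[of "snd x"] that by (auto simp: Omega_def)
      then have "\<bar>k (snd x)\<bar>\<^sup>2 \<le> C\<^sup>2" by (intro power_mono) auto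
      then show ?thesis by simp
    qed
    then have "integrable LO (\<lambda>x. (k (snd x))\<^sup>2)"
      by (intro bounded_LO_integrable[where B = "C\<^sup>2"]) (use m in measurable)
    then show ?thesis using m by (simp add: L2_def)
  qed
  have i: "integrable LO (\<lambda>x. w (snd x))" using z1 by (simp add: wd_def)
  note W = wd_is_weak_deriv[OF test_class_periodic]
  have C0: "0 \<le> C" using C(1)[of 0] by force
  have l: "(\<lambda>x. w (snd x)) \<in> L2" "(\<lambda>x. p (snd x)) \<in> L2" "(\<lambda>x. q (snd x)) \<in> L2" "(\<lambda>x. 0) \<in> L2"
    using L2[OF meas(1) C(1)] L2[OF meas(2) C(2)] L2[OF q(1) C(3)] L2[of "\<lambda>_. 0"] C0 by simp_all
  have d: "is_weak_deriv periodic_tests 0 0 (\<lambda>x. w (snd x)) (\<lambda>x. w (snd x))"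
    "is_weak_deriv periodic_tests 1 0 (\<lambda>x. w (snd x)) (\<lambda>x. 0)"
    "is_weak_deriv periodic_tests 0 1 (\<lambda>x. w (snd x)) (\<lambda>x. p (snd x))"
    "is_weak_deriv periodic_tests 2 0 (\<lambda>x. w (snd x)) (\<lambda>x. 0)"
    "is_weak_deriv periodic_tests 1 1 (\<lambda>x. w (snd x)) (\<lambda>x. 0)"
    "is_weak_deriv periodic_tests 0 2 (\<lambda>x. w (snd x)) (\<lambda>x. q (snd x))"
    using W(1)[OF i] W(2)[OF t1] W(3)[OF z1] W(4)[OF t1 t2] W(5)[OF t1 t3] W(6)[OF z1 z2] by simp_all
  show ?thesis
    unfolding H_per_def
  proof (intro CollectI conjI l(1) allI impI)
    fix i j :: nat assume "i + j \<le> 2"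
    then consider "i = 0 \<and> j = 0" | "i = 1 \<and> j = 0" | "i = 0 \<and> j = 1" | "i = 2 \<and> j = 0" | "i = 1 \<and> j = 1" | "i = 0 \<and> j = 2"
      by linarith
    then show "\<exists>g\<in>L2. is_weak_deriv periodic_tests i j (\<lambda>x. w (snd x)) g"
      by cases (use d l in blast)+
  qed
qed

end

text \<open>The chosen representative agrees almost everywhere with \<open>g\<close>.\<close>

lemma Linf_norm_le:
  assumes "is_weak_deriv interior_tests i j f g" "\<And>p. p \<in> Omega \<Longrightarrow> \<bar>g p\<bar> \<le> m"
  shows "Linf_norm (weak_deriv i j f) \<le> ereal m"
proof -
  have "is_weak_deriv interior_tests i j f (weak_deriv i j f)"
    unfolding weak_deriv_def by (rule someI[where P = "is_weak_deriv interior_tests i j f", OF assms(1)])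
  then have "weak_deriv i j f \<in> borel_measurable LO" by (auto simp: is_weak_deriv_def)
  moreover have "AE p in LO. ereal \<bar>weak_deriv i j f p\<bar> \<le> ereal m"
    using weak_deriv_AE[OF assms(1)] AE_LO_Omega by eventually_elim (simp add: assms(2))
  ultimately show ?thesis unfolding Linf_norm_def by (intro esssup_I) auto
qed

definition axisym :: "(real \<Rightarrow> real) \<Rightarrow> (real \<Rightarrow> real) \<Rightarrow> deformation" where
  "axisym w \<zeta> = (\<lambda>(\<theta>, z). (w z, \<theta>, \<zeta> z))"

lemma axisym_comps: "comp_rho (axisym w \<zeta>) = (\<lambda>p. w (snd p))" "comp_theta (axisym w \<zeta>) = fst" "comp_z (axisym w \<zeta>) = (\<lambda>p. \<zeta> (snd p))"
  "cartesian (axisym w \<zeta>) = (\<lambda>p. vector [w (snd p) * cos (fst p), w (snd p) * sin (fst p), \<zeta> (snd p)])"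
  by (auto simp: fun_eq_iff axisym_def comp_rho_def comp_theta_def comp_z_def cartesian_def split_beta)

lemma axisym_admissible:
  assumes w: "profile w p p' F B" and \<zeta>: "profile \<zeta> q q' F B"
    and per: "w (1/2) = w (- 1/2)" "p (1/2) = p (- 1/2)" "\<zeta> (1/2) - \<zeta> (- 1/2) = 1 - lam" "q (1/2) = q (- 1/2)"
    and bd: "\<And>t. t \<in> J \<Longrightarrow> \<rho> \<le> w t" "\<And>t. t \<in> J \<Longrightarrow> \<bar>p t\<bar> \<le> 1" "\<And>t. t \<in> J \<Longrightarrow> 0 \<le> q t" "\<And>t. t \<in> J \<Longrightarrow> q t \<le> 1"
    and m: "1 \<le> m"
  shows "axisym w \<zeta> \<in> admissible_NL lam \<rho> m"
proof -
  interpret w: profile w p p' F B by fact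
  interpret \<zeta>: profile \<zeta> q q' F B by fact
  have one: "continuous_on UNIV (\<lambda>_ :: real. 1 :: real)" "\<And>s::real. \<bar>1::real\<bar> \<le> 1" by simp_all
  have sJ: "snd x \<in> J" if "x \<in> Omega" for x using that by (auto simp: Omega_def)
  have H1: "(\<lambda>x. w (snd x)) \<in> H_per 2" by (rule w.H_per_profile[OF per(1,2)])
  have "profile (\<lambda>t. 0) (\<lambda>t. 0) (\<lambda>t. 0) {} 0" by unfold_locales auto
  then have H2: "(\<lambda>x :: real \<times> real. 0) \<in> H_per 2" using profile.H_per_profile by fastforce
  have pz: "profile (\<lambda>t. \<zeta> t - (1 - lam) * t) (\<lambda>t. q t - (1 - lam)) q' F B"
  proof
    show "((\<lambda>t. \<zeta> t - (1 - lam) * t) has_real_derivative q t - (1 - lam)) (at t)" if "t \<in> J - F" for t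
      using DERIV_diff[OF \<zeta>.wp(2)[OF that] DERIV_cmult[OF DERIV_ident, of "1 - lam"]] by simp
    show "((\<lambda>t. q t - (1 - lam)) has_real_derivative q' t) (at t)" if "t \<in> J - F" for t
      using DERIV_diff[OF \<zeta>.pq(2)[OF that] DERIV_const[of "1 - lam"]] by simp
  qed (use \<zeta>.fin \<zeta>.wp(1) \<zeta>.pq(1) \<zeta>.q in \<open>auto intro!: continuous_on_diff continuous_on_mult\<close>)
  have H3: "(\<lambda>x. \<zeta> (snd x) - (1 - lam) * snd x) \<in> H_per 2"
    by (rule profile.H_per_profile[OF pz]) (use per(3,4) in \<open>simp_all add: algebra_simps\<close>)
  note W = wd_is_weak_deriv[OF test_class_interior]
  have der1: "((\<lambda>_. 1) has_real_derivative 0) (at s)" "continuous_on UNIV (\<lambda>_::real. 0::real)" "\<bar>1::real\<bar> \<le> 1" "\<bar>0::real\<bar> \<le> 1" for s :: real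
    by simp_all
  have d: "is_weak_deriv interior_tests 1 0 (\<lambda>x. w (snd x)) (\<lambda>x. 0)" "is_weak_deriv interior_tests 0 1 (\<lambda>x. w (snd x)) (\<lambda>x. p (snd x))"
     "is_weak_deriv interior_tests 1 0 (\<lambda>x. \<zeta> (snd x)) (\<lambda>x. 0)" "is_weak_deriv interior_tests 0 1 (\<lambda>x. \<zeta> (snd x)) (\<lambda>x. q (snd x))"
    using W(2)[OF w.wd_theta[of "\<lambda>_. 1" "\<lambda>_. 0", OF der1]] W(3)[OF w.wd_z(1)[of "\<lambda>_. 1", OF one]]
      W(2)[OF \<zeta>.wd_theta[of "\<lambda>_. 1" "\<lambda>_. 0", OF der1]] W(3)[OF \<zeta>.wd_z(1)[of "\<lambda>_. 1", OF one]] by simp_all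
  have "C1 Theta fst (\<lambda>_. 1)" "C1 Zed fst (\<lambda>_. 0)" using C1_affine[of 1 0 0] by simp_all
  then have "wd C1_theta vanishing fst (\<lambda>_. 1)" "wd C1_z vanishing fst (\<lambda>_. 0)"
    using C1_wd[of Theta fst] C1_wd[of Zed fst] by (simp_all add: C1_def)
  then have dt: "is_weak_deriv interior_tests 1 0 fst (\<lambda>_. 1 :: real)" "is_weak_deriv interior_tests 0 1 fst (\<lambda>_. 0 :: real)"
    using W(2) W(3) by blast+
  have "\<bar>p (snd x)\<bar> \<le> m" "\<bar>q (snd x)\<bar> \<le> m" if "x \<in> Omega" for x
    using bd(2-4)[OF sJ[OF that]] m by linarith+
  then have lin: "Linf_norm (weak_deriv 1 0 f) \<le> ereal m \<and> Linf_norm (weak_deriv 0 1 f) \<le> ereal m"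
    if "f \<in> {(\<lambda>x. w (snd x)), fst, (\<lambda>x. \<zeta> (snd x))}" for f
    using that m by (elim insertE emptyE; simp only:; intro conjI)
      (rule Linf_norm_le[OF d(1)] Linf_norm_le[OF d(2)] Linf_norm_le[OF dt(1)] Linf_norm_le[OF dt(2)] Linf_norm_le[OF d(3)] Linf_norm_le[OF d(4)]; simp)+
  have r: "AE x in LO. \<rho> \<le> w (snd x)" using AE_LO_Omega by eventually_elim (rule bd(1)[OF sJ])
  have z: "AE x in LO. 0 \<le> weak_deriv 0 1 (\<lambda>x. \<zeta> (snd x)) x"
    using weak_deriv_AE[OF d(4)] AE_LO_Omega by eventually_elim (simp add: bd(3)[OF sJ])
  show ?thesis
    unfolding admissible_NL_def mem_Collect_eq axisym_comps
    using H1 H2 H3 lin r z by (simp add: case_prod_unfold)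
qed

lemma axisym_energy:
  assumes w: "profile w p p' F B" and \<zeta>: "profile \<zeta> q q' F B"
  shows "energy_NL h (axisym w \<zeta>) = (\<integral>\<^sup>+x. ennreal (((w (snd x))\<^sup>2 - 1)\<^sup>2 + ((p (snd x))\<^sup>2 + (q (snd x))\<^sup>2 - 1)\<^sup>2
     + h\<^sup>2 * ((w (snd x))\<^sup>2 + 2 * (p (snd x))\<^sup>2 + ((p' (snd x))\<^sup>2 + (q' (snd x))\<^sup>2))) \<partial>LO)"
proof -
  interpret w: profile w p p' F B by fact
  interpret \<zeta>: profile \<zeta> q q' F B by fact
  have one: "continuous_on UNIV (\<lambda>_ :: real. 1 :: real)" "\<And>s::real. \<bar>1::real\<bar> \<le> 1" by simp_all
  have zero: "continuous_on UNIV (\<lambda>_ :: real. 0 :: real)" "\<And>s::real. \<bar>0::real\<bar> \<le> 1" by simp_all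
  have cs: "continuous_on UNIV (cos :: real \<Rightarrow> real)" "\<And>s::real. \<bar>cos s\<bar> \<le> 1" "continuous_on UNIV (sin :: real \<Rightarrow> real)" "\<And>s::real. \<bar>sin s\<bar> \<le> 1"
    "continuous_on UNIV (\<lambda>s :: real. - sin s)" "\<And>s::real. \<bar>- sin s\<bar> \<le> 1" "continuous_on UNIV (\<lambda>s :: real. - cos s)" "\<And>s::real. \<bar>- cos s\<bar> \<le> 1"
    by (auto intro!: continuous_on_minus continuous_on_cos continuous_on_sin continuous_on_id)
  have dv: "\<And>s::real. (cos has_real_derivative - sin s) (at s)" "\<And>s::real. (sin has_real_derivative cos s) (at s)"
    "\<And>s::real. ((\<lambda>s. - sin s) has_real_derivative - cos s) (at s)" "\<And>s::real. ((\<lambda>_. 1) has_real_derivative 0) (at s)"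
    "\<And>s::real. ((\<lambda>_. 0) has_real_derivative 0) (at s)"
    by (auto intro!: derivative_eq_intros)
  note W = wd_is_weak_deriv[OF test_class_interior]
  note xt = w.wd_theta[OF dv(1) cs(5,2,6)] and xtt = w.wd_theta[OF dv(3) cs(7,6,8)]
  note yt = w.wd_theta[OF dv(2) cs(1,4,2)] and ytt = w.wd_theta[OF dv(1) cs(5,2,6)]
  note xz = w.wd_z[OF cs(1,2)] and yz = w.wd_z[OF cs(3,4)]
  note xtz = w.wd_z(1)[OF cs(5,6)] and ytz = w.wd_z(1)[OF cs(1,2)]
  note zt = \<zeta>.wd_theta[OF dv(4) zero(1) one(2) zero(2)] and ztt = \<zeta>.wd_theta[OF dv(5) zero(1) zero(2) zero(2)]
  note zz = \<zeta>.wd_z[OF one] and ztz = \<zeta>.wd_z(1)[OF zero]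
  have cart: "cartesian (axisym w \<zeta>) = (\<lambda>x. vector [cos (fst x) * w (snd x), sin (fst x) * w (snd x), 1 * \<zeta> (snd x)])"
    unfolding axisym_comps by (simp add: mult.commute)
  note D10 = weak_deriv_AE[OF interior_weak_deriv_vec3[OF W(2)[OF xt] W(2)[OF yt] W(2)[OF zt]], folded cart]
  note D01 = weak_deriv_AE[OF interior_weak_deriv_vec3[OF W(3)[OF xz(1)] W(3)[OF yz(1)] W(3)[OF zz(1)]], folded cart]
  note D20 = weak_deriv_AE[OF interior_weak_deriv_vec3[OF W(4)[OF xt xtt] W(4)[OF yt ytt] W(4)[OF zt ztt]], folded cart]
  note D11 = weak_deriv_AE[OF interior_weak_deriv_vec3[OF W(5)[OF xt xtz] W(5)[OF yt ytz] W(5)[OF zt ztz]], folded cart]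
  note D02 = weak_deriv_AE[OF interior_weak_deriv_vec3[OF W(6)[OF xz] W(6)[OF yz] W(6)[OF zz]], folded cart]
  show ?thesis
    unfolding energy_NL_def
  proof (rule nn_integral_cong_AE)
    show "AE x in LO. ennreal ((norm (transpose (grad (axisym w \<zeta>) x) ** grad (axisym w \<zeta>) x - mat 1))\<^sup>2 + h\<^sup>2 * hess_norm_sq (axisym w \<zeta>) x)
      = ennreal (((w (snd x))\<^sup>2 - 1)\<^sup>2 + ((p (snd x))\<^sup>2 + (q (snd x))\<^sup>2 - 1)\<^sup>2
     + h\<^sup>2 * ((w (snd x))\<^sup>2 + 2 * (p (snd x))\<^sup>2 + ((p' (snd x))\<^sup>2 + (q' (snd x))\<^sup>2)))"
      using D10 D01 D20 D11 D02
    proof eventually_elim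
      case (elim x)
      define c s where "c = cos (fst x)" and "s = sin (fst x)"
      have cs1: "s\<^sup>2 + c\<^sup>2 = 1" by (simp add: c_def s_def)
      have k: "(c * a)\<^sup>2 + (s * a)\<^sup>2 = a\<^sup>2" "(s * a)\<^sup>2 + (c * a)\<^sup>2 = a\<^sup>2" for a
      proof -
        have "(c * a)\<^sup>2 + (s * a)\<^sup>2 = (s\<^sup>2 + c\<^sup>2) * a\<^sup>2" by (simp add: power_mult_distrib algebra_simps)
        then show "(c * a)\<^sup>2 + (s * a)\<^sup>2 = a\<^sup>2" "(s * a)\<^sup>2 + (c * a)\<^sup>2 = a\<^sup>2" by (simp_all add: cs1)
      qed
      show ?case
        unfolding grad_def hess_norm_sq_def metric_norm elim c_def[symmetric] s_def[symmetric] inner_vec3 norm_vec3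
        using k by (simp add: power2_eq_square[symmetric])
    qed
  qed
qed

section \<open>Wrinkles\<close>

lemma antiderivative_exists:
  fixes f :: "real \<Rightarrow> real"
  assumes "continuous_on UNIV f"
  obtains F where "\<And>x. (F has_real_derivative f x) (at x)"
proof -
  have "\<exists>F. \<forall>x::real. - \<infinity> < ereal x \<longrightarrow> ereal x < \<infinity> \<longrightarrow> (F has_vector_derivative f x) (at x)"
    by (rule einterval_antiderivative) (use assms in \<open>auto simp: continuous_on_eq_continuous_at\<close>)
  then obtain F where "\<And>x. (F has_vector_derivative f x) (at x)" by auto
  then show ?thesis using that[of F] unfolding has_real_derivative_iff_has_vector_derivative by blast
qed

text \<open>The height of a wrinkle whose slope angle is \<open>A sin(2 \<pi> t)\<close>. The slope is
  odd and 1-periodic, hence its antiderivative is even and 1-periodic, and it increases on \<open>[0,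
  1/2]\<close>: the profile stays above the obstacle.\<close>

lemma wrinkle_height_exists:
  assumes A: "0 \<le> A" "A \<le> pi / 2"
  obtains H where "\<And>t. (H has_real_derivative sin (A * sin (2 * pi * t))) (at t)"
    "\<And>t. 0 \<le> H t" "\<And>t. H t \<le> A" "\<And>n::nat. H (real n) = 0"
proof -
  let ?f = "\<lambda>t. sin (A * sin (2 * pi * t))"
  have "continuous_on UNIV ?f" by (intro continuous_intros)
  then obtain G where G: "\<And>t. (G has_real_derivative ?f t) (at t)" using antiderivative_exists by blast
  define H where "H t = G t - G 0" for t
  have H: "(H has_real_derivative ?f t) (at t)" for t
    unfolding H_def[abs_def] using DERIV_diff[OF G[of t] DERIV_const[of "G 0"]] by simp
  have H0: "H 0 = 0" by (simp add: H_def)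
  have even: "H (- t) = H t" for t
  proof -
    have "((\<lambda>t. H (- t) - H t) has_real_derivative 0) (at t)" for t
    proof -
      have "((\<lambda>t. H (- t)) has_real_derivative ?f (- t) * (- 1)) (at t)"
        by (rule DERIV_chain2[OF H]) (auto intro!: derivative_eq_intros)
      from DERIV_diff[OF this H[of t]] show ?thesis by simp
    qed
    then have "H (- t) - H t = H (- 0) - H 0" by (intro DERIV_isconst_all) auto
    then show ?thesis by simp
  qed
  have per: "H (t + 1) = H t" for t
  proof -
    have "((\<lambda>t. H (t + 1) - H t) has_real_derivative 0) (at t)" for t
    proof -
      have "((\<lambda>t. H (t + 1)) has_real_derivative ?f (t + 1) * (1 + 0)) (at t)"
        by (rule DERIV_chain2[OF H]) (auto intro!: derivative_eq_intros)
      moreover have "sin (2 * pi * (t + 1)) = sin (2 * pi * t)"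
        using sin_periodic[of "2 * pi * t"] by (simp add: algebra_simps)
      ultimately have "((\<lambda>t. H (t + 1)) has_real_derivative ?f t) (at t)" by simp
      from DERIV_diff[OF this H[of t]] show ?thesis by simp
    qed
    then have "H (t + 1) - H t = H (- (1/2) + 1) - H (- (1/2))" by (intro DERIV_isconst_all) auto
    then show ?thesis using even[of "1/2"] by simp
  qed
  have half: "0 \<le> H t \<and> H t \<le> A" if t: "0 \<le> t" "t \<le> 1/2" for t
  proof -
    have fb: "0 \<le> ?f x \<and> ?f x \<le> A" if x: "0 \<le> x" "x \<le> t" for x
    proof -
      have "2 * pi * x \<le> 2 * pi * (1/2)" using x t by (intro mult_left_mono) auto
      then have s0: "0 \<le> sin (2 * pi * x)" using x by (intro sin_ge_zero) auto
      have "A * sin (2 * pi * x) \<le> A * 1" using A by (intro mult_left_mono) auto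
      moreover have a0: "0 \<le> A * sin (2 * pi * x)" using A s0 by simp
      ultimately have "A * sin (2 * pi * x) \<le> pi" using A pi_gt_zero by linarith
      then have "0 \<le> ?f x" using a0 by (intro sin_ge_zero)
      moreover have "?f x \<le> A * sin (2 * pi * x)" using a0 by (rule sin_x_le_x)
      ultimately show ?thesis using \<open>A * sin (2 * pi * x) \<le> A * 1\<close> by simp
    qed
    have "H 0 \<le> H t"
      by (rule DERIV_nonneg_imp_nondecreasing[OF t(1)]) (use H fb in blast)
    moreover have "A * 0 - H 0 \<le> A * t - H t"
    proof (rule DERIV_nonneg_imp_nondecreasing[OF t(1)])
      fix x assume x: "0 \<le> x" "x \<le> t"
      show "\<exists>y. ((\<lambda>a. A * a - H a) has_real_derivative y) (at x) \<and> 0 \<le> y"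
        using DERIV_diff[OF DERIV_cmult[OF DERIV_ident, of A] H[of x]] fb[OF x] by (intro exI[of _ "A * 1 - ?f x"]) auto
    qed
    moreover have "A * t \<le> A * 1" using t A by (intro mult_left_mono) auto
    ultimately show ?thesis using H0 by simp
  qed
  have all: "0 \<le> H t \<and> H t \<le> A" for t
  proof -
    define k where "k = \<lfloor>t + 1/2\<rfloor>"
    have k: "- 1/2 \<le> t - of_int k" "t - of_int k \<le> 1/2" unfolding k_def by linarith+
    have "H t = H (t - of_int k)" using periodic_of_int[of H t k] per by simp
    also have "\<dots> = H \<bar>t - of_int k\<bar>" using even[of "t - of_int k"] by (simp add: abs_if)
    finally have e: "H t = H \<bar>t - of_int k\<bar>" .
    have "\<bar>t - of_int k\<bar> \<le> 1/2" using k by linarith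
    then show ?thesis unfolding e by (intro half) simp_all
  qed
  have "H (real n) = 0" for n
    using periodic_of_int[of H "real n" "int n"] per H0 by simp
  then show ?thesis using that[of H] H all by blast
qed

text \<open>By concavity the sine lies above its chord between 0 and \<open>\<pi> / 4\<close>; apply this
  to \<open>u / 2\<close> and use the half-angle formula.\<close>

lemma one_minus_cos_ge:
  assumes "\<bar>u\<bar> \<le> pi / 2"
  shows "4 / pi\<^sup>2 * u\<^sup>2 \<le> 1 - cos u"
proof -
  have main: "4 / pi\<^sup>2 * u\<^sup>2 \<le> 1 - cos u" if u: "0 \<le> u" "u \<le> pi / 2" for u
  proof -
    have cvx: "convex_on {0..pi} (\<lambda>x. - sin x)"
      by (rule f''_ge0_imp_convex[where f' = "\<lambda>x. - cos x" and f'' = sin])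
         (auto intro!: derivative_eq_intros sin_ge_zero)
    define t where "t = 2 * u / pi"
    have t: "0 \<le> t" "t \<le> 1" using u by (auto simp: t_def divide_le_eq)
    have "- sin ((1 - t) *\<^sub>R 0 + t *\<^sub>R (pi / 4)) \<le> (1 - t) * (- sin 0) + t * (- sin (pi / 4))"
      by (rule convex_onD[OF cvx t]) auto
    then have "t * (sqrt 2 / 2) \<le> sin (t * pi / 4)" by (simp add: sin_45)
    moreover have e: "t * pi / 4 = u / 2" by (simp add: t_def)
    ultimately have "t * (sqrt 2 / 2) \<le> sin (u / 2)" by (simp only: e)
    then have "(t * (sqrt 2 / 2))\<^sup>2 \<le> (sin (u / 2))\<^sup>2" using t by (intro power_mono) auto
    then have "t\<^sup>2 / 2 \<le> (sin (u / 2))\<^sup>2" by (simp add: power_mult_distrib power_divide)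
    moreover have "cos (2 * (u / 2)) = 1 - 2 * (sin (u / 2))\<^sup>2" by (rule cos_double_sin)
    ultimately have "t\<^sup>2 \<le> 1 - cos u" by simp
    then show ?thesis by (simp add: t_def power_divide power_mult_distrib)
  qed
  show ?thesis using main[of u] main[of "- u"] assms by (cases "u \<ge> 0") auto
qed

text \<open>\<open>N\<close> wrinkles of width \<open>l\<close>, occupying a part of the axis of length
  \<open>L\<close>. The variable \<open>y\<close> runs through this part and is constant off it, so a
  single formula covers the wrinkles and the straight remainder; \<open>F\<close> contains the ends of
  the wrinkled part, where the curvature jumps.\<close>

locale wrinkles =
  fixes N :: nat and l :: real
  assumes N: "1 \<le> N" and l: "0 < l" and L1: "real N * l \<le> 1"
begin

definition L where "L = real N * l"
definition y where "y z = max 0 (min L (z + 1/2))"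
definition y' :: "real \<Rightarrow> real" where "y' z = (if 0 < z + 1/2 \<and> z + 1/2 < L then 1 else 0)"
definition s where "s z = sin (2 * pi * (y z / l))"
definition s' where "s' z = 2 * pi / l * cos (2 * pi * (y z / l)) * y' z"
definition F where "F = {- 1/2, - 1/2 + L}"

lemma L: "0 < L" "L \<le> 1" "l \<le> L" "l \<le> 1"
proof -
  have "1 * l \<le> real N * l" using N l by (intro mult_right_mono) auto
  then show "0 < L" "L \<le> 1" "l \<le> L" "l \<le> 1" using l L1 unfolding L_def by linarith+
qed

lemma y_cont: "continuous_on S y"
  unfolding y_def[abs_def] by (intro continuous_intros)

lemma s_cont: "continuous_on S s"
  unfolding s_def[abs_def] by (intro continuous_intros y_cont) (use l in auto)

lemma y_DERIV:
  assumes "z \<notin> F"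
  shows "(y has_real_derivative y' z) (at z)"
proof -
  consider "z + 1/2 < 0" | "0 < z + 1/2" "z + 1/2 < L" | "L < z + 1/2" using assms unfolding F_def by fastforce
  then show ?thesis
  proof cases
    case 1
    show ?thesis
    proof (rule has_field_derivative_transform_within_open[of "\<lambda>_. 0" _ _ "{..<- 1/2}"])
      show "((\<lambda>_. 0) has_real_derivative y' z) (at z)" using 1 by (simp add: y'_def)
    qed (use 1 L in \<open>auto simp: y_def\<close>)
  next
    case 2
    show ?thesis
    proof (rule has_field_derivative_transform_within_open[of "\<lambda>z. z + 1/2" _ _ "{- 1/2<..<- 1/2 + L}"])
      show "((\<lambda>z. z + 1/2) has_real_derivative y' z) (at z)" using 2 by (auto simp: y'_def intro!: derivative_eq_intros)
    qed (use 2 L in \<open>auto simp: y_def\<close>)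
  next
    case 3
    show ?thesis
    proof (rule has_field_derivative_transform_within_open[of "\<lambda>_. L" _ _ "{- 1/2 + L<..}"])
      show "((\<lambda>_. L) has_real_derivative y' z) (at z)" using 3 by (simp add: y'_def)
    qed (use 3 L in \<open>auto simp: y_def\<close>)
  qed
qed

lemma s_DERIV:
  assumes "z \<notin> F"
  shows "(s has_real_derivative s' z) (at z)"
proof -
  have "((\<lambda>z. 2 * pi / l * y z) has_real_derivative 2 * pi / l * y' z) (at z)"
    by (rule DERIV_cmult[OF y_DERIV[OF assms]])
  from DERIV_chain2[OF DERIV_sin this] show ?thesis by (simp add: s_def[abs_def] s'_def mult.assoc mult.left_commute)
qed

lemma y_off: "y' z = 0 \<Longrightarrow> y z = 0 \<or> y z = L"
  using L by (auto simp: y'_def y_def split: if_splits)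

lemma s_zero: "s z = 0" if "y z = 0 \<or> y z = L"
proof -
  have "sin (2 * pi * real N) = 0" using sin_npi[of "2 * N"] by (simp add: mult.commute mult.left_commute)
  then show ?thesis using that l by (auto simp: s_def L_def mult.assoc)
qed

lemma s'_meas: "s' \<in> borel_measurable borel"
proof -
  have "y \<in> borel_measurable borel" by (rule borel_measurable_continuous_onI[OF y_cont])
  then show ?thesis unfolding s'_def[abs_def] y'_def by measurable
qed

lemma s'_bound: "\<bar>s' z\<bar> \<le> 2 * pi / l"
proof -
  have "\<bar>cos (2 * pi * (y z / l))\<bar> * \<bar>y' z\<bar> \<le> 1 * 1" by (intro mult_mono) (auto simp: y'_def)
  then have "(2 * pi / l) * (\<bar>cos (2 * pi * (y z / l))\<bar> * \<bar>y' z\<bar>) \<le> (2 * pi / l) * 1" using l by (intro mult_left_mono) auto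
  then show ?thesis using l by (simp add: s'_def abs_mult mult.assoc)
qed

lemma ends: "y (- 1/2) = 0" "y (1/2) = L"
  using L by (simp_all add: y_def)

text \<open>The half-angle formula gives an explicit antiderivative, valid off the two jumps.\<close>

lemma s_square_integral: "((\<lambda>z. (s z)\<^sup>2) has_integral (L / 2)) J"
proof -
  define V where "V z = y z / 2 - l / (8 * pi) * sin (4 * pi * (y z / l))" for z
  have d: "(V has_vector_derivative (s z)\<^sup>2) (at z)" if z: "z \<in> J - F" for z
  proof -
    have zF: "z \<notin> F" using z by simp
    have "((\<lambda>z. 4 * pi / l * y z) has_real_derivative 4 * pi / l * y' z) (at z)"
      by (rule DERIV_cmult[OF y_DERIV[OF zF]])
    from DERIV_cmult[OF DERIV_chain2[OF DERIV_sin this], of "l / (8 * pi)"]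
    have "((\<lambda>z. l / (8 * pi) * sin (4 * pi * (y z / l))) has_real_derivative cos (4 * pi * (y z / l)) * y' z / 2) (at z)"
      using l by (simp add: mult.assoc field_simps)
    from DERIV_diff[OF DERIV_cdivide[OF y_DERIV[OF zF], of 2] this]
    have "(V has_real_derivative y' z / 2 - cos (4 * pi * (y z / l)) * y' z / 2) (at z)" by (simp add: V_def[abs_def])
    moreover have "y' z / 2 - cos (4 * pi * (y z / l)) * y' z / 2 = (s z)\<^sup>2"
    proof (cases "y' z = 0")
      case True then show ?thesis using s_zero[OF y_off[OF True]] by simp
    next
      case False
      then have "y' z = 1" by (simp add: y'_def split: if_splits)
      moreover have "cos (2 * (2 * pi * (y z / l))) = 1 - 2 * (s z)\<^sup>2" unfolding s_def by (rule cos_double_sin)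
      ultimately show ?thesis by (simp add: mult.assoc diff_divide_distrib)
    qed
    ultimately show ?thesis by (simp add: has_real_derivative_iff_has_vector_derivative)
  qed
  have "((\<lambda>z. (s z)\<^sup>2) has_integral (V (1/2) - V (- 1/2))) J"
  proof (rule fundamental_theorem_of_calculus_strong[of F, OF _ _ d])
    show "continuous_on J V" unfolding V_def[abs_def] using l by (intro continuous_intros y_cont) auto
  qed (simp_all add: F_def)
  moreover have "sin (4 * pi * real N) = 0" using sin_npi[of "4 * N"] by (simp add: mult.commute mult.left_commute)
  then have e: "V (1/2) - V (- 1/2) = L / 2" using l by (simp add: V_def ends[simplified] L_def mult.assoc)
  ultimately show ?thesis unfolding e by (simp only:)
qed

text \<open>The shortening \<open>\<integral> (1 - cos (A s))\<close> depends continuously on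
  \<open>A\<close> and is at least \<open>2 A\<^sup>2 L / \<pi>\<^sup>2\<close>, which is \<open>L / 2
  \<ge> lam\<close> for \<open>A = \<pi> / 2\<close>. The same lower bound estimates the amplitude found
  by the intermediate value theorem.\<close>

lemma amplitude_exists:
  assumes lam: "0 < lam" "2 * lam \<le> L"
  obtains A where "0 \<le> A" "A \<le> pi / 2" "integral J (\<lambda>z. cos (A * s z)) = 1 - lam" "A\<^sup>2 \<le> 5 * lam / L"
proof -
  define G where "G A = integral J (\<lambda>z. 1 - cos (A * s z))" for A
  have c: "continuous_on ({0..pi / 2} \<times> cbox (- 1/2) (1/2)) (\<lambda>(A, z). 1 - cos (A * s z))"
    unfolding case_prod_unfold
    by (intro continuous_intros continuous_on_compose2[OF s_cont[of UNIV] continuous_on_snd[OF continuous_on_id]]) auto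
  have Gc: "continuous_on {0..pi / 2} G"
    unfolding G_def[abs_def] using integral_continuous_on_param[OF c] by simp
  have Gl: "2 * A\<^sup>2 * L / pi\<^sup>2 \<le> G A" if A: "0 \<le> A" "A \<le> pi / 2" for A
  proof -
    have "integral J (\<lambda>z. 4 / pi\<^sup>2 * A\<^sup>2 * (s z)\<^sup>2) \<le> G A"
      unfolding G_def
    proof (rule integral_le)
      show "(\<lambda>z. 4 / pi\<^sup>2 * A\<^sup>2 * (s z)\<^sup>2) integrable_on J" using has_integral_mult_right[OF s_square_integral] by blast
      show "(\<lambda>z. 1 - cos (A * s z)) integrable_on J"
        by (intro integrable_continuous_interval continuous_intros s_cont)
      show "4 / pi\<^sup>2 * A\<^sup>2 * (s z)\<^sup>2 \<le> 1 - cos (A * s z)" for z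
      proof -
        have "A * \<bar>s z\<bar> \<le> A * 1" using A by (intro mult_left_mono) (auto simp: s_def)
        then have "\<bar>A * s z\<bar> \<le> pi / 2" using A by (simp add: abs_mult)
        from one_minus_cos_ge[OF this] show ?thesis by (simp add: power_mult_distrib)
      qed
    qed
    moreover have "integral J (\<lambda>z. 4 / pi\<^sup>2 * A\<^sup>2 * (s z)\<^sup>2) = 4 / pi\<^sup>2 * A\<^sup>2 * (L / 2)"
      by (rule integral_unique[OF has_integral_mult_right[OF s_square_integral]])
    ultimately have "4 / pi\<^sup>2 * A\<^sup>2 * (L / 2) \<le> G A" by (simp only:)
    then show ?thesis by (simp add: ac_simps)
  qed
  have "G 0 \<le> lam" using lam by (simp add: G_def)
  moreover have "lam \<le> G (pi / 2)" using Gl[of "pi / 2"] lam by (simp add: power_divide)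
  ultimately obtain A where A: "0 \<le> A" "A \<le> pi / 2" "G A = lam" using IVT'[OF _ _ _ Gc] by auto
  have ic: "(\<lambda>z. cos (A * s z)) integrable_on J" by (intro integrable_continuous_interval continuous_intros s_cont)
  have "G A = integral J (\<lambda>z. 1) - integral J (\<lambda>z. cos (A * s z))"
    unfolding G_def by (rule integral_diff[OF integrable_const_ivl ic])
  then have 1: "integral J (\<lambda>z. cos (A * s z)) = 1 - lam" using A(3) by simp
  have "2 * A\<^sup>2 * L \<le> lam * pi\<^sup>2" using Gl[OF A(1,2)] A(3) by (simp add: divide_le_eq)
  also have "\<dots> \<le> lam * 10"
  proof -
    have "pi \<le> 3.15" using pi_approx by simp
    then have "pi\<^sup>2 \<le> 3.15\<^sup>2" by (intro power_mono) auto
    then show ?thesis using lam by (intro mult_left_mono) (auto simp: power2_eq_square)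
  qed
  finally have "A\<^sup>2 \<le> 5 * lam / L" using L by (simp add: le_divide_eq mult.commute)
  then show ?thesis using that A 1 by blast
qed

text \<open>Radius and height have slopes \<open>sin \<phi>\<close> and \<open>cos \<phi>\<close>, so the
  axial strain vanishes and the bending is \<open>\<phi>'\<^sup>2\<close>. The excess is concentrated on
  the wrinkled length \<open>L\<close>; the height above the obstacle is at most \<open>A l\<close> and
  the curvature at most \<open>2 \<pi> A / l\<close>. The largest constant is \<open>42 \<ge> 2 + 4
  \<pi>\<^sup>2\<close>, from the bending term.\<close>

lemma wrinkled_deformation:
  assumes A: "0 \<le> A" "A \<le> pi / 2" and lam: "integral J (\<lambda>z. cos (A * s z)) = 1 - lam"
    and \<rho>: "1 \<le> \<rho>" "\<rho> \<le> \<rho>0" and h: "0 < h" "h\<^sup>2 \<le> a" "\<rho>\<^sup>2 - 1 \<le> a" and m: "1 \<le> m"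
  obtains \<Phi> where "\<Phi> \<in> admissible_NL lam \<rho> m"
    "energy_NL h \<Phi> \<le> ennreal (2 * pi * ((\<rho>\<^sup>2 - 1)\<^sup>2 + \<rho>\<^sup>2 * h\<^sup>2) + 2 * pi * L * (42 * \<rho>0\<^sup>2 * (a * A * l + A\<^sup>2 * l\<^sup>2 + h\<^sup>2 * A\<^sup>2 / l\<^sup>2)))"
proof -
  obtain H where H: "\<And>t. (H has_real_derivative sin (A * sin (2 * pi * t))) (at t)"
    "\<And>t. 0 \<le> H t" "\<And>t. H t \<le> A" "\<And>n::nat. H (real n) = 0"
    using wrinkle_height_exists[OF A] by metis
  have Hc: "continuous_on UNIV H" using H(1) by (meson DERIV_continuous_on has_field_derivative_at_within)
  define w where "w z = l * H (y z / l)" for z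
  define \<phi> where "\<phi> z = A * s z" for z
  have \<phi>c: "continuous_on UNIV \<phi>" unfolding \<phi>_def[abs_def] by (intro continuous_intros s_cont)
  have cc: "continuous_on UNIV (\<lambda>z. cos (\<phi> z))" "continuous_on UNIV (\<lambda>z. sin (\<phi> z))"
    by (intro continuous_on_cos continuous_on_sin \<phi>c)+
  obtain \<zeta> where \<zeta>: "\<And>z. (\<zeta> has_real_derivative cos (\<phi> z)) (at z)" using antiderivative_exists[OF cc(1)] by blast
  have wc: "continuous_on UNIV w"
    unfolding w_def[abs_def] using l by (intro continuous_intros continuous_on_compose2[OF Hc] y_cont) auto
  have w0: "w z = 0" if "y z = 0 \<or> y z = L" for z
    using that H(4)[of 0] H(4)[of N] l by (auto simp: w_def L_def)
  have wb: "0 \<le> w z" "w z \<le> A * l" for z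
    using H(2)[of "y z / l"] mult_left_mono[OF H(3)[of "y z / l"], of l] l by (simp_all add: w_def mult.commute)
  have wd: "(w has_real_derivative sin (\<phi> z)) (at z)" if "z \<notin> F" for z
  proof -
    have "((\<lambda>z. y z / l) has_real_derivative y' z / l) (at z)" by (rule DERIV_cdivide[OF y_DERIV[OF that]])
    from DERIV_cmult[OF DERIV_chain2[OF H(1) this], of l]
    have "(w has_real_derivative sin (\<phi> z) * y' z) (at z)"
      using l by (simp add: w_def[abs_def] \<phi>_def s_def)
    moreover have "sin (\<phi> z) * y' z = sin (\<phi> z)"
    proof (cases "y' z = 0")
      case True then show ?thesis using s_zero[OF y_off[OF True]] by (simp add: \<phi>_def)
    qed (simp add: y'_def split: if_splits)
    ultimately show ?thesis by simp
  qed
  have \<phi>d: "(\<phi> has_real_derivative A * s' z) (at z)" if "z \<notin> F" for z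
    unfolding \<phi>_def[abs_def] by (rule DERIV_cmult[OF s_DERIV[OF that]])
  have \<phi>'b: "\<bar>A * s' z\<bar> \<le> A * (2 * pi / l)" for z
    using mult_left_mono[OF s'_bound[of z] A(1)] A(1) by (simp add: abs_mult)
  have m': "(\<lambda>z. A * s' z) \<in> borel_measurable borel" "(\<lambda>z. cos (\<phi> z)) \<in> borel_measurable borel" "(\<lambda>z. sin (\<phi> z)) \<in> borel_measurable borel"
    using s'_meas cc by (auto intro: borel_measurable_continuous_onI)
  have trig: "\<bar>cos x * k\<bar> \<le> \<bar>k\<bar>" "\<bar>- sin x * k\<bar> \<le> \<bar>k\<bar>" for x k :: real
    using mult_right_mono[OF abs_cos_le_one[of x], of "\<bar>k\<bar>"] mult_right_mono[OF abs_sin_le_one[of x], of "\<bar>k\<bar>"]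
    by (simp_all add: abs_mult)
  have Pw: "profile (\<lambda>z. \<rho> + w z) (\<lambda>z. sin (\<phi> z)) (\<lambda>z. cos (\<phi> z) * (A * s' z)) F (A * (2 * pi / l))"
  proof
    show "finite F" by (simp add: F_def)
    show "continuous_on UNIV (\<lambda>z. \<rho> + w z)" by (intro continuous_intros wc)
    show "((\<lambda>z. \<rho> + w z) has_real_derivative sin (\<phi> t)) (at t)" if "t \<in> J - F" for t
      using DERIV_add[OF DERIV_const[of \<rho>] wd[of t]] that by simp
    show "((\<lambda>z. sin (\<phi> z)) has_real_derivative cos (\<phi> t) * (A * s' t)) (at t)" if "t \<in> J - F" for t
      using DERIV_chain2[OF DERIV_sin \<phi>d[of t]] that by simp
    show "(\<lambda>z. cos (\<phi> z) * (A * s' z)) \<in> borel_measurable borel" using m' by measurable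
    show "\<bar>cos (\<phi> t) * (A * s' t)\<bar> \<le> A * (2 * pi / l)" for t using trig(1) \<phi>'b order_trans by blast
  qed (rule cc)
  have P\<zeta>: "profile \<zeta> (\<lambda>z. cos (\<phi> z)) (\<lambda>z. - sin (\<phi> z) * (A * s' z)) F (A * (2 * pi / l))"
  proof
    show "finite F" by (simp add: F_def)
    show "continuous_on UNIV \<zeta>" using \<zeta> by (meson DERIV_continuous_on has_field_derivative_at_within)
    show "(\<zeta> has_real_derivative cos (\<phi> t)) (at t)" for t by (rule \<zeta>)
    show "((\<lambda>z. cos (\<phi> z)) has_real_derivative - sin (\<phi> t) * (A * s' t)) (at t)" if "t \<in> J - F" for t
      using DERIV_chain2[OF DERIV_cos \<phi>d[of t]] that by simp
    show "(\<lambda>z. - sin (\<phi> z) * (A * s' z)) \<in> borel_measurable borel" using m' by measurable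
    show "\<bar>- sin (\<phi> t) * (A * s' t)\<bar> \<le> A * (2 * pi / l)" for t using trig(2) \<phi>'b order_trans by blast
  qed (rule cc)
  have \<phi>e: "\<phi> (- 1/2) = 0" "\<phi> (1/2) = 0" using s_zero ends by (simp_all add: \<phi>_def)
  have \<phi>b: "\<bar>\<phi> z\<bar> \<le> A" for z
  proof -
    have "A * \<bar>s z\<bar> \<le> A * 1" using A by (intro mult_left_mono) (auto simp: s_def)
    then show ?thesis using A by (simp add: \<phi>_def abs_mult)
  qed
  have adm: "axisym (\<lambda>z. \<rho> + w z) \<zeta> \<in> admissible_NL lam \<rho> m"
  proof (rule axisym_admissible[OF Pw P\<zeta>])
    show "\<rho> + w (1/2) = \<rho> + w (- 1/2)" using w0 ends by simp
    show "sin (\<phi> (1/2)) = sin (\<phi> (- 1/2))" "cos (\<phi> (1/2)) = cos (\<phi> (- 1/2))" by (simp_all only: \<phi>e)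
    have "((\<lambda>z. cos (\<phi> z)) has_integral (\<zeta> (1/2) - \<zeta> (- 1/2))) J"
      using \<zeta> by (intro fundamental_theorem_of_calculus)
        (auto simp: has_real_derivative_iff_has_vector_derivative[symmetric] intro: has_field_derivative_at_within)
    then show "\<zeta> (1/2) - \<zeta> (- 1/2) = 1 - lam" using lam by (simp add: integral_unique \<phi>_def)
    show "0 \<le> cos (\<phi> t)" for t using \<phi>b[of t] A by (intro cos_ge_zero) (auto simp: abs_le_iff)
  qed (use wb m in auto)
  define base where "base = (\<rho>\<^sup>2 - 1)\<^sup>2 + \<rho>\<^sup>2 * h\<^sup>2"
  define X where "X = 42 * \<rho>0\<^sup>2 * (a * A * l + A\<^sup>2 * l\<^sup>2 + h\<^sup>2 * A\<^sup>2 / l\<^sup>2)"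
  define d where "d z = ((\<rho> + w z)\<^sup>2 - 1)\<^sup>2 + ((sin (\<phi> z))\<^sup>2 + (cos (\<phi> z))\<^sup>2 - 1)\<^sup>2
     + h\<^sup>2 * ((\<rho> + w z)\<^sup>2 + 2 * (sin (\<phi> z))\<^sup>2 + ((cos (\<phi> z) * (A * s' z))\<^sup>2 + (- sin (\<phi> z) * (A * s' z))\<^sup>2))" for z
  have a0: "0 < a" using h zero_less_power[of h 2] by linarith
  have X0: "0 \<le> X" unfolding X_def using a0 A l by simp
  have dz: "d z = base + 2 * (\<rho>\<^sup>2 - 1) * (2 * \<rho> * w z + (w z)\<^sup>2) + (2 * \<rho> * w z + (w z)\<^sup>2)\<^sup>2
      + h\<^sup>2 * (2 * \<rho> * w z + (w z)\<^sup>2) + h\<^sup>2 * (2 * (sin (\<phi> z))\<^sup>2 + (A * s' z)\<^sup>2)" for z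
  proof -
    have "(cos (\<phi> z) * (A * s' z))\<^sup>2 + (- sin (\<phi> z) * (A * s' z))\<^sup>2 = ((sin (\<phi> z))\<^sup>2 + (cos (\<phi> z))\<^sup>2) * (A * s' z)\<^sup>2"
      by (simp only: power_mult_distrib power2_minus distrib_right add.commute)
    then have e: "(cos (\<phi> z) * (A * s' z))\<^sup>2 + (- sin (\<phi> z) * (A * s' z))\<^sup>2 = (A * s' z)\<^sup>2" by simp
    show ?thesis unfolding d_def e base_def by (simp add: power2_eq_square algebra_simps)
  qed
  have on: "d z \<le> base + X" for z
  proof -
    define x where "x = 2 * \<rho> * w z + (w z)\<^sup>2"
    have "pi / 2 * l \<le> 2 * 1" using L(4) l pi_less_4 by (intro mult_mono) auto
    then have w2: "w z \<le> 2" using wb(2)[of z] mult_right_mono[OF A(2), of l] l by linarith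
    have x0: "0 \<le> x" using wb(1)[of z] \<rho> by (simp add: x_def)
    have "w z * w z \<le> 2 * w z" using w2 wb(1)[of z] by (intro mult_right_mono)
    moreover have "\<rho> * w z \<le> \<rho>0 * w z" "1 * w z \<le> \<rho>0 * w z" using \<rho> wb(1)[of z] by (intro mult_right_mono; simp)+
    ultimately have "x \<le> 4 * (\<rho>0 * w z)" unfolding x_def power2_eq_square by linarith
    also have "\<dots> \<le> 4 * (\<rho>0 * (A * l))" using wb(2)[of z] \<rho> by (intro mult_left_mono) auto
    finally have x4: "x \<le> 4 * \<rho>0 * (A * l)" by simp
    have Al: "0 \<le> A * l" using A l by simp
    have r2: "\<rho>0 \<le> \<rho>0\<^sup>2" using \<rho> by (simp add: power2_eq_square)
    have 1: "2 * (\<rho>\<^sup>2 - 1) * x + h\<^sup>2 * x \<le> 12 * \<rho>0\<^sup>2 * (a * A * l)"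
    proof -
      have "2 * (\<rho>\<^sup>2 - 1) * x + h\<^sup>2 * x \<le> 2 * a * x + a * x" using h x0 by (intro add_mono mult_right_mono) auto
      also have "\<dots> = 3 * a * x" by simp
      also have "\<dots> \<le> 3 * a * (4 * \<rho>0 * (A * l))" using x4 a0 by (intro mult_left_mono) auto
      also have "\<dots> = 12 * \<rho>0 * (a * A * l)" by simp
      also have "\<dots> \<le> 12 * \<rho>0\<^sup>2 * (a * A * l)" using r2 a0 A l by (intro mult_right_mono) auto
      finally show ?thesis .
    qed
    have 2: "x\<^sup>2 \<le> 16 * \<rho>0\<^sup>2 * (A\<^sup>2 * l\<^sup>2)"
      using power_mono[OF x4 x0, of 2] by (simp add: power_mult_distrib)
    have 3: "h\<^sup>2 * (2 * (sin (\<phi> z))\<^sup>2 + (A * s' z)\<^sup>2) \<le> 42 * \<rho>0\<^sup>2 * (h\<^sup>2 * A\<^sup>2 / l\<^sup>2)"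
    proof -
      have "\<bar>sin (\<phi> z)\<bar> \<le> A" using abs_sin_x_le_abs_x[of "\<phi> z"] \<phi>b[of z] by linarith
      then have "(sin (\<phi> z))\<^sup>2 \<le> A\<^sup>2" by (metis abs_ge_zero power2_abs power_mono)
      also have "A\<^sup>2 \<le> A\<^sup>2 / l\<^sup>2" using l L(4) by (simp add: le_divide_eq mult_left_le power_le_one)
      finally have i: "(sin (\<phi> z))\<^sup>2 \<le> A\<^sup>2 / l\<^sup>2" .
      have "(A * s' z)\<^sup>2 \<le> (A * (2 * pi / l))\<^sup>2" using \<phi>'b[of z] by (metis abs_ge_zero power2_abs power_mono)
      also have "\<dots> = 4 * pi\<^sup>2 * (A\<^sup>2 / l\<^sup>2)" by (simp add: power_mult_distrib power_divide)
      also have "\<dots> \<le> 40 * (A\<^sup>2 / l\<^sup>2)"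
      proof -
        have "pi \<le> 3.15" using pi_approx by simp
        then have "pi\<^sup>2 \<le> 3.15\<^sup>2" by (intro power_mono) auto
        then show ?thesis by (intro mult_right_mono) (auto simp: power2_eq_square)
      qed
      finally have "2 * (sin (\<phi> z))\<^sup>2 + (A * s' z)\<^sup>2 \<le> 42 * (A\<^sup>2 / l\<^sup>2)" using i by linarith
      then have "h\<^sup>2 * (2 * (sin (\<phi> z))\<^sup>2 + (A * s' z)\<^sup>2) \<le> h\<^sup>2 * (42 * (A\<^sup>2 / l\<^sup>2))" by (intro mult_left_mono) auto
      also have "\<dots> = 42 * 1 * (h\<^sup>2 * A\<^sup>2 / l\<^sup>2)" by simp
      also have "\<dots> \<le> 42 * \<rho>0\<^sup>2 * (h\<^sup>2 * A\<^sup>2 / l\<^sup>2)" using \<rho> by (intro mult_right_mono mult_left_mono) (auto simp: one_le_power)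
      finally show ?thesis .
    qed
    have 4: "12 * \<rho>0\<^sup>2 * (a * A * l) \<le> 42 * \<rho>0\<^sup>2 * (a * A * l)" "16 * \<rho>0\<^sup>2 * (A\<^sup>2 * l\<^sup>2) \<le> 42 * \<rho>0\<^sup>2 * (A\<^sup>2 * l\<^sup>2)"
      using a0 A l by (intro mult_right_mono; simp)+
    have "X = 42 * \<rho>0\<^sup>2 * (a * A * l) + 42 * \<rho>0\<^sup>2 * (A\<^sup>2 * l\<^sup>2) + 42 * \<rho>0\<^sup>2 * (h\<^sup>2 * A\<^sup>2 / l\<^sup>2)"
      unfolding X_def by (simp only: distrib_left)
    then show ?thesis unfolding dz x_def[symmetric] using 1 2 3 4 by linarith
  qed
  have off: "d z = base" if "- 1/2 + L < z" for z
  proof -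
    have "y z = L" "y' z = 0" using that L by (auto simp: y_def y'_def)
    then have "w z = 0" "s z = 0" "s' z = 0" using w0 s_zero by (auto simp: s'_def)
    then show ?thesis unfolding dz by (simp add: \<phi>_def)
  qed
  let ?S = "{0..2 * pi} \<times> {- 1/2..- 1/2 + L}"
  have S: "?S = cbox (0, - 1/2) (2 * pi, - 1/2 + L)" by (simp add: cbox_Pair_eq)
  have SO: "?S \<subseteq> Omega" using L by (auto simp: Omega_def)
  have Ss: "?S \<in> sets LO" using SO unfolding S by (simp add: sets_restrict_space_iff)
  have Sm: "measure LO ?S = 2 * pi * L"
    using SO L unfolding S by (simp add: measure_restrict_space content_Pair)
  have Si: "integrable LO (indicator ?S :: real \<times> real \<Rightarrow> real)"
    by (rule integrable_real_indicator[OF Ss]) (simp add: LO.emeasure_eq_measure)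
  have "energy_NL h (axisym (\<lambda>z. \<rho> + w z) \<zeta>) = (\<integral>\<^sup>+p. ennreal (d (snd p)) \<partial>LO)"
    unfolding axisym_energy[OF Pw P\<zeta>] d_def ..
  also have "\<dots> \<le> (\<integral>\<^sup>+p. ennreal (base + X * indicator ?S p) \<partial>LO)"
  proof (rule nn_integral_mono, rule ennreal_leI)
    fix p assume "p \<in> space LO"
    then have p: "p \<in> Omega" by simp
    show "d (snd p) \<le> base + X * indicator ?S p"
    proof (cases "snd p \<le> - 1/2 + L")
      case True
      then have "p \<in> ?S" using p by (auto simp: Omega_def)
      then show ?thesis using on by simp
    next
      case False
      then show ?thesis using off[of "snd p"] X0 by (auto simp: indicator_def)
    qed
  qed
  also have "\<dots> = ennreal (I (\<lambda>p. base + X * indicator ?S p))"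
    by (rule nn_integral_eq_integral) (use Si X0 in \<open>auto simp: base_def intro!: AE_I2\<close>)
  also have "I (\<lambda>p. base + X * indicator ?S p) = 2 * pi * base + X * (2 * pi * L)"
  proof -
    have "?S \<inter> Omega = ?S" using SO by blast
    then have "I (indicator ?S) = 2 * pi * L" using Sm by simp
    moreover have "I (\<lambda>p. base + X * indicator ?S p) = I (\<lambda>p. base) + X * I (indicator ?S)"
      using Si by simp
    ultimately show ?thesis using LO_const[of base] by simp
  qed
  finally have "energy_NL h (axisym (\<lambda>z. \<rho> + w z) \<zeta>) \<le> ennreal (2 * pi * base + 2 * pi * L * X)"
    by (simp add: mult.commute mult.left_commute)
  then show ?thesis using that[OF adm] by (simp add: base_def X_def)
qed

end

section \<open>The width of the wrinkles\<close>

text \<open>The hypothesis on \<open>a\<close> without fractional powers.\<close>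

lemma c0_cases:
  assumes "0 < h" "0 < lam" "0 < a" "c0_one lam h \<le> a"
  shows "lam\<^sup>2 * h \<le> a ^ 4 \<or> h \<le> a\<^sup>2"
proof -
  have "lam powr (1/2) * h powr (1/4) \<le> a \<or> h powr (1/2) \<le> a" using assms(4) by (auto simp: c0_one_def min_le_iff_disj)
  then show ?thesis
  proof
    assume "lam powr (1/2) * h powr (1/4) \<le> a"
    then have "(lam powr (1/2) * h powr (1/4)) ^ 4 \<le> a ^ 4" by (intro power_mono) auto
    moreover have "(lam powr (1/2)) ^ 4 = lam\<^sup>2" using powr_frac_power[of lam 4 2] assms by simp
    moreover have "(h powr (1/4)) ^ 4 = h" using powr_frac_power[of h 4 1] assms by simp
    ultimately show ?thesis by (simp add: power_mult_distrib)
  next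
    assume "h powr (1/2) \<le> a"
    then have "(h powr (1/2))\<^sup>2 \<le> a\<^sup>2" by (intro power_mono) auto
    moreover have "(h powr (1/2))\<^sup>2 = h" using powr_frac_power[of h 2 1] assms by simp
    ultimately show ?thesis by simp
  qed
qed

text \<open>With amplitude of order \<open>(\<lambda> / L)\<^sup>1\<^sup>/\<^sup>2\<close>, the left-hand
  side is the excess of \<open>N\<close> wrinkles of width \<open>l\<close>. For a single wrinkle the
  first and last term balance at \<open>l = k\<close> with \<open>k\<^sup>7 = h\<^sup>4 \<lambda> /
  a\<^sup>2\<close>. This is possible as long as \<open>k\<close> can accommodate the compression,
  \<open>k \<ge> 2 \<lambda>\<close>; otherwise \<open>2 \<lambda>\<close> is filled with wrinkles of
  about the balanced width \<open>r\<close>. In both cases the hypothesis on \<open>a\<close> makes the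
  width at most a multiple of \<open>h\<^sup>1\<^sup>/\<^sup>2\<close>, so that the middle term is
  dominated by the last.\<close>

lemma wrinkle_scales:
  fixes a h lam :: real
  assumes pos: "0 < h" "h \<le> 1/2" "0 < lam" "lam \<le> 1/2" "0 < a" and c0: "c0_one lam h \<le> a"
  obtains N :: nat and l where "1 \<le> N" "0 < l" "real N * l \<le> 1" "2 * lam \<le> real N * l"
    "a * l * sqrt (lam * (real N * l)) + lam * l\<^sup>2 + h\<^sup>2 * lam / l\<^sup>2
      \<le> 12 * max (a powr (4/7) * h powr (6/7) * lam powr (5/7)) (a powr (2/3) * h powr (2/3) * lam)"
proof -
  define Y1 Y2 where "Y1 = a powr (4/7) * h powr (6/7) * lam powr (5/7)" and "Y2 = a powr (2/3) * h powr (2/3) * lam"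
  have Y0: "0 < Y1" "0 < Y2" using pos by (auto simp: Y1_def Y2_def)
  note cc = c0_cases[OF pos(1,3,5) c0]
  define k where "k = (h ^ 4 * lam / a\<^sup>2) powr (1/7)"
  have k0: "0 < k" using pos by (simp add: k_def)
  have k7: "k ^ 7 = h ^ 4 * lam / a\<^sup>2" using powr_frac_power[of "h ^ 4 * lam / a\<^sup>2" 7 1] pos by (simp add: k_def)
  then have k7': "a\<^sup>2 * k ^ 7 = h ^ 4 * lam" using pos by simp
  show ?thesis
  proof (cases "2 * lam \<le> k")
    case True
    have k4: "k ^ 4 \<le> h\<^sup>2"
      using cc
    proof
      assume A: "lam\<^sup>2 * h \<le> a ^ 4"
      have "(a ^ 4)\<^sup>2 * (k ^ 4) ^ 7 = (a\<^sup>2 * k ^ 7) ^ 4" by (simp add: power_mult_distrib flip: power_mult)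
      also have "\<dots> = (lam\<^sup>2 * h)\<^sup>2 * (h\<^sup>2) ^ 7" unfolding k7' by (simp add: power_mult_distrib flip: power_mult power_add)
      also have "\<dots> \<le> (a ^ 4)\<^sup>2 * (h\<^sup>2) ^ 7" using A pos by (intro mult_right_mono power_mono) auto
      finally have "(k ^ 4) ^ 7 \<le> (h\<^sup>2) ^ 7" using pos by simp
      then show ?thesis by (simp only: power_mono_iff k0 zero_le_power2 zero_le_power less_imp_le zero_less_numeral)
    next
      assume A: "h \<le> a\<^sup>2"
      have "h * k ^ 7 \<le> a\<^sup>2 * k ^ 7" using A k0 by (intro mult_right_mono) auto
      also have "\<dots> = h * (h ^ 3 * lam)" unfolding k7' by (simp add: eval_nat_numeral)
      finally have "k ^ 7 \<le> h ^ 3 * lam" using pos by simp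
      also have "\<dots> \<le> h ^ 3 * k" using True pos by (intro mult_left_mono) auto
      finally have "k * k ^ 6 \<le> k * h ^ 3" by (simp add: eval_nat_numeral mult.commute)
      then have "k ^ 6 \<le> h ^ 3" using k0 by simp
      then have "(k\<^sup>2) ^ 3 \<le> h ^ 3" by (simp flip: power_mult)
      then have "k\<^sup>2 \<le> h" using pos by (simp only: power_mono_iff zero_le_power2 less_imp_le zero_less_numeral)
      then have "(k\<^sup>2)\<^sup>2 \<le> h\<^sup>2" by (intro power_mono) auto
      then show ?thesis by (simp flip: power_mult)
    qed
    have k1: "k \<le> 1"
    proof (rule ccontr)
      assume "\<not> k \<le> 1"
      then have "1 < k ^ 4" by (simp add: one_less_power)
      moreover have "h\<^sup>2 \<le> 1" using pos by (simp add: power_le_one)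
      ultimately show False using k4 by linarith
    qed
    define E where "E = h\<^sup>2 * lam / k\<^sup>2"
    have E0: "0 < E" using pos k0 by (simp add: E_def)
    have EY: "E = Y1"
    proof -
      have "E ^ 7 = (h\<^sup>2) ^ 7 * lam ^ 7 / (k ^ 7)\<^sup>2"
        by (simp add: E_def power_divide power_mult_distrib flip: power_mult)
      also have "\<dots> = (h\<^sup>2) ^ 7 * lam ^ 7 / (h ^ 4 * lam / a\<^sup>2)\<^sup>2" unfolding k7 ..
      also have "\<dots> = a ^ 4 * h ^ 6 * lam ^ 5"
        using pos by (simp add: power_divide power_mult_distrib field_simps flip: power_mult power_add)
      also have "\<dots> = Y1 ^ 7" using pos by (simp add: Y1_def power_mult_distrib seventh_powers)
      finally show ?thesis using E0 Y0 by (simp add: power_eq_iff_eq_base)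
    qed
    have t1: "a * k * sqrt (lam * k) = E"
    proof -
      have "(a * k * sqrt (lam * k))\<^sup>2 = a\<^sup>2 * k ^ 3 * lam"
        using pos k0 by (simp add: power_mult_distrib) (simp add: eval_nat_numeral)
      also have "\<dots> = (a\<^sup>2 * k ^ 7) * lam / k ^ 4" using k0 by (simp add: field_simps flip: power_add)
      also have "\<dots> = E\<^sup>2" unfolding k7' using k0
        by (simp add: E_def power_divide power_mult_distrib power2_eq_square[of lam] flip: power_mult)
      finally show ?thesis using E0 pos k0 by (simp add: power2_eq_iff_nonneg)
    qed
    have t2: "lam * k\<^sup>2 \<le> E"
    proof -
      have "lam * k\<^sup>2 * k\<^sup>2 = lam * k ^ 4" by (simp add: eval_nat_numeral)
      also have "\<dots> \<le> lam * h\<^sup>2" using k4 pos by (intro mult_left_mono) auto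
      finally show ?thesis using k0 by (simp add: E_def le_divide_eq mult.commute)
    qed
    show ?thesis
    proof (rule that[of 1 k])
      have "a * k * sqrt (lam * (real 1 * k)) + lam * k\<^sup>2 + h\<^sup>2 * lam / k\<^sup>2 \<le> 3 * E"
        using t1 t2 by (simp add: E_def[symmetric])
      also have "\<dots> \<le> 12 * max Y1 Y2" using EY Y0 by simp
      finally show "a * k * sqrt (lam * (real 1 * k)) + lam * k\<^sup>2 + h\<^sup>2 * lam / k\<^sup>2
        \<le> 12 * max (a powr (4/7) * h powr (6/7) * lam powr (5/7)) (a powr (2/3) * h powr (2/3) * lam)"
        by (simp only: Y1_def Y2_def)
    qed (use True k0 k1 in auto)
  next
    case False
    obtain r where r: "0 < r" "r ^ 3 = h\<^sup>2 / a" "a * r = a powr (2/3) * h powr (2/3)"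
      using balanced_width_exists[OF pos(5,1)] .
    have Y2: "a * r * lam = Y2" by (simp add: r(3) Y2_def)
    have r3: "a * r ^ 3 = h\<^sup>2" using r(2) pos by simp
    have r6: "a\<^sup>2 * r ^ 6 = h ^ 4"
    proof -
      have "(a * r ^ 3)\<^sup>2 = (h\<^sup>2)\<^sup>2" by (simp only: r3)
      then show ?thesis by (simp add: power_mult_distrib flip: power_mult)
    qed
    have "k ^ 7 \<le> (2 * lam) ^ 7" using False k0 by (intro power_mono) auto
    then have "a\<^sup>2 * k ^ 7 \<le> a\<^sup>2 * (2 * lam) ^ 7" by (intro mult_left_mono) auto
    then have "lam * h ^ 4 \<le> lam * (128 * a\<^sup>2 * lam ^ 6)" unfolding k7' by (simp add: power_mult_distrib eval_nat_numeral algebra_simps)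
    then have hl: "h ^ 4 \<le> 128 * a\<^sup>2 * lam ^ 6" using pos by simp
    have rl: "r \<le> 3 * lam"
    proof -
      have "a\<^sup>2 * r ^ 6 \<le> a\<^sup>2 * (128 * lam ^ 6)" using hl r6 by simp
      then have "r ^ 6 \<le> 128 * lam ^ 6" using pos by simp
      also have "\<dots> \<le> (3 * lam) ^ 6" using pos by (simp add: power_mult_distrib)
      finally show ?thesis using r(1) pos by (simp only: power_mono_iff less_imp_le zero_less_numeral mult_pos_pos)
    qed
    have r4: "r ^ 4 \<le> 4 * h\<^sup>2"
    proof -
      have "h \<le> 2 * a\<^sup>2"
        using cc
      proof
        assume A: "lam\<^sup>2 * h \<le> a ^ 4"
        have "h ^ 3 * h ^ 4 \<le> h ^ 3 * (128 * a\<^sup>2 * lam ^ 6)" using hl pos by (intro mult_left_mono) auto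
        also have "\<dots> = 128 * a\<^sup>2 * (lam\<^sup>2 * h) ^ 3" by (simp add: power_mult_distrib flip: power_mult)
        also have "\<dots> \<le> 128 * a\<^sup>2 * (a ^ 4) ^ 3" using A pos by (intro mult_left_mono power_mono) auto
        also have "\<dots> = (2 * a\<^sup>2) ^ 7" by (simp add: power_mult_distrib flip: power_mult power_add)
        finally have "h ^ 7 \<le> (2 * a\<^sup>2) ^ 7" by (simp flip: power_add)
        then show ?thesis using pos by (simp only: power_mono_iff less_imp_le zero_less_numeral zero_le_mult_iff zero_le_power2 zero_le_numeral simp_thms)
      next
        assume "h \<le> a\<^sup>2" then show ?thesis using zero_le_power2[of a] by linarith
      qed
      then have "h * r ^ 6 \<le> 2 * a\<^sup>2 * r ^ 6" using r(1) by (intro mult_right_mono) auto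
      also have "\<dots> = h * (2 * h ^ 3)" using r6 by (simp add: eval_nat_numeral)
      finally have "r ^ 6 \<le> 2 * h ^ 3" using pos by simp
      also have "\<dots> \<le> (2 * h) ^ 3" using pos by (simp add: power_mult_distrib)
      finally have "(r\<^sup>2) ^ 3 \<le> (2 * h) ^ 3" by (simp flip: power_mult)
      then have "r\<^sup>2 \<le> 2 * h" using pos by (simp only: power_mono_iff zero_le_power2 less_imp_le zero_less_numeral mult_pos_pos)
      then have "(r\<^sup>2)\<^sup>2 \<le> (2 * h)\<^sup>2" by (intro power_mono) auto
      then show ?thesis by (simp add: power_mult_distrib flip: power_mult)
    qed
    \<comment> \<open>Rounding up makes the width \<open>2 lam / N\<close> at most \<open>r\<close>; as \<open>r \<le> 3 lam\<close>, it is also at least \<open>2 r / 5\<close>.\<close>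
    define N where "N = nat \<lceil>2 * lam / r\<rceil>"
    have q0: "0 < 2 * lam / r" using pos r(1) by simp
    then have c1: "1 \<le> \<lceil>2 * lam / r\<rceil>" by (simp add: one_le_ceiling)
    have Nr: "real N = of_int \<lceil>2 * lam / r\<rceil>" using c1 by (simp add: N_def)
    have N1: "1 \<le> N" using c1 by (simp add: N_def nat_le_iff le_nat_iff)
    have N2: "2 * lam / r \<le> real N" "real N \<le> 2 * lam / r + 1" unfolding Nr by linarith+
    define l where "l = 2 * lam / real N"
    have Np: "0 < real N" using N1 by simp
    have l0: "0 < l" using pos Np by (simp add: l_def)
    have Nl: "real N * l = 2 * lam" using Np by (simp add: l_def)
    have lr: "l \<le> r"
    proof -
      have "2 * lam \<le> real N * r" using N2(1) r(1) by (simp add: divide_le_eq)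
      then show ?thesis using Np by (simp add: l_def divide_le_eq mult.commute)
    qed
    have rl2: "2 * r \<le> 5 * l"
    proof -
      have "real N * r \<le> 2 * lam + r" using mult_right_mono[OF N2(2), of r] r(1) by (simp add: distrib_right)
      then have "real N * r \<le> 5 * lam" using rl by linarith
      then have "2 * r * real N \<le> 10 * lam" by (simp add: mult.commute)
      then show ?thesis using Np by (simp add: l_def le_divide_eq)
    qed
    have b1: "a * l * sqrt (lam * (real N * l)) \<le> 3 / 2 * Y2"
    proof -
      have "sqrt (lam * (real N * l)) = sqrt 2 * lam"
      proof -
        have "lam * (real N * l) = 2 * lam\<^sup>2" unfolding Nl by (simp add: power2_eq_square)
        then show ?thesis using pos by (simp add: real_sqrt_mult)
      qed
      also have "\<dots> \<le> 3 / 2 * lam" using pos by (intro mult_right_mono real_le_lsqrt) (auto simp: power2_eq_square)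
      finally have "a * l * sqrt (lam * (real N * l)) \<le> a * r * (3 / 2 * lam)"
        using lr pos l0 r(1) by (intro mult_mono) auto
      then show ?thesis using Y2 by simp
    qed
    have rE: "h\<^sup>2 * lam / r\<^sup>2 = Y2"
    proof -
      have "h\<^sup>2 = a * r * r\<^sup>2" using r3 by (simp add: eval_nat_numeral mult.assoc)
      then show ?thesis using r(1) Y2 by simp
    qed
    have b2: "lam * l\<^sup>2 \<le> 4 * Y2"
    proof -
      have "lam * l\<^sup>2 \<le> lam * r\<^sup>2" using lr l0 pos by (intro mult_left_mono power_mono) auto
      also have "\<dots> \<le> 4 * (h\<^sup>2 * lam / r\<^sup>2)"
      proof -
        have "lam * r\<^sup>2 * r\<^sup>2 = lam * r ^ 4" by (simp add: eval_nat_numeral)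
        also have "\<dots> \<le> lam * (4 * h\<^sup>2)" using r4 pos by (intro mult_left_mono) auto
        finally have "lam * r\<^sup>2 \<le> lam * (4 * h\<^sup>2) / r\<^sup>2" using r(1) by (simp add: le_divide_eq)
        then show ?thesis by (simp add: mult.commute mult.left_commute)
      qed
      finally show ?thesis unfolding rE .
    qed
    have b3: "h\<^sup>2 * lam / l\<^sup>2 \<le> 25 / 4 * Y2"
    proof -
      have "(2 * r)\<^sup>2 \<le> (5 * l)\<^sup>2" using rl2 r(1) by (intro power_mono) auto
      then have "4 * r\<^sup>2 \<le> 25 * l\<^sup>2" by (simp add: power_mult_distrib)
      then have "h\<^sup>2 * lam / l\<^sup>2 \<le> h\<^sup>2 * lam / (4 / 25 * r\<^sup>2)"
        using pos l0 r(1) by (intro divide_left_mono) auto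
      also have "\<dots> = 25 / 4 * (h\<^sup>2 * lam / r\<^sup>2)" by simp
      finally show ?thesis unfolding rE .
    qed
    show ?thesis
    proof (rule that[of N l])
      have "a * l * sqrt (lam * (real N * l)) + lam * l\<^sup>2 + h\<^sup>2 * lam / l\<^sup>2 \<le> 12 * Y2"
        using b1 b2 b3 Y0 by linarith
      also have "\<dots> \<le> 12 * max Y1 Y2" by simp
      finally show "a * l * sqrt (lam * (real N * l)) + lam * l\<^sup>2 + h\<^sup>2 * lam / l\<^sup>2
        \<le> 12 * max (a powr (4/7) * h powr (6/7) * lam powr (5/7)) (a powr (2/3) * h powr (2/3) * lam)"
        by (simp only: Y1_def Y2_def)
    qed (use N1 l0 Nl pos in auto)
  qed
qed

text \<open>By the bound on \<open>A\<close>, \<open>L A\<^sup>2\<close> is at most \<open>5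
  \<lambda>\<close> and \<open>L A\<close> at most \<open>5 (\<lambda>
  L)\<^sup>1\<^sup>/\<^sup>2\<close>. The constant is \<open>18000 = 300 * 5 * 12\<close> with \<open>84
  \<pi> \<le> 300\<close>.\<close>

lemma wrinkled_upper_bound:
  assumes pos: "0 < h" "h \<le> 1/2" "0 < lam" "lam \<le> 1/2" "1 \<le> \<rho>" "\<rho> \<le> \<rho>0" "1 \<le> m"
    and c0: "c0_one lam h \<le> max (\<rho>\<^sup>2 - 1) (h\<^sup>2)"
  obtains \<Phi> where "\<Phi> \<in> admissible_NL lam \<rho> m"
    "energy_NL h \<Phi> \<le> ennreal (2 * pi * ((\<rho>\<^sup>2 - 1)\<^sup>2 + \<rho>\<^sup>2 * h\<^sup>2) + 18000 * \<rho>0\<^sup>2 *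
      (max (max (\<rho>\<^sup>2 - 1) (h\<^sup>2) powr (4/7) * h powr (6/7) * lam powr (5/7)) (max (\<rho>\<^sup>2 - 1) (h\<^sup>2) powr (2/3) * h powr (2/3) * lam)))"
proof -
  define a where "a = max (\<rho>\<^sup>2 - 1) (h\<^sup>2)"
  have a0: "0 < a" using pos by (simp add: a_def less_max_iff_disj)
  define Y' where "Y' = max (a powr (4/7) * h powr (6/7) * lam powr (5/7)) (a powr (2/3) * h powr (2/3) * lam)"
  obtain N l where Nl: "1 \<le> N" "0 < l" "real N * l \<le> 1" "2 * lam \<le> real N * l"
    "a * l * sqrt (lam * (real N * l)) + lam * l\<^sup>2 + h\<^sup>2 * lam / l\<^sup>2 \<le> 12 * Y'"
    using wrinkle_scales[OF pos(1-4) a0, folded Y'_def] c0 unfolding a_def[symmetric] by blast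
  interpret wrinkles N l by unfold_locales (use Nl in auto)
  have Ll: "2 * lam \<le> L" using Nl by (simp add: L_def)
  obtain A where A: "0 \<le> A" "A \<le> pi / 2" "integral J (\<lambda>z. cos (A * s z)) = 1 - lam" "A\<^sup>2 \<le> 5 * lam / L"
    using amplitude_exists[OF pos(3) Ll] .
  have ha: "h\<^sup>2 \<le> a" "\<rho>\<^sup>2 - 1 \<le> a" by (auto simp: a_def)
  obtain \<Phi> where \<Phi>: "\<Phi> \<in> admissible_NL lam \<rho> m"
    "energy_NL h \<Phi> \<le> ennreal (2 * pi * ((\<rho>\<^sup>2 - 1)\<^sup>2 + \<rho>\<^sup>2 * h\<^sup>2) + 2 * pi * L * (42 * \<rho>0\<^sup>2 * (a * A * l + A\<^sup>2 * l\<^sup>2 + h\<^sup>2 * A\<^sup>2 / l\<^sup>2)))"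
    using wrinkled_deformation[OF A(1-3) pos(5,6,1) ha pos(7)] .
  have LA2: "L * A\<^sup>2 \<le> 5 * lam" using A(4) L by (simp add: le_divide_eq mult.commute)
  have LA: "L * A \<le> 5 * sqrt (lam * L)"
  proof -
    have "(L * A)\<^sup>2 = L * (L * A\<^sup>2)" by (simp add: power2_eq_square)
    also have "\<dots> \<le> L * (5 * lam)" using LA2 L by (intro mult_left_mono) auto
    also have "\<dots> \<le> 25 * (lam * L)" using L pos by simp
    also have "\<dots> = (5 * sqrt (lam * L))\<^sup>2" using L pos by (simp add: power_mult_distrib)
    finally show ?thesis by (rule power2_le_imp_le) (use L pos in simp)
  qed
  define E where "E = a * l * sqrt (lam * L) + lam * l\<^sup>2 + h\<^sup>2 * lam / l\<^sup>2"
  have E: "E \<le> 12 * Y'" using Nl(5) by (simp add: E_def L_def)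
  have E0: "0 \<le> E" using a0 l L pos by (simp add: E_def)
  have "L * (a * A * l + A\<^sup>2 * l\<^sup>2 + h\<^sup>2 * A\<^sup>2 / l\<^sup>2) = a * l * (L * A) + l\<^sup>2 * (L * A\<^sup>2) + h\<^sup>2 / l\<^sup>2 * (L * A\<^sup>2)"
    by (simp add: algebra_simps)
  also have "\<dots> \<le> a * l * (5 * sqrt (lam * L)) + l\<^sup>2 * (5 * lam) + h\<^sup>2 / l\<^sup>2 * (5 * lam)"
    using LA LA2 a0 l by (intro add_mono mult_left_mono) auto
  also have "\<dots> = 5 * E" by (simp add: E_def algebra_simps)
  finally have F: "L * (a * A * l + A\<^sup>2 * l\<^sup>2 + h\<^sup>2 * A\<^sup>2 / l\<^sup>2) \<le> 5 * E" .
  have "2 * pi * L * (42 * \<rho>0\<^sup>2 * (a * A * l + A\<^sup>2 * l\<^sup>2 + h\<^sup>2 * A\<^sup>2 / l\<^sup>2)) = (84 * pi) * (\<rho>0\<^sup>2 * (L * (a * A * l + A\<^sup>2 * l\<^sup>2 + h\<^sup>2 * A\<^sup>2 / l\<^sup>2)))"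
    by simp
  also have "\<dots> \<le> 300 * (\<rho>0\<^sup>2 * (5 * E))"
  proof -
    have "84 * pi \<le> 300" using pi_approx by simp
    moreover have "0 \<le> \<rho>0\<^sup>2 * (L * (a * A * l + A\<^sup>2 * l\<^sup>2 + h\<^sup>2 * A\<^sup>2 / l\<^sup>2))" using L a0 A l by simp
    moreover have "\<rho>0\<^sup>2 * (L * (a * A * l + A\<^sup>2 * l\<^sup>2 + h\<^sup>2 * A\<^sup>2 / l\<^sup>2)) \<le> \<rho>0\<^sup>2 * (5 * E)"
      by (rule mult_left_mono[OF F zero_le_power2])
    ultimately show ?thesis by (rule_tac mult_mono) auto
  qed
  also have "\<dots> \<le> 300 * (\<rho>0\<^sup>2 * (5 * (12 * Y')))" using E by (intro mult_left_mono) auto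
  also have "\<dots> = 18000 * \<rho>0\<^sup>2 * Y'" by simp
  finally have "energy_NL h \<Phi> \<le> ennreal (2 * pi * ((\<rho>\<^sup>2 - 1)\<^sup>2 + \<rho>\<^sup>2 * h\<^sup>2) + 18000 * \<rho>0\<^sup>2 * Y')"
    using order_trans[OF \<Phi>(2) ennreal_leI] by simp
  then show ?thesis using that[OF \<Phi>(1)] by (simp add: Y'_def a_def)
qed

text \<open>The uniformly compressed cylinder; its axial strain is \<open>(1 - \<lambda>)\<^sup>2 -
  1\<close>.\<close>

lemma flat_upper_bound:
  assumes pos: "0 < lam" "lam \<le> 1/2" "1 \<le> \<rho>" "\<rho> \<le> \<rho>0" "1 \<le> m"
  obtains \<Phi> where "\<Phi> \<in> admissible_NL lam \<rho> m"
    "energy_NL h \<Phi> \<le> ennreal (2 * pi * ((\<rho>\<^sup>2 - 1)\<^sup>2 + \<rho>\<^sup>2 * h\<^sup>2) + 18000 * \<rho>0\<^sup>2 * lam\<^sup>2)"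
proof -
  have P: "profile (\<lambda>z. \<rho>) (\<lambda>z. 0) (\<lambda>z. 0) {} 0" by unfold_locales auto
  have Q: "profile (\<lambda>z. (1 - lam) * z) (\<lambda>z. 1 - lam) (\<lambda>z. 0) {} 0"
    by unfold_locales (auto intro!: continuous_intros derivative_eq_intros)
  have adm: "axisym (\<lambda>z. \<rho>) (\<lambda>z. (1 - lam) * z) \<in> admissible_NL lam \<rho> m"
    by (rule axisym_admissible[OF P Q]) (use pos in auto)
  have "energy_NL h (axisym (\<lambda>z. \<rho>) (\<lambda>z. (1 - lam) * z)) = (\<integral>\<^sup>+x. ennreal ((\<rho>\<^sup>2 - 1)\<^sup>2 + ((1 - lam)\<^sup>2 - 1)\<^sup>2 + h\<^sup>2 * \<rho>\<^sup>2) \<partial>LO)"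
    unfolding axisym_energy[OF P Q] by simp
  also have "\<dots> = ennreal (I (\<lambda>_. (\<rho>\<^sup>2 - 1)\<^sup>2 + ((1 - lam)\<^sup>2 - 1)\<^sup>2 + h\<^sup>2 * \<rho>\<^sup>2))"
    by (rule nn_integral_eq_integral) auto
  also have "I (\<lambda>_. (\<rho>\<^sup>2 - 1)\<^sup>2 + ((1 - lam)\<^sup>2 - 1)\<^sup>2 + h\<^sup>2 * \<rho>\<^sup>2) = 2 * pi * ((\<rho>\<^sup>2 - 1)\<^sup>2 + ((1 - lam)\<^sup>2 - 1)\<^sup>2 + h\<^sup>2 * \<rho>\<^sup>2)"
    by (rule LO_const)
  also have "ennreal \<dots> \<le> ennreal (2 * pi * ((\<rho>\<^sup>2 - 1)\<^sup>2 + \<rho>\<^sup>2 * h\<^sup>2) + 18000 * \<rho>0\<^sup>2 * lam\<^sup>2)"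
  proof (rule ennreal_leI)
    have "((1 - lam)\<^sup>2 - 1)\<^sup>2 = lam\<^sup>2 * (2 - lam)\<^sup>2" by (simp add: power2_eq_square algebra_simps)
    also have "\<dots> \<le> lam\<^sup>2 * 2\<^sup>2" using pos by (intro mult_left_mono power_mono) auto
    finally have "2 * pi * ((1 - lam)\<^sup>2 - 1)\<^sup>2 \<le> 8 * (4 * lam\<^sup>2)" using pi_less_4 by (intro mult_mono) auto
    also have "\<dots> \<le> 18000 * (1 * lam\<^sup>2)" by simp
    also have "\<dots> \<le> 18000 * (\<rho>0\<^sup>2 * lam\<^sup>2)" using pos by (intro mult_left_mono mult_right_mono) (auto simp: one_le_power)
    finally show "2 * pi * ((\<rho>\<^sup>2 - 1)\<^sup>2 + ((1 - lam)\<^sup>2 - 1)\<^sup>2 + h\<^sup>2 * \<rho>\<^sup>2) \<le> 2 * pi * ((\<rho>\<^sup>2 - 1)\<^sup>2 + \<rho>\<^sup>2 * h\<^sup>2) + 18000 * \<rho>0\<^sup>2 * lam\<^sup>2"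
      by (simp add: algebra_simps)
  qed
  finally show ?thesis using that[OF adm] by blast
qed

section \<open>The scaling law\<close>

theorem theorem1p3:
  fixes \<rho>0 m :: real
  assumes "1 \<le> \<rho>0" and "1 \<le> m"
  shows "\<exists>C>0. \<forall>h lam \<rho> :: real.
    0 < h \<and> h \<le> 1/2 \<and> 0 < lam \<and> lam \<le> 1/2 \<and> 1 \<le> \<rho> \<and> \<rho> \<le> \<rho>0 \<and>
    max (\<rho>\<^sup>2 - 1) (h\<^sup>2) \<ge> c0_one lam h \<longrightarrow>
    (let X = min_energy_NL h lam \<rho> m - ereal (bulk_energy_NL \<rho> h);
         a = max (\<rho>\<^sup>2 - 1) (h\<^sup>2);
         Y = min (lam\<^sup>2) (max (a powr (4/7) * h powr (6/7) * lam powr (5/7))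
                             (a powr (2/3) * h powr (2/3) * lam))
     in X \<le> ereal (C * Y) \<and> ereal Y \<le> ereal C * X)"
proof -
  define k where "k = lower_const \<rho>0 m"
  have k: "0 < k" unfolding k_def by (rule lower_const_pos[OF assms])
  define C where "C = max (18000 * \<rho>0\<^sup>2) (1 / k)"
  have C: "18000 * \<rho>0\<^sup>2 \<le> C" "1 / k \<le> C" by (simp_all add: C_def)
  have C0: "0 < C" using C(2) k by (meson less_le_trans zero_less_divide_1_iff)
  have main: "min_energy_NL h lam \<rho> m - ereal (bulk_energy_NL \<rho> h) \<le> ereal (C * Y) \<and>
      ereal Y \<le> ereal C * (min_energy_NL h lam \<rho> m - ereal (bulk_energy_NL \<rho> h))"
    if p: "0 < h" "h \<le> 1/2" "0 < lam" "lam \<le> 1/2" "1 \<le> \<rho>" "\<rho> \<le> \<rho>0" and c0: "c0_one lam h \<le> max (\<rho>\<^sup>2 - 1) (h\<^sup>2)"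
      and Y: "Y = min (lam\<^sup>2) (max (max (\<rho>\<^sup>2 - 1) (h\<^sup>2) powr (4/7) * h powr (6/7) * lam powr (5/7))
                             (max (\<rho>\<^sup>2 - 1) (h\<^sup>2) powr (2/3) * h powr (2/3) * lam))" for h lam \<rho> Y
  proof -
    define base where "base = 2 * pi * ((\<rho>\<^sup>2 - 1)\<^sup>2 + \<rho>\<^sup>2 * h\<^sup>2)"
    have base: "bulk_energy_NL \<rho> h = base" by (simp add: bulk_energy_NL_def measure_Omega base_def algebra_simps)
    have base0: "0 \<le> base" by (simp add: base_def)
    have Y0: "0 \<le> Y" unfolding Y using p by (simp add: le_max_iff_disj)
    define E where "E = (INF \<Phi>\<in>admissible_NL lam \<rho> m. energy_NL h \<Phi>)"
    have up: "E \<le> ennreal (base + 18000 * \<rho>0\<^sup>2 * Y)"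
    proof -
      obtain \<Phi>1 where 1: "\<Phi>1 \<in> admissible_NL lam \<rho> m" "energy_NL h \<Phi>1 \<le> ennreal (base + 18000 * \<rho>0\<^sup>2 *
        (max (max (\<rho>\<^sup>2 - 1) (h\<^sup>2) powr (4/7) * h powr (6/7) * lam powr (5/7)) (max (\<rho>\<^sup>2 - 1) (h\<^sup>2) powr (2/3) * h powr (2/3) * lam)))"
        using wrinkled_upper_bound[OF p assms(2) c0] unfolding base_def .
      obtain \<Phi>2 where 2: "\<Phi>2 \<in> admissible_NL lam \<rho> m" "energy_NL h \<Phi>2 \<le> ennreal (base + 18000 * \<rho>0\<^sup>2 * lam\<^sup>2)"
        using flat_upper_bound[OF p(3-6) assms(2), of h] unfolding base_def .
      have "E \<le> energy_NL h \<Phi>1" "E \<le> energy_NL h \<Phi>2" unfolding E_def using 1(1) 2(1) by (auto intro: INF_lower)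
      then show ?thesis using 1(2) 2(2) unfolding Y by (auto simp: min_def intro: order_trans)
    qed
    have lo: "ennreal (base + k * Y) \<le> E"
      unfolding E_def k_def base_def Y
      by (rule INF_greatest) (rule admissible_lower_bound[OF p(5,6,1-4) assms(2) c0])
    obtain e where e: "E = ennreal e" "0 \<le> e" using up by (cases E) (auto simp: top_unique)
    have e1: "e \<le> base + 18000 * \<rho>0\<^sup>2 * Y"
      using up base0 Y0 unfolding e(1) by (subst (asm) ennreal_le_iff) auto
    have e2: "base + k * Y \<le> e" using lo e(2) unfolding e(1) by (simp add: ennreal_le_iff)
    have X: "min_energy_NL h lam \<rho> m - ereal (bulk_energy_NL \<rho> h) = ereal (e - base)"
      unfolding min_energy_NL_def E_def[symmetric] e(1) base using e(2) by (simp add: enn2ereal_ennreal)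
    have "e - base \<le> C * Y" using e1 mult_right_mono[OF C(1) Y0] by linarith
    moreover have "Y \<le> C * (e - base)"
    proof -
      have "Y = 1 / k * (k * Y)" using k by simp
      also have "\<dots> \<le> C * (e - base)" using C C0 e2 k Y0 by (intro mult_mono) auto
      finally show ?thesis .
    qed
    ultimately show ?thesis unfolding X by simp
  qed
  show ?thesis
    using C0 main by (intro exI[of _ C]) (auto simp only: Let_def)
qed

end
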